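(* Let $k$ be an algebraically closed field of characteristic zero and let $\ell$ be a prime. Let $G^c$ be a finite $\ell$-group which is a central extension of an abelian $\ell$-group $A$, i.e. there is an exact sequence $1\to Z\to G^c\to A\to 1$ with $Z$ contained in the center of $G^c$. Let $V$ be a finite-dimensional faithful linear representation of $G^c$ over $k$. Then $V/G^c$ admits a tower of toric fibrations with rational source, i.e. a toric rational tower.
   Context: Quotients are considered up to $k$-birational equivalence: $V/G^c$ is a model of the field of invariants $k(V)^{G^c}$. Toric rational tower: a variety $X$ over a field $k$ admits a toric rational tower if there exists a sequence of dominant rational maps over $k$ $$X_n\xrightarrow{\pi_n}X_{n-1}\to\cdots\to X_1\xrightarrow{\pi_1}X_0:=X$$ such that (1) the source $X_n$ is rational over $k$; (2) for every $i$, the generic fiber of $\pi_i$ is geometrically rational and irreducible over the function field $k(X_{i-1})$; (2') for every $i$, the generic fiber of $\pi_i$ is birational, over $k(X_{i-1})$, to a torsor under an algebraic torus over $k(X_{i-1})$. *)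

theory Defs
  imports
    "HOL-Library.Poly_Mapping"
    "HOL-Algebra.Algebra"
    "HOL-Algebra.Algebraic_Closure_Type"
begin

text \<open>
  Geometry is done in the classical language of a universal domain: an algebraically closed field
  \<open>\<Omega>\<close> (a type of class \<^class>\<open>alg_closed_field\<close>) that contains all fields
  in sight as subsets. All fields have characteristic zero in the application, so a variety over a
  subfield \<open>F\<close> is the same as its set of points over the algebraic closure of \<open>F\<close>, cut out by
  polynomials over \<open>F\<close>; affine group schemes over \<open>F\<close> and their torsors are automatically reduced.
\<close>

section \<open>Polynomials in several variables\<close>

type_synonym 'a mpoly = "(nat \<Rightarrow>\<^sub>0 nat) \<Rightarrow>\<^sub>0 'a"

definition insertion :: "(nat \<Rightarrow> 'a::comm_ring_1) \<Rightarrow> 'a mpoly \<Rightarrow> 'a" where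
  "insertion e f =
     (\<Sum>m\<in>Poly_Mapping.keys f. Poly_Mapping.lookup f m * (\<Prod>i\<in>Poly_Mapping.keys m. e i ^ Poly_Mapping.lookup m i))"

text \<open>Points of affine \<open>n\<close>-space are lists of length \<open>n\<close>. Evaluation at such a point sends the
  variables with index at least \<open>n\<close> to \<open>0\<close>, so an arbitrary polynomial represents an element of
  the polynomial ring in the first \<open>n\<close> variables.\<close>

definition peval :: "'a::comm_ring_1 mpoly \<Rightarrow> 'a list \<Rightarrow> 'a" where
  "peval f xs = insertion (nth_default 0 xs) f"

definition pmap :: "'a::comm_ring_1 mpoly list \<Rightarrow> 'a list \<Rightarrow> 'a list" where
  "pmap fs xs = map (\<lambda>f. peval f xs) fs"

definition polys_over :: "'a::comm_ring_1 set \<Rightarrow> 'a mpoly set" where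
  "polys_over F = {f. range (Poly_Mapping.lookup f) \<subseteq> F}"

section \<open>Subfields of the universal domain\<close>

definition adjoin :: "'w::field set \<Rightarrow> 'w list \<Rightarrow> 'w set" where
  "adjoin F xs = generate_field ring_of_type_algebra (F \<union> set xs)"

definition alg_cl :: "'w::field set \<Rightarrow> 'w set" where
  "alg_cl F = {x. \<exists>p. p \<noteq> 0 \<and> range (Polynomial.coeff p) \<subseteq> F \<and> poly p x = 0}"

definition alg_independent :: "'w::field set \<Rightarrow> 'w list \<Rightarrow> bool" where
  "alg_independent F ts \<longleftrightarrow>
     (\<forall>f\<in>polys_over F. (\<forall>m\<in>Poly_Mapping.keys f. Poly_Mapping.keys m \<subseteq> {..<length ts}) \<longrightarrow>
        peval f ts = 0 \<longrightarrow> f = 0)"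

definition rational_over :: "'w::field set \<Rightarrow> 'w set \<Rightarrow> bool" where
  "rational_over F L \<longleftrightarrow> (\<exists>ts. alg_independent F ts \<and> L = adjoin F ts)"

section \<open>Affine varieties and morphisms over a subfield\<close>

definition affine_space :: "'w set \<Rightarrow> nat \<Rightarrow> 'w list set" where
  "affine_space E n = {xs. length xs = n \<and> set xs \<subseteq> E}"

definition closed_over :: "'w::field set \<Rightarrow> nat \<Rightarrow> 'w list set \<Rightarrow> bool" where
  "closed_over F n W \<longleftrightarrow>
     (\<exists>S. S \<subseteq> polys_over F \<and>
        W = {xs \<in> affine_space (alg_cl F) n. \<forall>f\<in>S. peval f xs = 0})"

definition prod_pts :: "'w list set \<Rightarrow> 'w list set \<Rightarrow> 'w list set" where
  "prod_pts W W' = {x @ y | x y. x \<in> W \<and> y \<in> W'}"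

definition morphism_over ::
    "'w::field set \<Rightarrow> 'w list set \<Rightarrow> 'w list set \<Rightarrow> 'w mpoly list \<Rightarrow> bool" where
  "morphism_over F W W' fs \<longleftrightarrow> set fs \<subseteq> polys_over F \<and> (\<forall>x\<in>W. pmap fs x \<in> W')"

definition irreducible_over :: "'w::field set \<Rightarrow> nat \<Rightarrow> 'w list set \<Rightarrow> bool" where
  "irreducible_over F n W \<longleftrightarrow> W \<noteq> {} \<and>
     (\<forall>A B. closed_over F n A \<and> closed_over F n B \<and> W \<subseteq> A \<union> B \<longrightarrow> W \<subseteq> A \<or> W \<subseteq> B)"

text \<open>A generic point of \<open>W\<close> over \<open>F\<close> is a point with coordinates in the universal domain whose
  vanishing ideal over \<open>F\<close> is the ideal of \<open>W\<close>. The field it generates over \<open>F\<close> is therefore the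
  fraction field of the coordinate ring \<open>F[W]\<close>. In particular \<open>is_function_field F n W L\<close>
  says that \<open>L\<close> is isomorphic over \<open>F\<close> to \<open>F(W)\<close>, i.e. that a variety over \<open>F\<close> with function field
  \<open>L\<close> is birational to \<open>W\<close>.\<close>

definition generic_point :: "'w::field set \<Rightarrow> nat \<Rightarrow> 'w list set \<Rightarrow> 'w list \<Rightarrow> bool" where
  "generic_point F n W x \<longleftrightarrow> length x = n \<and>
     (\<forall>f\<in>polys_over F. peval f x = 0 \<longleftrightarrow> (\<forall>y\<in>W. peval f y = 0))"

definition is_function_field :: "'w::field set \<Rightarrow> nat \<Rightarrow> 'w list set \<Rightarrow> 'w set \<Rightarrow> bool" where
  "is_function_field F n W L \<longleftrightarrow> (\<exists>x. generic_point F n W x \<and> L = adjoin F x)"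

text \<open>The points over the algebraic closure of the affine \<open>F\<close>-variety with generic point \<open>x\<close>.\<close>

definition locus :: "'w::field set \<Rightarrow> 'w list \<Rightarrow> 'w list set" where
  "locus F x = {y \<in> affine_space (alg_cl F) (length x).
     \<forall>f\<in>polys_over F. peval f x = 0 \<longrightarrow> peval f y = 0}"

section \<open>Tori and torsors\<close>

definition algebraic_group_over ::
    "'w::field set \<Rightarrow> nat \<Rightarrow> 'w list set \<Rightarrow> 'w mpoly list \<Rightarrow> 'w list \<Rightarrow> 'w mpoly list \<Rightarrow> bool" where
  "algebraic_group_over F n T \<mu> e \<iota> \<longleftrightarrow>
     closed_over F n T \<and>
     morphism_over F (prod_pts T T) T \<mu> \<and>
     e \<in> T \<and> set e \<subseteq> F \<and>
     morphism_over F T T \<iota> \<and>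
     (\<forall>s\<in>T. \<forall>t\<in>T. \<forall>u\<in>T. pmap \<mu> (pmap \<mu> (s @ t) @ u) = pmap \<mu> (s @ pmap \<mu> (t @ u))) \<and>
     (\<forall>t\<in>T. pmap \<mu> (e @ t) = t \<and> pmap \<mu> (t @ e) = t) \<and>
     (\<forall>t\<in>T. pmap \<mu> (pmap \<iota> t @ t) = e \<and> pmap \<mu> (t @ pmap \<iota> t) = e)"

text \<open>The split torus of rank \<open>r\<close>, as the closed subset of affine \<open>2 r\<close>-space given by the
  equations \<open>u\<^sub>i v\<^sub>i = 1\<close>; its group law is the coordinatewise multiplication.\<close>

definition split_torus :: "'w::field set \<Rightarrow> nat \<Rightarrow> 'w list set" where
  "split_torus E r = {us @ map inverse us | us. length us = r \<and> set us \<subseteq> E - {0}}"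

definition torus_over ::
    "'w::field set \<Rightarrow> nat \<Rightarrow> 'w list set \<Rightarrow> 'w mpoly list \<Rightarrow> 'w list \<Rightarrow> 'w mpoly list \<Rightarrow> bool" where
  "torus_over F n T \<mu> e \<iota> \<longleftrightarrow>
     algebraic_group_over F n T \<mu> e \<iota> \<and>
     (\<exists>r \<phi> \<psi>.
        morphism_over (alg_cl F) T (split_torus (alg_cl F) r) \<phi> \<and>
        morphism_over (alg_cl F) (split_torus (alg_cl F) r) T \<psi> \<and>
        (\<forall>t\<in>T. pmap \<psi> (pmap \<phi> t) = t) \<and>
        (\<forall>u\<in>split_torus (alg_cl F) r. pmap \<phi> (pmap \<psi> u) = u) \<and>
        (\<forall>s\<in>T. \<forall>t\<in>T. pmap \<phi> (pmap \<mu> (s @ t)) = map2 (*) (pmap \<phi> s) (pmap \<phi> t)))"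

text \<open>A torsor is a nonempty variety with an action for which
  \<open>(t, x) \<mapsto> (x, t x)\<close> is an isomorphism from \<open>T \<times> W\<close> to \<open>W \<times> W\<close> over \<open>F\<close>; the
  polynomials \<open>\<delta>\<close> give the first component of its inverse.\<close>

definition torsor_over ::
    "'w::field set \<Rightarrow> 'w list set \<Rightarrow> 'w mpoly list \<Rightarrow> 'w list \<Rightarrow> nat \<Rightarrow> 'w list set \<Rightarrow> bool" where
  "torsor_over F T \<mu> e m W \<longleftrightarrow>
     closed_over F m W \<and> W \<noteq> {} \<and>
     (\<exists>\<alpha> \<delta>.
        morphism_over F (prod_pts T W) W \<alpha> \<and>
        (\<forall>x\<in>W. pmap \<alpha> (e @ x) = x) \<and>
        (\<forall>s\<in>T. \<forall>t\<in>T. \<forall>x\<in>W. pmap \<alpha> (pmap \<mu> (s @ t) @ x) = pmap \<alpha> (s @ pmap \<alpha> (t @ x))) \<and>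
        morphism_over F (prod_pts W W) T \<delta> \<and>
        (\<forall>x\<in>W. \<forall>y\<in>W. pmap \<alpha> (pmap \<delta> (x @ y) @ x) = y) \<and>
        (\<forall>t\<in>T. \<forall>x\<in>W. pmap \<delta> (x @ pmap \<alpha> (t @ x)) = t))"

section \<open>Toric rational towers\<close>

text \<open>For a dominant rational map given by an inclusion \<open>F \<subseteq> L\<close> of function fields, the generic
  fibre is the \<open>F\<close>-variety, up to birational equivalence over \<open>F\<close>, with function field \<open>L\<close>;
  \<open>locus F x\<close> below is the base change of an affine model of it to the algebraic closure of \<open>F\<close>.\<close>

definition geom_rational_irreducible_fibre :: "'w::field set \<Rightarrow> 'w set \<Rightarrow> bool" where
  "geom_rational_irreducible_fibre F L \<longleftrightarrow>
     (\<exists>x. L = adjoin F x \<and>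
        irreducible_over (alg_cl F) (length x) (locus F x) \<and>
        (\<exists>M. is_function_field (alg_cl F) (length x) (locus F x) M \<and> rational_over (alg_cl F) M))"

definition toric_fibre :: "'w::field set \<Rightarrow> 'w set \<Rightarrow> bool" where
  "toric_fibre F L \<longleftrightarrow>
     (\<exists>n T \<mu> e \<iota> m W. torus_over F n T \<mu> e \<iota> \<and> torsor_over F T \<mu> e m W \<and> is_function_field F m W L)"

text \<open>\<open>K i\<close> is the function field of the \<open>i\<close>-th variety of the tower, and the dominant rational
  maps correspond to the inclusions \<open>K i \<subseteq> K (Suc i)\<close>; \<open>L\<close> is the function field of the
  variety at the bottom.\<close>

definition admits_toric_rational_tower :: "'w::field set \<Rightarrow> 'w set \<Rightarrow> bool" where
  "admits_toric_rational_tower k L \<longleftrightarrow>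
     (\<exists>(n::nat) K. K 0 = L \<and>
        (\<forall>i\<le>n. \<exists>xs. K i = adjoin k xs) \<and>
        (\<forall>i<n. K i \<subseteq> K (Suc i)) \<and>
        rational_over k (K n) \<and>
        (\<forall>i<n. geom_rational_irreducible_fibre (K i) (K (Suc i))) \<and>
        (\<forall>i<n. toric_fibre (K i) (K (Suc i))))"

section \<open>Linear representations and fields of invariants\<close>

definition representation_on ::
    "('k::field \<Rightarrow> 'v::ab_group_add \<Rightarrow> 'v) \<Rightarrow> ('g, 'x) monoid_scheme \<Rightarrow> ('g \<Rightarrow> 'v \<Rightarrow> 'v) \<Rightarrow> bool" where
  "representation_on scale G \<rho> \<longleftrightarrow>
     (\<forall>g\<in>carrier G. Vector_Spaces.linear scale scale (\<rho> g)) \<and>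
     \<rho> \<one>\<^bsub>G\<^esub> = id \<and>
     (\<forall>g\<in>carrier G. \<forall>h\<in>carrier G. \<rho> (g \<otimes>\<^bsub>G\<^esub> h) = \<rho> g \<circ> \<rho> h)"

text \<open>The coordinate ring \<open>k[V]\<close>; the ground field is infinite below, so polynomials on \<open>V\<close> and
  polynomial functions on \<open>V\<close> are the same.\<close>

inductive_set polynomial_functions ::
    "('k::field \<Rightarrow> 'v::ab_group_add \<Rightarrow> 'v) \<Rightarrow> ('v \<Rightarrow> 'k) set"
  for scale :: "'k::field \<Rightarrow> 'v::ab_group_add \<Rightarrow> 'v" where
  const: "(\<lambda>_. c) \<in> polynomial_functions scale"
| linear: "Vector_Spaces.linear scale (*) l \<Longrightarrow> l \<in> polynomial_functions scale"
| add: "p \<in> polynomial_functions scale \<Longrightarrow> q \<in> polynomial_functions scale \<Longrightarrow>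
          (\<lambda>v. p v + q v) \<in> polynomial_functions scale"
| mult: "p \<in> polynomial_functions scale \<Longrightarrow> q \<in> polynomial_functions scale \<Longrightarrow>
          (\<lambda>v. p v * q v) \<in> polynomial_functions scale"

text \<open>The universal domain over \<open>k\<close>: the algebraic closure of a purely transcendental extension
  of infinite transcendence degree. Every finitely generated extension of \<open>k\<close> embeds into it, and
  so does every finitely generated extension of a finitely generated subfield (extending the
  inclusion of that subfield).\<close>

type_synonym 'k universal = "'k mpoly fract alg_closure"

definition ground :: "'k::field \<Rightarrow> 'k universal" where
  "ground c = to_ac (Fract (Poly_Mapping.single 0 c) 1)"

text \<open>Embeddings over \<open>k\<close> of \<open>k[V]\<close>, equivalently of \<open>k(V)\<close>, into the universal domain.\<close>

definition function_field_embedding ::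
    "('k::field \<Rightarrow> 'v::ab_group_add \<Rightarrow> 'v) \<Rightarrow> (('v \<Rightarrow> 'k) \<Rightarrow> 'k universal) \<Rightarrow> bool" where
  "function_field_embedding scale \<phi> \<longleftrightarrow>
     (\<forall>c. \<phi> (\<lambda>_. c) = ground c) \<and>
     (\<forall>p\<in>polynomial_functions scale. \<forall>q\<in>polynomial_functions scale.
        \<phi> (\<lambda>v. p v + q v) = \<phi> p + \<phi> q \<and> \<phi> (\<lambda>v. p v * q v) = \<phi> p * \<phi> q) \<and>
     inj_on \<phi> (polynomial_functions scale)"

text \<open>The image of the field of invariants \<open>k(V)\<^sup>G\<close> under such an embedding; \<open>g\<close> acts on \<open>k(V)\<close> by
  \<open>p / q \<mapsto> (p \<circ> g\<^sup>-\<^sup>1) / (q \<circ> g\<^sup>-\<^sup>1)\<close>.\<close>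

definition field_of_invariants ::
    "('k::field \<Rightarrow> 'v::ab_group_add \<Rightarrow> 'v) \<Rightarrow> ('g, 'x) monoid_scheme \<Rightarrow> ('g \<Rightarrow> 'v \<Rightarrow> 'v) \<Rightarrow>
      (('v \<Rightarrow> 'k) \<Rightarrow> 'k universal) \<Rightarrow> 'k universal set" where
  "field_of_invariants scale G \<rho> \<phi> =
     {\<phi> p / \<phi> q | p q.
        p \<in> polynomial_functions scale \<and> q \<in> polynomial_functions scale \<and> q \<noteq> (\<lambda>_. 0) \<and>
        (\<forall>g\<in>carrier G. \<phi> (p \<circ> \<rho> (inv\<^bsub>G\<^esub> g)) / \<phi> (q \<circ> \<rho> (inv\<^bsub>G\<^esub> g)) = \<phi> p / \<phi> q)}"

section \<open>Existence of the embedding\<close>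

lemma insertion_add: "insertion e (f + g) = insertion e f + insertion e g"
  unfolding insertion_def by (rule setsum_keys_plus_distrib) (simp_all add: algebra_simps)

lemma insertion_zero [simp]: "insertion e 0 = 0"
  by (simp add: insertion_def)

lemma insertion_single:
  "insertion e (Poly_Mapping.single m c) = c * (\<Prod>i\<in>Poly_Mapping.keys m. e i ^ Poly_Mapping.lookup m i)"
  by (cases "c = 0") (simp_all add: insertion_def)

lemma monomial_add:
  fixes e :: "nat \<Rightarrow> 'a::comm_ring_1"
  shows "(\<Prod>i\<in>Poly_Mapping.keys (a + b). e i ^ Poly_Mapping.lookup (a + b) i) =
    (\<Prod>i\<in>Poly_Mapping.keys a. e i ^ Poly_Mapping.lookup a i) * (\<Prod>i\<in>Poly_Mapping.keys b. e i ^ Poly_Mapping.lookup b i)"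
proof -
  let ?A = "Poly_Mapping.keys a \<union> Poly_Mapping.keys b"
  have ext: "(\<Prod>i\<in>Poly_Mapping.keys c. e i ^ Poly_Mapping.lookup c i) = (\<Prod>i\<in>?A. e i ^ Poly_Mapping.lookup c i)"
    if "Poly_Mapping.keys c \<subseteq> ?A" for c :: "nat \<Rightarrow>\<^sub>0 nat"
    using that by (intro prod.mono_neutral_left) (auto simp: in_keys_iff)
  have "(\<Prod>i\<in>Poly_Mapping.keys (a + b). e i ^ Poly_Mapping.lookup (a + b) i)
      = (\<Prod>i\<in>?A. e i ^ Poly_Mapping.lookup a i * e i ^ Poly_Mapping.lookup b i)"
    by (subst ext) (use Poly_Mapping.keys_add[of a b] in \<open>auto simp: lookup_add power_add\<close>)
  then show ?thesis
    by (simp add: prod.distrib ext)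
qed

lemma mpoly_induct [case_names zero add]:
  fixes f :: "'b \<Rightarrow>\<^sub>0 'a::comm_monoid_add"
  assumes "P 0" "\<And>m c f. P f \<Longrightarrow> P (Poly_Mapping.single m c + f)"
  shows "P f"
proof (induction f rule: Poly_Mapping.update_induct)
  case const
  show ?case by fact
next
  case (update f a b)
  have "Poly_Mapping.update a b f = Poly_Mapping.single a b + f"
    using update(1) by (intro poly_mapping_eqI)
      (auto simp: lookup_add lookup_update lookup_single in_keys_iff when_def)
  then show ?case using assms(2)[OF update(3)] by simp
qed

lemma insertion_mult: "insertion e (f * g) = insertion e f * insertion e g"
proof (induction f rule: mpoly_induct)
  case (add m c f)
  have "insertion e (Poly_Mapping.single m c * g) = insertion e (Poly_Mapping.single m c) * insertion e g"
  proof (induction g rule: mpoly_induct)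
    case (add m' d g)
    then show ?case
      by (simp add: distrib_left insertion_add mult_single insertion_single monomial_add mult_ac)
  qed simp
  with add show ?case
    by (simp add: distrib_right insertion_add)
qed simp

lemma digits_unique:
  fixes a b :: "nat \<Rightarrow> nat"
  assumes "\<And>i. i < n \<Longrightarrow> a i < N" "\<And>i. i < n \<Longrightarrow> b i < N"
    "(\<Sum>i<n. a i * N ^ i) = (\<Sum>i<n. b i * N ^ i)" "i < n"
  shows "a i = b i"
  using assms
proof (induction n arbitrary: a b i)
  case (Suc n)
  have shift: "(\<Sum>i<Suc n. c i * N ^ i) = c 0 + N * (\<Sum>i<n. c (Suc i) * N ^ i)" for c :: "nat \<Rightarrow> nat"
    by (subst sum.lessThan_Suc_shift) (simp add: sum_distrib_left mult_ac)
  have eq: "a 0 + N * (\<Sum>i<n. a (Suc i) * N ^ i) = b 0 + N * (\<Sum>i<n. b (Suc i) * N ^ i)"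
    using Suc.prems(3) unfolding shift .
  have lt: "a 0 < N" "b 0 < N" using Suc.prems by auto
  have "(a 0 + N * (\<Sum>i<n. a (Suc i) * N ^ i)) mod N = (b 0 + N * (\<Sum>i<n. b (Suc i) * N ^ i)) mod N"
    using eq by simp
  with lt have 0: "a 0 = b 0" by simp
  with eq lt have 1: "(\<Sum>i<n. a (Suc i) * N ^ i) = (\<Sum>i<n. b (Suc i) * N ^ i)"
    by simp
  show ?case
  proof (cases i)
    case (Suc j)
    show ?thesis unfolding Suc
      by (rule Suc.IH[where a = "\<lambda>i. a (Suc i)" and b = "\<lambda>i. b (Suc i)"])
        (use Suc.prems 1 Suc in auto)
  qed (use 0 in simp)
qed simp

lemma insertion_eq_0_imp_eq_0:
  fixes f :: "'k::field_char_0 mpoly"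
  assumes vars: "\<And>m. m \<in> Poly_Mapping.keys f \<Longrightarrow> Poly_Mapping.keys m \<subseteq> {..<n}"
    and zero: "\<And>e. insertion e f = 0"
  shows "f = 0"
proof (rule ccontr)
  assume "f \<noteq> 0"
  then obtain m0 where m0: "m0 \<in> Poly_Mapping.keys f"
    by (metis all_not_in_conv keys_eq_empty)
  let ?E = "\<Union>m\<in>Poly_Mapping.keys f. Poly_Mapping.lookup m ` {..<n}"
  define N where "N = Suc (Max ?E)"
  have small: "Poly_Mapping.lookup m i < N" if "m \<in> Poly_Mapping.keys f" "i < n" for m i
    unfolding N_def less_Suc_eq_le using that by (intro Max_ge) auto
  define w where "w m = (\<Sum>i<n. Poly_Mapping.lookup m i * N ^ i)" for m :: "nat \<Rightarrow>\<^sub>0 nat"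
  have inj: "m = m'" if "m \<in> Poly_Mapping.keys f" "m' \<in> Poly_Mapping.keys f" "w m = w m'" for m m'
  proof (rule poly_mapping_eqI)
    fix i show "Poly_Mapping.lookup m i = Poly_Mapping.lookup m' i"
    proof (cases "i < n")
      case True
      then show ?thesis
        using digits_unique[of n "Poly_Mapping.lookup m" N "Poly_Mapping.lookup m'" i] that small by (auto simp: w_def)
    next
      case False
      then show ?thesis using vars[OF that(1)] vars[OF that(2)]
        by (metis in_keys_iff lessThan_iff subsetD)
    qed
  qed
  define q where "q = (\<Sum>m\<in>Poly_Mapping.keys f. Polynomial.monom (Poly_Mapping.lookup f m) (w m))"
  have mon: "t ^ w m = (\<Prod>i\<in>Poly_Mapping.keys m. (t ^ (N ^ i)) ^ Poly_Mapping.lookup m i)"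
    if "m \<in> Poly_Mapping.keys f" for m and t :: 'k
  proof -
    have "t ^ w m = (\<Prod>i<n. (t ^ (N ^ i)) ^ Poly_Mapping.lookup m i)"
      by (simp add: w_def power_sum mult.commute flip: power_mult)
    also have "\<dots> = (\<Prod>i\<in>Poly_Mapping.keys m. (t ^ (N ^ i)) ^ Poly_Mapping.lookup m i)"
      using vars[OF that] by (intro prod.mono_neutral_right) (auto simp: in_keys_iff)
    finally show ?thesis .
  qed
  have "poly q t = insertion (\<lambda>i. t ^ (N ^ i)) f" for t
    by (simp add: q_def insertion_def poly_sum poly_monom mon)
  then have "q = 0"
    using zero poly_all_0_iff_0 by metis
  have "Polynomial.coeff q (w m0) = (\<Sum>m\<in>Poly_Mapping.keys f. if m = m0 then Poly_Mapping.lookup f m else 0)"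
    unfolding q_def coeff_sum by (intro sum.cong) (use inj m0 in auto)
  also have "\<dots> = Poly_Mapping.lookup f m0" using m0 by simp
  finally show False using \<open>q = 0\<close> m0 by (simp add: in_keys_iff)
qed

lemma ex_function_field_embedding:
  fixes scale :: "'k::field_char_0 \<Rightarrow> 'v::ab_group_add \<Rightarrow> 'v"
  assumes "finite_dimensional_vector_space scale Basis"
  shows "\<exists>\<phi>. function_field_embedding scale \<phi>"
proof -
  interpret finite_dimensional_vector_space scale Basis by fact
  define n where "n = card Basis"
  obtain b where b: "bij_betw b {..<n} Basis"
    using ex_bij_betw_nat_finite[OF finite_Basis] by (auto simp: n_def atLeast0LessThan)
  define h where "h P v = insertion (\<lambda>i. representation Basis v (b i)) P" for P v
  define R :: "'k mpoly set" where
    "R = {P. \<forall>m\<in>Poly_Mapping.keys P. Poly_Mapping.keys m \<subseteq> {..<n}}"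
  have R_add: "P + Q \<in> R" if "P \<in> R" "Q \<in> R" for P Q
    using that Poly_Mapping.keys_add[of P Q] unfolding R_def by blast
  have R_uminus: "- P \<in> R" if "P \<in> R" for P
    using that by (simp add: R_def)
  have R_mult: "P * Q \<in> R" if "P \<in> R" "Q \<in> R" for P Q
    unfolding R_def
  proof (intro CollectI ballI)
    fix m assume "m \<in> Poly_Mapping.keys (P * Q)"
    then obtain a c where "m = a + c" "a \<in> Poly_Mapping.keys P" "c \<in> Poly_Mapping.keys Q"
      using Poly_Mapping.keys_mult[of P Q] by blast
    then show "Poly_Mapping.keys m \<subseteq> {..<n}"
      using that Poly_Mapping.keys_add[of a c] unfolding R_def by blast
  qed
  have R_single: "Poly_Mapping.single m c \<in> R" if "Poly_Mapping.keys m \<subseteq> {..<n}" for m c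
    using that by (auto simp: R_def)
  have h_add: "h (P + Q) = (\<lambda>v. h P v + h Q v)" for P Q
    by (rule ext) (simp add: h_def insertion_add)
  have h_mult: "h (P * Q) = (\<lambda>v. h P v * h Q v)" for P Q
    by (rule ext) (simp add: h_def insertion_mult)
  have h_const: "h (Poly_Mapping.single 0 c) = (\<lambda>_. c)" for c
    by (rule ext) (simp add: h_def insertion_single)
  have rep_sum: "representation Basis (\<Sum>i<n. scale (e i) (b i)) (b j) = e j" if "j < n" for e j
  proof -
    have bB: "b i \<in> Basis" if "i < n" for i using b that by (auto simp: bij_betw_def)
    have beq: "b i = b j \<longleftrightarrow> i = j" if "i < n" for i
      using b that \<open>j < n\<close> by (auto simp: bij_betw_def inj_on_def)
    have "representation Basis (\<Sum>i<n. scale (e i) (b i)) (b j)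
        = (\<Sum>i<n. representation Basis (scale (e i) (b i)) (b j))"
      by (subst representation_sum[OF independent_Basis]) (simp_all add: span_Basis)
    also have "\<dots> = (\<Sum>i<n. if i = j then e i else 0)"
    proof (rule sum.cong)
      fix i assume "i \<in> {..<n}"
      then show "representation Basis (scale (e i) (b i)) (b j) = (if i = j then e i else 0)"
        using bB[of i] beq[of i] by (auto simp: representation_scale[OF independent_Basis] span_Basis
            representation_basis[OF independent_Basis])
    qed simp
    also have "\<dots> = e j" using that by simp
    finally show ?thesis .
  qed
  have h_zero: "P = 0" if P: "P \<in> R" "h P = (\<lambda>_. 0)" for P
  proof (rule insertion_eq_0_imp_eq_0[of P n])
    show vars: "Poly_Mapping.keys m \<subseteq> {..<n}" if "m \<in> Poly_Mapping.keys P" for m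
      using that P by (simp add: R_def)
    fix e
    have "insertion e P = h P (\<Sum>i<n. scale (e i) (b i))"
      unfolding h_def insertion_def
    proof (intro sum.cong arg_cong2[where f = "(*)"] prod.cong refl)
      fix m i assume "m \<in> Poly_Mapping.keys P" "i \<in> Poly_Mapping.keys m"
      then have "i < n" using vars by blast
      then show "e i ^ Poly_Mapping.lookup m i =
          representation Basis (\<Sum>i<n. scale (e i) (b i)) (b i) ^ Poly_Mapping.lookup m i"
        by (simp only: rep_sum)
    qed
    then show "insertion e P = 0" using P by simp
  qed
  have h_inj: "P = Q" if "P \<in> R" "Q \<in> R" "h P = h Q" for P Q
  proof -
    have "h (P + - Q) = (\<lambda>_. 0)"
    proof
      fix v
      have "h (P + - Q) v + h Q v = h P v"
        using fun_cong[OF h_add[of "P + - Q" Q], of v] by simp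
      then show "h (P + - Q) v = 0" using that(3) by simp
    qed
    from h_zero[OF R_add[OF that(1) R_uminus[OF that(2)]] this] show ?thesis by simp
  qed
  have surj: "\<exists>P\<in>R. h P = p" if "p \<in> polynomial_functions scale" for p
    using that
  proof induction
    case (const c)
    show ?case
      by (intro bexI[of _ "Poly_Mapping.single 0 c"] R_single) (simp_all add: h_const)
  next
    case (linear l)
    interpret l: Vector_Spaces.linear scale "(*)" l by fact
    define y where "y i = Poly_Mapping.single (Poly_Mapping.single i (1::nat)) (l (b i))" for i :: nat
    have sumR: "(\<Sum>i\<in>I. y i) \<in> R" if "I \<subseteq> {..<n}" "finite I" for I
      using that(2,1)
    proof induction
      case (insert i I)
      then show ?case
        unfolding sum.insert[OF insert.hyps]
        by (intro R_add) (auto simp: y_def intro!: R_single)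
    qed (simp add: R_def)
    have sumh: "h (\<Sum>i\<in>I. y i) = (\<lambda>v. \<Sum>i\<in>I. l (b i) * representation Basis v (b i))"
      if "finite I" for I
      using that
    proof induction
      case (insert i I)
      then show ?case
        by (simp add: h_add) (simp add: h_def y_def insertion_single)
    qed (rule ext, simp add: h_def)
    have "l v = (\<Sum>i<n. l (b i) * representation Basis v (b i))" for v
    proof -
      have "v = (\<Sum>c\<in>Basis. scale (representation Basis v c) c)"
        by (rule sum_representation_eq[OF independent_Basis _ finite_Basis, symmetric])
          (simp_all add: span_Basis)
      then have "l v = l (\<Sum>c\<in>Basis. scale (representation Basis v c) c)"
        by (rule arg_cong[where f = l])
      also have "\<dots> = (\<Sum>c\<in>Basis. representation Basis v c * l c)"
        unfolding l.sum l.scale ..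
      also have "\<dots> = (\<Sum>i<n. representation Basis v (b i) * l (b i))"
        by (rule sum.reindex_bij_betw[OF b, symmetric])
      finally show ?thesis by (simp add: mult.commute)
    qed
    then have "(\<lambda>v. \<Sum>i<n. l (b i) * representation Basis v (b i)) = l"
      by (intro ext) (rule sym)
    then have "h (\<Sum>i<n. y i) = l"
      by (simp only: sumh[OF finite_lessThan])
    then show ?case using sumR[of "{..<n}"] by auto
  next
    case (add p q)
    then obtain P Q where "P \<in> R" "h P = p" "Q \<in> R" "h Q = q" by blast
    then show ?case by (intro bexI[of _ "P + Q"] R_add) (simp_all only: h_add)
  next
    case (mult p q)
    then obtain P Q where "P \<in> R" "h P = p" "Q \<in> R" "h Q = q" by blast
    then show ?case by (intro bexI[of _ "P * Q"] R_mult) (simp_all only: h_mult)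
  qed
  define r where "r p = (THE P. P \<in> R \<and> h P = p)" for p
  have r_eq: "r p = P" if "P \<in> R" "h P = p" for p P
    unfolding r_def using that h_inj by (intro the_equality) auto
  have r: "r p \<in> R" "h (r p) = p" if "p \<in> polynomial_functions scale" for p
    using surj[OF that] r_eq by auto
  define \<phi> where "\<phi> p = to_ac (Fract (r p) 1)" for p
  have "function_field_embedding scale \<phi>"
    unfolding function_field_embedding_def
  proof (intro conjI allI ballI)
    fix c show "\<phi> (\<lambda>_. c) = ground c"
      unfolding \<phi>_def ground_def by (subst r_eq[OF R_single h_const]) simp_all
  next
    fix p q assume pq: "p \<in> polynomial_functions scale" "q \<in> polynomial_functions scale"
    have "r (\<lambda>v. p v + q v) = r p + r q"
      by (rule r_eq) (use pq r R_add in \<open>auto simp: h_add\<close>)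
    then show "\<phi> (\<lambda>v. p v + q v) = \<phi> p + \<phi> q"
      by (simp add: \<phi>_def flip: to_ac_add)
    have "r (\<lambda>v. p v * q v) = r p * r q"
      by (rule r_eq) (use pq r R_mult in \<open>auto simp: h_mult\<close>)
    then show "\<phi> (\<lambda>v. p v * q v) = \<phi> p * \<phi> q"
      by (simp add: \<phi>_def flip: to_ac_mult)
  next
    show "inj_on \<phi> (polynomial_functions scale)"
    proof (rule inj_onI)
      fix p q
      assume pq: "p \<in> polynomial_functions scale" "q \<in> polynomial_functions scale" "\<phi> p = \<phi> q"
      have "r p = r q"
        using pq(3) by (simp add: \<phi>_def eq_fract)
      then have "h (r p) = h (r q)" by simp
      then show "p = q" by (simp only: r(2)[OF pq(1)] r(2)[OF pq(2)])
    qed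
  qed
  then show ?thesis by blast
qed

end

theory Submission
  imports Defs
begin

text \<open>Put \<open>n = |G|\<close>, let \<open>g\<^sub>i\<close> (\<open>i < r\<close>) enumerate \<open>G\<close>, and adjoin to \<open>k(V)\<close> independent Kummer
  generators \<open>u\<^sub>i\<close> and, for each \<open>i\<close>, the conjugates of a generic element \<open>z\<^sub>i\<close> whose norm from
  \<open>k(u\<^sub>0, \<dots>, u\<^sub>i\<^sub>-\<^sub>1)\<close> to the field of the powers \<open>u\<^sub>l\<^sup>n\<close> is \<open>u\<^sub>i\<^sup>n\<close>. The fibre product \<open>H\<close> of \<open>G\<close> and
  \<open>(\<int>/n)\<^sup>r\<close> over \<open>A\<close> acts on the resulting field, and the fixed fields of \<open>H\<close> form a tower over
  \<open>k(V)\<^sup>G\<close> in which each step is either purely transcendental of degree one or the function field of a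
  torsor under a norm torus.

  The top of the tower is rational because the \<open>z\<^sub>i\<close> split the symbols of the \<open>u\<^sub>i\<close>: they provide
  elements \<open>\<theta>\<close> of norm one which \<open>g\<^sub>i\<close> multiplies by a root of unity, and twisting the \<open>g\<^sub>i\<close> by products
  of these turns the commutation relations of the central extension into honest commutation. The
  commuting twisted operators are simultaneously diagonalisable, so the span of \<open>V\<^sup>*\<close> over the field of
  the \<open>u\<^sub>i\<close> and \<open>z\<^sub>i\<close> has a basis of semi-invariants, and invariants of such an action form a rational
  extension.\<close>

section \<open>Subfields, spans and dependence\<close>

text \<open>The obstacle is non-commutativity. If \<open>G\<close> were abelian, its operators on
  \<open>V\<close> would diagonalise and the quotient would be rational at once. For a central
  extension, a character \<open>\<chi>\<close> of the central subgroup leaves the lifts of two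
  elements of \<open>A\<close> commuting only up to the value of \<open>\<chi>\<close> at their
  commutator. Over the field of the \<open>u\<^sub>i\<^sup>n\<close> this obstruction is a
  combination of the symbols of \<open>u\<^sub>i\<^sup>n\<close> and
  \<open>u\<^sub>j\<^sup>n\<close>, and a symbol dies once one entry is a norm from the cyclic
  extension given by the other. For \<open>j < i\<close> the product of those conjugates of
  \<open>z\<^sub>i\<close> whose index is zero at \<open>j\<close> has norm
  \<open>u\<^sub>i\<^sup>n\<close> for that extension. Each pair of indices needs this only once, so
  norms from the preceding generators suffice and the construction is triangular. The fibre product
  is needed so that the \<open>u\<^sub>i\<close> carry an action compatible with \<open>A\<close>.
  Listing all of \<open>G\<close> makes the map from \<open>H\<close> to \<open>G\<close> visibly
  onto; its kernel acts trivially on \<open>k(V)\<close>, so the invariants at the bottom are still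
  those of \<open>G\<close>. The number \<open>n\<close> is the order of \<open>G\<close>, so that
  the \<open>n\<close>-th power of every lift is trivial.\<close>

definition subfld :: "'w::field set \<Rightarrow> bool" where
  "subfld F \<longleftrightarrow> 1 \<in> F \<and> (\<forall>x\<in>F. \<forall>y\<in>F. x - y \<in> F \<and> x * y \<in> F) \<and> (\<forall>x\<in>F. inverse x \<in> F)"

lemma subfldI:
  assumes "1 \<in> F" "\<And>x y. x \<in> F \<Longrightarrow> y \<in> F \<Longrightarrow> x - y \<in> F"
    "\<And>x y. x \<in> F \<Longrightarrow> y \<in> F \<Longrightarrow> x * y \<in> F" "\<And>x. x \<in> F \<Longrightarrow> inverse x \<in> F"
  shows "subfld F"
  using assms by (auto simp: subfld_def)

context
  fixes F :: "'w::field set"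
  assumes F: "subfld F"
begin

lemma subfld_1: "1 \<in> F" and subfld_diff: "x \<in> F \<Longrightarrow> y \<in> F \<Longrightarrow> x - y \<in> F"
  and subfld_mult: "x \<in> F \<Longrightarrow> y \<in> F \<Longrightarrow> x * y \<in> F" and subfld_inverse: "x \<in> F \<Longrightarrow> inverse x \<in> F"
  using F by (auto simp: subfld_def)

lemma subfld_0: "0 \<in> F"
  using subfld_diff[OF subfld_1 subfld_1] by simp

lemma subfld_uminus: "x \<in> F \<Longrightarrow> - x \<in> F"
  using subfld_diff[OF subfld_0, of x] by simp

lemma subfld_add: "x \<in> F \<Longrightarrow> y \<in> F \<Longrightarrow> x + y \<in> F"
  using subfld_diff[of x "- y"] subfld_uminus by simp

lemma subfld_divide: "x \<in> F \<Longrightarrow> y \<in> F \<Longrightarrow> x / y \<in> F"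
  by (simp add: divide_inverse subfld_mult subfld_inverse)

lemma subfld_power: "x \<in> F \<Longrightarrow> x ^ n \<in> F"
  by (induction n) (simp_all add: subfld_1 subfld_mult)

lemma subfld_of_nat: "of_nat n \<in> F"
  by (induction n) (simp_all add: subfld_0 subfld_1 subfld_add)

lemma subfld_sum: "(\<And>i. i \<in> I \<Longrightarrow> f i \<in> F) \<Longrightarrow> sum f I \<in> F"
  by (induction I rule: infinite_finite_induct) (simp_all add: subfld_0 subfld_add)

lemma subfld_prod: "(\<And>i. i \<in> I \<Longrightarrow> f i \<in> F) \<Longrightarrow> prod f I \<in> F"
  by (induction I rule: infinite_finite_induct) (simp_all add: subfld_1 subfld_mult)

end

lemmas subfld_closed = subfld_0 subfld_1 subfld_diff subfld_mult subfld_inverse subfld_uminus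
  subfld_add subfld_divide subfld_power subfld_of_nat subfld_sum subfld_prod

lemma infinite_subfld:
  fixes F :: "'w::field_char_0 set"
  assumes "subfld F"
  shows "infinite F"
proof -
  have "range (of_nat :: nat \<Rightarrow> 'w) \<subseteq> F"
    using subfld_of_nat[OF assms] by auto
  then show ?thesis
    by (metis finite_subset inj_of_nat infinite_UNIV_nat finite_imageD)
qed

text \<open>As an intersection this is visibly a closure operator, so an inclusion of generated
  fields is checked on generators; \<open>adjoin_eq_fgen\<close> identifies it with the
  \<open>adjoin\<close> used for towers.\<close>

definition fgen :: "'w::field set \<Rightarrow> 'w set" where
  "fgen S = \<Inter>{F. subfld F \<and> S \<subseteq> F}"

lemma subfld_fgen [simp]: "subfld (fgen S)"
  unfolding fgen_def subfld_def by auto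

lemma fgen_superset: "S \<subseteq> fgen S"
  unfolding fgen_def by auto

lemma fgen_inc: "x \<in> S \<Longrightarrow> x \<in> fgen S"
  using fgen_superset by auto

lemma fgen_least: "subfld F \<Longrightarrow> S \<subseteq> F \<Longrightarrow> fgen S \<subseteq> F"
  unfolding fgen_def by auto

lemma fgen_mono: "S \<subseteq> T \<Longrightarrow> fgen S \<subseteq> fgen T"
  by (meson fgen_least fgen_superset order_trans subfld_fgen)

lemma fgen_subfld: "subfld F \<Longrightarrow> fgen F = F"
  by (meson fgen_least fgen_superset order_antisym order_refl)

lemma fgen_fgen_Un: "fgen (fgen S \<union> T) = fgen (S \<union> T)"
proof
  show "fgen (fgen S \<union> T) \<subseteq> fgen (S \<union> T)"
    by (rule fgen_least) (use fgen_mono[of S "S \<union> T"] fgen_superset[of "S \<union> T"] in auto)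
  show "fgen (S \<union> T) \<subseteq> fgen (fgen S \<union> T)"
    by (rule fgen_mono) (use fgen_superset[of S] in auto)
qed

lemma fgen_eqI: "S \<subseteq> fgen T \<Longrightarrow> T \<subseteq> fgen S \<Longrightarrow> fgen S = fgen T"
  by (meson fgen_least order_antisym subfld_fgen)

lemma adjoin_eq_fgen: "adjoin F xs = fgen (F \<union> set xs)"
proof -
  let ?R = "ring_of_type_algebra :: 'a ring"
  interpret R: field ?R by (rule field_from_type_algebra)
  have [simp]: "carrier ?R = UNIV" "\<one>\<^bsub>?R\<^esub> = 1" "\<zero>\<^bsub>?R\<^esub> = 0"
    "x \<otimes>\<^bsub>?R\<^esub> y = x * y" "x \<oplus>\<^bsub>?R\<^esub> y = x + y" for x y
    by (simp_all add: ring_of_type_algebra_def)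
  have m [simp]: "\<ominus>\<^bsub>?R\<^esub> x = - x" for x
    by (rule R.minus_equality) simp_all
  have i [simp]: "inv\<^bsub>?R\<^esub> x = inverse x" if "x \<noteq> 0" for x
    by (rule R.comm_inv_char) (use that in simp_all)
  let ?G = "generate_field ?R (F \<union> set xs)"
  have G0: "0 \<in> ?G"
    using R.zero_in_generate[of "F \<union> set xs"] by simp
  have "?G \<subseteq> fgen (F \<union> set xs)"
  proof
    fix x assume "x \<in> ?G"
    then show "x \<in> fgen (F \<union> set xs)"
      by induction (auto simp: subfld_closed intro: fgen_inc)
  qed
  moreover have "fgen (F \<union> set xs) \<subseteq> ?G"
  proof (rule fgen_least)
    show "subfld ?G"
    proof (rule subfldI)
      show "1 \<in> ?G" using generate_field.one[of ?R "F \<union> set xs"] by simp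
    next
      fix x y assume xy: "x \<in> ?G" "y \<in> ?G"
      show "x * y \<in> ?G" using generate_field.eng_mult[OF xy] by simp
      show "x - y \<in> ?G" using generate_field.eng_add[OF xy(1) generate_field.a_inv[OF xy(2)]] by simp
    next
      fix x assume x: "x \<in> ?G"
      show "inverse x \<in> ?G"
        using generate_field.m_inv[OF x] G0 by (cases "x = 0") auto
    qed
  qed (auto intro: generate_field.incl)
  ultimately show ?thesis by (simp add: adjoin_def)
qed

section \<open>Steinitz exchange for an abstract closure operator\<close>

locale pregeometry =
  fixes cl :: "'a set \<Rightarrow> 'a set"
  assumes cl_superset: "S \<subseteq> cl S"
    and cl_mono: "S \<subseteq> T \<Longrightarrow> cl S \<subseteq> cl T"
    and cl_cl: "cl (cl S) = cl S"
    and exchange: "x \<in> cl (insert y S) \<Longrightarrow> x \<notin> cl S \<Longrightarrow> y \<in> cl (insert x S)"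
begin

definition indep :: "'a set \<Rightarrow> bool" where
  "indep S \<longleftrightarrow> (\<forall>x\<in>S. x \<notin> cl (S - {x}))"

lemma cl_least: "S \<subseteq> cl T \<Longrightarrow> cl S \<subseteq> cl T"
  using cl_mono[of S "cl T"] cl_cl by simp

lemma indep_subset: "indep T \<Longrightarrow> S \<subseteq> T \<Longrightarrow> indep S"
  unfolding indep_def using cl_mono[of "S - {x}" "T - {x}" for x] by blast

lemma indep_insert:
  assumes "indep T" "s \<notin> cl T"
  shows "indep (insert s T)"
  unfolding indep_def
proof (intro ballI notI)
  fix x assume x: "x \<in> insert s T" "x \<in> cl (insert s T - {x})"
  have "s \<notin> T" using assms cl_superset[of T] by blast
  show False
  proof (cases "x = s")
    case True
    then show False using x assms \<open>s \<notin> T\<close> by simp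
  next
    case False
    then have xT: "x \<in> T" "insert s T - {x} = insert s (T - {x})" using x by auto
    then have "s \<in> cl (insert x (T - {x}))"
      using exchange[of x s "T - {x}"] x assms(1) by (auto simp: indep_def)
    then show False using assms(2) xT(1) by (simp add: insert_absorb)
  qed
qed

text \<open>An element \<open>t\<close> of \<open>T\<close> outside \<open>S\<close> is exchanged
  for some \<open>s\<close> of \<open>S\<close> outside the closure of \<open>T - {t}\<close>.
  Cardinality and independence survive while \<open>card (T - S)\<close> drops; once
  \<open>T\<close> lies in \<open>S\<close> the bound is trivial.\<close>

lemma card_le_finite:
  assumes "finite S" "finite T" "indep T" "T \<subseteq> cl S"
  shows "card T \<le> card S"
  using assms(2-)
proof (induction "card (T - S)" arbitrary: T rule: less_induct)
  case less
  show ?case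
  proof (cases "T \<subseteq> S")
    case True
    then show ?thesis using \<open>finite S\<close> card_mono by blast
  next
    case False
    then obtain t where t: "t \<in> T" "t \<notin> S" by blast
    then have "t \<notin> cl (T - {t})" "t \<in> cl S" using less.prems by (auto simp: indep_def)
    then have "\<not> S \<subseteq> cl (T - {t})" using cl_least by blast
    then obtain s where s: "s \<in> S" "s \<notin> cl (T - {t})" by blast
    let ?T = "insert s (T - {t})"
    have sT: "s \<notin> T - {t}" using s cl_superset[of "T - {t}"] by blast
    have "card (?T - S) < card (T - S)"
      using t s less.prems(1) by (intro psubset_card_mono) auto
    moreover have "indep ?T"
      using s less.prems by (intro indep_insert) (auto intro: indep_subset)
    moreover have "?T \<subseteq> cl S" using s cl_superset[of S] less.prems by blast
    ultimately have "card ?T \<le> card S" using less.hyps[of ?T] less.prems by simp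
    moreover have "card ?T = card T"
      using card_insert_disjoint[OF _ sT] card.remove[OF less.prems(1) t(1)] less.prems(1) by simp
    ultimately show ?thesis by simp
  qed
qed

lemma card_le:
  assumes "finite S" "indep T" "T \<subseteq> cl S"
  shows "finite T \<and> card T \<le> card S"
proof -
  have "finite T"
  proof (rule ccontr)
    assume "infinite T"
    then obtain U where U: "U \<subseteq> T" "finite U" "card U = Suc (card S)"
      using infinite_arbitrarily_large by blast
    then show False
      using card_le_finite[OF assms(1) U(2) indep_subset[OF assms(2) U(1)]] assms(3) by auto
  qed
  then show ?thesis using card_le_finite assms by blast
qed

text \<open>A redundant element of \<open>S\<close> could be dropped with \<open>T\<close> still in
  the closure, and the smaller spanning set would contradict \<open>card_le\<close>. Changes of
  coordinates are later shown to preserve independence in this way.\<close>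

lemma indep_spanning:
  assumes "finite S" "indep T" "T \<subseteq> cl S" "card S \<le> card T"
  shows "indep S"
  unfolding indep_def
proof (intro ballI notI)
  fix x assume x: "x \<in> S" "x \<in> cl (S - {x})"
  have "S \<subseteq> cl (S - {x})"
    using x(2) cl_superset[of "S - {x}"] by blast
  then have "T \<subseteq> cl (S - {x})" using assms(3) cl_least by blast
  then have "card T \<le> card (S - {x})" using card_le[of "S - {x}" T] assms by simp
  moreover have "card (S - {x}) < card S"
    using x assms by (intro psubset_card_mono) auto
  ultimately show False using assms(4) by simp
qed

lemma ex_basis:
  assumes "finite S"
  shows "\<exists>B\<subseteq>S. indep B \<and> S \<subseteq> cl B"
  using assms
proof induction
  case empty
  show ?case by (auto simp: indep_def)
next
  case (insert x S)
  then obtain B where B: "B \<subseteq> S" "indep B" "S \<subseteq> cl B" by blast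
  show ?case
  proof (cases "x \<in> cl B")
    case True
    then show ?thesis using B by blast
  next
    case False
    have "S \<subseteq> cl (insert x B)" "x \<in> cl (insert x B)"
      using B cl_mono[of B "insert x B"] cl_superset[of "insert x B"] by blast+
    then show ?thesis using B indep_insert[OF B(2) False] by blast
  qed
qed

end

section \<open>Linear spans over a subfield\<close>

inductive_set fspan :: "'w::field set \<Rightarrow> 'w set \<Rightarrow> 'w set" for F S where
  zero: "0 \<in> fspan F S"
| step: "x \<in> fspan F S \<Longrightarrow> c \<in> F \<Longrightarrow> s \<in> S \<Longrightarrow> c * s + x \<in> fspan F S"

lemma fspan_mono: "S \<subseteq> T \<Longrightarrow> fspan F S \<subseteq> fspan F T"
proof
  fix x assume "S \<subseteq> T" "x \<in> fspan F S"
  from this(2,1) show "x \<in> fspan F T"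
    by induction (auto intro: fspan.intros)
qed

context
  fixes F :: "'w::field set"
  assumes F: "subfld F"
begin

lemma fspan_add: "x \<in> fspan F S \<Longrightarrow> y \<in> fspan F S \<Longrightarrow> x + y \<in> fspan F S"
  by (induction rule: fspan.induct) (auto intro: fspan.intros simp: add.assoc)

lemma fspan_scale: "x \<in> fspan F S \<Longrightarrow> c \<in> F \<Longrightarrow> c * x \<in> fspan F S"
proof (induction rule: fspan.induct)
  case (step x d s)
  then show ?case
    using fspan.step[of "c * x" F S "c * d" s] by (simp add: subfld_mult[OF F] algebra_simps)
qed (auto intro: fspan.intros)

lemma fspan_inc: "s \<in> S \<Longrightarrow> s \<in> fspan F S"
  using fspan.step[OF fspan.zero subfld_1[OF F], of s S] by simp

lemma fspan_uminus: "x \<in> fspan F S \<Longrightarrow> - x \<in> fspan F S"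
  using fspan_scale[of x S "- 1"] subfld_uminus[OF F subfld_1[OF F]] by simp

lemma fspan_diff: "x \<in> fspan F S \<Longrightarrow> y \<in> fspan F S \<Longrightarrow> x - y \<in> fspan F S"
  using fspan_add[OF _ fspan_uminus, of x S y] by simp

lemma fspan_sum: "(\<And>i. i \<in> I \<Longrightarrow> f i \<in> fspan F S) \<Longrightarrow> sum f I \<in> fspan F S"
  by (induction I rule: infinite_finite_induct) (auto intro: fspan.zero fspan_add)

lemma fspan_least: "S \<subseteq> fspan F T \<Longrightarrow> fspan F S \<subseteq> fspan F T"
proof
  fix x assume "S \<subseteq> fspan F T" "x \<in> fspan F S"
  from this(2,1) show "x \<in> fspan F T"
    by induction (auto intro: fspan.zero fspan_add fspan_scale)
qed

lemma fspan_mult_right: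
  "x \<in> fspan F S \<Longrightarrow> (\<And>s. s \<in> S \<Longrightarrow> s * c \<in> fspan F T) \<Longrightarrow> x * c \<in> fspan F T"
  by (induction rule: fspan.induct)
    (auto simp: distrib_right mult.assoc intro: fspan.zero fspan_add fspan_scale)

lemma fspan_insertE:
  assumes "x \<in> fspan F (insert y S)"
  obtains c z where "c \<in> F" "z \<in> fspan F S" "x = c * y + z"
proof -
  have "\<exists>c z. c \<in> F \<and> z \<in> fspan F S \<and> x = c * y + z"
    using assms
  proof induction
    case zero
    then show ?case using fspan.zero[of F S] subfld_0[OF F] by force
  next
    case (step x d s)
    then obtain c z where cz: "c \<in> F" "z \<in> fspan F S" "x = c * y + z" by blast
    show ?case
    proof (cases "s = y")
      case True
      then show ?thesis
        using cz step by (intro exI[of _ "d + c"] exI[of _ z]) (simp add: subfld_add[OF F] algebra_simps)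
    next
      case False
      then show ?thesis
        using cz step by (intro exI[of _ c] exI[of _ "d * s + z"]) (auto intro: fspan.step)
    qed
  qed
  then show ?thesis using that by blast
qed

lemma fspan_imageE:
  assumes "x \<in> fspan F (f ` J)" "finite J"
  obtains c where "\<And>j. c j \<in> F" "x = (\<Sum>j\<in>J. c j * f j)"
proof -
  have "\<exists>c. (\<forall>j. c j \<in> F) \<and> x = (\<Sum>j\<in>J. c j * f j)"
    using assms(1)
  proof induction
    case zero
    then show ?case by (intro exI[of _ "\<lambda>_. 0"]) (simp add: subfld_0[OF F])
  next
    case (step x d s)
    then obtain c j where c: "\<forall>j. c j \<in> F" "x = (\<Sum>j\<in>J. c j * f j)" "j \<in> J" "s = f j" by blast
    have "(\<Sum>i\<in>J. (c(j := c j + d)) i * f i) = d * s + x"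
      using c assms(2) by (simp add: sum.remove[of J j] algebra_simps)
    then show ?case
      using c(1) step.hyps by (intro exI[of _ "c(j := c j + d)"]) (auto simp: subfld_add[OF F])
  qed
  then show ?thesis using that by blast
qed

lemma pregeometry_fspan: "pregeometry (fspan F)"
proof
  fix S T :: "'w set" and x y
  show "S \<subseteq> fspan F S" using fspan_inc by auto
  show "fspan F S \<subseteq> fspan F T" if "S \<subseteq> T" using that by (rule fspan_mono)
  show "fspan F (fspan F S) = fspan F S"
    using fspan_least[of "fspan F S" S] fspan_inc by blast
  show "y \<in> fspan F (insert x S)" if x: "x \<in> fspan F (insert y S)" "x \<notin> fspan F S"
  proof -
    obtain c z where c: "c \<in> F" "z \<in> fspan F S" "x = c * y + z" using fspan_insertE[OF x(1)] .
    then have "c \<noteq> 0" using x(2) by auto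
    then have "y = inverse c * x + inverse c * (- z)" using c by (simp add: field_simps)
    moreover have "z \<in> fspan F (insert x S)" using c fspan_mono[of S "insert x S" F] by blast
    then have "inverse c * x + inverse c * (- z) \<in> fspan F (insert x S)"
      using c by (intro fspan_add fspan_scale[OF fspan_inc] fspan_scale[OF fspan_uminus] subfld_inverse[OF F]) simp_all
    ultimately show ?thesis by (simp only:)
  qed
qed

end

section \<open>Algebraic elements via finite-dimensional stable spaces\<close>

lemma alg_cl_mono: "F \<subseteq> E \<Longrightarrow> alg_cl F \<subseteq> alg_cl E"
  unfolding alg_cl_def by blast

text \<open>An element is algebraic over \<open>F\<close> iff it multiplies a finite-dimensional space over \<open>F\<close>
  containing \<open>1\<close> into itself.\<close>

definition stab :: "'w::field set \<Rightarrow> 'w set \<Rightarrow> 'w set" where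
  "stab F B = {a. \<forall>b\<in>fspan F B. b * a \<in> fspan F B}"

context
  fixes F :: "'w::field set"
  assumes F: "subfld F"
begin

lemma alg_clI_power:
  assumes "x ^ N = (\<Sum>j<N. c j * x ^ j)" "\<And>j. j < N \<Longrightarrow> c j \<in> F"
  shows "x \<in> alg_cl F"
proof -
  let ?p = "Polynomial.monom 1 N - (\<Sum>j<N. Polynomial.monom (c j) j)"
  have c: "Polynomial.coeff ?p i = (if i = N then 1 else 0) - (if i < N then c i else 0)" for i
    by (simp add: coeff_sum)
  have "Polynomial.coeff ?p N \<noteq> 0" unfolding c by simp
  then have "?p \<noteq> 0" by (metis coeff_0)
  moreover have "poly ?p x = 0" using assms by (simp add: poly_monom poly_sum)
  moreover have "range (Polynomial.coeff ?p) \<subseteq> F"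
    using assms(2) by (auto simp: c subfld_closed[OF F] simp del: coeff_diff)
  ultimately show ?thesis unfolding alg_cl_def by blast
qed

lemma alg_cl_powerE:
  assumes "x \<in> alg_cl F"
  obtains N c where "N > 0" "x ^ N = (\<Sum>j<N. c j * x ^ j)" "\<And>j. c j \<in> F"
proof -
  obtain p where p: "p \<noteq> 0" "range (Polynomial.coeff p) \<subseteq> F" "poly p x = 0"
    using assms unfolding alg_cl_def by blast
  let ?N = "degree p" and ?l = "lead_coeff p"
  have l: "?l \<noteq> 0" using p by simp
  have "(\<Sum>j\<le>?N. Polynomial.coeff p j * x ^ j) = 0" using p(3) by (simp add: poly_altdef)
  then have e: "?l * x ^ ?N = - (\<Sum>j<?N. Polynomial.coeff p j * x ^ j)"
    by (simp add: lessThan_Suc_atMost[symmetric] eq_neg_iff_add_eq_0 add.commute)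
  have "x ^ ?N = inverse ?l * (?l * x ^ ?N)" using l by simp
  also have "\<dots> = (\<Sum>j<?N. (- inverse ?l * Polynomial.coeff p j) * x ^ j)"
    unfolding e by (simp add: sum_distrib_left sum_negf mult.assoc)
  finally have "x ^ ?N = (\<Sum>j<?N. (- inverse ?l * Polynomial.coeff p j) * x ^ j)" .
  moreover have "?N > 0"
  proof (rule ccontr)
    assume "\<not> ?N > 0"
    then show False using e l by simp
  qed
  moreover have "- inverse ?l * Polynomial.coeff p j \<in> F" for j
    using p(2) by (auto intro!: subfld_mult[OF F] subfld_uminus[OF F] subfld_inverse[OF F])
  ultimately show ?thesis using that[of ?N "\<lambda>j. - inverse ?l * Polynomial.coeff p j"] by blast
qed

end

context
  fixes F :: "'w::field set"
  assumes F: "subfld F"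
begin

lemma stabI: "(\<And>b. b \<in> B \<Longrightarrow> b * a \<in> fspan F B) \<Longrightarrow> a \<in> stab F B"
  unfolding stab_def using fspan_mult_right[OF F] by blast

text \<open>As \<open>1\<close> is in the span, all powers of \<open>a\<close> stay in a space
  spanned by \<open>card B\<close> elements, so \<open>card B + 1\<close> of them are dependent. The
  relation is either a coincidence \<open>a ^ i = a ^ j\<close>, which the set of powers would hide,
  or a linear one between distinct powers.\<close>

lemma stab_algebraic:
  assumes B: "finite B" "1 \<in> fspan F B" and a: "a \<in> stab F B"
  shows "a \<in> alg_cl F"
proof -
  interpret pregeometry "fspan F" by (rule pregeometry_fspan[OF F])
  have pow: "a ^ i \<in> fspan F B" for i
  proof (induction i)
    case (Suc i)
    then show ?case using a by (auto simp: stab_def mult.commute[of a])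
  qed (use B in simp)
  let ?n = "card B" and ?f = "\<lambda>i. a ^ i"
  show ?thesis
  proof (cases "inj_on ?f {..?n}")
    case False
    then obtain i j where ij: "i < j" "a ^ i = a ^ j"
      unfolding inj_on_def by (metis linorder_neqE_nat)
    show ?thesis
    proof (rule alg_clI_power[OF F, of a j "\<lambda>k. if k = i then 1 else 0"])
      show "a ^ j = (\<Sum>k<j. (if k = i then 1 else 0) * a ^ k)"
        using ij by (simp add: if_distrib[of "\<lambda>c. c * _"] cong: if_cong)
    qed (simp add: subfld_closed[OF F])
  next
    case True
    have "\<not> indep (?f ` {..?n})"
      using card_le[OF B(1), of "?f ` {..?n}"] pow True by (auto simp: card_image)
    then obtain i where i: "i \<le> ?n" "a ^ i \<in> fspan F (?f ` {..?n} - {a ^ i})"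
      by (auto simp: indep_def)
    moreover have "?f ` {..?n} - {a ^ i} = ?f ` ({..?n} - {i})"
      using True i by (auto simp: inj_on_def)
    ultimately obtain c where c: "\<And>j. c j \<in> F" "a ^ i = (\<Sum>j\<in>{..?n} - {i}. c j * a ^ j)"
      using fspan_imageE[OF F, of "a ^ i" ?f "{..?n} - {i}"] by auto
    let ?p = "Polynomial.monom 1 i - (\<Sum>j\<in>{..?n} - {i}. Polynomial.monom (c j) j)"
    have co: "Polynomial.coeff ?p k = (if k = i then 1 else 0) - (if k \<in> {..?n} - {i} then c k else 0)" for k
      by (simp add: coeff_sum)
    have "Polynomial.coeff ?p i \<noteq> 0" unfolding co by simp
    then have "?p \<noteq> 0" by (metis coeff_0)
    moreover have "poly ?p a = 0" using c by (simp add: poly_monom poly_sum)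
    moreover have "range (Polynomial.coeff ?p) \<subseteq> F"
      using c(1) by (auto simp: co subfld_closed[OF F] simp del: coeff_diff)
    ultimately show ?thesis unfolding alg_cl_def by blast
  qed
qed

text \<open>The enlarged space is spanned by the products \<open>b * x ^ j\<close> with
  \<open>j < N\<close>, and the equation for \<open>x\<close> reduces \<open>x ^ N\<close> again.
  The last conclusion records where the new spanning set lives; the finite generation of invariant
  fields depends on it.\<close>

lemma stab_adjoin_root:
  assumes B: "finite B" "1 \<in> fspan F B"
    and x: "N > 0" "x ^ N = (\<Sum>j<N. r j * x ^ j)" "\<And>j. j < N \<Longrightarrow> r j \<in> stab F B"
  obtains B' where "finite B'" "1 \<in> fspan F B'" "stab F B \<subseteq> stab F B'" "x \<in> stab F B'"
    "\<And>M. subfld M \<Longrightarrow> B \<subseteq> M \<Longrightarrow> x \<in> M \<Longrightarrow> B' \<subseteq> M"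
proof -
  define B' where "B' = (\<lambda>(b, j). b * x ^ j) ` (B \<times> {..<N})"
  have B': "b * x ^ j \<in> fspan F B'" if "b \<in> B" "j < N" for b j
    using that by (auto simp: B'_def intro!: fspan_inc[OF F] image_eqI[where x = "(b, j)"])
  have span: "y * x ^ j \<in> fspan F B'" if "y \<in> fspan F B" "j < N" for y j
    by (rule fspan_mult_right[OF F that(1)]) (use that B' in auto)
  have "stab F B \<subseteq> stab F B'"
  proof
    fix a assume a: "a \<in> stab F B"
    show "a \<in> stab F B'"
    proof (rule stabI)
      fix y assume "y \<in> B'"
      then obtain b j where bj: "b \<in> B" "j < N" "y = b * x ^ j" by (auto simp: B'_def)
      have "b * a \<in> fspan F B" using a fspan_inc[OF F bj(1)] by (auto simp: stab_def)
      from span[OF this bj(2)] show "y * a \<in> fspan F B'" using bj by (simp add: mult_ac)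
    qed
  qed
  moreover have "x \<in> stab F B'"
  proof (rule stabI)
    fix y assume "y \<in> B'"
    then obtain b j where bj: "b \<in> B" "j < N" "y = b * x ^ j" by (auto simp: B'_def)
    show "y * x \<in> fspan F B'"
    proof (cases "Suc j < N")
      case True
      then show ?thesis using B'[OF bj(1) True] bj by (simp add: mult_ac)
    next
      case False
      then have "y * x = b * x ^ N" using bj by (simp add: mult_ac) (metis Suc_lessI power_Suc mult.commute)
      also have "\<dots> = (\<Sum>j<N. (b * r j) * x ^ j)" by (simp add: x(2) sum_distrib_left mult.assoc)
      also have "\<dots> \<in> fspan F B'"
        by (intro fspan_sum[OF F] span) (use x(3) bj fspan_inc[OF F] in \<open>auto simp: stab_def\<close>)
      finally show ?thesis .
    qed
  qed
  moreover have "1 \<in> fspan F B'" using span[OF B(2) x(1)] by simp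
  moreover have "finite B'" using B by (simp add: B'_def)
  moreover have "B' \<subseteq> M" if "subfld M" "B \<subseteq> M" "x \<in> M" for M
    using that by (auto simp: B'_def intro: subfld_mult subfld_power)
  ultimately show ?thesis using that by blast
qed

lemma subset_stab: "F \<subseteq> stab F B"
proof
  fix a assume "a \<in> F"
  then show "a \<in> stab F B"
    using fspan_scale[OF F, of _ B a] by (simp add: stab_def mult.commute[of _ a])
qed

lemma stab_diff: "x \<in> stab F B \<Longrightarrow> y \<in> stab F B \<Longrightarrow> x - y \<in> stab F B"
  using fspan_diff[OF F] by (auto simp: stab_def right_diff_distrib)

lemma stab_mult: "x \<in> stab F B \<Longrightarrow> y \<in> stab F B \<Longrightarrow> x * y \<in> stab F B"
  by (auto simp: stab_def mult.assoc[symmetric])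

text \<open>One finite-dimensional space serves several algebraic elements at once. Differences and
  products stabilise it too, so algebraic elements form a field without any computation of
  polynomials for sums and products.\<close>

lemma finite_algebraic_stab:
  assumes "finite A" "A \<subseteq> alg_cl F"
  obtains B where "finite B" "1 \<in> fspan F B" "A \<subseteq> stab F B"
    "\<And>M. subfld M \<Longrightarrow> A \<subseteq> M \<Longrightarrow> B \<subseteq> M"
proof -
  have "\<exists>B. finite B \<and> 1 \<in> fspan F B \<and> A \<subseteq> stab F B \<and> (\<forall>M. subfld M \<longrightarrow> A \<subseteq> M \<longrightarrow> B \<subseteq> M)"
    using assms
  proof induction
    case empty
    show ?case using fspan_inc[OF F, of 1 "{1}"] by (intro exI[of _ "{1}"]) (auto intro: subfld_1)
  next
    case (insert x A)
    then obtain B where B: "finite B" "1 \<in> fspan F B" "A \<subseteq> stab F B"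
      "\<forall>M. subfld M \<longrightarrow> A \<subseteq> M \<longrightarrow> B \<subseteq> M" by blast
    obtain N c where "N > 0" "x ^ N = (\<Sum>j<N. c j * x ^ j)" "\<And>j. c j \<in> F"
      using alg_cl_powerE[OF F] insert.prems by blast
    note Nc = this
    obtain B' where B': "finite B'" "1 \<in> fspan F B'" "stab F B \<subseteq> stab F B'" "x \<in> stab F B'"
      "\<And>M. subfld M \<Longrightarrow> B \<subseteq> M \<Longrightarrow> x \<in> M \<Longrightarrow> B' \<subseteq> M"
      by (rule stab_adjoin_root[OF B(1,2) Nc(1,2)]) (use Nc(3) subset_stab in auto)
    have "B' \<subseteq> M" if "subfld M" "insert x A \<subseteq> M" for M
      using that B(4) by (intro B'(5)) auto
    then show ?case using B(3) B' by (intro exI[of _ B']) blast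
  qed
  then show ?thesis using that by blast
qed

lemma alg_cl_superset: "F \<subseteq> alg_cl F"
  using stab_algebraic[of "{1}"] subset_stab[of "{1}"] fspan_inc[OF F, of 1 "{1}"] by auto

lemma subfld_alg_cl: "subfld (alg_cl F)"
proof (rule subfldI)
  show "1 \<in> alg_cl F" using alg_cl_superset subfld_1[OF F] by blast
next
  fix x y assume "x \<in> alg_cl F" "y \<in> alg_cl F"
  then have "finite {x, y}" "{x, y} \<subseteq> alg_cl F" by auto
  then obtain B where "finite B" "1 \<in> fspan F B" "{x, y} \<subseteq> stab F B"
    by (rule finite_algebraic_stab)
  then show "x - y \<in> alg_cl F" "x * y \<in> alg_cl F"
    using stab_algebraic stab_diff stab_mult by auto
next
  fix x assume x: "x \<in> alg_cl F"
  show "inverse x \<in> alg_cl F"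
  proof (cases "x = 0")
    case False
    obtain p where p: "p \<noteq> 0" "range (Polynomial.coeff p) \<subseteq> F" "poly p x = 0"
      using x unfolding alg_cl_def by blast
    have "poly (reflect_poly p) (inverse x) = 0"
      using p False by (simp add: poly_reflect_poly_nz)
    moreover have "range (Polynomial.coeff (reflect_poly p)) \<subseteq> F"
      using p(2) subfld_0[OF F] by (auto simp: coeff_reflect_poly)
    moreover have "reflect_poly p \<noteq> 0" using p by simp
    ultimately show ?thesis unfolding alg_cl_def by blast
  qed (use x in simp)
qed

lemma alg_cl_alg_cl: "alg_cl (alg_cl F) = alg_cl F"
proof
  show "alg_cl (alg_cl F) \<subseteq> alg_cl F"
  proof
    fix x assume "x \<in> alg_cl (alg_cl F)"
    then obtain N c where N: "N > 0" "x ^ N = (\<Sum>j<N. c j * x ^ j)" "\<And>j. c j \<in> alg_cl F"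
      using alg_cl_powerE[OF subfld_alg_cl] by blast
    have "finite (c ` {..<N})" "c ` {..<N} \<subseteq> alg_cl F" using N(3) by auto
    then obtain B where B: "finite B" "1 \<in> fspan F B" "c ` {..<N} \<subseteq> stab F B"
      by (rule finite_algebraic_stab)
    obtain B' where "finite B'" "1 \<in> fspan F B'" "x \<in> stab F B'"
      by (rule stab_adjoin_root[OF B(1,2) N(1,2)]) (use B(3) in auto)
    then show "x \<in> alg_cl F" using stab_algebraic by blast
  qed
qed (use alg_cl_mono[OF alg_cl_superset] in blast)

end

section \<open>Polynomial functions and generic families\<close>

text \<open>Functions instead of formal polynomials: over infinite fields nothing is lost, and the
  variables may be indexed by any type, such as \<open>idx\<close> or the field elements
  themselves.\<close>

inductive_set pf :: "'w::field set \<Rightarrow> 'i set \<Rightarrow> (('i \<Rightarrow> 'w) \<Rightarrow> 'w) set" for F I where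
  const: "c \<in> F \<Longrightarrow> (\<lambda>_. c) \<in> pf F I"
| proj: "i \<in> I \<Longrightarrow> (\<lambda>e. e i) \<in> pf F I"
| add: "p \<in> pf F I \<Longrightarrow> q \<in> pf F I \<Longrightarrow> (\<lambda>e. p e + q e) \<in> pf F I"
| mult: "p \<in> pf F I \<Longrightarrow> q \<in> pf F I \<Longrightarrow> (\<lambda>e. p e * q e) \<in> pf F I"

lemma pf_mono: "p \<in> pf F I \<Longrightarrow> F \<subseteq> E \<Longrightarrow> I \<subseteq> J \<Longrightarrow> p \<in> pf E J"
  by (induction rule: pf.induct) (auto intro: pf.intros)

lemma pf_cong: "p \<in> pf F I \<Longrightarrow> (\<And>i. i \<in> I \<Longrightarrow> e i = e' i) \<Longrightarrow> p e = p e'"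
  by (induction rule: pf.induct) auto

lemma pf_value: "p \<in> pf F I \<Longrightarrow> subfld E \<Longrightarrow> F \<subseteq> E \<Longrightarrow> (\<And>i. i \<in> I \<Longrightarrow> e i \<in> E) \<Longrightarrow> p e \<in> E"
  by (induction rule: pf.induct) (auto intro: subfld_add subfld_mult)

lemma pf_compose:
  "p \<in> pf F I \<Longrightarrow> (\<And>i. i \<in> I \<Longrightarrow> q i \<in> pf F J) \<Longrightarrow> (\<lambda>e. p (\<lambda>i. q i e)) \<in> pf F J"
proof (induction rule: pf.induct)
  case (proj i)
  then show ?case by simp
qed (auto intro: pf.intros)

context
  fixes F :: "'w::field set"
  assumes F: "subfld F"
begin

lemma pf_sum: "(\<And>k. k \<in> K \<Longrightarrow> p k \<in> pf F I) \<Longrightarrow> (\<lambda>e. \<Sum>k\<in>K. p k e) \<in> pf F I"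
  by (induction K rule: infinite_finite_induct) (auto intro: pf.intros subfld_0[OF F])

lemma pf_prod: "(\<And>k. k \<in> K \<Longrightarrow> p k \<in> pf F I) \<Longrightarrow> (\<lambda>e. \<Prod>k\<in>K. p k e) \<in> pf F I"
  by (induction K rule: infinite_finite_induct) (auto intro: pf.intros subfld_1[OF F])

lemma pf_power: "p \<in> pf F I \<Longrightarrow> (\<lambda>e. p e ^ n) \<in> pf F I"
  by (induction n) (auto intro: pf.intros subfld_1[OF F])

lemma pf_scale: "c \<in> F \<Longrightarrow> p \<in> pf F I \<Longrightarrow> (\<lambda>e. c * p e) \<in> pf F I"
  by (rule pf.mult[OF pf.const])

lemma pf_uminus: "p \<in> pf F I \<Longrightarrow> (\<lambda>e. - p e) \<in> pf F I"
  using pf_scale[OF subfld_uminus[OF F subfld_1[OF F]]] by simp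

lemma pf_diff: "p \<in> pf F I \<Longrightarrow> q \<in> pf F I \<Longrightarrow> (\<lambda>e. p e - q e) \<in> pf F I"
  using pf.add[OF _ pf_uminus, of p I q] by simp

lemma pf_fix: "p \<in> pf F I \<Longrightarrow> t \<in> F \<Longrightarrow> (\<lambda>e. p (e(j := t))) \<in> pf F (I - {j})"
proof -
  assume p: "p \<in> pf F I" "t \<in> F"
  have "(\<lambda>e. p (\<lambda>i. (if i = j then (\<lambda>_. t) else (\<lambda>e. e i)) e)) \<in> pf F (I - {j})"
    using p by (intro pf_compose[OF p(1)]) (auto intro: pf.intros)
  moreover have "(\<lambda>i. (if i = j then (\<lambda>_. t) else (\<lambda>e. e i)) e) = e(j := t)" for e by auto
  ultimately show ?thesis by simp
qed

end

lemma pf_univariate: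
  assumes "p \<in> pf F I" "subfld E" "F \<subseteq> E" "\<And>i. i \<in> I - {j} \<Longrightarrow> e i \<in> E"
  shows "\<exists>P. range (Polynomial.coeff P) \<subseteq> E \<and> (\<forall>t. p (e(j := t)) = poly P t)"
  using assms(1)
proof induction
  case (const c)
  then show ?case
    using assms by (intro exI[of _ "[:c:]"]) (auto simp: coeff_pCons subfld_0 split: nat.splits)
next
  case (proj i)
  show ?case
  proof (cases "i = j")
    case True
    then show ?thesis
      using assms by (intro exI[of _ "[:0, 1:]"])
        (auto simp: coeff_pCons subfld_0 subfld_1 split: nat.splits)
  next
    case False
    then show ?thesis
      using assms proj by (intro exI[of _ "[:e i:]"])
        (auto simp: coeff_pCons subfld_0 split: nat.splits)
  qed
next
  case (add p q)
  then obtain P Q where "range (Polynomial.coeff P) \<subseteq> E" "\<forall>t. p (e(j := t)) = poly P t"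
    "range (Polynomial.coeff Q) \<subseteq> E" "\<forall>t. q (e(j := t)) = poly Q t" by blast
  then show ?case
    by (intro exI[of _ "P + Q"]) (auto intro!: subfld_add[OF assms(2)] simp del: fun_upd_apply)
next
  case (mult p q)
  then obtain P Q where "range (Polynomial.coeff P) \<subseteq> E" "\<forall>t. p (e(j := t)) = poly P t"
    "range (Polynomial.coeff Q) \<subseteq> E" "\<forall>t. q (e(j := t)) = poly Q t" by blast
  then show ?case
    by (intro exI[of _ "P * Q"])
      (auto simp: coeff_mult simp del: fun_upd_apply intro!: subfld_sum[OF assms(2)] subfld_mult[OF assms(2)])
qed

lemma pf_univariate_zero:
  fixes p :: "('i \<Rightarrow> 'w::field) \<Rightarrow> 'w"
  assumes "p \<in> pf F I" "infinite A" "\<And>t. t \<in> A \<Longrightarrow> p (e(j := t)) = 0"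
  shows "p (e(j := t)) = 0"
proof -
  obtain P where P: "\<forall>t. p (e(j := t)) = poly P t"
    using pf_univariate[OF assms(1), of UNIV j e] by (auto simp: subfld_def)
  then have "A \<subseteq> {t. poly P t = 0}" using assms(3) by auto
  then have "P = 0" using poly_roots_finite[of P] assms(2) finite_subset by blast
  then show ?thesis using P by simp
qed

text \<open>Coordinates are freed one at a time; along each coordinate line the function is a
  univariate polynomial with infinitely many zeros.\<close>

lemma pf_zero:
  fixes p :: "('i \<Rightarrow> 'w::field) \<Rightarrow> 'w"
  assumes "finite I" "p \<in> pf F I" "infinite A"
    and zero: "\<And>e. (\<And>i. i \<in> I \<Longrightarrow> e i \<in> A) \<Longrightarrow> p e = 0"
  shows "p e = 0"
proof -
  have "finite J \<Longrightarrow> J \<subseteq> I \<Longrightarrow> (\<And>i. i \<in> I - J \<Longrightarrow> e i \<in> A) \<Longrightarrow> p e = 0" for J e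
  proof (induction J arbitrary: e rule: finite_induct)
    case empty
    then show ?case using zero by simp
  next
    case (insert j J)
    have "p (e(j := t)) = 0" if "t \<in> A" for t
      using insert that by (intro insert.IH) auto
    from pf_univariate_zero[OF assms(2,3) this, of "e j"] show ?case by simp
  qed
  from this[of I e] assms(1) show ?thesis by simp
qed

section \<open>Generic families, that is, algebraically independent ones\<close>

definition gen :: "'w::field set \<Rightarrow> 'i set \<Rightarrow> ('i \<Rightarrow> 'w) \<Rightarrow> bool" where
  "gen F I \<xi> \<longleftrightarrow> (\<forall>p\<in>pf F I. p \<xi> = 0 \<longrightarrow> (\<forall>e. p e = 0))"

lemma gen_zero: "gen F I \<xi> \<Longrightarrow> p \<in> pf F I \<Longrightarrow> p \<xi> = 0 \<Longrightarrow> p e = 0"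
  unfolding gen_def by blast

lemma gen_mono: "gen E J \<xi> \<Longrightarrow> F \<subseteq> E \<Longrightarrow> I \<subseteq> J \<Longrightarrow> gen F I \<xi>"
  unfolding gen_def using pf_mono by blast

lemma gen_cong: "gen F I \<xi> \<Longrightarrow> (\<And>i. i \<in> I \<Longrightarrow> \<xi> i = Y i) \<Longrightarrow> gen F I Y"
  unfolding gen_def using pf_cong by metis

lemma gen_empty: "gen F {} \<xi>"
  unfolding gen_def using pf_cong[of _ F "{}"] by (metis empty_iff)

text \<open>Read as a polynomial in the \<open>j\<close>-th variable over the field of the others, a
  relation has the transcendental root \<open>\<xi> j\<close> and so vanishes. Setting that variable
  to a constant of \<open>F\<close> then gives a relation among the old variables, and
  \<open>F\<close> is infinite.\<close>

lemma gen_insert: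
  fixes F :: "'w::field_char_0 set"
  assumes F: "subfld F" and J: "gen F J \<xi>" "j \<notin> J" "\<xi> j \<notin> alg_cl (fgen (F \<union> \<xi> ` J))"
  shows "gen F (insert j J) \<xi>"
  unfolding gen_def
proof (intro ballI impI allI)
  fix p e assume p: "p \<in> pf F (insert j J)" "p \<xi> = 0"
  have "F \<subseteq> fgen (F \<union> \<xi> ` J)" "\<xi> ` J \<subseteq> fgen (F \<union> \<xi> ` J)"
    using fgen_superset[of "F \<union> \<xi> ` J"] by auto
  then obtain P where P: "range (Polynomial.coeff P) \<subseteq> fgen (F \<union> \<xi> ` J)" "\<forall>t. p (\<xi>(j := t)) = poly P t"
    using pf_univariate[OF p(1), of "fgen (F \<union> \<xi> ` J)" j \<xi>] by auto
  have "poly P (\<xi> j) = 0" using P(2)[rule_format, of "\<xi> j"] p(2) by simp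
  then have "P = 0" using P(1) J(3) unfolding alg_cl_def by blast
  have "p (e(j := t)) = 0" if "t \<in> F" for t
  proof (rule gen_zero[OF J(1), of "\<lambda>e. p (e(j := t))"])
    show "(\<lambda>e. p (e(j := t))) \<in> pf F J"
      using pf_fix[OF F p(1) that, of j] J(2) by (simp add: insert_Diff_if)
    show "p (\<xi>(j := t)) = 0" using P \<open>P = 0\<close> by simp
  qed
  from pf_univariate_zero[OF p(1) infinite_subfld[OF F] this, of "e j"] show "p e = 0" by simp
qed

lemma fgenE:
  assumes F: "subfld F" and x: "x \<in> fgen (F \<union> \<xi> ` I)"
  obtains p q where "p \<in> pf F I" "q \<in> pf F I" "q \<xi> \<noteq> 0" "x = p \<xi> / q \<xi>"
proof -
  let ?Q = "{p \<xi> / q \<xi> | p q. p \<in> pf F I \<and> q \<in> pf F I \<and> q \<xi> \<noteq> 0}"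
  have QI: "p \<xi> / q \<xi> \<in> ?Q" if "p \<in> pf F I" "q \<in> pf F I" "q \<xi> \<noteq> 0" for p q
    using that by blast
  have one: "(\<lambda>_. 1) \<in> pf F I" by (intro pf.const subfld_1[OF F])
  have "subfld ?Q"
  proof (rule subfldI)
    show "1 \<in> ?Q" using QI[OF one one] by simp
  next
    fix x y assume "x \<in> ?Q" "y \<in> ?Q"
    then obtain p q r s where pq: "p \<in> pf F I" "q \<in> pf F I" "q \<xi> \<noteq> 0" "x = p \<xi> / q \<xi>"
      "r \<in> pf F I" "s \<in> pf F I" "s \<xi> \<noteq> 0" "y = r \<xi> / s \<xi>" by blast
    have "x * y = (p \<xi> * r \<xi>) / (q \<xi> * s \<xi>)" using pq by simp
    then show "x * y \<in> ?Q"
      using QI[OF pf.mult[OF pq(1,5)] pf.mult[OF pq(2,6)]] pq by simp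
    have "x - y = (p \<xi> * s \<xi> - r \<xi> * q \<xi>) / (q \<xi> * s \<xi>)" using pq by (simp add: diff_frac_eq)
    then show "x - y \<in> ?Q"
      using QI[OF pf_diff[OF F pf.mult[OF pq(1,6)] pf.mult[OF pq(5,2)]] pf.mult[OF pq(2,6)]] pq by simp
  next
    fix x assume "x \<in> ?Q"
    then obtain p q where pq: "p \<in> pf F I" "q \<in> pf F I" "q \<xi> \<noteq> 0" "x = p \<xi> / q \<xi>" by blast
    show "inverse x \<in> ?Q"
    proof (cases "p \<xi> = 0")
      case True
      then show ?thesis using pq QI[OF pf.const[OF subfld_0[OF F]] one] by simp
    next
      case False
      then show ?thesis using QI[OF pq(2,1)] pq by simp
    qed
  qed
  moreover have "F \<union> \<xi> ` I \<subseteq> ?Q"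
    using QI[OF _ one] pf.const[of _ F I] pf.proj[of _ I F] by fastforce
  ultimately have "x \<in> ?Q" using fgen_least x by blast
  then show ?thesis using that by blast
qed

lemma pf_fgen: "p \<in> pf F I \<Longrightarrow> p \<xi> \<in> fgen (F \<union> \<xi> ` I)"
  by (rule pf_value) (auto intro: fgen_inc)

lemma gen_transcendental:
  fixes F :: "'w::field_char_0 set"
  assumes F: "subfld F" and g: "gen F (insert j J) \<xi>" "j \<notin> J"
  shows "\<xi> j \<notin> alg_cl (fgen (F \<union> \<xi> ` J))"
proof
  assume "\<xi> j \<in> alg_cl (fgen (F \<union> \<xi> ` J))"
  then obtain P where P: "P \<noteq> 0" "range (Polynomial.coeff P) \<subseteq> fgen (F \<union> \<xi> ` J)" "poly P (\<xi> j) = 0"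
    unfolding alg_cl_def by blast
  have "\<forall>n. \<exists>p q. p \<in> pf F J \<and> q \<in> pf F J \<and> q \<xi> \<noteq> 0 \<and> Polynomial.coeff P n = p \<xi> / q \<xi>"
    using fgenE[OF F] P(2) by (metis range_subsetD)
  then obtain p q where pq: "\<And>n. p n \<in> pf F J" "\<And>n. q n \<in> pf F J" "\<And>n. q n \<xi> \<noteq> 0"
    "\<And>n. Polynomial.coeff P n = p n \<xi> / q n \<xi>" by metis
  let ?N = "degree P"
  \<comment> \<open>This is \<open>P\<close> with denominators cleared: coefficient \<open>n\<close>
    is multiplied by all \<open>q m\<close> with \<open>m \<noteq> n\<close>, so that
    \<open>Q\<close> is polynomial in all variables and becomes \<open>D * P\<close> once the others
    are set to \<open>\<xi>\<close>.\<close>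
  define Q where "Q = (\<lambda>e. \<Sum>n\<le>?N. p n e * (\<Prod>m\<in>{..?N} - {n}. q m e) * e j ^ n)"
  have pq': "p n \<in> pf F (insert j J)" "q n \<in> pf F (insert j J)" for n
    by (rule pf_mono[OF pq(1)], auto) (rule pf_mono[OF pq(2)], auto)
  have Q: "Q \<in> pf F (insert j J)"
    unfolding Q_def
    by (intro pf_sum[OF F] pf.mult pf_prod[OF F] pf_power[OF F] pq' pf.proj) simp
  define D where "D = (\<Prod>m\<le>?N. q m \<xi>)"
  have D: "D \<noteq> 0" using pq(3) by (simp add: D_def)
  have val: "Q (\<xi>(j := t)) = D * poly P t" for t
  proof -
    have j: "(\<xi>(j := t)) i = \<xi> i" if "i \<in> J" for i using that g(2) by auto
    have "p n (\<xi>(j := t)) = p n \<xi>" "q n (\<xi>(j := t)) = q n \<xi>" for n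
      by (rule pf_cong[OF pq(1)], erule j) (rule pf_cong[OF pq(2)], erule j)
    then have "Q (\<xi>(j := t)) = (\<Sum>n\<le>?N. p n \<xi> * (\<Prod>m\<in>{..?N} - {n}. q m \<xi>) * t ^ n)"
      by (simp add: Q_def)
    also have "\<dots> = (\<Sum>n\<le>?N. D * (Polynomial.coeff P n * t ^ n))"
    proof (rule sum.cong)
      fix n assume n: "n \<in> {..?N}"
      have "D = q n \<xi> * (\<Prod>m\<in>{..?N} - {n}. q m \<xi>)"
        unfolding D_def using n by (simp add: prod.remove)
      then show "p n \<xi> * (\<Prod>m\<in>{..?N} - {n}. q m \<xi>) * t ^ n = D * (Polynomial.coeff P n * t ^ n)"
        using pq(3) by (simp add: pq(4))
    qed simp
    finally show ?thesis by (simp add: poly_altdef sum_distrib_left)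
  qed
  have "Q \<xi> = 0" using val[of "\<xi> j"] P(3) by simp
  then have "D * poly P t = 0" for t
    using gen_zero[OF g(1) Q, of "\<xi>(j := t)"] val by simp
  then have "poly P t = 0" for t using D by simp
  then show False using P(1) poly_all_0_iff_0 by blast
qed

section \<open>Algebraic dependence as a pregeometry\<close>

definition acl :: "'w::field set \<Rightarrow> 'w set \<Rightarrow> 'w set" where
  "acl F S = alg_cl (fgen (F \<union> S))"

lemma acl_superset: "S \<subseteq> acl F S" and acl_base: "F \<subseteq> acl F S"
  unfolding acl_def using alg_cl_superset[of "fgen (F \<union> S)"] fgen_superset[of "F \<union> S"] by auto

lemma subfld_acl [simp]: "subfld (acl F S)"
  unfolding acl_def by (rule subfld_alg_cl) simp

lemma fgen_acl: "fgen (F \<union> S) \<subseteq> acl F S"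
  unfolding acl_def by (rule alg_cl_superset) simp

lemma alg_cl_least: "F \<subseteq> acl E S \<Longrightarrow> alg_cl F \<subseteq> acl E S"
  unfolding acl_def using alg_cl_mono[of F "alg_cl (fgen (E \<union> S))"] alg_cl_alg_cl[of "fgen (E \<union> S)"]
  by simp

lemma acl_least: "E \<subseteq> acl F T \<Longrightarrow> S \<subseteq> acl F T \<Longrightarrow> acl E S \<subseteq> acl F T"
  unfolding acl_def[of E S] by (intro alg_cl_least fgen_least) auto

lemma pregeometry_acl:
  fixes F :: "'w::field_char_0 set"
  assumes F: "subfld F"
  shows "pregeometry (acl F)"
proof
  fix S T :: "'w set" and x y
  show "S \<subseteq> acl F S" by (rule acl_superset)
  show mono: "acl F S \<subseteq> acl F T" if "S \<subseteq> T"
    by (rule acl_least) (use acl_base[of F T] acl_superset[of T F] that in auto)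
  show "acl F (acl F S) = acl F S"
    using acl_least[of F F S "acl F S"] acl_base[of F S] acl_superset[of "acl F S" F] by blast
  show "y \<in> acl F (insert x S)" if x: "x \<in> acl F (insert y S)" "x \<notin> acl F S"
  proof (rule ccontr)
    assume y: "y \<notin> acl F (insert x S)"
    \<comment> \<open>A family indexed by \<open>bool\<close> holds both elements. Genericity does
      not see the order of insertion, so \<open>x\<close> followed by \<open>y\<close> can be reread
      as \<open>y\<close> followed by \<open>x\<close>.\<close>
    let ?E = "fgen (F \<union> S)" and ?\<xi> = "\<lambda>b. if b then x else y"
    have e: "fgen (?E \<union> ?\<xi> ` {True}) = fgen (F \<union> insert x S)" "fgen (?E \<union> ?\<xi> ` {False}) = fgen (F \<union> insert y S)"
      "fgen (?E \<union> ?\<xi> ` {}) = fgen (F \<union> S)"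
      by (simp_all only: fgen_fgen_Un) (simp_all add: Un_insert_right)
    have "gen ?E (insert True {}) ?\<xi>"
      by (rule gen_insert) (use x e(3) in \<open>simp_all add: gen_empty acl_def\<close>)
    then have "gen ?E (insert False {True}) ?\<xi>"
      by (rule gen_insert[rotated]) (use y e(1) in \<open>simp_all add: acl_def\<close>)
    then have "gen ?E (insert True {False}) ?\<xi>" by (simp add: insert_commute)
    then have "?\<xi> True \<notin> alg_cl (fgen (?E \<union> ?\<xi> ` {False}))"
      by (rule gen_transcendental[rotated]) simp_all
    then show False using x e(2) by (simp add: acl_def)
  qed
qed

lemma gen_iff_indep:
  fixes F :: "'w::field_char_0 set"
  assumes F: "subfld F" and I: "finite I"
  shows "gen F I \<xi> \<longleftrightarrow> inj_on \<xi> I \<and> pregeometry.indep (acl F) (\<xi> ` I)"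
proof -
  interpret pregeometry "acl F" by (rule pregeometry_acl[OF F])
  show ?thesis
  proof (intro iffI conjI)
    assume g: "gen F I \<xi>"
    have t: "\<xi> i \<notin> acl F (\<xi> ` (I - {i}))" if "i \<in> I" for i
      unfolding acl_def
      by (rule gen_transcendental[OF F]) (use g that in \<open>simp_all add: insert_absorb\<close>)
    show inj: "inj_on \<xi> I"
    proof (rule inj_onI, rule ccontr)
      fix i j assume ij: "i \<in> I" "j \<in> I" "\<xi> i = \<xi> j" "i \<noteq> j"
      then have "\<xi> i \<in> \<xi> ` (I - {i})" by auto
      then show False using t[OF ij(1)] acl_superset[of "\<xi> ` (I - {i})" F] by blast
    qed
    show "indep (\<xi> ` I)"
      unfolding indep_def
    proof
      fix x assume "x \<in> \<xi> ` I"
      then obtain i where i: "i \<in> I" "x = \<xi> i" by blast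
      then have "\<xi> ` I - {x} = \<xi> ` (I - {i})" using inj by (auto simp: inj_on_def)
      then show "x \<notin> acl F (\<xi> ` I - {x})" using t i by simp
    qed
  next
    assume "inj_on \<xi> I \<and> indep (\<xi> ` I)"
    with I show "gen F I \<xi>"
    proof (induction rule: finite_induct)
      case empty
      show ?case by (rule gen_empty)
    next
      case (insert j J)
      have "indep (\<xi> ` J)" using insert.prems indep_subset[of "\<xi> ` insert j J"] by blast
      then have g: "gen F J \<xi>" using insert by simp
      have "\<xi> ` insert j J - {\<xi> j} = \<xi> ` J" using insert.prems insert.hyps by (auto simp: inj_on_def)
      then have "\<xi> j \<notin> acl F (\<xi> ` J)" using insert.prems by (auto simp: indep_def)
      then show ?case
        by (intro gen_insert[OF F g insert.hyps(2)]) (simp add: acl_def)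
    qed
  qed
qed

text \<open>A count of transcendence degrees: \<open>card I\<close> independent elements that are
  algebraic over the \<open>Y j\<close> force at least as many distinct \<open>Y j\<close>, hence
  exactly as many, and these are independent.\<close>

lemma gen_spanning:
  fixes F :: "'w::field_char_0 set"
  assumes F: "subfld F" and I: "finite I" "gen F I \<xi>" and J: "finite J" "card J \<le> card I"
    and "\<xi> ` I \<subseteq> acl F (Y ` J)"
  shows "gen F J Y \<and> card J = card I"
proof -
  interpret pregeometry "acl F" by (rule pregeometry_acl[OF F])
  have \<xi>: "inj_on \<xi> I" "indep (\<xi> ` I)" using gen_iff_indep[OF F I(1)] I(2) by auto
  have "card (\<xi> ` I) \<le> card (Y ` J)"
    using card_le[of "Y ` J" "\<xi> ` I"] \<xi> assms by auto
  then have c: "card J \<le> card (Y ` J)" "card J = card I"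
    using \<xi> J card_image_le[OF J(1), of Y] by (auto simp: card_image)
  then have "inj_on Y J" using J card_image_le[OF J(1), of Y] by (intro eq_card_imp_inj_on) auto
  moreover have "indep (Y ` J)"
    by (rule indep_spanning[of _ "\<xi> ` I"])
      (use \<xi> assms c card_image_le[OF J(1), of Y] in \<open>auto simp: card_image\<close>)
  ultimately show ?thesis using gen_iff_indep[OF F J(1)] c by blast
qed

text \<open>A field algebraic over the first block of variables cannot create relations in the
  second block: each closure over \<open>E\<close> lies in a closure over \<open>F\<close> with the
  first block added.\<close>

lemma gen_base_change:
  fixes F :: "'w::field_char_0 set"
  assumes F: "subfld F" and E: "subfld E" "E \<subseteq> acl F (\<xi> ` I)" and J: "finite J" "I \<inter> J = {}"
    and g: "gen F (I \<union> J) \<xi>"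
  shows "gen E J \<xi>"
proof -
  have "finite J' \<Longrightarrow> J' \<subseteq> J \<Longrightarrow> gen E J' \<xi>" for J'
  proof (induction rule: finite_induct)
    case (insert j J')
    have "gen F (insert j (I \<union> J')) \<xi>" by (rule gen_mono[OF g]) (use insert in auto)
    then have "\<xi> j \<notin> acl F (\<xi> ` (I \<union> J'))"
      unfolding acl_def by (rule gen_transcendental[OF F]) (use insert J in auto)
    moreover have "acl E (\<xi> ` J') \<subseteq> acl F (\<xi> ` (I \<union> J'))"
    proof (rule acl_least)
      have "acl F (\<xi> ` I) \<subseteq> acl F (\<xi> ` (I \<union> J'))"
        by (rule acl_least) (use acl_base[of F] acl_superset[of "\<xi> ` (I \<union> J')" F] in auto)
      then show "E \<subseteq> acl F (\<xi> ` (I \<union> J'))" using E by blast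
      show "\<xi> ` J' \<subseteq> acl F (\<xi> ` (I \<union> J'))" using acl_superset[of "\<xi> ` (I \<union> J')" F] by blast
    qed
    ultimately show ?case
      using insert by (intro gen_insert[OF E(1)]) (auto simp: acl_def)
  qed (rule gen_empty)
  then show ?thesis using J by blast
qed

section \<open>Passage between polynomial functions and formal polynomials\<close>

lemma pf_imp_mpoly:
  assumes F: "subfld F" and p: "p \<in> pf F I"
  shows "\<exists>f\<in>polys_over F. (\<forall>m\<in>Poly_Mapping.keys f. Poly_Mapping.keys m \<subseteq> I) \<and> (\<forall>e. insertion e f = p e)"
  using p
proof induction
  case (const c)
  then show ?case
    using subfld_0[OF F] by (intro bexI[of _ "Poly_Mapping.single 0 c"])
      (auto simp: insertion_single polys_over_def lookup_single when_def)
next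
  case (proj i)
  then show ?case
    using subfld_0[OF F] subfld_1[OF F]
    by (intro bexI[of _ "Poly_Mapping.single (Poly_Mapping.single i 1) 1"])
      (auto simp: insertion_single polys_over_def lookup_single when_def)
next
  case (add p q)
  then obtain f g where fg: "f \<in> polys_over F" "\<forall>m\<in>Poly_Mapping.keys f. Poly_Mapping.keys m \<subseteq> I"
    "\<forall>e. insertion e f = p e" "g \<in> polys_over F" "\<forall>m\<in>Poly_Mapping.keys g. Poly_Mapping.keys m \<subseteq> I"
    "\<forall>e. insertion e g = q e" by blast
  have "f + g \<in> polys_over F"
    using fg by (auto simp: polys_over_def lookup_add intro!: subfld_add[OF F])
  moreover have "\<forall>m\<in>Poly_Mapping.keys (f + g). Poly_Mapping.keys m \<subseteq> I"
    using fg Poly_Mapping.keys_add[of f g] by blast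
  ultimately show ?case using fg by (intro bexI[of _ "f + g"]) (simp_all add: insertion_add)
next
  case (mult p q)
  then obtain f g where fg: "f \<in> polys_over F" "\<forall>m\<in>Poly_Mapping.keys f. Poly_Mapping.keys m \<subseteq> I"
    "\<forall>e. insertion e f = p e" "g \<in> polys_over F" "\<forall>m\<in>Poly_Mapping.keys g. Poly_Mapping.keys m \<subseteq> I"
    "\<forall>e. insertion e g = q e" by blast
  have "f * g \<in> polys_over F"
  proof -
    have lk: "Poly_Mapping.lookup f a \<in> F" "Poly_Mapping.lookup g a \<in> F" for a
      using fg(1,4) by (auto simp: polys_over_def)
    have mono: "h = (\<Sum>a\<in>Poly_Mapping.keys h. Poly_Mapping.single a (Poly_Mapping.lookup h a))"
      for h :: "'a mpoly"
      by (intro poly_mapping_eqI) (simp add: lookup_sum lookup_single when_def in_keys_iff)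
    have "f * g = (\<Sum>a\<in>Poly_Mapping.keys f. \<Sum>b\<in>Poly_Mapping.keys g.
        Poly_Mapping.single (a + b) (Poly_Mapping.lookup f a * Poly_Mapping.lookup g b))"
      by (subst mono[of f], subst mono[of g]) (simp add: sum_product mult_single)
    then show ?thesis
      by (auto simp: polys_over_def lookup_sum lookup_single when_def
          intro!: subfld_sum[OF F] subfld_mult[OF F] lk subfld_0[OF F])
  qed
  moreover have "\<forall>m\<in>Poly_Mapping.keys (f * g). Poly_Mapping.keys m \<subseteq> I"
  proof
    fix m assume "m \<in> Poly_Mapping.keys (f * g)"
    then obtain a c where "m = a + c" "a \<in> Poly_Mapping.keys f" "c \<in> Poly_Mapping.keys g"
      using Poly_Mapping.keys_mult[of f g] by blast
    then show "Poly_Mapping.keys m \<subseteq> I"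
      using fg Poly_Mapping.keys_add[of a c] by blast
  qed
  ultimately show ?case using fg by (intro bexI[of _ "f * g"]) (simp_all add: insertion_mult)
qed

lemma insertion_pf:
  assumes F: "subfld F" and f: "f \<in> polys_over F"
    and q: "\<And>i. q i \<in> pf F I"
  shows "(\<lambda>e. insertion (\<lambda>i. q i e) f) \<in> pf F I"
  unfolding insertion_def
  using f by (intro pf_sum[OF F] pf.mult pf.const pf_prod[OF F] pf_power[OF F] q)
    (auto simp: polys_over_def)

lemma peval_pf:
  assumes F: "subfld F" and f: "f \<in> polys_over F"
  shows "(\<lambda>e. peval f (map e [0..<q])) \<in> pf F {..<q}"
proof -
  have "(\<lambda>e. insertion (\<lambda>i. (if i < q then (\<lambda>e. e i) else (\<lambda>_. 0)) e) f) \<in> pf F {..<q}"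
    by (rule insertion_pf[OF F f]) (auto intro: pf.intros subfld_0[OF F])
  moreover have "nth_default 0 (map e [0..<q]) = (\<lambda>i. (if i < q then (\<lambda>e. e i) else (\<lambda>_. 0)) e)" for e :: "nat \<Rightarrow> 'a"
    by (auto simp: nth_default_def)
  ultimately show ?thesis by (simp add: peval_def)
qed

lemma map_nth_default: "length xs = q \<Longrightarrow> map (nth_default 0 xs) [0..<q] = xs"
  by (auto intro!: nth_equalityI simp: nth_default_def)

lemma gen_alg_independent:
  fixes F :: "'w::field_char_0 set"
  assumes F: "subfld F" and g: "gen F {..<length ts} (nth ts)"
  shows "alg_independent F ts"
  unfolding alg_independent_def
proof (intro ballI impI)
  fix f assume f: "f \<in> polys_over F" "\<forall>m\<in>Poly_Mapping.keys f. Poly_Mapping.keys m \<subseteq> {..<length ts}" "peval f ts = 0"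
  have "peval f (map (nth ts) [0..<length ts]) = 0" using f(3) by (simp add: map_nth)
  then have z: "peval f (map e [0..<length ts]) = 0" for e
    using gen_zero[OF g peval_pf[OF F f(1)]] by blast
  show "f = 0"
  proof (rule insertion_eq_0_imp_eq_0)
    fix e
    have "insertion e f = insertion (nth_default 0 (map e [0..<length ts])) f"
      unfolding insertion_def using f(2)
      by (intro sum.cong arg_cong2[where f = "(*)"] prod.cong refl) (auto simp: nth_default_def)
    then show "insertion e f = 0" using z[of e] by (simp add: peval_def)
  qed (use f(2) in blast)
qed

section \<open>Fixed fields of finite groups\<close>

definition polys_in :: "'w::field set \<Rightarrow> 'w \<Rightarrow> 'w set" where
  "polys_in M y = {poly P y | P. range (Polynomial.coeff P) \<subseteq> M}"

lemma polys_inI: "range (Polynomial.coeff P) \<subseteq> M \<Longrightarrow> poly P y \<in> polys_in M y"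
  unfolding polys_in_def by blast

lemma polys_in_closed:
  assumes M: "subfld M"
  shows "x \<in> M \<Longrightarrow> x \<in> polys_in M y" "y \<in> polys_in M y"
    "x \<in> polys_in M y \<Longrightarrow> z \<in> polys_in M y \<Longrightarrow> x + z \<in> polys_in M y"
    "x \<in> polys_in M y \<Longrightarrow> z \<in> polys_in M y \<Longrightarrow> x * z \<in> polys_in M y"
proof -
  show "x \<in> polys_in M y" if "x \<in> M"
  proof -
    have "range (Polynomial.coeff [:x:]) \<subseteq> M"
      using that subfld_0[OF M] by (auto simp: coeff_pCons split: nat.splits)
    from polys_inI[OF this, of y] show ?thesis by simp
  qed
  show "y \<in> polys_in M y"
  proof -
    have "range (Polynomial.coeff [:0, 1:]) \<subseteq> M"
      using subfld_0[OF M] subfld_1[OF M] by (auto simp: coeff_pCons split: nat.splits)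
    from polys_inI[OF this, of y] show ?thesis by simp
  qed
  assume "x \<in> polys_in M y" "z \<in> polys_in M y"
  then obtain P Q where PQ: "range (Polynomial.coeff P) \<subseteq> M" "x = poly P y"
    "range (Polynomial.coeff Q) \<subseteq> M" "z = poly Q y" unfolding polys_in_def by blast
  have "range (Polynomial.coeff (P + Q)) \<subseteq> M" "range (Polynomial.coeff (P * Q)) \<subseteq> M"
    using PQ by (auto simp: coeff_mult intro!: subfld_add[OF M] subfld_sum[OF M] subfld_mult[OF M])
  then show "x + z \<in> polys_in M y" "x * z \<in> polys_in M y"
    using polys_inI[of "P + Q" M y] polys_inI[of "P * Q" M y] PQ by auto
qed

lemma fgen_singleE:
  assumes M: "subfld M" and x: "x \<in> fgen (M \<union> {y})"
  obtains p q where "p \<in> polys_in M y" "q \<in> polys_in M y" "q \<noteq> 0" "x = p / q"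
proof -
  have "x \<in> fgen (M \<union> (\<lambda>_. y) ` {()})" using x by simp
  then obtain p q where pq: "p \<in> pf M {()}" "q \<in> pf M {()}" "q (\<lambda>_. y) \<noteq> 0" "x = p (\<lambda>_. y) / q (\<lambda>_. y)"
    by (rule fgenE[OF M])
  have "p (\<lambda>_. y) \<in> polys_in M y" if "p \<in> pf M {()}" for p
    using that by induction (auto intro: polys_in_closed[OF M])
  then show ?thesis using that pq by blast
qed

lemma polys_in_subset: "subfld M \<Longrightarrow> polys_in M y \<subseteq> fgen (M \<union> {y})"
  unfolding polys_in_def poly_altdef
  by (auto intro!: subfld_sum subfld_mult subfld_power intro: fgen_inc)

lemma polys_in_zero:
  assumes "subfld M" "y \<notin> alg_cl M" "\<And>i. c i \<in> M" "(\<Sum>i\<le>n. c i * y ^ i) = 0" "i \<le> n"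
  shows "c i = 0"
proof -
  let ?P = "\<Sum>i\<le>n. Polynomial.monom (c i) i"
  have co: "Polynomial.coeff ?P k = (if k \<le> n then c k else 0)" for k
    by (simp add: coeff_sum)
  have "range (Polynomial.coeff ?P) \<subseteq> M"
    using assms(3) subfld_0[OF assms(1)] by (auto simp: co)
  moreover have "poly ?P y = 0" using assms(4) by (simp add: poly_sum poly_monom)
  ultimately have "?P = 0" using assms(2) unfolding alg_cl_def by blast
  then show ?thesis using co[of i] assms(5) by simp
qed

lemma root_algebraic:
  assumes M: "subfld M" and y: "y ^ n \<in> alg_cl M" "n > 0"
  shows "y \<in> alg_cl M"
proof -
  have "y \<in> alg_cl (alg_cl M)"
  proof (rule alg_clI_power[OF subfld_alg_cl[OF M]])
    show "y ^ n = (\<Sum>j<n. (if j = 0 then y ^ n else 0) * y ^ j)"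
      using y(2) by (simp add: if_distrib[of "\<lambda>c. c * _"] cong: if_cong)
  qed (use y subfld_0[OF subfld_alg_cl[OF M]] in simp)
  then show ?thesis using alg_cl_alg_cl[OF M] by simp
qed

text \<open>Coefficients are separated from parts defined over a second field \<open>K\<close>. With
  \<open>K\<close> the fixed field, an averaging operator has to act on the coefficients
  \<open>c\<close> only.\<close>

lemma pf_decomp:
  fixes M K :: "'w::field set" and I :: "'i set"
  assumes M: "subfld M" and K: "subfld K" and p: "p \<in> pf M I"
  shows "\<exists>cs. (\<forall>(c, m)\<in>set cs. c \<in> M \<and> m \<in> pf K I) \<and> (\<forall>e. p e = (\<Sum>(c, m)\<leftarrow>cs. c * m e))"
  using p
proof induction
  case (const c)
  then show ?case
    using subfld_1[OF K] by (intro exI[of _ "[(c, \<lambda>_. 1)]"]) (auto intro: pf.intros)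
next
  case (proj i)
  then show ?case
    using subfld_1[OF M] by (intro exI[of _ "[(1, \<lambda>e. e i)]"]) (auto intro: pf.intros)
next
  case (add p q)
  then obtain cs ds where "\<forall>(c, m)\<in>set cs. c \<in> M \<and> m \<in> pf K I" "\<forall>e. p e = (\<Sum>(c, m)\<leftarrow>cs. c * m e)"
    "\<forall>(c, m)\<in>set ds. c \<in> M \<and> m \<in> pf K I" "\<forall>e. q e = (\<Sum>(c, m)\<leftarrow>ds. c * m e)" by blast
  then show ?case by (intro exI[of _ "cs @ ds"]) auto
next
  case (mult p q)
  then obtain cs ds where cs: "\<forall>(c, m)\<in>set cs. c \<in> M \<and> m \<in> pf K I" "\<forall>e. p e = (\<Sum>(c, m)\<leftarrow>cs. c * m e)"
    and ds: "\<forall>(c, m)\<in>set ds. c \<in> M \<and> m \<in> pf K I" "\<forall>e. q e = (\<Sum>(c, m)\<leftarrow>ds. c * m e)" by blast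
  let ?f = "\<lambda>(c, m) (d, m'). (c * d, \<lambda>e. m e * m' e)"
  let ?l = "concat (map (\<lambda>x. map (?f x) ds) cs)"
  have 1: "(\<Sum>(c, m)\<leftarrow>map (?f x) ds'. c * m e) = (case x of (c, m) \<Rightarrow> c * m e) * (\<Sum>(c, m)\<leftarrow>ds'. c * m e)"
    for x e and ds' :: "('w \<times> (('i \<Rightarrow> 'w) \<Rightarrow> 'w)) list"
    by (cases x, induction ds') (auto simp: algebra_simps)
  have 2: "(\<Sum>(c, m)\<leftarrow>concat (map (\<lambda>x. map (?f x) ds) cs'). c * m e)
      = (\<Sum>(c, m)\<leftarrow>cs'. c * m e) * (\<Sum>(c, m)\<leftarrow>ds. c * m e)" for cs' e
    by (induction cs') (simp_all add: 1 distrib_right del: map_map)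
  show ?case
  proof (intro exI[of _ ?l] conjI allI ballI)
    fix x assume "x \<in> set ?l"
    then show "case x of (c, m) \<Rightarrow> c \<in> M \<and> m \<in> pf K I"
      using cs(1) ds(1) by (fastforce intro: subfld_mult[OF M] pf.mult)
  qed (simp only: 2 cs ds)
qed

section \<open>Finite groups of field automorphisms and averaging\<close>

locale fin_act =
  fixes \<Phi> :: "'w::field_char_0 set" and H :: "('w \<Rightarrow> 'w) set"
  assumes subfld_\<Phi>: "subfld \<Phi>" and finite_H: "finite H" and id_H: "id \<in> H"
    and comp_H: "f \<in> H \<Longrightarrow> g \<in> H \<Longrightarrow> f \<circ> g \<in> H"
    and H_closed: "f \<in> H \<Longrightarrow> x \<in> \<Phi> \<Longrightarrow> f x \<in> \<Phi>"
    and H_add: "f \<in> H \<Longrightarrow> x \<in> \<Phi> \<Longrightarrow> y \<in> \<Phi> \<Longrightarrow> f (x + y) = f x + f y"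
    and H_mult: "f \<in> H \<Longrightarrow> x \<in> \<Phi> \<Longrightarrow> y \<in> \<Phi> \<Longrightarrow> f (x * y) = f x * f y"
    and H_inj: "f \<in> H \<Longrightarrow> inj f"
begin

lemma H_0: "f \<in> H \<Longrightarrow> f 0 = 0"
  using H_add[of f 0 0] subfld_0[OF subfld_\<Phi>] by simp

lemma H_eq_0: "f \<in> H \<Longrightarrow> f x = 0 \<longleftrightarrow> x = 0"
  using H_inj H_0 by (metis injD)

lemma H_1: "f \<in> H \<Longrightarrow> f 1 = 1"
  using H_mult[of f 1 1] subfld_1[OF subfld_\<Phi>] H_eq_0[of f 1] by simp

lemma H_uminus: "f \<in> H \<Longrightarrow> x \<in> \<Phi> \<Longrightarrow> f (- x) = - f x"
  using H_add[of f x "- x"] H_0[of f] subfld_uminus[OF subfld_\<Phi>]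
  by (simp add: eq_neg_iff_add_eq_0 add.commute)

lemma H_diff: "f \<in> H \<Longrightarrow> x \<in> \<Phi> \<Longrightarrow> y \<in> \<Phi> \<Longrightarrow> f (x - y) = f x - f y"
  using H_add[of f x "- y"] H_uminus subfld_uminus[OF subfld_\<Phi>] by simp

lemma H_inverse: "f \<in> H \<Longrightarrow> x \<in> \<Phi> \<Longrightarrow> f (inverse x) = inverse (f x)"
proof (cases "x = 0")
  case False
  assume "f \<in> H" "x \<in> \<Phi>"
  then show ?thesis
    using H_mult[of f x "inverse x"] False H_1[of f] subfld_inverse[OF subfld_\<Phi>, of x]
    by (intro inverse_unique[symmetric]) simp
qed (simp add: H_0)

lemma H_divide: "f \<in> H \<Longrightarrow> x \<in> \<Phi> \<Longrightarrow> y \<in> \<Phi> \<Longrightarrow> f (x / y) = f x / f y"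
  by (simp add: divide_inverse H_mult H_inverse subfld_inverse[OF subfld_\<Phi>])

lemma H_power: "f \<in> H \<Longrightarrow> x \<in> \<Phi> \<Longrightarrow> f (x ^ n) = f x ^ n"
  by (induction n) (simp_all add: H_1 H_mult subfld_power[OF subfld_\<Phi>])

lemma H_sum: "f \<in> H \<Longrightarrow> (\<And>i. i \<in> I \<Longrightarrow> x i \<in> \<Phi>) \<Longrightarrow> f (\<Sum>i\<in>I. x i) = (\<Sum>i\<in>I. f (x i))"
  by (induction I rule: infinite_finite_induct) (simp_all add: H_0 H_add subfld_sum[OF subfld_\<Phi>])

lemma H_prod: "f \<in> H \<Longrightarrow> (\<And>i. i \<in> I \<Longrightarrow> x i \<in> \<Phi>) \<Longrightarrow> f (\<Prod>i\<in>I. x i) = (\<Prod>i\<in>I. f (x i))"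
  by (induction I rule: infinite_finite_induct) (simp_all add: H_1 H_mult subfld_prod[OF subfld_\<Phi>])

lemma H_of_nat: "f \<in> H \<Longrightarrow> f (of_nat n) = of_nat n"
  by (induction n) (simp_all add: H_0 H_1 H_add subfld_closed[OF subfld_\<Phi>])

lemma funpow_H: "f \<in> H \<Longrightarrow> f ^^ n \<in> H"
  by (induction n) (auto simp: id_H[unfolded id_def] id_def comp_H intro: comp_H id_H)

text \<open>Left translation is injective because the maps are, hence bijective on the finite set
  \<open>H\<close>. It replaces inverses whenever a sum or product over the group is
  reindexed.\<close>

lemma bij_comp:
  assumes "f \<in> H"
  shows "bij_betw ((\<circ>) f) H H"
proof -
  have "inj_on ((\<circ>) f) H"
    using H_inj[OF assms] by (auto simp: inj_on_def fun_eq_iff dest: injD)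
  moreover have "(\<circ>) f ` H \<subseteq> H" using comp_H assms by auto
  ultimately show ?thesis
    using finite_H by (simp add: bij_betw_def endo_inj_surj)
qed

lemma card_H: "of_nat (card H) \<noteq> (0 :: 'w)"
  using finite_H id_H by auto

definition Fix :: "'w set \<Rightarrow> 'w set" where
  "Fix M = {x \<in> M. \<forall>f\<in>H. f x = x}"

definition stable :: "'w set \<Rightarrow> bool" where
  "stable M \<longleftrightarrow> subfld M \<and> M \<subseteq> \<Phi> \<and> (\<forall>f\<in>H. \<forall>x\<in>M. f x \<in> M)"

lemma stableD: "stable M \<Longrightarrow> subfld M" "stable M \<Longrightarrow> x \<in> M \<Longrightarrow> x \<in> \<Phi>"
  "stable M \<Longrightarrow> f \<in> H \<Longrightarrow> x \<in> M \<Longrightarrow> f x \<in> M"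
  by (auto simp: stable_def)

lemma FixI: "x \<in> M \<Longrightarrow> (\<And>f. f \<in> H \<Longrightarrow> f x = x) \<Longrightarrow> x \<in> Fix M"
  by (auto simp: Fix_def)

lemma FixD: "x \<in> Fix M \<Longrightarrow> x \<in> M" "x \<in> Fix M \<Longrightarrow> f \<in> H \<Longrightarrow> f x = x"
  by (auto simp: Fix_def)

lemma Fix_mono: "M \<subseteq> N \<Longrightarrow> Fix M \<subseteq> Fix N"
  by (auto simp: Fix_def)

lemma subfld_Fix:
  assumes "subfld M" "M \<subseteq> \<Phi>"
  shows "subfld (Fix M)"
  by (rule subfldI; rule FixI)
    (use assms in \<open>auto simp: Fix_def H_1 H_diff H_mult H_inverse subfld_closed subset_eq\<close>)

lemma stable_fgen:
  assumes M: "stable M" and Y: "Y \<subseteq> \<Phi>" "\<And>f y. f \<in> H \<Longrightarrow> y \<in> Y \<Longrightarrow> f y \<in> fgen (M \<union> Y)"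
  shows "stable (fgen (M \<union> Y))"
proof -
  let ?L = "fgen (M \<union> Y)"
  have L: "?L \<subseteq> \<Phi>" by (rule fgen_least[OF subfld_\<Phi>]) (use M Y in \<open>auto simp: stable_def\<close>)
  have "?L \<subseteq> {x \<in> \<Phi>. f x \<in> ?L}" if f: "f \<in> H" for f
  proof (rule fgen_least)
    show "subfld {x \<in> \<Phi>. f x \<in> ?L}"
      by (rule subfldI)
        (auto simp: H_1[OF f] H_diff[OF f] H_mult[OF f] H_inverse[OF f] subfld_closed[OF subfld_fgen]
          subfld_closed[OF subfld_\<Phi>])
    show "M \<union> Y \<subseteq> {x \<in> \<Phi>. f x \<in> ?L}"
      using M Y f by (auto simp: stable_def intro: fgen_inc)
  qed
  then show ?thesis using L by (auto simp: stable_def)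
qed

text \<open>The Reynolds operator; characteristic zero makes the division by \<open>card H\<close>
  meaningful.\<close>

definition avg :: "'w \<Rightarrow> 'w" where
  "avg x = (\<Sum>f\<in>H. f x) / of_nat (card H)"

lemma avg_Fix:
  assumes "stable M" "x \<in> M"
  shows "avg x \<in> Fix M"
proof (rule FixI)
  show "avg x \<in> M"
    using assms by (auto simp: avg_def stable_def intro!: subfld_divide subfld_sum subfld_of_nat)
  fix g assume g: "g \<in> H"
  have \<Phi>: "f x \<in> \<Phi>" if "f \<in> H" for f using assms H_closed that by (auto simp: stable_def)
  have "g (\<Sum>f\<in>H. f x) = (\<Sum>f\<in>H. (g \<circ> f) x)" by (simp add: H_sum[OF g] \<Phi>)
  also have "\<dots> = (\<Sum>f\<in>H. f x)"
    by (rule sum.reindex_bij_betw[OF bij_comp[OF g], where g = "\<lambda>f. f x"])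
  finally show "g (avg x) = avg x"
    by (simp add: avg_def H_divide[OF g] H_of_nat[OF g] subfld_sum[OF subfld_\<Phi>] \<Phi> subfld_of_nat[OF subfld_\<Phi>])
qed

lemma avg_fixed: "x \<in> Fix M \<Longrightarrow> avg x = x"
proof -
  assume "x \<in> Fix M"
  then have "(\<Sum>f\<in>H. f x) = (\<Sum>f\<in>H. x)" by (intro sum.cong) (auto simp: Fix_def)
  then show ?thesis using card_H by (simp add: avg_def)
qed

lemma avg_add: "x \<in> \<Phi> \<Longrightarrow> y \<in> \<Phi> \<Longrightarrow> avg (x + y) = avg x + avg y"
  by (simp add: avg_def H_add sum.distrib add_divide_distrib)

lemma avg_0: "avg 0 = 0"
  by (simp add: avg_def H_0)

lemma avg_mult: "x \<in> \<Phi> \<Longrightarrow> y \<in> Fix \<Phi> \<Longrightarrow> avg (x * y) = avg x * y"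
proof -
  assume "x \<in> \<Phi>" "y \<in> Fix \<Phi>"
  then have "(\<Sum>f\<in>H. f (x * y)) = (\<Sum>f\<in>H. f x * y)"
    by (intro sum.cong) (auto simp: Fix_def H_mult)
  then show ?thesis by (simp add: avg_def sum_distrib_right)
qed

text \<open>Numerator and denominator are multiplied by the other conjugates of \<open>q\<close>:
  the denominator becomes the norm of \<open>q\<close>, which is fixed, and then so is the
  numerator. With \<open>R\<close> merely a stable multiplicative set, the argument covers
  polynomial values in several kinds of generators.\<close>

lemma Fix_fraction:
  assumes R: "R \<subseteq> \<Phi>" "\<And>x y. x \<in> R \<Longrightarrow> y \<in> R \<Longrightarrow> x * y \<in> R" "\<And>f x. f \<in> H \<Longrightarrow> x \<in> R \<Longrightarrow> f x \<in> R"
    and x: "\<And>f. f \<in> H \<Longrightarrow> f x = x" "x = p / q" "p \<in> R" "q \<in> R" "q \<noteq> 0"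
  obtains p' q' where "p' \<in> Fix R" "q' \<in> Fix R" "q' \<noteq> 0" "x = p' / q'"
proof -
  define q' where "q' = (\<Prod>f\<in>H. f q)"
  have \<Phi>: "p \<in> \<Phi>" "q \<in> \<Phi>" "f q \<in> \<Phi>" if "f \<in> H" for f using x R that by auto
  \<comment> \<open>The product is attached to an element \<open>y\<close> of \<open>R\<close>,
    since \<open>R\<close> need not contain \<open>1\<close>.\<close>
  have mem: "y * (\<Prod>f\<in>H'. f q) \<in> R" if "y \<in> R" "H' \<subseteq> H" for y H'
    using finite_subset[OF that(2) finite_H] that(2,1)
  proof (induction H' arbitrary: y rule: finite_induct)
    case (insert f H')
    have "f q \<in> R" using R(3)[of f q] x(4) insert.prems by simp
    then have "y * f q \<in> R" using R(2) insert.prems by simp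
    then have "(y * f q) * (\<Prod>f\<in>H'. f q) \<in> R" using insert.IH insert.prems by simp
    then show ?case using insert.hyps by (simp add: mult.assoc)
  qed simp
  have q'_eq: "q' = q * (\<Prod>f\<in>H - {id}. f q)"
    using finite_H id_H by (simp add: q'_def prod.remove)
  have "q' \<in> R" unfolding q'_eq using x by (intro mem) auto
  moreover have "g q' = q'" if g: "g \<in> H" for g
  proof -
    have "g q' = (\<Prod>f\<in>H. (g \<circ> f) q)" by (simp add: q'_def H_prod[OF g] \<Phi>)
    also have "\<dots> = q'"
      unfolding q'_def by (rule prod.reindex_bij_betw[OF bij_comp[OF g], where g = "\<lambda>f. f q"])
    finally show ?thesis .
  qed
  ultimately have q': "q' \<in> Fix R" by (auto intro: FixI)
  have q0: "q' \<noteq> 0" using finite_H x by (simp add: q'_def H_eq_0)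
  have "x * q' = p * (\<Prod>f\<in>H - {id}. f q)" using x by (simp add: q'_eq)
  then have "x * q' \<in> R" using mem[OF x(3), of "H - {id}"] by simp
  moreover have "g (x * q') = x * q'" if g: "g \<in> H" for g
  proof -
    have "x \<in> \<Phi>" unfolding x(2) by (rule subfld_divide[OF subfld_\<Phi>]) (use x R in auto)
    moreover have "q' \<in> \<Phi>" using FixD[OF q'] R by blast
    ultimately show ?thesis using x(1)[OF g] FixD(2)[OF q' g] H_mult[OF g] by simp
  qed
  ultimately have "x * q' \<in> Fix R" by (auto intro: FixI)
  then show ?thesis using that[of "x * q'" q'] q' q0 by simp
qed

lemma avg_pf:
  assumes M: "stable M" and p: "p \<in> pf M I"
  obtains p' where "p' \<in> pf (Fix M) I" "\<And>y. (\<And>i. i \<in> I \<Longrightarrow> y i \<in> Fix \<Phi>) \<Longrightarrow> avg (p y) = p' y"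
proof -
  have K: "subfld (Fix M)" by (rule subfld_Fix) (use M in \<open>auto simp: stable_def\<close>)
  obtain cs where cs: "\<forall>(c, m)\<in>set cs. c \<in> M \<and> m \<in> pf (Fix M) I" "\<forall>e. p e = (\<Sum>(c, m)\<leftarrow>cs. c * m e)"
    using pf_decomp[OF stableD(1)[OF M] K p] by blast
  let ?p = "\<lambda>e. \<Sum>(c, m)\<leftarrow>cs. avg c * m e"
  have "?p \<in> pf (Fix M) I"
    using cs(1)
  proof (induction cs)
    case Nil
    then show ?case by (auto intro: pf.const subfld_0[OF K])
  next
    case (Cons x cs)
    then show ?case by (auto intro!: pf.intros avg_Fix[OF M])
  qed
  moreover have "avg (p y) = ?p y" if y: "\<And>i. i \<in> I \<Longrightarrow> y i \<in> Fix \<Phi>" for y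
  proof -
    have m: "m y \<in> Fix \<Phi>" if "m \<in> pf (Fix M) I" for m
      by (rule pf_value[OF that]) (use y subfld_Fix[OF subfld_\<Phi>] Fix_mono[of M \<Phi>] M in \<open>auto simp: stable_def\<close>)
    have "(\<Sum>(c, m)\<leftarrow>cs. c * m y) \<in> \<Phi> \<and> avg (\<Sum>(c, m)\<leftarrow>cs. c * m y) = (\<Sum>(c, m)\<leftarrow>cs. avg c * m y)"
      using cs(1)
    proof (induction cs)
      case Nil
      then show ?case by (simp add: avg_0 subfld_0[OF subfld_\<Phi>])
    next
      case (Cons x cs)
      obtain c n where x: "x = (c, n)" by force
      have "c \<in> \<Phi>" "n y \<in> Fix \<Phi>" using Cons.prems x stableD(2)[OF M] m by auto
      then show ?case
        using Cons x FixD(1)[of "n y"] by (auto simp: avg_add avg_mult subfld_add[OF subfld_\<Phi>] subfld_mult[OF subfld_\<Phi>])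
    qed
    then show ?thesis using cs(2) by simp
  qed
  ultimately show ?thesis using that by blast
qed

text \<open>Adjoining invariant elements commutes with taking invariants. A fixed fraction has a
  fixed numerator and denominator by \<open>Fix_fraction\<close>, and averaging a polynomial value
  at the fixed point \<open>y\<close> only replaces coefficients by their averages.\<close>

lemma Fix_adjoin_fixed:
  assumes M: "stable M" and y: "\<And>i. i \<in> I \<Longrightarrow> y i \<in> Fix \<Phi>"
  shows "Fix (fgen (M \<union> y ` I)) = fgen (Fix M \<union> y ` I)"
proof
  have L: "fgen (M \<union> y ` I) \<subseteq> \<Phi>"
    by (rule fgen_least[OF subfld_\<Phi>]) (use M y in \<open>auto simp: stable_def Fix_def\<close>)
  show "fgen (Fix M \<union> y ` I) \<subseteq> Fix (fgen (M \<union> y ` I))"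
  proof (rule fgen_least)
    show "subfld (Fix (fgen (M \<union> y ` I)))" by (rule subfld_Fix) (use L in auto)
    show "Fix M \<union> y ` I \<subseteq> Fix (fgen (M \<union> y ` I))"
      using y by (auto simp: Fix_def intro: fgen_inc)
  qed
  show "Fix (fgen (M \<union> y ` I)) \<subseteq> fgen (Fix M \<union> y ` I)"
  proof
    fix x assume x: "x \<in> Fix (fgen (M \<union> y ` I))"
    obtain p q where pq: "p \<in> pf M I" "q \<in> pf M I" "q y \<noteq> 0" "x = p y / q y"
      using fgenE[OF stableD(1)[OF M] FixD(1)[OF x]] .
    let ?R = "{p y | p. p \<in> pf M I}"
    have "?R \<subseteq> \<Phi>" using pf_fgen[of _ M I y] L by blast
    moreover have "a * b \<in> ?R" if ab: "a \<in> ?R" "b \<in> ?R" for a b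
    proof -
      obtain s t where "s \<in> pf M I" "t \<in> pf M I" "a = s y" "b = t y" using ab by blast
      then show ?thesis using pf.mult[of s M I t] by auto
    qed
    moreover have "f a \<in> ?R" if f: "f \<in> H" and a: "a \<in> ?R" for f a
    proof -
      obtain p where p: "p \<in> pf M I" "a = p y" using a by blast
      from p(1) have "p y \<in> \<Phi> \<and> (\<exists>s\<in>pf M I. f (p y) = s y)"
      proof induction
        case (const c)
        then show ?case using M f by (auto simp: stable_def intro!: bexI[of _ "\<lambda>_. f c"] pf.const)
      next
        case (proj i)
        then show ?case using y[OF proj] f by (auto simp: Fix_def intro!: bexI[of _ "\<lambda>e. e i"] pf.proj)
      next
        case (add p q)
        then obtain s t where "s \<in> pf M I" "f (p y) = s y" "t \<in> pf M I" "f (q y) = t y" by blast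
        then show ?case
          using add H_add[OF f] subfld_add[OF subfld_\<Phi>] by (auto intro!: bexI[of _ "\<lambda>e. s e + t e"] pf.add)
      next
        case (mult p q)
        then obtain s t where "s \<in> pf M I" "f (p y) = s y" "t \<in> pf M I" "f (q y) = t y" by blast
        then show ?case
          using mult H_mult[OF f] subfld_mult[OF subfld_\<Phi>] by (auto intro!: bexI[of _ "\<lambda>e. s e * t e"] pf.mult)
      qed
      then show ?thesis using p by auto
    qed
    ultimately obtain p' q' where p'q': "p' \<in> Fix ?R" "q' \<in> Fix ?R" "q' \<noteq> 0" "x = p' / q'"
      using Fix_fraction[of ?R x "p y" "q y"] pq FixD(2)[OF x] by blast
    have "a \<in> fgen (Fix M \<union> y ` I)" if a: "a \<in> Fix ?R" for a
    proof -
      obtain p where p: "p \<in> pf M I" "a = p y" using FixD(1)[OF a] by blast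
      obtain p' where p': "p' \<in> pf (Fix M) I" "avg (p y) = p' y" using avg_pf[OF M p(1)] y by metis
      then have "a = p' y" using avg_fixed[OF a] p by simp
      then show ?thesis using pf_fgen[OF p'(1)] by simp
    qed
    then show "x \<in> fgen (Fix M \<union> y ` I)" using p'q' by (simp add: subfld_divide)
  qed
qed

text \<open>Galois descent for polynomial functions: the averaged function has fixed coefficients
  and agrees with \<open>p\<close> at all points over the infinite field \<open>Fix M\<close>, hence
  everywhere.\<close>

lemma pf_descent:
  assumes M: "stable M" and I: "finite I" and p: "p \<in> pf M I"
    and val: "\<And>e. (\<And>i. i \<in> I \<Longrightarrow> e i \<in> Fix M) \<Longrightarrow> p e \<in> Fix M"
  shows "p \<in> pf (Fix M) I"
proof -
  have M': "M \<subseteq> \<Phi>" "subfld M" using M by (auto simp: stable_def)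
  obtain p' where p': "p' \<in> pf (Fix M) I" "\<And>y. (\<And>i. i \<in> I \<Longrightarrow> y i \<in> Fix \<Phi>) \<Longrightarrow> avg (p y) = p' y"
    using avg_pf[OF M p] by metis
  have "p' \<in> pf M I" using pf_mono[OF p'(1)] by (auto simp: Fix_def)
  from pf_diff[OF M'(2) p this] have d: "(\<lambda>e. p e - p' e) \<in> pf M I" .
  have "p e - p' e = 0" for e
  proof (rule pf_zero[OF I d])
    show "infinite (Fix M)" by (rule infinite_subfld[OF subfld_Fix[OF M'(2,1)]])
    fix e assume e: "\<And>i. i \<in> I \<Longrightarrow> e i \<in> Fix M"
    then have "avg (p e) = p' e" using p'(2)[of e] Fix_mono[OF M'(1)] by blast
    then show "p e - p' e = 0" using avg_fixed[OF val[OF e]] by simp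
  qed
  then have "p = p'" by (simp add: fun_eq_iff)
  then show ?thesis using p'(1) by simp
qed

section \<open>Adjoining a semi-invariant element\<close>

definition semi :: "'w set \<Rightarrow> 'w \<Rightarrow> bool" where
  "semi M y \<longleftrightarrow> y \<in> \<Phi> \<and> (\<forall>f\<in>H. \<exists>c\<in>M. f y = c * y)"

lemma semi_invariant_polys:
  assumes M: "stable M" and semi: "semi M y"
  shows "polys_in M y \<subseteq> \<Phi>" "x \<in> polys_in M y \<Longrightarrow> f \<in> H \<Longrightarrow> f x \<in> polys_in M y"
    "f \<in> H \<Longrightarrow> range (Polynomial.coeff P) \<subseteq> M \<Longrightarrow>
      f (poly P y) = (\<Sum>i\<le>degree P. f (Polynomial.coeff P i) * f y ^ i)"
proof -
  have y: "y \<in> \<Phi>" "\<And>f. f \<in> H \<Longrightarrow> \<exists>c\<in>M. f y = c * y" using semi by (auto simp: semi_def)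
  have co: "Polynomial.coeff P i \<in> \<Phi>" if "range (Polynomial.coeff P) \<subseteq> M" for P i
    using that M by (auto simp: stable_def)
  show "polys_in M y \<subseteq> \<Phi>"
    using polys_in_subset[OF stableD(1)[OF M], of y] fgen_least[OF subfld_\<Phi>, of "M \<union> {y}"] M y(1)
    by (auto simp: stable_def)
  show fP: "f (poly P y) = (\<Sum>i\<le>degree P. f (Polynomial.coeff P i) * f y ^ i)"
    if "f \<in> H" "range (Polynomial.coeff P) \<subseteq> M" for f P
    unfolding poly_altdef using that y(1) co
    by (simp add: H_sum H_mult H_power subfld_mult[OF subfld_\<Phi>] subfld_power[OF subfld_\<Phi>])
  show "f x \<in> polys_in M y" if x: "x \<in> polys_in M y" and f: "f \<in> H"
  proof -
    obtain P where P: "range (Polynomial.coeff P) \<subseteq> M" "x = poly P y"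
      using x unfolding polys_in_def by blast
    obtain c where c: "c \<in> M" "f y = c * y" using y(2)[OF f] by blast
    note cl = polys_in_closed[OF stableD(1)[OF M], where y = y]
    have pw: "(c * y) ^ i \<in> polys_in M y" for i
      by (induction i) (simp_all add: cl(1)[OF subfld_1[OF stableD(1)[OF M]]] cl(4)[OF cl(4)[OF cl(1)[OF c(1)] cl(2)]])
    have "(\<Sum>i\<in>I. f (Polynomial.coeff P i) * f y ^ i) \<in> polys_in M y" for I
      using P(1) c(2) by (induction I rule: infinite_finite_induct)
        (auto intro!: cl(3) cl(4) pw intro: cl(1) stableD(3)[OF M f] subfld_0[OF stableD(1)[OF M]])
    then show ?thesis using fP[OF f P(1)] P(2) by simp
  qed
qed

lemma Fix_semi_invariant_fraction:
  assumes M: "stable M" and semi: "semi M y"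
    and x: "x \<in> Fix (fgen (M \<union> {y}))"
  obtains p q where "p \<in> Fix (polys_in M y)" "q \<in> Fix (polys_in M y)" "q \<noteq> 0" "x = p / q"
proof -
  obtain p q where "p \<in> polys_in M y" "q \<in> polys_in M y" "q \<noteq> 0" "x = p / q"
    using fgen_singleE[OF stableD(1)[OF M] FixD(1)[OF x]] .
  then show ?thesis
    using Fix_fraction[of "polys_in M y" x p q] semi_invariant_polys[OF M semi]
      polys_in_closed(4)[OF stableD(1)[OF M]] FixD(2)[OF x] that by blast
qed

text \<open>The factors \<open>c f\<close> form a cocycle in \<open>M\<close>, so invariants are
  sought among the monomials \<open>b * y ^ e\<close> with \<open>b\<close> in \<open>M\<close>. As
  \<open>y\<close> is transcendental, an invariant polynomial is invariant term by term, and the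
  exponents that occur are multiples of the smallest positive one, whose monomial is
  \<open>w\<close>.\<close>

lemma Fix_semi_invariant:
  assumes M: "stable M" and semi: "semi M y"
    and tr: "y \<notin> alg_cl M"
  obtains w where "w \<in> \<Phi>" "w \<notin> alg_cl M" "Fix (fgen (M \<union> {y})) = fgen (Fix M \<union> {w})"
proof -
  note F = stableD(1)[OF M]
  have M\<Phi>: "M \<subseteq> \<Phi>" using M by (simp add: stable_def)
  have y: "y \<in> \<Phi>" "\<And>f. f \<in> H \<Longrightarrow> \<exists>c\<in>M. f y = c * y" using semi by (auto simp: semi_def)
  have y0: "y \<noteq> 0" using tr alg_cl_superset[OF F] subfld_0[OF F] by auto
  obtain c where c: "\<And>f. f \<in> H \<Longrightarrow> c f \<in> M" "\<And>f. f \<in> H \<Longrightarrow> f y = c f * y" using y(2) by metis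
  define fixd where "fixd x \<longleftrightarrow> (\<forall>f\<in>H. f x = x)" for x
  define good where "good e b \<longleftrightarrow> e > 0 \<and> b \<in> M \<and> b \<noteq> 0 \<and> fixd (b * y ^ e)" for e :: nat and b
  \<comment> \<open>The norm of \<open>y\<close> is an invariant monomial, so some positive exponent
    exists.\<close>
  have "good (card H) (\<Prod>f\<in>H. c f)"
  proof -
    have "(\<Prod>f\<in>H. f y) = (\<Prod>f\<in>H. c f) * y ^ card H" by (simp add: c(2) prod.distrib)
    moreover have "fixd (\<Prod>f\<in>H. f y)"
      unfolding fixd_def
    proof
      fix g assume g: "g \<in> H"
      have "g (\<Prod>f\<in>H. f y) = (\<Prod>f\<in>H. (g \<circ> f) y)" by (simp add: H_prod[OF g] H_closed y)
      also have "\<dots> = (\<Prod>f\<in>H. f y)"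
        by (rule prod.reindex_bij_betw[OF bij_comp[OF g], where g = "\<lambda>f. f y"])
      finally show "g (\<Prod>f\<in>H. f y) = (\<Prod>f\<in>H. f y)" .
    qed
    moreover have "card H > 0" using finite_H id_H card_gt_0_iff by blast
    moreover have "c f \<noteq> 0" if "f \<in> H" for f using c(2)[OF that] H_eq_0[OF that, of y] y0 by auto
    ultimately show ?thesis
      using finite_H c(1) by (auto simp: good_def intro: subfld_prod[OF F])
  qed
  then have ex: "\<exists>e. \<exists>b. good e b" by blast
  define e where "e = (LEAST e. \<exists>b. good e b)"
  obtain b where b: "good e b" using LeastI_ex[OF ex] unfolding e_def by blast
  have min: "e \<le> i" if "good i a" for i a unfolding e_def by (rule Least_le) (use that in blast)
  define w where "w = b * y ^ e"
  have be: "e > 0" "b \<in> M" "b \<noteq> 0" "fixd w" using b by (auto simp: good_def w_def)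
  have w\<Phi>: "w \<in> \<Phi>" using be M\<Phi> y(1) by (auto simp: w_def intro!: subfld_mult[OF subfld_\<Phi>] subfld_power[OF subfld_\<Phi>])
  have w0: "w \<noteq> 0" using be y0 by (simp add: w_def)
  have fixd_div: "fixd (x / z)" if "x \<in> \<Phi>" "z \<in> \<Phi>" "fixd x" "fixd z" for x z
    using that by (auto simp: fixd_def H_divide)
  \<comment> \<open>Division by \<open>w\<close> lowers the exponent by \<open>e\<close>; an
    exponent strictly between \<open>0\<close> and \<open>e\<close> would contradict
    minimality.\<close>
  have trm: "a * y ^ i \<in> fgen (Fix M \<union> {w})" if "a \<in> M" "fixd (a * y ^ i)" for a i
    using that
  proof (induction i arbitrary: a rule: less_induct)
    case (less i)
    show ?case
    proof (cases "a = 0 \<or> i = 0")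
      case True
      then show ?thesis
      proof
        assume "i = 0"
        then show ?thesis using less.prems by (auto simp: fixd_def Fix_def intro: fgen_inc)
      qed (simp add: subfld_0)
    next
      case False
      then have "good i a" using less.prems by (simp add: good_def)
      then have ei: "e \<le> i" by (rule min)
      then have yi: "y ^ i = y ^ e * y ^ (i - e)" by (simp add: power_add[symmetric])
      have eq: "a * y ^ i / w = (a / b) * y ^ (i - e)"
        using be y0 by (simp add: w_def yi field_simps)
      have "a * y ^ i \<in> \<Phi>" using less.prems M\<Phi> y(1) subfld_mult[OF subfld_\<Phi>] subfld_power[OF subfld_\<Phi>] by blast
      then have fx: "fixd ((a / b) * y ^ (i - e))"
        using fixd_div[OF _ w\<Phi> less.prems(2) be(4)] eq by simp
      have lt: "i - e < i" using be(1) ei by simp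
      have ab: "a / b \<in> M" using less.prems(1) be by (intro subfld_divide[OF F])
      have "(a / b) * y ^ (i - e) \<in> fgen (Fix M \<union> {w})" by (rule less.IH[OF lt ab fx])
      then have "w * ((a / b) * y ^ (i - e)) \<in> fgen (Fix M \<union> {w})"
        using fgen_inc[of w "Fix M \<union> {w}"] by (intro subfld_mult[OF subfld_fgen, of w]) blast+
      moreover have "a * y ^ i = w * ((a / b) * y ^ (i - e))" using eq w0 by (simp add: field_simps)
      ultimately show ?thesis by (simp only:)
    qed
  qed
  have fixed: "p \<in> fgen (Fix M \<union> {w})" if p: "p \<in> Fix (polys_in M y)" for p
  proof -
    obtain P where P: "range (Polynomial.coeff P) \<subseteq> M" "p = poly P y"
      using FixD(1)[OF p] unfolding polys_in_def by blast
    have co: "Polynomial.coeff P i \<in> M" for i using P(1) by auto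
    have "fixd (Polynomial.coeff P i * y ^ i)" for i
      unfolding fixd_def
    proof
      fix f assume f: "f \<in> H"
      have eq: "f (Polynomial.coeff P i * y ^ i) = f (Polynomial.coeff P i) * c f ^ i * y ^ i" for i
        using co M\<Phi> y(1) c(2)[OF f]
        by (simp add: H_mult[OF f] H_power[OF f] subfld_power[OF subfld_\<Phi>] subset_eq power_mult_distrib)
      show "f (Polynomial.coeff P i * y ^ i) = Polynomial.coeff P i * y ^ i"
      proof (cases "i \<le> degree P")
        case True
        have "f (Polynomial.coeff P i) * c f ^ i - Polynomial.coeff P i = 0"
        proof (rule polys_in_zero[OF F tr _ _ True])
          show "f (Polynomial.coeff P i) * c f ^ i - Polynomial.coeff P i \<in> M" for i
            using co c(1)[OF f] stableD(3)[OF M f] by (auto intro!: subfld_diff[OF F] subfld_mult[OF F] subfld_power[OF F])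
          have "(\<Sum>i\<le>degree P. f (Polynomial.coeff P i) * c f ^ i * y ^ i) = f p"
            using semi_invariant_polys(3)[OF M semi f P(1)] P(2) c(2)[OF f]
            by (simp add: power_mult_distrib mult.assoc)
          also have "\<dots> = (\<Sum>i\<le>degree P. Polynomial.coeff P i * y ^ i)"
            using FixD(2)[OF p f] P(2) by (simp add: poly_altdef)
          finally show "(\<Sum>i\<le>degree P. (f (Polynomial.coeff P i) * c f ^ i - Polynomial.coeff P i) * y ^ i) = 0"
            by (simp add: left_diff_distrib sum_subtractf)
        qed
        then show ?thesis unfolding eq by simp
      next
        case False
        then show ?thesis by (simp add: coeff_eq_0 H_0[OF f])
      qed
    qed
    then show ?thesis
      unfolding P(2) poly_altdef by (intro subfld_sum trm co) auto
  qed
  have "Fix (fgen (M \<union> {y})) \<subseteq> fgen (Fix M \<union> {w})"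
  proof
    fix x assume x: "x \<in> Fix (fgen (M \<union> {y}))"
    obtain p q where "p \<in> Fix (polys_in M y)" "q \<in> Fix (polys_in M y)" "q \<noteq> 0" "x = p / q"
      using Fix_semi_invariant_fraction[OF M semi x] .
    then show "x \<in> fgen (Fix M \<union> {w})" using fixed by (simp add: subfld_divide)
  qed
  moreover have "fgen (Fix M \<union> {w}) \<subseteq> Fix (fgen (M \<union> {y}))"
  proof (rule fgen_least)
    have "fgen (M \<union> {y}) \<subseteq> \<Phi>" by (rule fgen_least[OF subfld_\<Phi>]) (use M\<Phi> y(1) in auto)
    then show "subfld (Fix (fgen (M \<union> {y})))" by (intro subfld_Fix) simp_all
    have "w \<in> fgen (M \<union> {y})"
      unfolding w_def using be by (intro subfld_mult subfld_power) (auto intro: fgen_inc)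
    then show "Fix M \<union> {w} \<subseteq> Fix (fgen (M \<union> {y}))"
      using be(4) by (auto simp: Fix_def fixd_def intro: fgen_inc)
  qed
  moreover have "w \<notin> alg_cl M"
  proof
    assume "w \<in> alg_cl M"
    then have "w / b \<in> alg_cl M"
      using be alg_cl_superset[OF F] by (intro subfld_divide[OF subfld_alg_cl[OF F]]) auto
    then have "y ^ e \<in> alg_cl M" using be by (simp add: w_def)
    then show False using root_algebraic[OF F _ be(1)] tr by blast
  qed
  ultimately show ?thesis using that w\<Phi> by blast
qed

text \<open>Powers of \<open>\<tau>\<close> fix \<open>M\<close> and multiply \<open>u ^ i\<close>
  by powers of \<open>\<zeta> ^ i\<close>. Summing an invariant polynomial over them kills every
  exponent not divisible by \<open>n\<close>, and the remaining terms lie in \<open>M\<close>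
  because \<open>u ^ n\<close> does.\<close>

lemma Fix_kummer:
  assumes M: "stable M" and semi: "semi M u"
    and n: "n > 0" "u ^ n \<in> M"
    and \<tau>: "\<tau> \<in> H" "\<And>x. x \<in> M \<Longrightarrow> \<tau> x = x" "\<tau> u = \<zeta> * u" "\<zeta> \<in> M" "\<zeta> ^ n = 1"
    and prim: "\<And>i. 0 < i \<Longrightarrow> i < n \<Longrightarrow> \<zeta> ^ i \<noteq> 1"
  shows "Fix (fgen (M \<union> {u})) = Fix M"
proof
  note F = stableD(1)[OF M]
  have M\<Phi>: "M \<subseteq> \<Phi>" using M by (simp add: stable_def)
  have u: "u \<in> \<Phi>" "\<And>f. f \<in> H \<Longrightarrow> \<exists>c\<in>M. f u = c * u" using semi by (auto simp: semi_def)
  show "Fix M \<subseteq> Fix (fgen (M \<union> {u}))" by (rule Fix_mono) (auto intro: fgen_inc)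
  have fixed: "p \<in> Fix M" if p: "p \<in> Fix (polys_in M u)" for p
  proof -
    obtain P where P: "range (Polynomial.coeff P) \<subseteq> M" "p = poly P u"
      using FixD(1)[OF p] unfolding polys_in_def by blast
    have co: "Polynomial.coeff P i \<in> M" for i using P(1) by auto
    have pow: "\<tau> ^^ s \<in> H" for s by (rule funpow_H[OF \<tau>(1)])
    have powM: "(\<tau> ^^ s) x = x" if "x \<in> M" for x s
      using that by (induction s) (simp_all add: \<tau>(2))
    have powu: "(\<tau> ^^ s) u = \<zeta> ^ s * u" for s
    proof (induction s)
      case (Suc s)
      have "\<zeta> ^ s \<in> M" using \<tau>(4) by (rule subfld_power[OF F])
      then show ?case
        using Suc u(1) M\<Phi> \<tau>(2,3) by (simp add: H_mult[OF \<tau>(1)] subset_eq mult_ac)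
    qed simp
    have ps: "p = (\<Sum>i\<le>degree P. Polynomial.coeff P i * u ^ i * (\<zeta> ^ i) ^ s)" for s
    proof -
      have "p = (\<tau> ^^ s) (poly P u)" using FixD(2)[OF p pow] P(2) by simp
      also have "\<dots> = (\<Sum>i\<le>degree P. Polynomial.coeff P i * u ^ i * (\<zeta> ^ i) ^ s)"
        unfolding semi_invariant_polys(3)[OF M semi pow P(1)] powu
        by (intro sum.cong) (simp_all add: powM co power_mult_distrib power_mult[symmetric] mult_ac)
      finally show ?thesis .
    qed
    have geo: "(\<Sum>s<n. (\<zeta> ^ i) ^ s) = (if n dvd i then of_nat n else 0)" for i
    proof (cases "n dvd i")
      case True
      then obtain j where "i = n * j" by blast
      then show ?thesis by (simp add: power_mult \<tau>(5))
    next
      case False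
      have "\<zeta> ^ i = \<zeta> ^ (i mod n)"
        by (metis \<tau>(5) mult.left_neutral mult_div_mod_eq power_add power_mult power_one)
      then have "\<zeta> ^ i \<noteq> 1" using prim[of "i mod n"] False n(1) by (auto simp: mod_greater_zero_iff_not_dvd)
      moreover have "(\<zeta> ^ i) ^ n = 1" by (metis \<tau>(5) power_mult mult.commute power_one)
      ultimately show ?thesis using False by (simp add: geometric_sum)
    qed
    have "of_nat n * p = (\<Sum>s<n. p)" by simp
    also have "\<dots> = (\<Sum>s<n. \<Sum>i\<le>degree P. Polynomial.coeff P i * u ^ i * (\<zeta> ^ i) ^ s)"
      by (rule sum.cong[OF refl]) (rule ps)
    also have "\<dots> = (\<Sum>i\<le>degree P. Polynomial.coeff P i * u ^ i * (\<Sum>s<n. (\<zeta> ^ i) ^ s))"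
      by (subst sum.swap) (simp add: sum_distrib_left)
    also have "\<dots> \<in> M"
    proof (rule subfld_sum[OF F])
      fix i
      show "Polynomial.coeff P i * u ^ i * (\<Sum>s<n. (\<zeta> ^ i) ^ s) \<in> M"
      proof (cases "n dvd i")
        case True
        then obtain j where "i = n * j" by blast
        then have "u ^ i \<in> M" using subfld_power[OF F n(2)] by (simp add: power_mult)
        then show ?thesis using co True unfolding geo by (auto intro!: subfld_mult[OF F] subfld_of_nat[OF F])
      qed (simp add: geo subfld_0[OF F])
    qed
    finally have "of_nat n * p / of_nat n \<in> M" using subfld_of_nat[OF F] by (intro subfld_divide[OF F])
    then have "p \<in> M" using n(1) by simp
    then show ?thesis using p by (auto simp: Fix_def)
  qed
  show "Fix (fgen (M \<union> {u})) \<subseteq> Fix M"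
  proof
    fix x assume x: "x \<in> Fix (fgen (M \<union> {u}))"
    obtain p q where "p \<in> Fix (polys_in M u)" "q \<in> Fix (polys_in M u)" "q \<noteq> 0" "x = p / q"
      using Fix_semi_invariant_fraction[OF M semi x] .
    then show "x \<in> Fix M" using fixed subfld_divide[OF subfld_Fix[OF F M\<Phi>]] by blast
  qed
qed

section \<open>Finite generation of the field of invariants\<close>

lemma orbit_polynomial:
  assumes M: "stable M" and x: "x \<in> M"
  obtains N c where "N > 0" "x ^ N = (\<Sum>j<N. c j * x ^ j)" "\<And>j. c j \<in> Fix M"
proof -
  note F = stableD(1)[OF M]
  define N where "N = card H"
  have N: "N > 0" unfolding N_def using finite_H id_H card_gt_0_iff by blast
  \<comment> \<open>The coefficient of \<open>X ^ j\<close> in the product of the factors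
    \<open>X - f x\<close>: the subset \<open>A\<close> collects the factors that contribute
    \<open>X\<close>.\<close>
  define d where "d j = (\<Sum>A\<in>{A \<in> Pow H. card A = j}. \<Prod>f\<in>H - A. - f x)" for j
  have fx: "- f x \<in> M" if "f \<in> H" for f using stableD(3)[OF M that x] subfld_uminus[OF F] by blast
  have fx\<Phi>: "- f x \<in> \<Phi>" "f x \<in> \<Phi>" if "f \<in> H" for f using fx[OF that] stableD(3)[OF M that x] stableD(2)[OF M] by auto
  have "d j \<in> Fix M" for j
  proof (rule FixI)
    show "d j \<in> M" unfolding d_def by (intro subfld_sum[OF F] subfld_prod[OF F] fx) auto
    fix g assume g: "g \<in> H"
    let ?h = "(`) ((\<circ>) g)"
    have bij: "bij_betw ?h {A \<in> Pow H. card A = j} {A \<in> Pow H. card A = j}"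
    proof -
      have inj: "inj_on ((\<circ>) g) H" using bij_comp[OF g] by (simp add: bij_betw_def)
      have "inj_on ?h {A \<in> Pow H. card A = j}"
        by (rule inj_on_subset[OF inj_on_image_Pow[OF inj]]) auto
      moreover have "?h ` {A \<in> Pow H. card A = j} \<subseteq> {A \<in> Pow H. card A = j}"
        using comp_H[OF g] inj by (auto simp: card_image inj_on_subset)
      ultimately show ?thesis using finite_H by (simp add: bij_betw_def endo_inj_surj)
    qed
    have "g (d j) = (\<Sum>A\<in>{A \<in> Pow H. card A = j}. \<Prod>f\<in>H - A. - (g \<circ> f) x)"
    proof -
      have "g (d j) = (\<Sum>A\<in>{A \<in> Pow H. card A = j}. g (\<Prod>f\<in>H - A. - f x))"
        unfolding d_def by (rule H_sum[OF g]) (auto intro!: subfld_prod[OF subfld_\<Phi>] fx\<Phi>(1))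
      also have "\<dots> = (\<Sum>A\<in>{A \<in> Pow H. card A = j}. \<Prod>f\<in>H - A. - (g \<circ> f) x)"
      proof (rule sum.cong[OF refl])
        fix A assume "A \<in> {A \<in> Pow H. card A = j}"
        have "g (\<Prod>f\<in>H - A. - f x) = (\<Prod>f\<in>H - A. g (- f x))"
          by (rule H_prod[OF g]) (use fx\<Phi> in auto)
        also have "\<dots> = (\<Prod>f\<in>H - A. - (g \<circ> f) x)"
          by (rule prod.cong) (auto simp: H_uminus[OF g] fx\<Phi>)
        finally show "g (\<Prod>f\<in>H - A. - f x) = (\<Prod>f\<in>H - A. - (g \<circ> f) x)" .
      qed
      finally show ?thesis .
    qed
    also have "\<dots> = (\<Sum>A\<in>{A \<in> Pow H. card A = j}. \<Prod>f\<in>H - ?h A. - f x)"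
    proof (rule sum.cong[OF refl])
      fix A assume A: "A \<in> {A \<in> Pow H. card A = j}"
      have b: "bij_betw ((\<circ>) g) (H - A) (H - ?h A)"
        using bij_comp[OF g] A by (auto simp: bij_betw_def inj_on_diff inj_on_image_set_diff[of "(\<circ>) g" H H A])
      show "(\<Prod>f\<in>H - A. - (g \<circ> f) x) = (\<Prod>f\<in>H - ?h A. - f x)"
        by (rule prod.reindex_bij_betw[OF b, where g = "\<lambda>f. - f x"])
    qed
    also have "\<dots> = d j"
      unfolding d_def by (rule sum.reindex_bij_betw[OF bij, where g = "\<lambda>A. \<Prod>f\<in>H - A. - f x"])
    finally show "g (d j) = d j" .
  qed
  moreover have "x ^ N = (\<Sum>j<N. (- d j) * x ^ j)"
  proof -
    have "0 = (\<Prod>f\<in>H. x + - f x)"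
      using finite_H id_H by (auto simp: prod_zero_iff intro!: bexI[of _ id])
    also have "\<dots> = (\<Sum>A\<in>Pow H. (\<Prod>f\<in>A. x) * (\<Prod>f\<in>H - A. - f x))"
      by (rule prod_add[OF finite_H])
    also have "\<dots> = (\<Sum>A\<in>Pow H. x ^ card A * (\<Prod>f\<in>H - A. - f x))" by simp
    also have "\<dots> = (\<Sum>j\<le>N. \<Sum>A\<in>{A \<in> Pow H. card A = j}. x ^ card A * (\<Prod>f\<in>H - A. - f x))"
      by (rule sum.group[symmetric]) (use finite_H in \<open>auto simp: N_def card_mono\<close>)
    also have "\<dots> = (\<Sum>j\<le>N. x ^ j * d j)"
      by (rule sum.cong) (auto simp: d_def sum_distrib_left)
    also have "\<dots> = x ^ N * d N + (\<Sum>j<N. d j * x ^ j)"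
      by (simp add: lessThan_Suc_atMost[symmetric] mult.commute)
    also have "d N = 1"
    proof -
      have "{A \<in> Pow H. card A = N} = {H}"
        using finite_H card_subset_eq by (auto simp: N_def)
      then show ?thesis by (simp add: d_def)
    qed
    finally show ?thesis by (simp add: eq_neg_iff_add_eq_0 sum_negf)
  qed
  ultimately show ?thesis
    using that[of N "\<lambda>j. - d j"] N subfld_uminus[OF subfld_Fix[OF F]] M by (auto simp: stable_def)
qed

text \<open>Noether's argument. The coefficients of the orbit polynomials of the \<open>v i\<close>
  generate a field \<open>F'\<close> of invariants over which the \<open>v i\<close> are algebraic,
  so \<open>k[v]\<close> lies in a finite span over \<open>F'\<close>. The averages of the spanning
  elements and those coefficients generate all invariants.\<close>

lemma Fix_finitely_generated:
  assumes k: "subfld k" "k \<subseteq> Fix \<Phi>" and I: "finite I" and v: "\<And>i. i \<in> I \<Longrightarrow> v i \<in> \<Phi>"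
    and act: "\<And>f i. f \<in> H \<Longrightarrow> i \<in> I \<Longrightarrow> \<exists>p\<in>pf k I. f (v i) = p v"
  shows "\<exists>xs. Fix (fgen (k \<union> v ` I)) = fgen (k \<union> set xs)"
proof -
  let ?M = "fgen (k \<union> v ` I)"
  let ?R = "{p v | p. p \<in> pf k I}"
  have L: "?M \<subseteq> \<Phi>" by (rule fgen_least[OF subfld_\<Phi>]) (use k v in \<open>auto simp: Fix_def\<close>)
  have R\<Phi>: "?R \<subseteq> \<Phi>" using pf_fgen[of _ k I v] L by blast
  have R_mult: "a * b \<in> ?R" if ab: "a \<in> ?R" "b \<in> ?R" for a b
  proof -
    obtain s t where "s \<in> pf k I" "t \<in> pf k I" "a = s v" "b = t v" using ab by blast
    then show ?thesis using pf.mult[of s k I t] by auto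
  qed
  have R_H: "f a \<in> ?R" if f: "f \<in> H" and a: "a \<in> ?R" for f a
  proof -
    obtain p where p: "p \<in> pf k I" "a = p v" using a by blast
    from p(1) have "p v \<in> \<Phi> \<and> (\<exists>s\<in>pf k I. f (p v) = s v)"
    proof induction
      case (const c)
      then show ?case using k f by (auto simp: Fix_def intro!: bexI[of _ "\<lambda>_. c"] pf.const)
    next
      case (proj i)
      then show ?case using v[OF proj] act[OF f proj] by auto
    next
      case (add p q)
      then obtain s t where "s \<in> pf k I" "f (p v) = s v" "t \<in> pf k I" "f (q v) = t v" by blast
      then show ?case
        using add H_add[OF f] subfld_add[OF subfld_\<Phi>] by (auto intro!: bexI[of _ "\<lambda>e. s e + t e"] pf.add)
    next
      case (mult p q)
      then obtain s t where "s \<in> pf k I" "f (p v) = s v" "t \<in> pf k I" "f (q v) = t v" by blast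
      then show ?case
        using mult H_mult[OF f] subfld_mult[OF subfld_\<Phi>] by (auto intro!: bexI[of _ "\<lambda>e. s e * t e"] pf.mult)
    qed
    then show ?thesis using p by auto
  qed
  have stM: "stable ?M"
  proof -
    have "stable k" using k unfolding stable_def Fix_def by fastforce
    then show ?thesis
    proof (rule stable_fgen)
      show "v ` I \<subseteq> \<Phi>" using v by auto
      show "f y \<in> ?M" if "f \<in> H" "y \<in> v ` I" for f y
        using that act[of f] pf_fgen[of _ k I v] by fastforce
    qed
  qed
  have "\<forall>i\<in>I. \<exists>N c. N > 0 \<and> v i ^ N = (\<Sum>j<N. c j * v i ^ j) \<and> (\<forall>j. c j \<in> Fix ?M)"
  proof
    fix i assume "i \<in> I"
    then have "v i \<in> ?M" by (auto intro: fgen_inc)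
    then obtain N c where "N > 0" "v i ^ N = (\<Sum>j<N. c j * v i ^ j)" "\<And>j. c j \<in> Fix ?M"
      by (rule orbit_polynomial[OF stM]) blast
    then show "\<exists>N c. N > 0 \<and> v i ^ N = (\<Sum>j<N. c j * v i ^ j) \<and> (\<forall>j. c j \<in> Fix ?M)"
      by (intro exI[of _ N] exI[of _ c]) simp
  qed
  then obtain N c where Nc: "\<And>i. i \<in> I \<Longrightarrow> N i > 0"
    "\<And>i. i \<in> I \<Longrightarrow> v i ^ N i = (\<Sum>j<N i. c i j * v i ^ j)" "\<And>i j. i \<in> I \<Longrightarrow> c i j \<in> Fix ?M" by metis
  define D where "D = (\<Union>i\<in>I. c i ` {..<N i})"
  define F' where "F' = fgen (k \<union> D)"
  have F': "subfld F'" by (simp add: F'_def)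
  have D: "finite D" "D \<subseteq> Fix ?M" using I Nc(3) by (auto simp: D_def)
  have subF: "subfld (Fix ?M)" by (rule subfld_Fix) (use L in auto)
  have kM: "k \<subseteq> Fix ?M" using k(2) by (auto simp: Fix_def intro: fgen_inc)
  have F'M: "F' \<subseteq> Fix ?M" unfolding F'_def by (rule fgen_least[OF subF]) (use D kM in auto)
  have "v i \<in> alg_cl F'" if i: "i \<in> I" for i
  proof (rule alg_clI_power[OF F' Nc(2)[OF i]])
    show "c i j \<in> F'" if "j < N i" for j
      using that i by (auto simp: F'_def D_def intro!: fgen_inc)
  qed
  then obtain B where B: "finite B" "1 \<in> fspan F' B" "v ` I \<subseteq> stab F' B"
    "\<And>M. subfld M \<Longrightarrow> v ` I \<subseteq> M \<Longrightarrow> B \<subseteq> M"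
    using finite_algebraic_stab[OF F', of "v ` I"] I by blast
  have BM: "B \<subseteq> ?M" by (rule B(4)) (auto intro: fgen_inc)
  have pv: "p v \<in> stab F' B" if "p \<in> pf k I" for p
    using that
  proof induction
    case (const c)
    then show ?case using subset_stab[OF F', of B] by (auto simp: F'_def intro: fgen_inc)
  next
    case (proj i)
    then show ?case using B(3) by blast
  next
    case (add p q)
    have "p v + q v = p v - (0 - q v)" by simp
    moreover have "0 \<in> stab F' B" using subset_stab[OF F', of B] subfld_0[OF F'] by blast
    ultimately show ?case using add stab_diff[OF F'] by metis
  next
    case (mult p q)
    then show ?case by (intro stab_mult[OF F'])
  qed
  define G where "G = fgen (k \<union> (D \<union> avg ` B))"
  have "F' \<subseteq> G" unfolding F'_def G_def by (rule fgen_mono) auto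
  have span: "x \<in> \<Phi> \<and> avg x \<in> G" if "x \<in> fspan F' B" for x
    using that
  proof induction
    case zero
    then show ?case by (simp add: avg_0 subfld_0[OF subfld_\<Phi>] G_def subfld_0)
  next
    case (step x d s)
    have d: "d \<in> Fix \<Phi>" "d \<in> G" using step F'M Fix_mono[OF L] \<open>F' \<subseteq> G\<close> by auto
    have s: "s \<in> \<Phi>" "avg s \<in> G" using step BM L by (auto simp: G_def intro: fgen_inc)
    have "avg (d * s + x) = avg s * d + avg x"
      using d s step FixD(1)[of d]
      by (subst avg_add) (auto simp: avg_mult mult.commute[of d] subfld_mult[OF subfld_\<Phi>])
    moreover have "d * s + x \<in> \<Phi>"
      using d s step FixD(1)[of d] by (intro subfld_add[OF subfld_\<Phi>] subfld_mult[OF subfld_\<Phi>]) auto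
    ultimately show ?case
      using d s step by (simp add: G_def subfld_add subfld_mult)
  qed
  have "Fix ?M \<subseteq> G"
  proof
    fix x assume x: "x \<in> Fix ?M"
    obtain p q where pq: "p \<in> pf k I" "q \<in> pf k I" "q v \<noteq> 0" "x = p v / q v"
      using fgenE[OF k(1) FixD(1)[OF x]] .
    obtain p' q' where p'q': "p' \<in> Fix ?R" "q' \<in> Fix ?R" "q' \<noteq> 0" "x = p' / q'"
      using Fix_fraction[of ?R x "p v" "q v"] R\<Phi> R_mult R_H pq FixD(2)[OF x] by blast
    have "a \<in> G" if a: "a \<in> Fix ?R" for a
    proof -
      obtain p where p: "p \<in> pf k I" "a = p v" using FixD(1)[OF a] by blast
      have "1 * p v \<in> fspan F' B" using pv[OF p(1)] B(2) unfolding stab_def by blast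
      then show ?thesis using span[of "p v"] avg_fixed[OF a] p by simp
    qed
    then show "x \<in> G" using p'q' by (simp add: subfld_divide G_def)
  qed
  moreover have "G \<subseteq> Fix ?M"
    unfolding G_def by (rule fgen_least[OF subF]) (use kM D BM avg_Fix[OF stM] in auto)
  moreover obtain xs where "set xs = D \<union> avg ` B"
    using finite_list[of "D \<union> avg ` B"] D(1) B(1) by auto
  ultimately show ?thesis unfolding G_def by (intro exI[of _ xs]) auto
qed

end

section \<open>Norm tori and their torsors\<close>

lemma gen_reindex:
  assumes g: "gen F J x" and h: "inj_on h I" "h ` I \<subseteq> J"
  shows "gen F I (\<lambda>i. x (h i))"
  unfolding gen_def
proof (intro ballI impI allI)
  fix p e assume p: "p \<in> pf F I" "p (\<lambda>i. x (h i)) = 0"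
  have "(\<lambda>e. p (\<lambda>i. e (h i))) \<in> pf F J"
    by (rule pf_compose[OF p(1)]) (use h in \<open>auto intro: pf.proj\<close>)
  from gen_zero[OF g this p(2), of "\<lambda>j. e (the_inv_into I h j)"]
  have "p (\<lambda>i. e (the_inv_into I h (h i))) = 0" .
  moreover have "p (\<lambda>i. e (the_inv_into I h (h i))) = p e"
    by (rule pf_cong[OF p(1)]) (simp add: the_inv_into_f_f[OF h(1)])
  ultimately show "p e = 0" by simp
qed

lemma ex_pmap:
  assumes F: "subfld F" and p: "\<And>i. i < n \<Longrightarrow> p i \<in> pf F I"
  obtains fs where "set fs \<subseteq> polys_over F"
    "\<And>xs. pmap fs xs = map (\<lambda>i. p i (nth_default 0 xs)) [0..<n]"
proof -
  have "\<forall>i. \<exists>f. i < n \<longrightarrow> f \<in> polys_over F \<and> (\<forall>e. insertion e f = p i e)"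
    using pf_imp_mpoly[OF F p] by blast
  then obtain f where f: "\<And>i. i < n \<Longrightarrow> f i \<in> polys_over F \<and> (\<forall>e. insertion e (f i) = p i e)"
    by metis
  show ?thesis
    by (rule that[of "map f [0..<n]"]) (use f in \<open>auto simp: pmap_def peval_def\<close>)
qed

lemma polys_over_mono: "F \<subseteq> E \<Longrightarrow> polys_over F \<subseteq> polys_over E"
  by (auto simp: polys_over_def)

text \<open>On the hypersurface \<open>x\<^sub>0 \<cdots> x\<^sub>q\<^sub>-\<^sub>1 = a\<close> the coordinate \<open>x\<^sub>0\<close> is a Laurent monomial in the others.\<close>

lemma hypersurface_pf:
  fixes q :: nat and E :: "'w::field set"
  assumes E: "subfld E" and a: "a \<in> E" and p: "p \<in> pf E {..<q}" and q: "q > 0"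
  shows "\<exists>D p'. p' \<in> pf E {1..<q} \<and>
    (\<forall>e. (\<Prod>i<q. e i) = a \<longrightarrow> p e * (\<Prod>i=1..<q. e i) ^ D = p' e)"
  using p
proof induction
  case (const c)
  then show ?case by (intro exI[of _ 0] exI[of _ "\<lambda>_. c"]) (auto intro: pf.const)
next
  case (proj i)
  show ?case
  proof (cases "i = 0")
    case True
    have "(\<Prod>i<q. e i) = e 0 * (\<Prod>i=1..<q. e i)" for e :: "nat \<Rightarrow> 'w"
      using q by (simp add: lessThan_atLeast0 prod.atLeast_Suc_lessThan)
    then show ?thesis using True a
      by (intro exI[of _ 1] exI[of _ "\<lambda>_. a"]) (auto intro: pf.const)
  next
    case False
    then show ?thesis using proj
      by (intro exI[of _ 0] exI[of _ "\<lambda>e. e i"]) (auto intro: pf.proj)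
  qed
next
  case (add p r)
  then obtain D p' D' r' where h: "p' \<in> pf E {1..<q}" "r' \<in> pf E {1..<q}"
    "\<forall>e. (\<Prod>i<q. e i) = a \<longrightarrow> p e * (\<Prod>i=1..<q. e i) ^ D = p' e"
    "\<forall>e. (\<Prod>i<q. e i) = a \<longrightarrow> r e * (\<Prod>i=1..<q. e i) ^ D' = r' e" by blast
  have P: "(\<lambda>e. (\<Prod>i=1..<q. e i) ^ n) \<in> pf E {1..<q}" for n
    by (intro pf_power[OF E] pf_prod[OF E] pf.proj)
  show ?case
  proof (intro exI conjI allI impI)
    show "(\<lambda>e. p' e * (\<Prod>i=1..<q. e i) ^ D' + r' e * (\<Prod>i=1..<q. e i) ^ D) \<in> pf E {1..<q}"
      by (intro pf.add pf.mult P h)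
    fix e assume e: "(\<Prod>i<q. e i) = a"
    show "(p e + r e) * (\<Prod>i=1..<q. e i) ^ (D + D') =
      p' e * (\<Prod>i=1..<q. e i) ^ D' + r' e * (\<Prod>i=1..<q. e i) ^ D"
      using h(3)[rule_format, OF e, symmetric] h(4)[rule_format, OF e, symmetric]
      by (simp add: power_add algebra_simps)
  qed
next
  case (mult p r)
  then obtain D p' D' r' where h: "p' \<in> pf E {1..<q}" "r' \<in> pf E {1..<q}"
    "\<forall>e. (\<Prod>i<q. e i) = a \<longrightarrow> p e * (\<Prod>i=1..<q. e i) ^ D = p' e"
    "\<forall>e. (\<Prod>i<q. e i) = a \<longrightarrow> r e * (\<Prod>i=1..<q. e i) ^ D' = r' e" by blast
  show ?case
  proof (intro exI conjI allI impI)
    show "(\<lambda>e. p' e * r' e) \<in> pf E {1..<q}" by (intro pf.mult h)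
    fix e assume e: "(\<Prod>i<q. e i) = a"
    show "p e * r e * (\<Prod>i=1..<q. e i) ^ (D + D') = p' e * r' e"
      using h(3)[rule_format, OF e, symmetric] h(4)[rule_format, OF e, symmetric]
      by (simp add: power_add algebra_simps)
  qed
qed

text \<open>A form over \<open>K\<close> of the split algebra of rank \<open>q\<close>, given by the coordinate change \<open>C\<close> over the
  algebraic closure, and a generic element \<open>z\<close> of norm \<open>a\<close>.\<close>

locale norm_torsor =
  fixes K :: "'w::field_char_0 set" and q :: nat and C C' :: "nat \<Rightarrow> nat \<Rightarrow> 'w"
    and a :: 'w and z :: "nat \<Rightarrow> 'w" and zz yy :: "(nat \<Rightarrow> 'w) \<Rightarrow> nat \<Rightarrow> 'w"
  defines "zz \<equiv> \<lambda>e s. \<Sum>m<q. C' s m * e m" and "yy \<equiv> \<lambda>w i. \<Sum>s<q. C i s * w s"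
  assumes K: "subfld K" and q: "q > 0"
    and C_alg: "i < q \<Longrightarrow> s < q \<Longrightarrow> C i s \<in> alg_cl K"
    and C'_alg: "s < q \<Longrightarrow> i < q \<Longrightarrow> C' s i \<in> alg_cl K"
    and CC': "i < q \<Longrightarrow> j < q \<Longrightarrow> (\<Sum>s<q. C i s * C' s j) = of_bool (i = j)"
    and C'C: "s < q \<Longrightarrow> t < q \<Longrightarrow> (\<Sum>i<q. C' s i * C i t) = of_bool (s = t)"
    and a: "a \<in> K" "a \<noteq> 0" and z: "(\<Prod>s<q. z s) = a" "gen (alg_cl K) {1..<q} z"
    and norm_K: "(\<lambda>e. \<Prod>s<q. zz e s) \<in> pf K {..<q}"
    and mult_K: "i < q \<Longrightarrow> (\<lambda>e. yy (\<lambda>s. zz e s * zz (\<lambda>m. e (q + m)) s) i) \<in> pf K {..<2 * q}"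
    and adj_K: "i < q \<Longrightarrow> (\<lambda>e. yy (\<lambda>s. \<Prod>t\<in>{..<q} - {s}. zz e t) i) \<in> pf K {..<q}"
    and one_K: "i < q \<Longrightarrow> yy (\<lambda>_. 1) i \<in> K"
begin

abbreviation "E \<equiv> alg_cl K"

lemma subfld_E: "subfld E" and K_E: "K \<subseteq> E" and alg_cl_E: "alg_cl E = E"
  using subfld_alg_cl[OF K] alg_cl_superset[OF K] alg_cl_alg_cl[OF K] by auto

lemma zz_yy: "s < q \<Longrightarrow> zz (yy w) s = w s"
proof -
  assume s: "s < q"
  have "zz (yy w) s = (\<Sum>i<q. \<Sum>t<q. C' s i * C i t * w t)"
    by (simp add: zz_def yy_def sum_distrib_left mult.assoc)
  also have "\<dots> = (\<Sum>t<q. (\<Sum>i<q. C' s i * C i t) * w t)"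
    by (subst sum.swap) (simp add: sum_distrib_right)
  also have "\<dots> = (\<Sum>t<q. of_bool (s = t) * w t)"
    by (intro sum.cong) (use s C'C in auto)
  also have "\<dots> = w s" using s by simp
  finally show ?thesis .
qed

lemma yy_zz: "i < q \<Longrightarrow> yy (zz e) i = e i"
proof -
  assume i: "i < q"
  have "yy (zz e) i = (\<Sum>s<q. \<Sum>j<q. C i s * C' s j * e j)"
    by (simp add: zz_def yy_def sum_distrib_left mult.assoc)
  also have "\<dots> = (\<Sum>j<q. (\<Sum>s<q. C i s * C' s j) * e j)"
    by (subst sum.swap) (simp add: sum_distrib_right)
  also have "\<dots> = (\<Sum>j<q. of_bool (i = j) * e j)"
    by (intro sum.cong) (use i CC' in auto)
  also have "\<dots> = e i" using i by simp
  finally show ?thesis .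
qed

lemma yy_cong: "(\<And>s. s < q \<Longrightarrow> w s = w' s) \<Longrightarrow> yy w = yy w'"
  by (auto simp: yy_def fun_eq_iff intro!: sum.cong)

lemma zz_cong: "(\<And>i. i < q \<Longrightarrow> e i = e' i) \<Longrightarrow> zz e = zz e'"
  by (auto simp: zz_def fun_eq_iff intro!: sum.cong)

section \<open>Level sets of the norm\<close>

definition pt :: "(nat \<Rightarrow> 'w) \<Rightarrow> 'w list" where
  "pt w = map (yy w) [0..<q]"

definition on :: "'w \<Rightarrow> (nat \<Rightarrow> 'w) \<Rightarrow> bool" where
  "on c w \<longleftrightarrow> (\<forall>s<q. w s \<in> E) \<and> (\<Prod>s<q. w s) = c"

text \<open>\<open>fib 1\<close> will be the torus and \<open>fib a\<close> the torsor. Points are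
  parametrised by split components \<open>w\<close>, where multiplication is componentwise, while
  \<open>pt\<close> lists the coordinates in which everything is defined over \<open>K\<close>;
  \<open>zz\<close> and \<open>yy\<close> pass between the two.\<close>

definition fib :: "'w \<Rightarrow> 'w list set" where
  "fib c = {pt w | w. on c w}"

lemma length_pt [simp]: "length (pt w) = q"
  by (simp add: pt_def)

lemma pt_eqI: "(\<And>s. s < q \<Longrightarrow> w s = w' s) \<Longrightarrow> pt w = pt w'"
  unfolding pt_def using yy_cong by metis

lemma nth_pt: "i < q \<Longrightarrow> pt w ! i = yy w i"
  by (simp add: pt_def)

lemma env_pt: "i < q \<Longrightarrow> nth_default 0 (pt w) i = yy w i"
  unfolding pt_def by (simp add: nth_default_def)

lemma zz_pt: "s < q \<Longrightarrow> zz (nth_default 0 (pt w)) s = w s"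
  using zz_cong[of "nth_default 0 (pt w)" "yy w"] env_pt zz_yy by auto

lemma env_append: "i < q \<Longrightarrow> nth_default 0 (pt w @ xs) i = yy w i"
  "nth_default 0 (pt w @ xs) (q + i) = nth_default 0 xs i"
  by (simp_all add: nth_default_append nth_pt)

lemma zz_append: "s < q \<Longrightarrow> zz (nth_default 0 (pt w @ xs)) s = w s"
  "zz (\<lambda>m. nth_default 0 (pt w @ xs) (q + m)) = zz (nth_default 0 xs)"
  using zz_cong[of "nth_default 0 (pt w @ xs)" "yy w"] env_append zz_yy by auto

lemma yy_E: "(\<And>s. s < q \<Longrightarrow> w s \<in> E) \<Longrightarrow> i < q \<Longrightarrow> yy w i \<in> E"
  unfolding yy_def by (intro subfld_sum[OF subfld_E] subfld_mult[OF subfld_E] C_alg) auto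

lemma zz_E: "(\<And>i. i < q \<Longrightarrow> e i \<in> E) \<Longrightarrow> s < q \<Longrightarrow> zz e s \<in> E"
  unfolding zz_def by (intro subfld_sum[OF subfld_E] subfld_mult[OF subfld_E] C'_alg) auto

lemma on_fib: "on c w \<Longrightarrow> pt w \<in> fib c"
  unfolding fib_def by blast

lemma fib_eq: "fib c = {xs \<in> affine_space E q. (\<Prod>s<q. zz (nth_default 0 xs) s) = c}"
proof (intro equalityI subsetI)
  fix xs assume "xs \<in> fib c"
  then obtain w where w: "xs = pt w" "on c w" unfolding fib_def by blast
  then show "xs \<in> {xs \<in> affine_space E q. (\<Prod>s<q. zz (nth_default 0 xs) s) = c}"
  proof -
    have "(\<Prod>s<q. zz (nth_default 0 (pt w)) s) = (\<Prod>s<q. w s)" by (intro prod.cong) (simp_all add: zz_pt)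
    moreover have "pt w \<in> affine_space E q"
      using yy_E[of w] w(2) by (auto simp: on_def affine_space_def) (auto simp: pt_def)
    ultimately show ?thesis using w by (simp add: on_def)
  qed
next
  fix xs assume xs: "xs \<in> {xs \<in> affine_space E q. (\<Prod>s<q. zz (nth_default 0 xs) s) = c}"
  let ?w = "zz (nth_default 0 xs)"
  have l: "length xs = q" and xE: "set xs \<subseteq> E" using xs by (auto simp: affine_space_def)
  have "pt ?w = map (nth_default 0 xs) [0..<q]" by (simp add: pt_def yy_zz)
  then have "xs = pt ?w" using map_nth_default[OF l] by simp
  moreover have "on c ?w"
    unfolding on_def using xs xE l by (auto intro!: zz_E simp: nth_default_def)
  ultimately show "xs \<in> fib c" unfolding fib_def by blast
qed

lemma closed_fib:
  assumes "c \<in> K"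
  shows "closed_over K q (fib c)"
proof -
  have "(\<lambda>e. (\<Prod>s<q. zz e s) - c) \<in> pf K {..<q}"
    using assms by (intro pf_diff[OF K] norm_K pf.const)
  then obtain f where f: "f \<in> polys_over K" "\<And>e. insertion e f = (\<Prod>s<q. zz e s) - c"
    using pf_imp_mpoly[OF K] by blast
  show ?thesis
    unfolding closed_over_def fib_eq
    by (rule exI[of _ "{f}"]) (use f in \<open>auto simp: peval_def\<close>)
qed

lemma on_mult: "on c w \<Longrightarrow> on c' w' \<Longrightarrow> on (c * c') (\<lambda>s. w s * w' s)"
  by (auto simp: on_def prod.distrib subfld_mult[OF subfld_E])

text \<open>The product of the other components is a polynomial substitute for inversion: it is the
  inverse on norm one, and \<open>inverse a * cof w s\<close> is the inverse of \<open>w s\<close>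
  on norm \<open>a\<close>.\<close>

definition cof :: "(nat \<Rightarrow> 'w) \<Rightarrow> nat \<Rightarrow> 'w" where
  "cof w s = (\<Prod>t\<in>{..<q} - {s}. w t)"

lemma cof: "on c w \<Longrightarrow> s < q \<Longrightarrow> w s * cof w s = c" "on c w \<Longrightarrow> s < q \<Longrightarrow> cof w s * w s = c"
  by (simp_all add: on_def cof_def prod.remove[of "{..<q}" s] mult.commute)

lemma on_nonzero: "on c w \<Longrightarrow> c \<noteq> 0 \<Longrightarrow> s < q \<Longrightarrow> w s \<noteq> 0"
  using cof(1)[of c w s] by auto

lemma cof_inverse: "on 1 w \<Longrightarrow> s < q \<Longrightarrow> cof w s = inverse (w s)"
  using cof(1)[of 1 w s] by (simp add: inverse_unique)

lemma on_cof: "on 1 w \<Longrightarrow> on 1 (cof w)"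
  unfolding on_def
proof (intro conjI allI impI)
  assume w: "(\<forall>s<q. w s \<in> E) \<and> (\<Prod>s<q. w s) = 1"
  then have o: "on 1 w" by (simp add: on_def)
  show "cof w s \<in> E" if "s < q" for s
    using w cof_inverse[OF o that] that by (simp add: subfld_inverse[OF subfld_E])
  have "(\<Prod>s<q. cof w s) = (\<Prod>s<q. inverse (w s))"
    by (intro prod.cong) (simp_all add: cof_inverse[OF o])
  then show "(\<Prod>s<q. cof w s) = 1" using w prod_inversef[of w "{..<q}"] by (simp add: comp_def)
qed

lemma mult_map:
  obtains \<mu> where "set \<mu> \<subseteq> polys_over K" "\<And>w w'. pmap \<mu> (pt w @ pt w') = pt (\<lambda>s. w s * w' s)"
proof -
  obtain \<mu> where \<mu>: "set \<mu> \<subseteq> polys_over K"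
    "\<And>xs. pmap \<mu> xs = map (\<lambda>i. yy (\<lambda>s. zz (nth_default 0 xs) s * zz (\<lambda>m. nth_default 0 xs (q + m)) s) i) [0..<q]"
    by (rule ex_pmap[OF K, of q "\<lambda>i e. yy (\<lambda>s. zz e s * zz (\<lambda>m. e (q + m)) s) i" "{..<2 * q}"])
      (use mult_K in blast)+
  have "pmap \<mu> (pt w @ pt w') = pt (\<lambda>s. w s * w' s)" for w w'
    unfolding \<mu>(2) pt_def[symmetric] by (rule pt_eqI) (simp add: zz_append zz_pt)
  then show ?thesis using that \<mu>(1) by blast
qed

lemma cof_map:
  obtains \<iota> where "set \<iota> \<subseteq> polys_over K" "\<And>w. pmap \<iota> (pt w) = pt (cof w)"
proof -
  obtain \<iota> where \<iota>: "set \<iota> \<subseteq> polys_over K"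
    "\<And>xs. pmap \<iota> xs = map (\<lambda>i. yy (\<lambda>s. \<Prod>t\<in>{..<q} - {s}. zz (nth_default 0 xs) t) i) [0..<q]"
    by (rule ex_pmap[OF K, of q "\<lambda>i e. yy (\<lambda>s. \<Prod>t\<in>{..<q} - {s}. zz e t) i" "{..<q}"])
      (use adj_K in blast)+
  have "pmap \<iota> (pt w) = pt (cof w)" for w
    unfolding \<iota>(2) pt_def[symmetric] by (rule pt_eqI) (simp add: zz_pt cof_def)
  then show ?thesis using that \<iota>(1) by blast
qed

text \<open>The torsor difference \<open>w' / w\<close>, written with \<open>cof\<close> to be
  polynomial: the multiplication is composed with the adjugate on the first \<open>q\<close>
  variables and the identity on the others, which keeps the coefficients in
  \<open>K\<close>.\<close>

lemma quot_map:
  obtains \<delta> where "set \<delta> \<subseteq> polys_over K"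
    "\<And>w w'. pmap \<delta> (pt w @ pt w') = pt (\<lambda>s. inverse a * (cof w s * w' s))"
proof -
  let ?adj = "\<lambda>i e. yy (\<lambda>s. \<Prod>t\<in>{..<q} - {s}. zz e t) i"
  let ?mul = "\<lambda>i e. yy (\<lambda>s. zz e s * zz (\<lambda>m. e (q + m)) s) i"
  let ?arg = "\<lambda>j. if j < q then ?adj j else (\<lambda>e. e j)"
  let ?p = "\<lambda>i e. inverse a * ?mul i (\<lambda>j. ?arg j e)"
  have p_K: "?p i \<in> pf K {..<2 * q}" if "i < q" for i
  proof (intro pf.mult pf.const subfld_inverse[OF K] a pf_compose[OF mult_K[OF that]])
    fix j assume "j \<in> {..<2 * q}"
    then show "?arg j \<in> pf K {..<2 * q}"
      using pf_mono[OF adj_K[of j], of K "{..<2 * q}"] by (auto intro: pf.proj)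
  qed
  obtain \<delta> where \<delta>: "set \<delta> \<subseteq> polys_over K"
    "\<And>xs. pmap \<delta> xs = map (\<lambda>i. ?p i (nth_default 0 xs)) [0..<q]"
    by (rule ex_pmap[OF K, of q ?p "{..<2 * q}"]) (erule p_K, blast)
  have "pmap \<delta> (pt w @ pt w') = pt (\<lambda>s. inverse a * (cof w s * w' s))" for w w'
  proof -
    let ?e = "nth_default 0 (pt w @ pt w')"
    have 1: "?arg j ?e = yy (cof w) j" if "j < q" for j
      using that by (simp, intro fun_cong[OF yy_cong]) (auto simp: cof_def zz_append intro!: prod.cong)
    have 2: "zz (\<lambda>j. ?arg j ?e) s = cof w s" if "s < q" for s
      using zz_cong[of "\<lambda>j. ?arg j ?e" "yy (cof w)"] 1 zz_yy[OF that] by simp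
    have 3: "zz (\<lambda>m. ?arg (q + m) ?e) s = w' s" if "s < q" for s
      using that by (simp add: zz_append zz_pt)
    have "?mul i (\<lambda>j. ?arg j ?e) = yy (\<lambda>s. cof w s * w' s) i" for i
      by (rule fun_cong[OF yy_cong]) (simp only: 2 3)
    then have "?p i ?e = yy (\<lambda>s. inverse a * (cof w s * w' s)) i" for i
      by (simp add: yy_def sum_distrib_left mult_ac)
    then show ?thesis unfolding \<delta>(2) pt_def by simp
  qed
  then show ?thesis using that \<delta>(1) by blast
qed

text \<open>Dropping component \<open>0\<close>, which the norm one condition recovers, identifies
  the torus over \<open>E\<close> with the split torus of rank \<open>q - 1\<close>.\<close>

lemma torus_maps:
  obtains \<phi> \<psi> where "morphism_over E (fib 1) (split_torus E (q - 1)) \<phi>"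
    "morphism_over E (split_torus E (q - 1)) (fib 1) \<psi>"
    "\<And>t. t \<in> fib 1 \<Longrightarrow> pmap \<psi> (pmap \<phi> t) = t"
    "\<And>u. u \<in> split_torus E (q - 1) \<Longrightarrow> pmap \<phi> (pmap \<psi> u) = u"
    "\<And>w w'. on 1 w \<Longrightarrow> on 1 w' \<Longrightarrow>
      pmap \<phi> (pt (\<lambda>s. w s * w' s)) = map2 (*) (pmap \<phi> (pt w)) (pmap \<phi> (pt w'))"
proof -
  let ?r = "q - 1"
  let ?p = "\<lambda>j e. if j < ?r then zz e (Suc j) else cof (zz e) (Suc (j - ?r))"
  have zzp: "(\<lambda>e. zz e s) \<in> pf E {..<q}" if "s < q" for s
    unfolding zz_def using that C'_alg
    by (intro pf_sum[OF subfld_E] pf.mult pf.const pf.proj) auto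
  have p_E: "?p j \<in> pf E {..<q}" if "j < 2 * ?r" for j
  proof (cases "j < ?r")
    case True
    then show ?thesis by (simp add: zzp)
  next
    case False
    have "(\<lambda>e. \<Prod>t\<in>{..<q} - {Suc (j - ?r)}. zz e t) \<in> pf E {..<q}"
      by (intro pf_prod[OF subfld_E] zzp) auto
    then show ?thesis using False by (simp add: cof_def)
  qed
  obtain \<phi> where \<phi>: "set \<phi> \<subseteq> polys_over E"
    "\<And>xs. pmap \<phi> xs = map (\<lambda>i. ?p i (nth_default 0 xs)) [0..<2 * ?r]"
    by (rule ex_pmap[OF subfld_E, of "2 * ?r" ?p "{..<q}"]) (erule p_E, blast)
  have \<phi>_pt: "pmap \<phi> (pt w) = map (\<lambda>j. w (Suc j)) [0..<?r] @ map inverse (map (\<lambda>j. w (Suc j)) [0..<?r])"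
    if w: "on 1 w" for w
  proof (rule nth_equalityI)
    fix i assume i: "i < length (pmap \<phi> (pt w))"
    have "cof (zz (nth_default 0 (pt w))) s = inverse (w s)" if "s < q" for s
      using cof_inverse[OF w that] by (auto simp: cof_def zz_pt intro!: prod.cong)
    then show "pmap \<phi> (pt w) ! i = (map (\<lambda>j. w (Suc j)) [0..<?r] @ map inverse (map (\<lambda>j. w (Suc j)) [0..<?r])) ! i"
      using i by (auto simp: \<phi>(2) nth_append zz_pt)
  qed (simp add: \<phi>(2))
  \<comment> \<open>Component \<open>0\<close> is the inverse of the product of the others; since
    the second half of a point of the split torus lists the inverses, this is a polynomial.\<close>
  let ?w = "\<lambda>e s. if s = 0 then \<Prod>j<?r. e (?r + j) else e (s - 1)"
  have w_E: "(\<lambda>e. yy (?w e) i) \<in> pf E {..<2 * ?r}" if "i < q" for i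
    unfolding yy_def
  proof (intro pf_sum[OF subfld_E] pf.mult pf.const)
    fix s assume s: "s \<in> {..<q}"
    then show "C i s \<in> E" using C_alg that by simp
    show "(\<lambda>e. ?w e s) \<in> pf E {..<2 * ?r}"
    proof (cases "s = 0")
      case True
      have "(\<lambda>e. \<Prod>j<?r. e (?r + j)) \<in> pf E {..<2 * ?r}"
        by (intro pf_prod[OF subfld_E] pf.proj) auto
      then show ?thesis using True by simp
    next
      case False
      then have "s - 1 \<in> {..<2 * ?r}" using s by auto
      then show ?thesis using False pf.proj[of "s - 1" "{..<2 * ?r}" E] by simp
    qed
  qed
  obtain \<psi> where \<psi>: "set \<psi> \<subseteq> polys_over E"
    "\<And>xs. pmap \<psi> xs = map (\<lambda>i. yy (?w (nth_default 0 xs)) i) [0..<q]"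
    by (rule ex_pmap[OF subfld_E, of q "\<lambda>i e. yy (?w e) i" "{..<2 * ?r}"]) (erule w_E, blast)
  have \<psi>_pt: "pmap \<psi> (us @ map inverse us) = pt (\<lambda>s. if s = 0 then inverse (prod_list us) else us ! (s - 1))"
    if "length us = ?r" for us
  proof -
    have "nth_default 0 (us @ map inverse us) (?r + j) = inverse (us ! j)" if "j < ?r" for j
      unfolding nth_default_def using that \<open>length us = ?r\<close> q by (cases q) (simp_all add: nth_append)
    then have "(\<Prod>j<?r. nth_default 0 (us @ map inverse us) (?r + j)) = (\<Prod>j<?r. inverse (us ! j))"
      by (intro prod.cong) auto
    also have "\<dots> = inverse (prod_list us)"
      by (simp add: prod.list_conv_set_nth that lessThan_atLeast0 prod_inversef[unfolded comp_def])
    finally have P: "(\<Prod>j<?r. nth_default 0 (us @ map inverse us) (?r + j)) = inverse (prod_list us)" .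
    show ?thesis
      unfolding \<psi>(2) pt_def[symmetric]
    proof (rule pt_eqI)
      fix s assume s: "s < q"
      show "?w (nth_default 0 (us @ map inverse us)) s = (if s = 0 then inverse (prod_list us) else us ! (s - 1))"
      proof (cases "s = 0")
        case True
        then show ?thesis using P by (simp only: if_True simp_thms)
      next
        case False
        then have "s - 1 < length us" using s that by simp
        then show ?thesis using False by (simp add: nth_default_append)
      qed
    qed
  qed
  have prod_q: "(\<Prod>s<q. w s) = w 0 * (\<Prod>j<?r. w (Suc j))" for w :: "nat \<Rightarrow> 'w"
    using q prod.lessThan_Suc_shift[of w ?r] by simp
  have on_us: "on 1 (\<lambda>s. if s = 0 then inverse (prod_list us) else us ! (s - 1))"
    if us: "length us = ?r" "set us \<subseteq> E - {0}" for us
  proof -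
    have nz: "prod_list us \<noteq> 0" using us(2) by (auto simp: prod_list_zero_iff)
    have "prod_list us = (\<Prod>j<?r. us ! j)"
      by (simp add: prod.list_conv_set_nth us lessThan_atLeast0)
    moreover have "us ! j \<in> E" if "j < ?r" for j using us that by (metis Diff_iff nth_mem subsetD)
    ultimately show ?thesis
      unfolding on_def prod_q using nz
      by (auto intro!: subfld_inverse[OF subfld_E] subfld_prod[OF subfld_E])
  qed
  have m1: "pmap \<phi> t \<in> split_torus E ?r" if "t \<in> fib 1" for t
  proof -
    obtain w where w: "t = pt w" "on 1 w" using \<open>t \<in> fib 1\<close> unfolding fib_def by blast
    show ?thesis
      unfolding w(1) \<phi>_pt[OF w(2)] split_torus_def
      using w(2) on_nonzero[OF w(2)]
      by (intro CollectI exI[of _ "map (\<lambda>j. w (Suc j)) [0..<?r]"]) (auto simp: on_def)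
  qed
  have m2: "pmap \<psi> u \<in> fib 1" if "u \<in> split_torus E ?r" for u
    using that on_fib[OF on_us] by (auto simp: split_torus_def \<psi>_pt)
  have i1: "pmap \<psi> (pmap \<phi> t) = t" if "t \<in> fib 1" for t
  proof -
    obtain w where w: "t = pt w" "on 1 w" using \<open>t \<in> fib 1\<close> unfolding fib_def by blast
    have "w 0 * (\<Prod>j<?r. w (Suc j)) = 1" using w(2) unfolding on_def prod_q by blast
    then have "inverse (\<Prod>j<?r. w (Suc j)) = w 0" by (intro inverse_unique) (simp add: mult.commute)
    then show ?thesis
      unfolding w(1) \<phi>_pt[OF w(2)]
      by (subst \<psi>_pt) (auto intro!: pt_eqI simp: prod.list_conv_set_nth lessThan_atLeast0)
  qed
  have i2: "pmap \<phi> (pmap \<psi> u) = u" if "u \<in> split_torus E ?r" for u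
  proof -
    obtain us where us: "u = us @ map inverse us" "length us = ?r" "set us \<subseteq> E - {0}"
      using \<open>u \<in> split_torus E ?r\<close> unfolding split_torus_def by blast
    have "map (\<lambda>j. us ! j) [0..<?r] = us" using us(2) by (metis map_nth)
    then show ?thesis
      unfolding us(1) \<psi>_pt[OF us(2)] \<phi>_pt[OF on_us[OF us(2,3)]] by simp
  qed
  have m: "pmap \<phi> (pt (\<lambda>s. w s * w' s)) = map2 (*) (pmap \<phi> (pt w)) (pmap \<phi> (pt w'))"
    if w: "on 1 w" "on 1 w'" for w w'
  proof -
    have o: "on 1 (\<lambda>s. w s * w' s)" using on_mult[OF w] by simp
    show ?thesis
      unfolding \<phi>_pt[OF w(1)] \<phi>_pt[OF w(2)] \<phi>_pt[OF o]
      by (rule nth_equalityI) (auto simp: nth_append)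
  qed
  show ?thesis
    by (rule that[of \<phi> \<psi>]) (use \<phi>(1) \<psi>(1) m1 m2 i1 i2 m in \<open>auto simp: morphism_over_def\<close>)
qed

definition gpt :: "'w list" where
  "gpt = pt z"

text \<open>In split components and after multiplication by a power of the free ones,
  \<open>f\<close> becomes a polynomial in the components \<open>1\<close> to \<open>q - 1\<close>,
  where \<open>z\<close> is generic. Allowing any \<open>F\<close> inside \<open>E\<close> yields
  the function field over \<open>K\<close> as well as that of the geometric fibre.\<close>

lemma generic:
  assumes F: "F \<subseteq> E"
  shows "generic_point F q (fib a) gpt"
  unfolding generic_point_def
proof (intro conjI ballI)
  show "length gpt = q" by (simp add: gpt_def)
  fix f assume f: "f \<in> polys_over F"
  then have "f \<in> polys_over E" using polys_over_mono[OF F] by blast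
  from peval_pf[OF subfld_E this]
  have "(\<lambda>w. peval f (map (\<lambda>i. (\<lambda>w. yy w i) w) [0..<q])) \<in> pf E {..<q}"
    by (rule pf_compose) (auto simp: yy_def intro!: pf_sum[OF subfld_E] pf.intros C_alg)
  then have p: "(\<lambda>w. peval f (pt w)) \<in> pf E {..<q}" by (simp add: pt_def)
  have aE: "a \<in> E" using a K_E by blast
  obtain D p' where p': "p' \<in> pf E {1..<q}"
    "\<And>e. (\<Prod>i<q. e i) = a \<Longrightarrow> peval f (pt e) * (\<Prod>i=1..<q. e i) ^ D = p' e"
    using hypersurface_pf[OF subfld_E aE p q] by blast
  have prod_q: "(\<Prod>i<q. e i) = e 0 * (\<Prod>i=1..<q. e i)" for e :: "nat \<Rightarrow> 'w"
    using q by (simp add: lessThan_atLeast0 prod.atLeast_Suc_lessThan)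
  have nz: "(\<Prod>i=1..<q. e i) ^ D \<noteq> 0" if "(\<Prod>i<q. e i) = a" for e :: "nat \<Rightarrow> 'w"
  proof -
    have "(\<Prod>i=1..<q. e i) \<noteq> 0" using that a(2) unfolding prod_q by (metis mult_zero_right)
    then show ?thesis by simp
  qed
  show "peval f gpt = 0 \<longleftrightarrow> (\<forall>y\<in>fib a. peval f y = 0)"
  proof
    assume "peval f gpt = 0"
    then have "p' z = 0" using p'(2)[OF z(1)] by (simp add: gpt_def)
    then have zero: "p' e = 0" for e using gen_zero[OF z(2) p'(1)] by blast
    show "\<forall>y\<in>fib a. peval f y = 0"
    proof
      fix y assume "y \<in> fib a"
      then obtain w where w: "y = pt w" "on a w" unfolding fib_def by blast
      then have "(\<Prod>i<q. w i) = a" by (simp add: on_def)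
      then have "peval f (pt w) * (\<Prod>i=1..<q. w i) ^ D = 0" "(\<Prod>i=1..<q. w i) ^ D \<noteq> 0"
        using p'(2)[of w] nz[of w] zero by simp_all
      then show "peval f y = 0" unfolding w(1) mult_eq_0_iff by blast
    qed
  next
    assume v: "\<forall>y\<in>fib a. peval f y = 0"
    have "p' e = 0" for e
    proof (rule pf_zero[OF _ p'(1)])
      show "infinite (E - {0})" using infinite_subfld[OF subfld_E] by simp
      fix e :: "nat \<Rightarrow> 'w" assume e: "\<And>i. i \<in> {1..<q} \<Longrightarrow> e i \<in> E - {0}"
      let ?P = "\<Prod>i=1..<q. e i"
      \<comment> \<open>Nonzero values of the free components extend to a point of norm
        \<open>a\<close>; this is why the test points are taken in \<open>E - {0}\<close>.\<close>
      let ?e = "e(0 := a / ?P)"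
      have P: "?P \<noteq> 0" "?P \<in> E" using e by (auto intro!: subfld_prod[OF subfld_E])
      have "(\<Prod>i=1..<q. ?e i) = ?P" by (intro prod.cong) auto
      then have pa: "(\<Prod>i<q. ?e i) = a" using P unfolding prod_q by simp
      then have "on a ?e"
        unfolding on_def using e P(2) aE by (auto intro!: subfld_divide[OF subfld_E])
      then have "peval f (pt ?e) = 0" using v on_fib by blast
      then have "p' ?e = 0" using p'(2)[OF pa] by (simp only: mult_zero_left)
      moreover have "p' ?e = p' e" by (rule pf_cong[OF p'(1)]) auto
      ultimately show "p' e = 0" by simp
    qed simp
    then have "peval f gpt * (\<Prod>i=1..<q. z i) ^ D = 0" using p'(2)[OF z(1)] by (simp add: gpt_def)
    then show "peval f gpt = 0" using nz[OF z(1)] unfolding mult_eq_0_iff by blast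
  qed
qed

lemma fgen_gpt: "adjoin K gpt = fgen (K \<union> yy z ` {..<q})"
  by (simp add: adjoin_eq_fgen gpt_def pt_def lessThan_atLeast0)

lemma ex_on: "\<exists>w. on a w"
proof -
  have "(\<Prod>s<q. if s = 0 then a else 1) = a" using q by (simp add: prod.delta)
  then show ?thesis
    using a K_E subfld_1[OF subfld_E] by (intro exI[of _ "\<lambda>s. if s = 0 then a else 1"]) (auto simp: on_def)
qed

lemma morphism_fibI:
  "set f \<subseteq> polys_over K \<Longrightarrow> (\<And>w. on c w \<Longrightarrow> pmap f (pt w) \<in> S) \<Longrightarrow> morphism_over K (fib c) S f"
  by (auto simp: morphism_over_def fib_def)

lemma morphism_prod_fibI:
  "set f \<subseteq> polys_over K \<Longrightarrow> (\<And>w w'. on c w \<Longrightarrow> on c' w' \<Longrightarrow> pmap f (pt w @ pt w') \<in> S) \<Longrightarrow>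
    morphism_over K (prod_pts (fib c) (fib c')) S f"
  by (auto simp: morphism_over_def prod_pts_def fib_def)

text \<open>Group law and action are the same polynomials \<open>\<mu>\<close>, restricted to pairs
  of norms \<open>(1, 1)\<close> and \<open>(1, a)\<close>, so every axiom reduces to an identity
  between components.\<close>

lemma toric: "toric_fibre K (fgen (K \<union> yy z ` {..<q}))"
proof -
  obtain \<mu> where \<mu>: "set \<mu> \<subseteq> polys_over K" "\<And>w w'. pmap \<mu> (pt w @ pt w') = pt (\<lambda>s. w s * w' s)"
    by (rule mult_map) blast
  obtain \<iota> where \<iota>: "set \<iota> \<subseteq> polys_over K" "\<And>w. pmap \<iota> (pt w) = pt (cof w)" by (rule cof_map) blast
  obtain \<delta> where \<delta>: "set \<delta> \<subseteq> polys_over K"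
    "\<And>w w'. pmap \<delta> (pt w @ pt w') = pt (\<lambda>s. inverse a * (cof w s * w' s))" by (rule quot_map) blast
  obtain \<phi> \<psi> where \<phi>\<psi>: "morphism_over E (fib 1) (split_torus E (q - 1)) \<phi>"
    "morphism_over E (split_torus E (q - 1)) (fib 1) \<psi>"
    "\<And>t. t \<in> fib 1 \<Longrightarrow> pmap \<psi> (pmap \<phi> t) = t"
    "\<And>u. u \<in> split_torus E (q - 1) \<Longrightarrow> pmap \<phi> (pmap \<psi> u) = u"
    "\<And>w w'. on 1 w \<Longrightarrow> on 1 w' \<Longrightarrow>
      pmap \<phi> (pt (\<lambda>s. w s * w' s)) = map2 (*) (pmap \<phi> (pt w)) (pmap \<phi> (pt w'))"
    by (rule torus_maps) blast
  let ?e = "pt (\<lambda>_. 1)"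
  have fibE: "\<exists>w. x = pt w \<and> on c w" if "x \<in> fib c" for x c using that unfolding fib_def by blast
  have on1: "on 1 (\<lambda>_. 1)" by (simp add: on_def subfld_1[OF subfld_E])
  have mul: "pt (\<lambda>s. w s * w' s) \<in> fib c" if "on 1 w" "on c w'" for w w' c
    using on_fib[OF on_mult[OF that]] by simp
  have grp: "algebraic_group_over K q (fib 1) \<mu> ?e \<iota>"
    unfolding algebraic_group_over_def
  proof (intro conjI ballI)
    show "closed_over K q (fib 1)" by (rule closed_fib[OF subfld_1[OF K]])
    show "morphism_over K (prod_pts (fib 1) (fib 1)) (fib 1) \<mu>"
      by (rule morphism_prod_fibI[OF \<mu>(1)]) (simp only: \<mu>(2) mul)
    show "?e \<in> fib 1" by (rule on_fib[OF on1])
    show "set ?e \<subseteq> K" using one_K by (auto simp: pt_def)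
    show "morphism_over K (fib 1) (fib 1) \<iota>"
      by (rule morphism_fibI[OF \<iota>(1)]) (simp only: \<iota>(2) on_fib[OF on_cof])
  next
    fix s t u assume "s \<in> fib 1" "t \<in> fib 1" "u \<in> fib 1"
    then obtain w w' w'' where w: "s = pt w" "t = pt w'" "u = pt w''" using fibE by meson
    show "pmap \<mu> (pmap \<mu> (s @ t) @ u) = pmap \<mu> (s @ pmap \<mu> (t @ u))"
      unfolding w \<mu>(2) by (simp only: mult.assoc)
  next
    fix t assume "t \<in> fib 1"
    then obtain w where w: "t = pt w" "on 1 w" using fibE by blast
    show "pmap \<mu> (?e @ t) = t" "pmap \<mu> (t @ ?e) = t" unfolding w \<mu>(2) by simp_all
    show "pmap \<mu> (pmap \<iota> t @ t) = ?e" "pmap \<mu> (t @ pmap \<iota> t) = ?e"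
      unfolding w \<mu>(2) \<iota>(2) using cof[OF w(2)] by (auto intro: pt_eqI)
  qed
  have tor: "torus_over K q (fib 1) \<mu> ?e \<iota>"
    unfolding torus_over_def
  proof (rule conjI[OF grp], rule exI[of _ "q - 1"], rule exI[of _ \<phi>], rule exI[of _ \<psi>], intro conjI ballI)
    fix s t assume "s \<in> fib 1" "t \<in> fib 1"
    then obtain w w' where "s = pt w" "on 1 w" "t = pt w'" "on 1 w'" using fibE by meson
    then show "pmap \<phi> (pmap \<mu> (s @ t)) = map2 (*) (pmap \<phi> s) (pmap \<phi> t)"
      using \<mu>(2) \<phi>\<psi>(5) by simp
  qed (fact \<phi>\<psi>(1,2) | rule \<phi>\<psi>(3,4), assumption)+
  have cofa: "inverse a * (cof w s * w s) = 1" "inverse a * (w s * cof w s) = 1" if "on a w" "s < q" for w s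
    using cof[OF that] a by simp_all
  have tsr: "torsor_over K (fib 1) \<mu> ?e q (fib a)"
    unfolding torsor_over_def
  proof (rule conjI[rotated], rule conjI[rotated], rule exI[of _ \<mu>], rule exI[of _ \<delta>], intro conjI ballI)
    show "closed_over K q (fib a)" by (rule closed_fib[OF a(1)])
    show "fib a \<noteq> {}" using ex_on on_fib by blast
    show "morphism_over K (prod_pts (fib 1) (fib a)) (fib a) \<mu>"
      by (rule morphism_prod_fibI[OF \<mu>(1)]) (simp only: \<mu>(2) mul)
  next
    fix x assume "x \<in> fib a"
    then obtain w where w: "x = pt w" "on a w" using fibE by blast
    show "pmap \<mu> (?e @ x) = x" unfolding w \<mu>(2) by simp
  next
    fix s t x assume "s \<in> fib 1" "t \<in> fib 1" "x \<in> fib a"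
    then obtain w w' w'' where w: "s = pt w" "t = pt w'" "x = pt w''" using fibE by meson
    show "pmap \<mu> (pmap \<mu> (s @ t) @ x) = pmap \<mu> (s @ pmap \<mu> (t @ x))"
      unfolding w \<mu>(2) by (simp only: mult.assoc)
  next
    have "pt (\<lambda>s. inverse a * (cof w s * w' s)) \<in> fib 1" if w: "on a w" "on a w'" for w w'
    proof (rule on_fib)
      have eq: "inverse a * (cof w s * w' s) = w' s / w s" if "s < q" for s
        using cofa(1)[OF w(1) that] on_nonzero[OF w(1) a(2) that] by (simp add: field_simps)
      have "(\<Prod>s<q. inverse a * (cof w s * w' s)) = (\<Prod>s<q. w' s / w s)"
        by (intro prod.cong) (simp_all only: eq lessThan_iff)
      also have "\<dots> = 1" using w a by (simp add: prod_dividef on_def)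
      finally show "on 1 (\<lambda>s. inverse a * (cof w s * w' s))"
        using w by (auto simp: on_def eq intro!: subfld_divide[OF subfld_E])
    qed
    then show "morphism_over K (prod_pts (fib a) (fib a)) (fib 1) \<delta>"
      by (intro morphism_prod_fibI[OF \<delta>(1)]) (simp only: \<delta>(2))
  next
    fix x y assume "x \<in> fib a" "y \<in> fib a"
    then obtain w w' where w: "x = pt w" "on a w" "y = pt w'" "on a w'" using fibE by meson
    show "pmap \<mu> (pmap \<delta> (x @ y) @ x) = y"
      unfolding w \<delta>(2) \<mu>(2)
    proof (rule pt_eqI)
      fix s assume "s < q"
      have "inverse a * (cof w s * w' s) * w s = inverse a * (cof w s * w s) * w' s" by simp
      then show "inverse a * (cof w s * w' s) * w s = w' s" using cofa(1)[OF w(2) \<open>s < q\<close>] by simp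
    qed
  next
    fix t x assume "t \<in> fib 1" "x \<in> fib a"
    then obtain w w' where w: "t = pt w" "on 1 w" "x = pt w'" "on a w'" using fibE by meson
    show "pmap \<delta> (x @ pmap \<mu> (t @ x)) = t"
      unfolding w \<delta>(2) \<mu>(2)
    proof (rule pt_eqI)
      fix s assume "s < q"
      have "inverse a * (cof w' s * (w s * w' s)) = inverse a * (cof w' s * w' s) * w s" by simp
      then show "inverse a * (cof w' s * (w s * w' s)) = w s" using cofa(1)[OF w(4) \<open>s < q\<close>] by simp
    qed
  qed
  have "is_function_field K q (fib a) (fgen (K \<union> yy z ` {..<q}))"
    unfolding is_function_field_def using generic[OF K_E] fgen_gpt by metis
  then show ?thesis unfolding toric_fibre_def using tor tsr by blast
qed

text \<open>The norm equation has coefficients in \<open>K\<close> and holds at the generic point,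
  so it holds on the locus; conversely, genericity puts all of \<open>fib a\<close> into the
  locus.\<close>

lemma locus_gpt: "locus K gpt = fib a"
proof
  show "fib a \<subseteq> locus K gpt"
    using generic[OF K_E] unfolding generic_point_def locus_def fib_eq by auto
  show "locus K gpt \<subseteq> fib a"
  proof
    fix y assume y: "y \<in> locus K gpt"
    have "(\<lambda>e. (\<Prod>s<q. zz e s) - a) \<in> pf K {..<q}"
      using a by (intro pf_diff[OF K] norm_K pf.const)
    then obtain f where f: "f \<in> polys_over K" "\<And>e. insertion e f = (\<Prod>s<q. zz e s) - a"
      using pf_imp_mpoly[OF K] by blast
    have "peval f gpt = 0" using f(2) z(1) by (simp add: peval_def gpt_def zz_pt)
    then have "peval f y = 0" using y f(1) by (auto simp: locus_def)
    then show "y \<in> fib a" using y f(2) unfolding fib_eq by (auto simp: locus_def gpt_def peval_def)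
  qed
qed

text \<open>A set with a generic point over \<open>E\<close> is irreducible because values at that
  point lie in a field. Over \<open>E\<close> the split components are available, and solving the
  norm equation for component \<open>0\<close> leaves \<open>q - 1\<close> independent
  generators.\<close>

lemma geom: "geom_rational_irreducible_fibre K (fgen (K \<union> yy z ` {..<q}))"
  unfolding geom_rational_irreducible_fibre_def
proof (intro exI[of _ gpt] conjI)
  have l: "length gpt = q" by (simp add: gpt_def)
  note gen_E = generic[OF order_refl]
  show "fgen (K \<union> yy z ` {..<q}) = adjoin K gpt" by (rule fgen_gpt[symmetric])
  show "irreducible_over E (length gpt) (locus K gpt)"
    unfolding irreducible_over_def locus_gpt l
  proof (intro conjI allI impI)
    show "fib a \<noteq> {}" using ex_on on_fib by blast
    fix A B assume AB: "closed_over E q A \<and> closed_over E q B \<and> fib a \<subseteq> A \<union> B"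
    then obtain S S' where S: "S \<subseteq> polys_over E" "A = {xs \<in> affine_space E q. \<forall>f\<in>S. peval f xs = 0}"
      "S' \<subseteq> polys_over E" "B = {xs \<in> affine_space E q. \<forall>f\<in>S'. peval f xs = 0}"
      unfolding closed_over_def alg_cl_E by blast
    have aff: "fib a \<subseteq> affine_space E q" unfolding fib_eq by blast
    show "fib a \<subseteq> A \<or> fib a \<subseteq> B"
    proof (rule ccontr)
      assume "\<not> (fib a \<subseteq> A \<or> fib a \<subseteq> B)"
      then obtain f g x y where fg: "f \<in> S" "x \<in> fib a" "peval f x \<noteq> 0"
        "g \<in> S'" "y \<in> fib a" "peval g y \<noteq> 0" using S aff by blast
      have "f \<in> polys_over E" "g \<in> polys_over E" using fg S by auto
      then have nz: "peval f gpt \<noteq> 0" "peval g gpt \<noteq> 0"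
        using gen_E fg unfolding generic_point_def by blast+
      obtain h where h: "h \<in> polys_over E" "\<And>e. insertion e h = insertion e f * insertion e g"
      proof -
        have pf: "(\<lambda>e. insertion e f) \<in> pf E UNIV" if "f \<in> polys_over E" for f :: "'w mpoly"
          using insertion_pf[OF subfld_E that, of "\<lambda>i e. e i" UNIV] by (auto intro: pf.proj)
        from pf_imp_mpoly[OF subfld_E pf.mult[OF pf pf, OF \<open>f \<in> polys_over E\<close> \<open>g \<in> polys_over E\<close>]]
        show ?thesis using that by auto
      qed
      have "\<forall>y\<in>fib a. peval h y = 0"
        using AB S fg h(2) unfolding peval_def by (auto simp: subset_eq)
      then have "peval h gpt = 0" using gen_E h(1) unfolding generic_point_def by blast
      then show False using nz h(2) by (simp add: peval_def)
    qed
  qed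
  let ?ts = "map z [1..<q]"
  have "is_function_field E (length gpt) (locus K gpt) (adjoin E gpt)"
    unfolding is_function_field_def locus_gpt l using gen_E by blast
  moreover have "rational_over E (adjoin E gpt)"
    unfolding rational_over_def
  proof (intro exI[of _ ?ts] conjI)
    have "gen E {..<q - 1} (\<lambda>i. z (Suc i))"
      by (rule gen_reindex[OF z(2), of Suc]) auto
    then have "gen E {..<length ?ts} (\<lambda>i. z (Suc i))" by simp
    then have "gen E {..<length ?ts} (nth ?ts)" by (rule gen_cong) auto
    then show "alg_independent E ?ts" by (rule gen_alg_independent[OF subfld_E])
    show "adjoin E gpt = adjoin E ?ts"
      unfolding adjoin_eq_fgen
    proof (rule fgen_eqI)
      let ?L = "fgen (E \<union> set ?ts)" and ?L' = "fgen (E \<union> set gpt)"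
      have EL: "E \<subseteq> ?L" "E \<subseteq> ?L'"
        using fgen_superset[of "E \<union> set ?ts"] fgen_superset[of "E \<union> set gpt"] by blast+
      have zi: "z i \<in> ?L" if "1 \<le> i" "i < q" for i using that by (auto intro: fgen_inc)
      have prod_q: "(\<Prod>i<q. z i) = z 0 * (\<Prod>i=1..<q. z i)"
        using q by (simp add: lessThan_atLeast0 prod.atLeast_Suc_lessThan)
      then have "(\<Prod>i=1..<q. z i) \<noteq> 0" using z(1) a(2) by auto
      then have "z 0 = a / (\<Prod>i=1..<q. z i)" using prod_q z(1) by (simp add: field_simps)
      also have "\<dots> \<in> ?L"
        by (intro subfld_divide subfld_prod subfld_fgen) (use a K_E EL zi in auto)
      finally have "z i \<in> ?L" if "i < q" for i using zi[of i] that by (cases "i = 0") auto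
      then have "yy z i \<in> ?L" if "i < q" for i
        unfolding yy_def using that C_alg EL by (intro subfld_sum subfld_mult subfld_fgen) auto
      then show "E \<union> set gpt \<subseteq> ?L" using EL by (auto simp: gpt_def pt_def)
      have "yy z i \<in> ?L'" if "i < q" for i using that by (auto simp: gpt_def pt_def intro: fgen_inc)
      then have "zz (yy z) i \<in> ?L'" if "i < q" for i
        unfolding zz_def using that C'_alg EL by (intro subfld_sum subfld_mult subfld_fgen) auto
      then show "E \<union> set ?ts \<subseteq> ?L'" using EL zz_yy by auto
    qed
  qed
  ultimately show "\<exists>M. is_function_field E (length gpt) (locus K gpt) M \<and> rational_over E M" by blast
qed

end

section \<open>Transcendental extensions and their automorphisms\<close>

definition rat :: "'w::field set \<Rightarrow> 'w set \<Rightarrow> bool" where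
  "rat F L \<longleftrightarrow> (\<exists>ts. gen F {..<length ts} (nth ts) \<and> L = fgen (F \<union> set ts))"

lemma rat_refl: "subfld F \<Longrightarrow> rat F F"
  unfolding rat_def by (intro exI[of _ "[]"]) (simp add: gen_empty fgen_subfld)

lemma rat_imp_rational_over:
  fixes F :: "'w::field_char_0 set"
  shows "subfld F \<Longrightarrow> rat F L \<Longrightarrow> rational_over F L"
  unfolding rat_def rational_over_def adjoin_eq_fgen using gen_alg_independent by blast

lemma rat_adjoin:
  fixes F :: "'w::field_char_0 set"
  assumes F: "subfld F" and L: "rat F L" and w: "w \<notin> alg_cl L"
  shows "rat F (fgen (L \<union> {w}))"
proof -
  obtain ts where ts: "gen F {..<length ts} (nth ts)" "L = fgen (F \<union> set ts)"
    using L unfolding rat_def by blast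
  let ?ts = "ts @ [w]"
  have "gen F {..<length ts} (nth ?ts)"
    by (rule gen_cong[OF ts(1)]) (simp add: nth_append)
  moreover have "nth ?ts ` {..<length ts} = set ts"
    by (force simp: nth_append in_set_conv_nth)
  then have "?ts ! length ts \<notin> alg_cl (fgen (F \<union> nth ?ts ` {..<length ts}))"
    using w ts(2) by simp
  ultimately have "gen F (insert (length ts) {..<length ts}) (nth ?ts)"
    by (intro gen_insert[OF F]) auto
  then have "gen F {..<length ?ts} (nth ?ts)" by (simp add: lessThan_Suc)
  moreover have "fgen (L \<union> {w}) = fgen (F \<union> set ?ts)"
    unfolding ts(2) fgen_fgen_Un by (simp add: Un_assoc)
  ultimately show ?thesis unfolding rat_def by blast
qed

lemma rat_adjoin_family:
  fixes F :: "'w::field_char_0 set"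
  assumes F: "subfld F" and L: "subfld L" "rat F L" and J: "finite J" "gen L J y"
  shows "rat F (fgen (L \<union> y ` J))"
  using J
proof (induction J rule: finite_induct)
  case empty
  then show ?case using L by (simp add: fgen_subfld)
next
  case (insert j J)
  have "gen L J y" using gen_mono[OF insert.prems] by blast
  then have "rat F (fgen (L \<union> y ` J))" by (rule insert.IH)
  moreover have "y j \<notin> alg_cl (fgen (L \<union> y ` J))"
    by (rule gen_transcendental[OF L(1) insert.prems]) fact
  ultimately have "rat F (fgen (fgen (L \<union> y ` J) \<union> {y j}))" by (rule rat_adjoin[OF F])
  then show ?case unfolding fgen_fgen_Un by simp
qed

text \<open>This supplies auxiliary variables inside the universal domain without disturbing a given
  family: finitely many elements cannot algebraically capture infinitely many independent
  \<open>t n\<close>, so a fresh one is always left.\<close>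

lemma gen_extend:
  fixes F :: "'w::field_char_0 set"
  assumes F: "subfld F" and t: "\<And>n::nat. gen F {..<n} t"
    and I: "finite I" "gen F I x" and J: "finite J" "I \<inter> J = {}"
  shows "\<exists>x'. (\<forall>i\<in>I. x' i = x i) \<and> gen F (I \<union> J) x'"
  using J
proof (induction J rule: finite_induct)
  case empty
  then show ?case using I by (intro exI[of _ x]) simp
next
  case (insert j J)
  interpret pregeometry "acl F" by (rule pregeometry_acl[OF F])
  obtain x' where x': "\<forall>i\<in>I. x' i = x i" "gen F (I \<union> J) x'" using insert by auto
  have fin: "finite (I \<union> J)" using I insert by simp
  have "\<exists>n. t n \<notin> acl F (x' ` (I \<union> J))"
  proof (rule ccontr)
    let ?n = "Suc (card (x' ` (I \<union> J)))"
    assume "\<not> ?thesis"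
    then have "t ` {..<?n} \<subseteq> acl F (x' ` (I \<union> J))" by auto
    moreover have "inj_on t {..<?n}" "indep (t ` {..<?n})" using gen_iff_indep[OF F, of "{..<?n}"] t by auto
    ultimately show False using card_le[of "x' ` (I \<union> J)" "t ` {..<?n}"] fin by (simp add: card_image)
  qed
  then obtain n where n: "t n \<notin> acl F (x' ` (I \<union> J))" by blast
  have j: "j \<notin> I \<union> J" using insert by auto
  let ?x = "x'(j := t n)"
  have eq: "?x ` (I \<union> J) = x' ` (I \<union> J)" using j by auto
  have "gen F (insert j (I \<union> J)) ?x"
  proof (rule gen_insert[OF F _ j])
    show "gen F (I \<union> J) ?x" by (rule gen_cong[OF x'(2)]) (use j in auto)
    show "?x j \<notin> alg_cl (fgen (F \<union> ?x ` (I \<union> J)))" using n unfolding eq by (simp add: acl_def)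
  qed
  moreover have "\<forall>i\<in>I. ?x i = x i" using x'(1) j by auto
  ultimately show ?case by (intro exI[of _ ?x]) (simp del: fun_upd_apply)
qed

text \<open>Injective endomorphisms of \<open>L\<close> over \<open>F\<close>, extended by the
  identity outside \<open>L\<close>. This normal form makes equality of functions the same as
  equality on \<open>L\<close>, so that finite groups become finite sets of functions.\<close>

definition auts :: "'w::field set \<Rightarrow> 'w set \<Rightarrow> ('w \<Rightarrow> 'w) set" where
  "auts F L = {f. (\<forall>y. y \<notin> L \<longrightarrow> f y = y) \<and> (\<forall>y\<in>L. f y \<in> L) \<and> (\<forall>c\<in>F. f c = c) \<and> inj f \<and>
     (\<forall>y\<in>L. \<forall>z\<in>L. f (y + z) = f y + f z \<and> f (y * z) = f y * f z)}"

lemma auts_id: "id \<in> auts F L"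
  by (simp add: auts_def)

lemma auts_comp: "f \<in> auts F L \<Longrightarrow> g \<in> auts F L \<Longrightarrow> f \<circ> g \<in> auts F L"
  unfolding auts_def by (auto intro: inj_compose)

lemma auts_pf:
  assumes f: "f \<in> auts F L" and L: "subfld L" "F \<subseteq> L" and x: "\<And>i. i \<in> I \<Longrightarrow> x i \<in> L" and p: "p \<in> pf F I"
  shows "f (p x) = p (\<lambda>i. f (x i))"
proof -
  have "p x \<in> L \<and> f (p x) = p (\<lambda>i. f (x i))"
    using p
  proof induction
    case (const c)
    then show ?case using L f by (auto simp: auts_def)
  next
    case (add p q)
    then show ?case using f by (auto simp: auts_def subfld_add[OF L(1)])
  next
    case (mult p q)
    then show ?case using f by (auto simp: auts_def subfld_mult[OF L(1)])
  qed (use x in auto)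
  then show ?thesis by blast
qed

lemma auts_fin_act:
  fixes L :: "'w::field_char_0 set"
  assumes "subfld L" "finite H" "id \<in> H" "\<And>f g. f \<in> H \<Longrightarrow> g \<in> H \<Longrightarrow> f \<circ> g \<in> H" "H \<subseteq> auts F L"
  shows "fin_act L H"
  by unfold_locales (use assms in \<open>auto simp: auts_def subset_eq\<close>)

lemma auts_eqI:
  assumes F: "subfld F" and f: "f \<in> auts F (fgen (F \<union> x ` I))" and g: "g \<in> auts F (fgen (F \<union> x ` I))"
    and eq: "\<And>i. i \<in> I \<Longrightarrow> f (x i) = g (x i)"
  shows "f = g"
proof
  let ?L = "fgen (F \<union> x ` I)"
  have L: "subfld ?L" "F \<subseteq> ?L" by (auto intro: fgen_inc)
  have x: "x i \<in> ?L" if "i \<in> I" for i using that by (auto intro: fgen_inc)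
  fix y
  show "f y = g y"
  proof (cases "y \<in> ?L")
    case True
    then obtain p q where pq: "p \<in> pf F I" "q \<in> pf F I" "q x \<noteq> 0" "y = p x / q x"
      by (rule fgenE[OF F])
    have "h y * h (q x) = h (p x)" if h: "h \<in> auts F ?L" for h
    proof -
      have "q x \<in> ?L" by (rule pf_fgen[OF pq(2)])
      then have "h (y * q x) = h y * h (q x)" using h True by (auto simp: auts_def)
      then show ?thesis using pq(3,4) by simp
    qed
    moreover have "f (p x) = g (p x)" "f (q x) = g (q x)"
      using auts_pf[OF f L x pq(1)] auts_pf[OF g L x pq(1)] pf_cong[OF pq(1), of "\<lambda>i. f (x i)" "\<lambda>i. g (x i)"]
        auts_pf[OF f L x pq(2)] auts_pf[OF g L x pq(2)] pf_cong[OF pq(2), of "\<lambda>i. f (x i)" "\<lambda>i. g (x i)"] eq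
      by auto
    moreover have "g (q x) \<noteq> 0"
    proof -
      have "inj g" "g 0 = 0"
        using g subfld_0[OF F] by (auto simp: auts_def)
      then show ?thesis using pq(3) by (metis injD)
    qed
    ultimately show ?thesis using f g by (metis mult_right_cancel)
  next
    case False
    then show ?thesis using f g by (simp add: auts_def)
  qed
qed

text \<open>A generic family satisfies no relations, so substituting another family for it is well
  defined on fractions as long as denominators survive; genericity of the images guarantees this and
  gives injectivity.\<close>

lemma ex_aut:
  assumes F: "subfld F" and x: "gen F I x" and x': "gen F I x'" "\<And>i. i \<in> I \<Longrightarrow> x' i \<in> fgen (F \<union> x ` I)"
  shows "\<exists>f\<in>auts F (fgen (F \<union> x ` I)). \<forall>i\<in>I. f (x i) = x' i"
proof -
  let ?L = "fgen (F \<union> x ` I)"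
  have "\<exists>p q. y \<in> ?L \<longrightarrow> p \<in> pf F I \<and> q \<in> pf F I \<and> q x \<noteq> 0 \<and> p x = y * q x" for y
  proof (cases "y \<in> ?L")
    case True
    then obtain p q where "p \<in> pf F I" "q \<in> pf F I" "q x \<noteq> 0" "y = p x / q x"
      by (rule fgenE[OF F])
    then show ?thesis by (intro exI[of _ p] exI[of _ q]) simp
  qed simp
  then obtain num den where rep: "num y \<in> pf F I" "den y \<in> pf F I" "den y x \<noteq> 0" "num y x = y * den y x"
    if "y \<in> ?L" for y by metis
  have nz: "p x' \<noteq> 0" if "p \<in> pf F I" "p x \<noteq> 0" for p
    using gen_zero[OF x'(1) that(1)] that(2) by blast
  define f where "f y = (if y \<in> ?L then num y x' / den y x' else y)" for y
  have f_eq: "f y = p x' / q x'" if pq: "p \<in> pf F I" "q \<in> pf F I" "q x \<noteq> 0" "y = p x / q x" for p q y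
  proof -
    have y: "y \<in> ?L" unfolding pq(4) by (intro subfld_divide subfld_fgen pf_fgen pq)
    have "(\<lambda>e. num y e * q e - p e * den y e) \<in> pf F I"
      using rep[OF y] pq by (intro pf_diff[OF F] pf.mult)
    moreover have "num y x * q x - p x * den y x = 0"
      unfolding rep(4)[OF y] using pq(3,4) by simp
    ultimately have "num y x' * q x' - p x' * den y x' = 0" using gen_zero[OF x] by blast
    then show ?thesis
      using y nz[OF pq(2,3)] nz[OF rep(2,3)[OF y]] by (simp add: f_def field_simps)
  qed
  have one: "(\<lambda>_. 1) \<in> pf F I" by (intro pf.const subfld_1[OF F])
  have f_const: "f c = c" if "c \<in> F" for c
    using f_eq[OF pf.const[OF that] one] by simp
  have f_x: "f (x i) = x' i" if "i \<in> I" for i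
    using f_eq[OF pf.proj[OF that] one] by simp
  have x'L: "p x' \<in> ?L" if "p \<in> pf F I" for p
    by (rule pf_value[OF that]) (use x'(2) in \<open>auto intro: fgen_inc\<close>)
  have f_L: "f y \<in> ?L" if "y \<in> ?L" for y
    using that x'L rep[OF that] by (simp add: f_def subfld_divide)
  have f_add: "f (y + z) = f y + f z" and f_mult: "f (y * z) = f y * f z" if "y \<in> ?L" "z \<in> ?L" for y z
  proof -
    note r = rep[OF that(1)] rep[OF that(2)]
    have fy: "f y = num y x' / den y x'" "f z = num z x' / den z x'" using that by (simp_all add: f_def)
    have n: "den y x' \<noteq> 0" "den z x' \<noteq> 0" using nz r by auto
    have 1: "(\<lambda>e. num y e * den z e + num z e * den y e) \<in> pf F I" "(\<lambda>e. num y e * num z e) \<in> pf F I"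
      "(\<lambda>e. den y e * den z e) \<in> pf F I" using r by (auto intro: pf.intros)
    have 2: "y + z = (num y x * den z x + num z x * den y x) / (den y x * den z x)"
      unfolding r(4) r(8) using r(3,7) by (simp add: field_simps)
    have 3: "y * z = num y x * num z x / (den y x * den z x)"
      unfolding r(4) r(8) using r(3,7) by simp
    show "f (y + z) = f y + f z"
      using f_eq[OF 1(1,3) _ 2] r n by (simp add: fy add_frac_eq)
    show "f (y * z) = f y * f z"
      using f_eq[OF 1(2,3) _ 3] r n by (simp add: fy)
  qed
  have f0: "y = 0" if y: "y \<in> ?L" "f y = 0" for y
  proof -
    have "num y x' = 0" using y nz[OF rep(2,3)[OF y(1)]] by (simp add: f_def)
    then have "num y x = 0" using gen_zero[OF x'(1) rep(1)[OF y(1)]] by blast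
    then show ?thesis using rep(3,4)[OF y(1)] by simp
  qed
  have "inj f"
  proof (rule injI)
    fix y z assume eq: "f y = f z"
    show "y = z"
    proof (cases "y \<in> ?L \<and> z \<in> ?L")
      case True
      then have d: "y - z \<in> ?L" by (simp add: subfld_diff)
      then have "f (y - z) + f z = f y" using f_add[of "y - z" z] True by simp
      then show ?thesis using f0[OF d] eq by simp
    next
      case False
      then show ?thesis using eq f_L by (metis f_def)
    qed
  qed
  then have "f \<in> auts F ?L"
    using f_const f_add f_mult f_L by (simp add: auts_def f_def)
  then show ?thesis using f_x by blast
qed

section \<open>Steps of the tower\<close>

definition tstep :: "'w::field set \<Rightarrow> 'w set \<Rightarrow> bool" where
  "tstep F L \<longleftrightarrow> F \<subseteq> L \<and> (\<exists>xs. L = adjoin F xs) \<and>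
     geom_rational_irreducible_fibre F L \<and> toric_fibre F L"

lemma tower_from_steps:
  assumes "tstep\<^sup>*\<^sup>* L L'" and L: "L = adjoin k xs" and rat: "rational_over k L'"
  shows "admits_toric_rational_tower k L"
proof -
  have "\<exists>(n::nat) K. K 0 = L \<and> K n = L' \<and> (\<forall>i\<le>n. \<exists>xs. K i = adjoin k xs) \<and> (\<forall>i<n. tstep (K i) (K (Suc i)))"
    using assms(1)
  proof (induction rule: rtranclp_induct)
    case base
    then show ?case using L by (intro exI[of _ 0] exI[of _ "\<lambda>_. L"]) auto
  next
    case (step M M')
    then obtain n :: nat and K where K: "K 0 = L" "K n = M" "\<forall>i\<le>n. \<exists>xs. K i = adjoin k xs"
      "\<forall>i<n. tstep (K i) (K (Suc i))" by blast
    obtain ys where ys: "M = adjoin k ys" using K by auto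
    obtain zs where "M' = adjoin M zs" using step by (auto simp: tstep_def)
    then have "M' = adjoin k (ys @ zs)" unfolding ys adjoin_eq_fgen fgen_fgen_Un by (simp add: Un_assoc)
    then show ?case
      using K step.hyps(2)
      by (intro exI[of _ "Suc n"] exI[of _ "K(Suc n := M')"]) (auto simp: le_Suc_eq less_Suc_eq)
  qed
  then show ?thesis
    unfolding admits_toric_rational_tower_def tstep_def using rat by metis
qed

lemma (in norm_torsor) tstep: "tstep K (fgen (K \<union> yy z ` {..<q}))"
  unfolding tstep_def using toric geom fgen_gpt fgen_superset[of "K \<union> yy z ` {..<q}"] by blast

text \<open>A split torus of rank one is the torus of norm one elements of the split algebra of rank two.\<close>

lemma tstep_transcendental:
  fixes K :: "'w::field_char_0 set"
  assumes K: "subfld K" and w: "w \<notin> alg_cl K"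
  shows "tstep K (fgen (K \<union> {w}))"
proof -
  have E: "subfld (alg_cl K)" "K \<subseteq> alg_cl K" using subfld_alg_cl alg_cl_superset K by auto
  have w0: "w \<noteq> 0" using w subfld_0[OF E(1)] by auto
  \<comment> \<open>Identity matrices, as the algebra is already split. The point
    \<open>(inverse w, w)\<close> has norm \<open>1\<close>, and its component \<open>1\<close> is
    transcendental.\<close>
  let ?C = "\<lambda>i j. of_bool (i = j) :: 'w" and ?z = "\<lambda>i::nat. if i = 0 then inverse w else w"
  have sum: "(\<Sum>m<2. ?C s m * e m) = e s" if "s < 2" for s :: nat and e
    using that by simp
  have of_bool_K: "of_bool b \<in> F" if "subfld F" for b and F :: "'w set"
    using subfld_0[OF that] subfld_1[OF that] by (cases b) auto
  have two: "{..<2::nat} = {0, 1}" by auto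
  have "norm_torsor K 2 ?C ?C 1 ?z"
  proof
    show "(\<lambda>e. \<Prod>s<2. \<Sum>m<2. ?C s m * e m) \<in> pf K {..<2}"
      by (intro pf_prod[OF K] pf_sum[OF K] pf.mult pf.const pf.proj of_bool_K[OF K])
    show "gen (alg_cl K) {1..<2} ?z"
    proof -
      have "gen (alg_cl K) (insert 1 {}) ?z"
        by (rule gen_insert[OF E(1) gen_empty])
          (use w in \<open>simp_all add: fgen_subfld[OF E(1)] alg_cl_alg_cl[OF K]\<close>)
      moreover have "{1..<2} = {1::nat}" by auto
      ultimately show ?thesis by simp
    qed
    fix i :: nat assume i: "i < 2"
    have e: "(\<lambda>e. e (2 + m)) \<in> pf K {..<2 * 2}" if "m < 2" for m :: nat
      using that by (intro pf.proj) auto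
    show "(\<lambda>e. \<Sum>s<2. ?C i s * ((\<Sum>m<2. ?C s m * e m) * (\<Sum>m<2. ?C s m * e (2 + m)))) \<in> pf K {..<2 * 2}"
      by (intro pf_sum[OF K] pf.mult pf.const e of_bool_K[OF K] pf.proj) auto
    show "(\<lambda>e. \<Sum>s<2. ?C i s * (\<Prod>t\<in>{..<2} - {s}. \<Sum>m<2. ?C t m * e m)) \<in> pf K {..<2}"
      by (intro pf_sum[OF K] pf_prod[OF K] pf.mult pf.const pf.proj of_bool_K[OF K]) auto
    show "(\<Sum>s<2. ?C i s * 1) \<in> K"
      by (intro subfld_sum[OF K] subfld_mult[OF K] of_bool_K[OF K] subfld_1[OF K])
  qed (use K w0 of_bool_K[OF E(1)] subfld_1[OF K] in \<open>auto simp: two dest!: less_2_cases\<close>)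
  note tstep = norm_torsor.tstep[OF this]
  have "(\<lambda>i. \<Sum>m<2. ?C i m * ?z m) ` {..<2} = {inverse w, w}" by (auto simp: two)
  then have "tstep K (fgen (K \<union> {inverse w, w}))" using tstep by simp
  moreover have "fgen (K \<union> {inverse w, w}) = fgen (K \<union> {w})"
    by (rule fgen_eqI) (auto intro: fgen_inc subfld_inverse)
  ultimately show ?thesis by simp
qed

section \<open>The universal domain\<close>

lemma ground_hom:
  fixes c d :: "'k::field"
  shows "ground (c + d) = ground c + ground d" "ground (c * d) = ground c * ground d" "ground (0::'k) = 0"
    "ground (1::'k) = 1" "ground (- c) = - ground c" "ground (inverse c) = inverse (ground c)" "inj (ground :: 'k \<Rightarrow> _)"
proof -
  show add: "ground (c + d) = ground c + ground d" for c d :: 'k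
    by (simp add: ground_def single_add flip: to_ac_add)
  show mult: "ground (c * d) = ground c * ground d" for c d :: 'k
    by (simp add: ground_def mult_single flip: to_ac_mult)
  show zero: "ground (0::'k) = 0" by (simp add: ground_def flip: Zero_fract_def)
  show one: "ground (1::'k) = 1" by (simp add: ground_def flip: One_fract_def)
  show "ground (- c) = - ground c" for c :: 'k
    using add[of c "- c"] zero by (simp add: eq_neg_iff_add_eq_0 add.commute)
  show inv: "ground (inverse c) = inverse (ground c)" for c :: 'k
  proof (cases "c = 0")
    case False
    then have "ground c * ground (inverse c) = 1" using mult[of c "inverse c"] one by simp
    then show ?thesis by (metis inverse_unique)
  qed (simp add: zero)
  show "inj (ground :: 'k \<Rightarrow> _)"
    by (rule injI) (simp add: ground_def eq_fract, metis lookup_single_eq)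
qed

lemma subfld_ground: "subfld (range ground)"
proof (rule subfldI)
  show "1 \<in> range ground" using ground_hom(4) by (metis rangeI)
next
  fix x y :: "'a universal" assume "x \<in> range ground" "y \<in> range ground"
  then obtain a b where ab: "x = ground a" "y = ground b" by blast
  show "x * y \<in> range ground" unfolding ab ground_hom(2)[symmetric] by simp
  have "x - y = ground (a + - b)" unfolding ab ground_hom(1,5) by simp
  then show "x - y \<in> range ground" by simp
next
  fix x :: "'a universal" assume "x \<in> range ground"
  then obtain a where a: "x = ground a" by blast
  show "inverse x \<in> range ground" unfolding a ground_hom(6)[symmetric] by simp
qed

instance fract :: ("{idom, ring_char_0}") field_char_0
proof
  show "inj (of_nat :: nat \<Rightarrow> 'a fract)"
    by (rule injI) (simp add: of_nat_fract eq_fract)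
qed

text \<open>The indeterminates of the universal domain are the reservoir of independent elements.
  The value at them and the values at ground points are read off the same formal polynomial
  \<open>f\<close>; the first being zero forces \<open>f = 0\<close>, hence the others
  vanish.\<close>

lemma gen_universal:
  "gen (range (ground :: 'k::field_char_0 \<Rightarrow> 'k universal)) {..<n}
    (\<lambda>i. to_ac (Fract (Poly_Mapping.single (Poly_Mapping.single i 1) 1) 1))"
  (is "gen ?k _ ?t")
  unfolding gen_def
proof (intro ballI impI allI)
  fix p e assume p: "p \<in> pf ?k {..<n}" "p ?t = 0"
  have "\<exists>f. p ?t = to_ac (Fract f 1) \<and> (\<forall>e. p (\<lambda>i. ground (e i)) = ground (insertion e f))"
    using p(1)
  proof induction
    case (const c)
    then obtain d where "c = ground d" by blast
    then show ?case
      by (intro exI[of _ "Poly_Mapping.single 0 d"]) (simp add: ground_def insertion_single)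
  next
    case (proj i)
    show ?case
      by (intro exI[of _ "Poly_Mapping.single (Poly_Mapping.single i 1) 1"]) (simp add: insertion_single)
  next
    case (add p q)
    then obtain f g where fg: "p ?t = to_ac (Fract f 1)" "\<forall>e. p (\<lambda>i. ground (e i)) = ground (insertion e f)"
      "q ?t = to_ac (Fract g 1)" "\<forall>e. q (\<lambda>i. ground (e i)) = ground (insertion e g)" by blast
    then show ?case
      by (intro exI[of _ "f + g"]) (simp add: insertion_add ground_hom flip: to_ac_add)
  next
    case (mult p q)
    then obtain f g where fg: "p ?t = to_ac (Fract f 1)" "\<forall>e. p (\<lambda>i. ground (e i)) = ground (insertion e f)"
      "q ?t = to_ac (Fract g 1)" "\<forall>e. q (\<lambda>i. ground (e i)) = ground (insertion e g)" by blast
    then show ?case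
      by (intro exI[of _ "f * g"]) (simp add: insertion_mult ground_hom flip: to_ac_mult)
  qed
  then obtain f where f: "p ?t = to_ac (Fract f 1)" "\<forall>e. p (\<lambda>i. ground (e i)) = ground (insertion e f)" by blast
  have f0: "f = 0" using f(1) p(2) by (simp add: Zero_fract_def eq_fract)
  show "p e = 0"
  proof (rule pf_zero[OF _ p(1) infinite_subfld[OF subfld_ground[where 'a = 'k]]])
    fix e :: "nat \<Rightarrow> 'k universal" assume e: "\<And>i. i \<in> {..<n} \<Longrightarrow> e i \<in> ?k"
    then have "\<forall>i\<in>{..<n}. \<exists>d. e i = ground d" by blast
    then obtain d where "\<And>i. i \<in> {..<n} \<Longrightarrow> e i = ground (d i)" by metis
    then have "p e = p (\<lambda>i. ground (d i))" by (intro pf_cong[OF p(1)])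
    then show "p e = 0" using f(2) f0 by (simp add: ground_hom)
  qed simp
qed

text \<open>Galois descent for a split algebra. \<open>H\<close> permutes the columns of
  \<open>C\<close> and the rows of \<open>C'\<close> alike, so points over the fixed field
  correspond to component vectors permuted by \<open>H\<close>, a condition kept by products and
  adjugates. \<open>pf_descent\<close> turns values in \<open>Fix M\<close> into coefficients in
  \<open>Fix M\<close>.\<close>

lemma (in fin_act) norm_torsor_descent:
  assumes M: "stable M" and q: "q > 0"
    and C: "\<And>i s. i < q \<Longrightarrow> s < q \<Longrightarrow> C i s \<in> M \<and> C i s \<in> alg_cl (Fix M)"
    and C': "\<And>i s. i < q \<Longrightarrow> s < q \<Longrightarrow> C' s i \<in> M \<and> C' s i \<in> alg_cl (Fix M)"
    and CC': "\<And>i j. i < q \<Longrightarrow> j < q \<Longrightarrow> (\<Sum>s<q. C i s * C' s j) = of_bool (i = j)"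
    and C'C: "\<And>s t. s < q \<Longrightarrow> t < q \<Longrightarrow> (\<Sum>i<q. C' s i * C i t) = of_bool (s = t)"
    and a: "a \<in> Fix M" "a \<noteq> 0" and z: "(\<Prod>s<q. z s) = a" "gen (alg_cl (Fix M)) {1..<q} z"
    and perm: "\<And>f. f \<in> H \<Longrightarrow> \<exists>\<pi>. bij_betw \<pi> {..<q} {..<q} \<and>
      (\<forall>i<q. \<forall>s<q. f (C i s) = C i (\<pi> s) \<and> f (C' s i) = C' (\<pi> s) i)"
  shows "norm_torsor (Fix M) q C C' a z"
proof -
  note FM = stableD(1)[OF M]
  have M\<Phi>: "M \<subseteq> \<Phi>" using M by (simp add: stable_def)
  define zz where "zz e s = (\<Sum>m<q. C' s m * e m)" for e s
  define yy where "yy w i = (\<Sum>s<q. C i s * w s)" for w i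
  obtain \<pi> where bij: "\<And>f. f \<in> H \<Longrightarrow> bij_betw (\<pi> f) {..<q} {..<q}"
    and \<pi>C: "\<And>f i s. f \<in> H \<Longrightarrow> i < q \<Longrightarrow> s < q \<Longrightarrow> f (C i s) = C i (\<pi> f s)"
    and \<pi>C': "\<And>f i s. f \<in> H \<Longrightarrow> i < q \<Longrightarrow> s < q \<Longrightarrow> f (C' s i) = C' (\<pi> f s) i"
    using perm by metis
  have \<pi>q: "\<pi> f s < q" if "f \<in> H" "s < q" for f s
    using bij[OF that(1)] that(2) by (auto simp: bij_betw_def)
  \<comment> \<open>The components of points rational over \<open>Fix M\<close>: applying
    \<open>f\<close> permutes them by \<open>\<pi> f\<close>.\<close>
  define equi where "equi w \<longleftrightarrow> (\<forall>s<q. w s \<in> M) \<and> (\<forall>f\<in>H. \<forall>s<q. f (w s) = w (\<pi> f s))" for w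
  have equiD: "w s \<in> \<Phi>" if "equi w" "s < q" for w s using that M\<Phi> by (auto simp: equi_def)
  have C\<Phi>: "C i s \<in> \<Phi>" "C' s i \<in> \<Phi>" if "i < q" "s < q" for i s using C C' that M\<Phi> by blast+
  have equi_zz: "equi (zz e)" if e: "\<And>i. i < q \<Longrightarrow> e i \<in> Fix M" for e
    unfolding equi_def
  proof (intro conjI ballI allI impI)
    show "zz e s \<in> M" if "s < q" for s
      unfolding zz_def using that C' FixD(1)[OF e] by (intro subfld_sum[OF FM] subfld_mult[OF FM]) auto
    show "f (zz e s) = zz e (\<pi> f s)" if f: "f \<in> H" and s: "s < q" for f s
    proof -
      have e\<Phi>: "e m \<in> \<Phi>" if "m < q" for m using FixD(1)[OF e[OF that]] M\<Phi> by blast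
      have "f (zz e s) = (\<Sum>m<q. f (C' s m * e m))"
        unfolding zz_def by (rule H_sum[OF f]) (auto intro!: subfld_mult[OF subfld_\<Phi>] C\<Phi> s e\<Phi>)
      also have "\<dots> = zz e (\<pi> f s)"
        unfolding zz_def
        by (rule sum.cong) (simp_all add: H_mult[OF f] C\<Phi> s e\<Phi> \<pi>C'[OF f] FixD(2)[OF e f])
      finally show ?thesis .
    qed
  qed
  have equi_mult: "equi (\<lambda>s. w s * w' s)" if "equi w" "equi w'" for w w'
    using that equiD[OF that(1)] equiD[OF that(2)] by (auto simp: equi_def H_mult subfld_mult[OF FM])
  have equi_adj: "equi (\<lambda>s. \<Prod>t\<in>{..<q} - {s}. w t)" if w: "equi w" for w
    unfolding equi_def
  proof (intro conjI ballI allI impI)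
    show "(\<Prod>t\<in>{..<q} - {s}. w t) \<in> M" for s
      using w by (intro subfld_prod[OF FM]) (auto simp: equi_def)
    show "f (\<Prod>t\<in>{..<q} - {s}. w t) = (\<Prod>t\<in>{..<q} - {\<pi> f s}. w t)" if f: "f \<in> H" and s: "s < q" for f s
    proof -
      have "f (\<Prod>t\<in>{..<q} - {s}. w t) = (\<Prod>t\<in>{..<q} - {s}. f (w t))"
        by (rule H_prod[OF f]) (use equiD[OF w] in auto)
      also have "\<dots> = (\<Prod>t\<in>{..<q} - {s}. w (\<pi> f t))"
        by (rule prod.cong) (use w f in \<open>auto simp: equi_def\<close>)
      also have "\<dots> = (\<Prod>t\<in>{..<q} - {\<pi> f s}. w t)"
      proof (rule prod.reindex_bij_betw)
        show "bij_betw (\<pi> f) ({..<q} - {s}) ({..<q} - {\<pi> f s})"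
          using bij[OF f] s by (auto simp: bij_betw_def inj_on_diff inj_on_image_set_diff[of "\<pi> f" "{..<q}"])
      qed
      finally show ?thesis .
    qed
  qed
  have yy_Fix: "yy w i \<in> Fix M" if w: "equi w" and i: "i < q" for w i
  proof (rule FixI)
    show "yy w i \<in> M"
      unfolding yy_def using C i w by (intro subfld_sum[OF FM] subfld_mult[OF FM]) (auto simp: equi_def)
    fix f assume f: "f \<in> H"
    have "f (yy w i) = (\<Sum>s<q. f (C i s * w s))"
      unfolding yy_def by (rule H_sum[OF f]) (auto intro!: subfld_mult[OF subfld_\<Phi>] C\<Phi> i equiD[OF w])
    also have "\<dots> = (\<Sum>s<q. C i (\<pi> f s) * w (\<pi> f s))"
      by (rule sum.cong) (use w f in \<open>simp_all add: H_mult[OF f] C\<Phi> i equiD[OF w] \<pi>C[OF f] equi_def\<close>)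
    also have "\<dots> = yy w i"
      unfolding yy_def by (rule sum.reindex_bij_betw[OF bij[OF f], where g = "\<lambda>s. C i s * w s"])
    finally show "f (yy w i) = yy w i" .
  qed
  have prod_Fix: "(\<Prod>s<q. w s) \<in> Fix M" if w: "equi w" for w
  proof (rule FixI)
    show "(\<Prod>s<q. w s) \<in> M" using w by (intro subfld_prod[OF FM]) (auto simp: equi_def)
    fix f assume f: "f \<in> H"
    have "f (\<Prod>s<q. w s) = (\<Prod>s<q. f (w s))" by (rule H_prod[OF f]) (use equiD[OF w] in auto)
    also have "\<dots> = (\<Prod>s<q. w (\<pi> f s))" by (rule prod.cong) (use w f in \<open>auto simp: equi_def\<close>)
    also have "\<dots> = (\<Prod>s<q. w s)" by (rule prod.reindex_bij_betw[OF bij[OF f]])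
    finally show "f (\<Prod>s<q. w s) = (\<Prod>s<q. w s)" .
  qed
  have pf_zz: "(\<lambda>e. zz (\<lambda>m. e (h m)) s) \<in> pf M J" if "s < q" "\<And>m. m < q \<Longrightarrow> h m \<in> J" for s h J
    unfolding zz_def using that C' by (intro pf_sum[OF FM] pf.mult pf.const pf.proj) auto
  have pf_zz': "(\<lambda>e. zz e s) \<in> pf M J" if "s < q" "{..<q} \<subseteq> J" for s J
    using pf_zz[of s "\<lambda>m. m" J] that by auto
  have pf_yy: "(\<lambda>e. yy (\<lambda>s. w s e) i) \<in> pf M J" if "i < q" "\<And>s. s < q \<Longrightarrow> w s \<in> pf M J" for w i J
    unfolding yy_def using that C by (intro pf_sum[OF FM] pf.mult pf.const) auto
  show ?thesis
  proof (unfold_locales, fold zz_def yy_def)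
    show "subfld (Fix M)" by (rule subfld_Fix[OF FM M\<Phi>])
    show "(\<lambda>e. \<Prod>s<q. zz e s) \<in> pf (Fix M) {..<q}"
    proof (rule pf_descent[OF M])
      show "(\<lambda>e. \<Prod>s<q. zz e s) \<in> pf M {..<q}" by (intro pf_prod[OF FM] pf_zz') auto
    qed (use prod_Fix equi_zz in auto)
    fix i assume i: "i < q"
    show "(\<lambda>e. yy (\<lambda>s. zz e s * zz (\<lambda>m. e (q + m)) s) i) \<in> pf (Fix M) {..<2 * q}"
    proof (rule pf_descent[OF M])
      show "(\<lambda>e. yy (\<lambda>s. zz e s * zz (\<lambda>m. e (q + m)) s) i) \<in> pf M {..<2 * q}"
        by (intro pf_yy[OF i] pf.mult pf_zz' pf_zz) auto
      show "yy (\<lambda>s. zz e s * zz (\<lambda>m. e (q + m)) s) i \<in> Fix M" if "\<And>i. i \<in> {..<2 * q} \<Longrightarrow> e i \<in> Fix M" for e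
        using that by (intro yy_Fix[OF _ i] equi_mult equi_zz) auto
    qed simp
    show "(\<lambda>e. yy (\<lambda>s. \<Prod>t\<in>{..<q} - {s}. zz e t) i) \<in> pf (Fix M) {..<q}"
    proof (rule pf_descent[OF M])
      show "(\<lambda>e. yy (\<lambda>s. \<Prod>t\<in>{..<q} - {s}. zz e t) i) \<in> pf M {..<q}"
        by (intro pf_yy[OF i] pf_prod[OF FM] pf_zz') auto
      show "yy (\<lambda>s. \<Prod>t\<in>{..<q} - {s}. zz e t) i \<in> Fix M" if "\<And>i. i \<in> {..<q} \<Longrightarrow> e i \<in> Fix M" for e
        using that by (intro yy_Fix[OF _ i] equi_adj equi_zz) auto
    qed simp
    have "equi (\<lambda>_. 1)" using H_1 subfld_1[OF FM] by (auto simp: equi_def)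
    then show "yy (\<lambda>_. 1) i \<in> Fix M" using yy_Fix i by blast
  qed (use q C C' CC'[folded yy_def] C'C[folded zz_def] a z in auto)
qed

section \<open>Adjoining norms\<close>

text \<open>The function fields of the tower are generated by coordinates \<open>Lin j\<close> of the representation,
  Kummer generators \<open>Chr i\<close>, and conjugates \<open>Nrm i s\<close> of an element whose norm is the \<open>n\<close>-th power
  of the \<open>i\<close>-th Kummer generator. The conjugates are indexed by \<open>s \<in> (\<int>/n)\<^sup>i\<close>, the Galois
  group of the preceding Kummer generators; the one with index \<open>0\<close> is determined by the others.\<close>

datatype idx = Lin nat | Chr nat | Nrm nat "nat \<Rightarrow> nat"

text \<open>Extensional functions represent \<open>(\<int>/n)\<^sup>i\<close> by residues, so the
  set is finite and equality is decided on the components below \<open>i\<close>.\<close>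

definition box :: "nat \<Rightarrow> nat \<Rightarrow> (nat \<Rightarrow> nat) set" where
  "box n i = {..<i} \<rightarrow>\<^sub>E {..<n}"

definition box0 :: "nat \<Rightarrow> nat \<Rightarrow> nat" where
  "box0 i = (\<lambda>l\<in>{..<i}. 0)"

definition shift :: "nat \<Rightarrow> nat \<Rightarrow> (nat \<Rightarrow> nat) \<Rightarrow> (nat \<Rightarrow> nat) \<Rightarrow> nat \<Rightarrow> nat" where
  "shift n i e s = (\<lambda>l\<in>{..<i}. (s l + e l) mod n)"

definition cidx :: "nat \<Rightarrow> nat \<Rightarrow> idx set" where
  "cidx n m = Chr ` {..<m} \<union> (\<Union>i<m. Nrm i ` (box n i - {box0 i}))"

lemma finite_box [simp]: "finite (box n i)"
  unfolding box_def by (intro finite_PiE) auto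

lemma finite_cidx [simp]: "finite (cidx n m)"
  unfolding cidx_def by auto

lemma box0_in: "n > 0 \<Longrightarrow> box0 i \<in> box n i"
  by (auto simp: box_def box0_def)

lemma shift_in: "n > 0 \<Longrightarrow> shift n i e s \<in> box n i"
  by (auto simp: box_def shift_def)

lemma box_less: "s \<in> box n i \<Longrightarrow> l < i \<Longrightarrow> s l < n"
  using PiE_mem[of s "{..<i}" "\<lambda>_. {..<n}" l] by (simp add: box_def)

lemma shift_eqI:
  assumes "t \<in> box n i" "\<And>l. l < i \<Longrightarrow> (s l + e l) mod n = t l"
  shows "shift n i e s = t"
proof
  fix l show "shift n i e s l = t l"
    using assms PiE_arb[of t "{..<i}" "\<lambda>_. {..<n}" l] by (cases "l < i") (auto simp: shift_def box_def)
qed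

lemma shift_zero: "s \<in> box n i \<Longrightarrow> shift n i (\<lambda>_. 0) s = s"
  by (rule shift_eqI) (simp_all add: box_less)

lemma shift_shift: "shift n i e (shift n i e' s) = shift n i (\<lambda>l. e l + e' l) s"
  by (auto simp: shift_def fun_eq_iff mod_simps ac_simps)

lemma add_mod_cancel:
  fixes a b c n :: nat
  assumes "a < n" "b < n" "(a + c) mod n = (b + c) mod n"
  shows "a = b"
  using assms
proof (induction a b rule: linorder_wlog)
  case (le a b)
  then have "n dvd (b + c) - (a + c)" using mod_eq_dvd_iff_nat[of "a + c" "b + c" n] by simp
  then have "n dvd b - a" by simp
  then show ?case using le by (auto dest: dvd_imp_le)
qed auto

lemma bij_shift:
  assumes n: "n > 0"
  shows "bij_betw (shift n i e) (box n i) (box n i)"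
proof -
  have "inj_on (shift n i e) (box n i)"
  proof (rule inj_onI)
    fix s t assume s: "s \<in> box n i" and t: "t \<in> box n i" and eq: "shift n i e s = shift n i e t"
    show "s = t"
    proof (rule PiE_ext[OF s[unfolded box_def] t[unfolded box_def]])
      fix l assume l: "l \<in> {..<i}"
      then have "s l < n" "t l < n" using s t by (auto simp: box_def)
      moreover have "(s l + e l) mod n = (t l + e l) mod n"
        using fun_cong[OF eq, of l] l by (simp add: shift_def)
      ultimately show "s l = t l"
        by (rule add_mod_cancel)
    qed
  qed
  then show ?thesis
    unfolding bij_betw_def using shift_in[OF n] by (intro conjI endo_inj_surj) auto
qed

lemma cidx_Suc: "cidx n (Suc m) = insert (Chr m) (cidx n m \<union> Nrm m ` (box n m - {box0 m}))"
  by (auto simp: cidx_def lessThan_Suc)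

lemma cidx_mono: "m \<le> m' \<Longrightarrow> cidx n m \<subseteq> cidx n m'"
  unfolding cidx_def by (intro Un_mono image_mono UN_mono) auto

locale norm_family =
  fixes k :: "'w::field_char_0 set" and n r d :: nat and \<zeta> :: 'w and x :: "idx \<Rightarrow> 'w"
  assumes k: "subfld k" and n: "n > 0" and \<zeta>: "\<zeta> \<in> k" "\<zeta> ^ n = 1"
    and prim: "\<And>i. 0 < i \<Longrightarrow> i < n \<Longrightarrow> \<zeta> ^ i \<noteq> 1"
    and gen_x: "gen k (Lin ` {..<d} \<union> cidx n r) x"
begin

abbreviation u :: "nat \<Rightarrow> 'w" where
  "u i \<equiv> x (Chr i)"

text \<open>The conjugate with index \<open>box0 i\<close> is defined from the others so that the
  norm is \<open>u i ^ n\<close> by construction, while all the \<open>x (Nrm i t)\<close> in use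
  remain free variables.\<close>

definition zf :: "nat \<Rightarrow> (nat \<Rightarrow> nat) \<Rightarrow> 'w" where
  "zf i s = (if s = box0 i then u i ^ n / (\<Prod>t\<in>box n i - {box0 i}. x (Nrm i t)) else x (Nrm i s))"

text \<open>\<open>N m\<close> omits the coordinates of the representation. The tower climbs through
  the fixed fields of the \<open>L m\<close>; rationality of its top is derived from that of the
  fixed fields of the \<open>N m\<close>.\<close>

definition N :: "nat \<Rightarrow> 'w set" where
  "N m = fgen (k \<union> x ` cidx n m)"

definition L :: "nat \<Rightarrow> 'w set" where
  "L m = fgen (k \<union> x ` (Lin ` {..<d} \<union> cidx n m))"

lemma subfld_N [simp]: "subfld (N m)" and subfld_L [simp]: "subfld (L m)"
  by (simp_all add: N_def L_def)

lemma N_subset_L: "N m \<subseteq> L m"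
  unfolding N_def L_def by (rule fgen_mono) auto

lemma N_mono: "m \<le> m' \<Longrightarrow> N m \<subseteq> N m'" and L_mono: "m \<le> m' \<Longrightarrow> L m \<subseteq> L m'"
  unfolding N_def L_def using cidx_mono[of m m' n] by (intro fgen_mono; auto)+

lemma k_subset_N: "k \<subseteq> N m"
  unfolding N_def by (auto intro: fgen_inc)

lemma k_subset_L: "k \<subseteq> L m"
  unfolding L_def by (auto intro: fgen_inc)

lemma x_nonzero:
  assumes "j \<in> Lin ` {..<d} \<union> cidx n r"
  shows "x j \<noteq> 0"
proof
  assume "x j = 0"
  from gen_zero[OF gen_x pf.proj[OF assms] this, of "\<lambda>_. 1"] show False by simp
qed

lemma u_nonzero: "i < r \<Longrightarrow> u i \<noteq> 0"
  by (rule x_nonzero) (auto simp: cidx_def)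

lemma zf_prod: "i < r \<Longrightarrow> (\<Prod>s\<in>box n i. zf i s) = u i ^ n"
proof -
  assume i: "i < r"
  have "(\<Prod>s\<in>box n i. zf i s) = zf i (box0 i) * (\<Prod>s\<in>box n i - {box0 i}. zf i s)"
    by (rule prod.remove) (simp_all add: box0_in n)
  also have "(\<Prod>s\<in>box n i - {box0 i}. zf i s) = (\<Prod>s\<in>box n i - {box0 i}. x (Nrm i s))"
    by (rule prod.cong) (auto simp: zf_def)
  also have "(\<Prod>s\<in>box n i - {box0 i}. x (Nrm i s)) \<noteq> 0"
    using i x_nonzero by (auto simp: cidx_def)
  then have "zf i (box0 i) * (\<Prod>s\<in>box n i - {box0 i}. x (Nrm i s)) = u i ^ n" by (simp add: zf_def)
  finally show ?thesis .
qed

lemma zf_nonzero: "i < r \<Longrightarrow> s \<in> box n i \<Longrightarrow> zf i s \<noteq> 0"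
  using zf_prod[of i] u_nonzero[of i] n by (metis finite_box power_not_zero prod_zero_iff)

lemma u_N: "i < m \<Longrightarrow> u i \<in> N m"
  unfolding N_def by (auto simp: cidx_def intro: fgen_inc)

lemma x_zf_subset: "x ` Nrm i ` (box n i - {box0 i}) \<subseteq> zf i ` box n i"
  by (auto simp: zf_def)

lemma zf_in: "u i \<in> F \<Longrightarrow> x ` Nrm i ` (box n i - {box0 i}) \<subseteq> F \<Longrightarrow> subfld F \<Longrightarrow> s \<in> box n i \<Longrightarrow> zf i s \<in> F"
  unfolding zf_def by (auto intro!: subfld_divide[of F] subfld_power[of F] subfld_prod[of F])

lemma zf_N: "i < m \<Longrightarrow> s \<in> box n i \<Longrightarrow> zf i s \<in> N m"
proof (rule zf_in[OF u_N])
  assume "i < m"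
  then have "x ` Nrm i ` (box n i - {box0 i}) \<subseteq> k \<union> x ` cidx n m" by (auto simp: cidx_def)
  then show "x ` Nrm i ` (box n i - {box0 i}) \<subseteq> N m" unfolding N_def using fgen_superset by blast
qed simp_all

lemma u_transcendental: "m < r \<Longrightarrow> u m \<notin> alg_cl (L m)"
  unfolding L_def
proof (rule gen_transcendental[OF k])
  assume m: "m < r"
  show "gen k (insert (Chr m) (Lin ` {..<d} \<union> cidx n m)) x"
    by (rule gen_mono[OF gen_x]) (use m cidx_mono[of "Suc m" r n] in \<open>auto simp: cidx_Suc\<close>)
qed (auto simp: cidx_def)

text \<open>Once \<open>u m\<close> is in the base, the norm equation removes one conjugate.
  \<open>E\<close> may be algebraic over the earlier generators, because the torsor needs
  independence over an algebraic closure.\<close>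

lemma gen_norms:
  assumes m: "m < r" and E: "subfld E" "E \<subseteq> acl k (x ` insert (Chr m) (Lin ` {..<d} \<union> cidx n m))"
  shows "gen E (box n m - {box0 m}) (zf m)"
proof -
  have "gen E (Nrm m ` (box n m - {box0 m})) x"
  proof (rule gen_base_change[OF k E])
    show "gen k (insert (Chr m) (Lin ` {..<d} \<union> cidx n m) \<union> Nrm m ` (box n m - {box0 m})) x"
      by (rule gen_mono[OF gen_x]) (use m cidx_mono[of "Suc m" r n] in \<open>auto simp: cidx_Suc\<close>)
  qed (auto simp: cidx_def)
  then have "gen E (box n m - {box0 m}) (\<lambda>s. x (Nrm m s))"
    by (rule gen_reindex) (auto simp: inj_on_def)
  then show ?thesis by (rule gen_cong) (auto simp: zf_def)
qed

text \<open>Without \<open>u m\<close> in the base all \<open>n ^ m\<close> conjugates are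
  independent: \<open>u m\<close> is algebraic over them through its \<open>n\<close>-th power, so
  trading \<open>u m\<close> for the dependent conjugate keeps the transcendence degree.\<close>

lemma gen_N_norms:
  assumes m: "m < r"
  shows "gen (N m) (box n m) (zf m)"
proof -
  let ?I = "insert (Chr m) (Nrm m ` (box n m - {box0 m}))"
  have g: "gen (N m) ?I x"
  proof (rule gen_base_change[OF k subfld_N])
    show "N m \<subseteq> acl k (x ` cidx n m)" unfolding N_def by (rule fgen_acl)
    show "gen k (cidx n m \<union> ?I) x"
      by (rule gen_mono[OF gen_x]) (use m cidx_mono[of "Suc m" r n] in \<open>auto simp: cidx_Suc\<close>)
  qed (auto simp: cidx_def)
  have "card ?I = Suc (card (box n m - {box0 m}))"
    by (subst card_insert_disjoint) (auto simp: card_image inj_on_def)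
  then have card: "card ?I = card (box n m)"
    using card.remove[OF finite_box box0_in[OF n]] by metis
  let ?A = "acl (N m) (zf m ` box n m)"
  have sub: "zf m ` box n m \<subseteq> ?A" by (rule acl_superset)
  have "u m ^ n \<in> fgen (N m \<union> zf m ` box n m)"
    unfolding zf_prod[OF m, symmetric] by (intro subfld_prod) (auto intro: fgen_inc)
  then have "u m ^ n \<in> alg_cl (fgen (N m \<union> zf m ` box n m))" using alg_cl_superset[OF subfld_fgen] by blast
  then have "u m \<in> ?A" unfolding acl_def by (rule root_algebraic[OF subfld_fgen]) (rule n)
  then have "x ` ?I \<subseteq> ?A" using sub x_zf_subset[of m] by auto
  then show ?thesis
    using gen_spanning[OF subfld_N _ g, of "box n m" "zf m"] card by auto
qed

text \<open>The matrix \<open>cf\<close> is a generalised Fourier matrix of the group \<open>(\<int>/n)\<^sup>i\<close>.\<close>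

definition cf :: "nat \<Rightarrow> (nat \<Rightarrow> nat) \<Rightarrow> (nat \<Rightarrow> nat) \<Rightarrow> 'w" where
  "cf i t s = (\<Prod>l<i. (\<zeta> ^ s l * u l) ^ t l)"

lemma \<zeta>_nonzero: "\<zeta> \<noteq> 0"
  using \<zeta>(2) n by (metis power_0_left zero_neq_one not_gr0)

lemma \<zeta>_pow_mod: "\<zeta> ^ (a mod n) = \<zeta> ^ a"
  by (metis \<zeta>(2) mult.left_neutral mult_div_mod_eq power_add power_mult power_one)

lemma \<zeta>_pow_eq: "a < n \<Longrightarrow> b < n \<Longrightarrow> \<zeta> ^ a = \<zeta> ^ b \<Longrightarrow> a = b"
proof (induction a b rule: linorder_wlog)
  case (le a b)
  have "\<zeta> ^ a * \<zeta> ^ (b - a) = \<zeta> ^ a * 1" using le power_add[of \<zeta> a "b - a"] by simp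
  then have "\<zeta> ^ (b - a) = 1" using \<zeta>_nonzero by simp
  then show ?case using prim[of "b - a"] le by (cases "a = b") auto
qed auto

lemma geometric:
  assumes "c ^ n = 1"
  shows "(\<Sum>j<n. c ^ j) = (if c = 1 then of_nat n else (0 :: 'w))"
  using assms by (simp add: geometric_sum)

lemma card_box: "card (box n i) = n ^ i"
  by (simp add: box_def card_PiE)

text \<open>The entries are products over \<open>l < i\<close>, so the sum over the box factors into
  one geometric series for each \<open>l\<close>, with ratio
  \<open>\<zeta> ^ t l / \<zeta> ^ t' l\<close>; the powers of \<open>u l\<close> cancel when the
  exponents agree, and otherwise the series vanishes.\<close>

lemma cf_orthogonal_s:
  assumes i: "i \<le> r" and t: "t \<in> box n i" "t' \<in> box n i"
  shows "(\<Sum>s\<in>box n i. cf i t s * (inverse (cf i t' s) / of_nat (n ^ i))) = of_bool (t = t')"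
proof -
  have "(\<Sum>s\<in>box n i. cf i t s / cf i t' s)
    = (\<Sum>s\<in>box n i. \<Prod>l<i. (\<zeta> ^ s l * u l) ^ t l / (\<zeta> ^ s l * u l) ^ t' l)"
    by (simp add: cf_def prod_dividef)
  also have "\<dots> = (\<Prod>l<i. \<Sum>a<n. (\<zeta> ^ a * u l) ^ t l / (\<zeta> ^ a * u l) ^ t' l)"
    unfolding box_def by (rule prod_sum_PiE[symmetric]) auto
  also have "\<dots> = (\<Prod>l<i. if t l = t' l then of_nat n else 0)"
  proof (rule prod.cong[OF refl])
    fix l assume l: "l \<in> {..<i}"
    then have u: "u l \<noteq> 0" using u_nonzero i by simp
    have tl: "t l < n" "t' l < n" using t l by (auto simp: box_def)
    have "(\<Sum>a<n. (\<zeta> ^ a * u l) ^ t l / (\<zeta> ^ a * u l) ^ t' l)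
      = (\<Sum>a<n. u l ^ t l / u l ^ t' l * (\<zeta> ^ t l / \<zeta> ^ t' l) ^ a)"
      by (intro sum.cong) (simp_all add: power_mult_distrib power_divide mult.commute flip: power_mult)
    also have "\<dots> = u l ^ t l / u l ^ t' l * (\<Sum>a<n. (\<zeta> ^ t l / \<zeta> ^ t' l) ^ a)"
      by (simp add: sum_distrib_left)
    also have "(\<Sum>a<n. (\<zeta> ^ t l / \<zeta> ^ t' l) ^ a) = (if \<zeta> ^ t l / \<zeta> ^ t' l = 1 then of_nat n else 0)"
    proof (rule geometric)
      have "(\<zeta> ^ a) ^ n = 1" for a by (metis \<zeta>(2) power_mult mult.commute power_one)
      then show "(\<zeta> ^ t l / \<zeta> ^ t' l) ^ n = 1" by (simp add: power_divide)
    qed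
    also have "\<zeta> ^ t l / \<zeta> ^ t' l = 1 \<longleftrightarrow> t l = t' l"
      using \<zeta>_pow_eq[OF tl] \<zeta>_nonzero by auto
    finally show "(\<Sum>a<n. (\<zeta> ^ a * u l) ^ t l / (\<zeta> ^ a * u l) ^ t' l) = (if t l = t' l then of_nat n else 0)"
      using u by simp
  qed
  also have "\<dots> = of_nat (n ^ i) * of_bool (t = t')"
  proof (cases "t = t'")
    case False
    then obtain l where "l < i" "t l \<noteq> t' l"
      using PiE_ext[OF t[unfolded box_def]] by auto
    then have "(\<Prod>l<i. if t l = t' l then of_nat n else 0) = (0 :: 'w)"
      by (intro prod_zero) auto
    then show ?thesis using False by simp
  qed simp
  finally have *: "(\<Sum>s\<in>box n i. cf i t s / cf i t' s) = of_nat (n ^ i) * of_bool (t = t')" .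
  have "(\<Sum>s\<in>box n i. cf i t s * (inverse (cf i t' s) / of_nat (n ^ i))) = (\<Sum>s\<in>box n i. cf i t s / cf i t' s) / of_nat (n ^ i)"
    unfolding sum_divide_distrib by (rule sum.cong) (simp_all add: divide_inverse mult.assoc)
  also have "\<dots> = of_bool (t = t')" unfolding * using n by simp
  finally show ?thesis .
qed

text \<open>The dual relation: the same exponent \<open>t\<close> occurs twice, so the
  \<open>u l\<close> cancel at once and the ratio is
  \<open>\<zeta> ^ s' l / \<zeta> ^ s l\<close>.\<close>

lemma cf_orthogonal_t:
  assumes i: "i \<le> r" and s: "s \<in> box n i" "s' \<in> box n i"
  shows "(\<Sum>t\<in>box n i. (inverse (cf i t s) / of_nat (n ^ i)) * cf i t s') = of_bool (s = s')"
proof -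
  have "(\<Sum>t\<in>box n i. cf i t s' / cf i t s)
    = (\<Sum>t\<in>box n i. \<Prod>l<i. (\<zeta> ^ s' l / \<zeta> ^ s l) ^ t l)"
  proof (rule sum.cong[OF refl])
    fix t
    have "(\<zeta> ^ s' l * u l) ^ t l / (\<zeta> ^ s l * u l) ^ t l = (\<zeta> ^ s' l / \<zeta> ^ s l) ^ t l" if "l < i" for l
      using u_nonzero[of l] that i by (simp add: power_mult_distrib power_divide)
    then show "cf i t s' / cf i t s = (\<Prod>l<i. (\<zeta> ^ s' l / \<zeta> ^ s l) ^ t l)"
      unfolding cf_def prod_dividef[symmetric] by (intro prod.cong) auto
  qed
  also have "\<dots> = (\<Prod>l<i. \<Sum>a<n. (\<zeta> ^ s' l / \<zeta> ^ s l) ^ a)"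
    unfolding box_def by (rule prod_sum_PiE[symmetric]) auto
  also have "\<dots> = (\<Prod>l<i. if s l = s' l then of_nat n else 0)"
  proof (rule prod.cong[OF refl])
    fix l assume l: "l \<in> {..<i}"
    have sl: "s' l < n" "s l < n" using s l by (auto simp: box_def)
    have "(\<zeta> ^ a) ^ n = 1" for a by (metis \<zeta>(2) power_mult mult.commute power_one)
    then have "(\<zeta> ^ s' l / \<zeta> ^ s l) ^ n = 1" by (simp add: power_divide)
    then have "(\<Sum>a<n. (\<zeta> ^ s' l / \<zeta> ^ s l) ^ a) = (if \<zeta> ^ s' l / \<zeta> ^ s l = 1 then of_nat n else 0)"
      by (rule geometric)
    also have "\<zeta> ^ s' l / \<zeta> ^ s l = 1 \<longleftrightarrow> s l = s' l"
      using \<zeta>_pow_eq[OF sl] \<zeta>_nonzero by auto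
    finally show "(\<Sum>a<n. (\<zeta> ^ s' l / \<zeta> ^ s l) ^ a) = (if s l = s' l then of_nat n else 0)" .
  qed
  also have "\<dots> = of_nat (n ^ i) * of_bool (s = s')"
  proof (cases "s = s'")
    case False
    then obtain l where "l < i" "s l \<noteq> s' l"
      using PiE_ext[OF s[unfolded box_def]] by auto
    then have "(\<Prod>l<i. if s l = s' l then of_nat n else 0) = (0 :: 'w)"
      by (intro prod_zero) auto
    then show ?thesis using False by simp
  qed simp
  finally have *: "(\<Sum>t\<in>box n i. cf i t s' / cf i t s) = of_nat (n ^ i) * of_bool (s = s')" .
  have "(\<Sum>t\<in>box n i. (inverse (cf i t s) / of_nat (n ^ i)) * cf i t s') = (\<Sum>t\<in>box n i. cf i t s' / cf i t s) / of_nat (n ^ i)"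
    unfolding sum_divide_distrib by (rule sum.cong) (simp_all add: divide_inverse mult_ac)
  also have "\<dots> = of_bool (s = s')" unfolding * using n by simp
  finally show ?thesis .
qed

end

section \<open>Fixed fields along the tower\<close>

locale norm_tower = norm_family k n r d \<zeta> x + fin_act \<Phi> H
  for k :: "'w::field_char_0 set" and n r d :: nat and \<zeta> :: 'w and x :: "idx \<Rightarrow> 'w"
    and \<Phi> :: "'w set" and H :: "('w \<Rightarrow> 'w) set" +
  assumes \<Phi>_eq: "\<Phi> = L r"
    and fix_k: "f \<in> H \<Longrightarrow> c \<in> k \<Longrightarrow> f c = c"
    and act: "f \<in> H \<Longrightarrow> \<exists>e. \<forall>i<r. f (u i) = \<zeta> ^ e i * u i \<and> (\<forall>s\<in>box n i. f (zf i s) = zf i (shift n i e s))"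
    and lin: "f \<in> H \<Longrightarrow> j < d \<Longrightarrow> f (x (Lin j)) \<in> fspan k (x ` Lin ` {..<d})"
    and rot: "j < r \<Longrightarrow> \<exists>f\<in>H. \<forall>i<r. f (u i) = (if i = j then \<zeta> * u i else u i) \<and>
      (\<forall>s\<in>box n i. f (zf i s) = zf i (shift n i (\<lambda>l. of_bool (l = j)) s))"
begin

lemma L_\<Phi>: "m \<le> r \<Longrightarrow> L m \<subseteq> \<Phi>" and N_\<Phi>: "m \<le> r \<Longrightarrow> N m \<subseteq> \<Phi>"
  using L_mono[of m r] N_subset_L[of m] \<Phi>_eq by auto

lemma k_\<Phi>: "k \<subseteq> \<Phi>"
  using k_subset_L[of r] unfolding \<Phi>_eq .

lemma k_Fix: "k \<subseteq> Fix \<Phi>"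
  using k_\<Phi> fix_k by (auto simp: Fix_def)

lemma stable_k: "stable k"
  using k k_\<Phi> by (auto simp: stable_def fix_k)

lemma cidx_act: "m \<le> r \<Longrightarrow> f \<in> H \<Longrightarrow> j \<in> cidx n m \<Longrightarrow> f (x j) \<in> N m"
proof -
  assume m: "m \<le> r" and f: "f \<in> H" and j: "j \<in> cidx n m"
  obtain e where e: "\<forall>i<r. f (u i) = \<zeta> ^ e i * u i \<and> (\<forall>s\<in>box n i. f (zf i s) = zf i (shift n i e s))"
    using act[OF f] by blast
  have \<zeta>N: "\<zeta> ^ a \<in> N m" for a using \<zeta> k_subset_N[of m] by (intro subfld_power) auto
  from j consider i where "i < m" "j = Chr i" | i s where "i < m" "s \<in> box n i" "s \<noteq> box0 i" "j = Nrm i s"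
    by (auto simp: cidx_def)
  then show ?thesis
  proof cases
    case 1
    then show ?thesis using e m u_N \<zeta>N by (auto intro!: subfld_mult)
  next
    case 2
    then have "x j = zf i s" by (simp add: zf_def)
    then show ?thesis using e m 2 zf_N shift_in[OF n] by simp
  qed
qed

lemma stable_N: "m \<le> r \<Longrightarrow> stable (N m)"
  unfolding N_def
proof (rule stable_fgen[OF stable_k])
  assume m: "m \<le> r"
  show "x ` cidx n m \<subseteq> \<Phi>" using N_\<Phi>[OF m] fgen_superset[of "k \<union> x ` cidx n m"] by (auto simp: N_def)
  show "f y \<in> fgen (k \<union> x ` cidx n m)" if "f \<in> H" "y \<in> x ` cidx n m" for f y
    using cidx_act[OF m that(1)] that(2) by (auto simp: N_def)
qed

lemma stable_L: "m \<le> r \<Longrightarrow> stable (L m)"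
  unfolding L_def
proof (rule stable_fgen[OF stable_k])
  assume m: "m \<le> r"
  let ?Y = "x ` (Lin ` {..<d} \<union> cidx n m)"
  show "?Y \<subseteq> \<Phi>" using L_\<Phi>[OF m] fgen_superset[of "k \<union> ?Y"] unfolding L_def by blast
  show "f y \<in> fgen (k \<union> ?Y)" if f: "f \<in> H" and y: "y \<in> ?Y" for f y
  proof -
    have "fspan k (x ` Lin ` {..<d}) \<subseteq> fgen (k \<union> ?Y)"
    proof
      fix z assume "z \<in> fspan k (x ` Lin ` {..<d})"
      then show "z \<in> fgen (k \<union> ?Y)"
        by induction (auto intro!: subfld_add[OF subfld_fgen] subfld_mult[OF subfld_fgen] subfld_0[OF subfld_fgen] intro: fgen_inc)
    qed
    moreover have "N m \<subseteq> fgen (k \<union> ?Y)" unfolding N_def by (rule fgen_mono) auto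
    ultimately show ?thesis using y lin[OF f] cidx_act[OF m f] by blast
  qed
qed

lemma semi_u: "m < r \<Longrightarrow> k \<subseteq> M \<Longrightarrow> semi M (u m)"
  unfolding semi_def
proof (intro conjI ballI)
  assume m: "m < r" and M: "k \<subseteq> M"
  show "u m \<in> \<Phi>" using u_N[OF m] N_\<Phi>[of r] by blast
  fix f assume "f \<in> H"
  then obtain e where "f (u m) = \<zeta> ^ e m * u m" using act m by blast
  moreover have "\<zeta> ^ e m \<in> M" using subfld_power[OF k \<zeta>(1)] M by blast
  ultimately show "\<exists>c\<in>M. f (u m) = c * u m" by blast
qed

text \<open>Multiplying \<open>u l\<close> by \<open>\<zeta> ^ e l\<close> amounts to translating
  the index \<open>s\<close> by \<open>e\<close>. Matrix columns and conjugates are therefore moved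
  by the same permutation.\<close>

lemma cf_act:
  assumes f: "f \<in> H" and e: "\<forall>i<r. f (u i) = \<zeta> ^ e i * u i" and i: "i \<le> r"
  shows "f (cf i t s) = cf i t (shift n i e s)"
proof -
  have u\<Phi>: "u l \<in> \<Phi>" if "l < i" for l using u_N[of l r] N_\<Phi>[of r] that i by auto
  have \<zeta>\<Phi>: "\<zeta> ^ a \<in> \<Phi>" for a using subfld_power[OF k \<zeta>(1)] k_Fix by (auto simp: Fix_def)
  have p: "(\<zeta> ^ s l * u l) ^ t l \<in> \<Phi>" if "l < i" for l
    by (intro subfld_power[OF subfld_\<Phi>] subfld_mult[OF subfld_\<Phi>] u\<Phi> \<zeta>\<Phi> that)
  have "f (cf i t s) = (\<Prod>l<i. f ((\<zeta> ^ s l * u l) ^ t l))"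
    unfolding cf_def by (rule H_prod[OF f]) (use p in auto)
  also have "\<dots> = cf i t (shift n i e s)"
    unfolding cf_def
  proof (rule prod.cong[OF refl])
    fix l assume l: "l \<in> {..<i}"
    then have lr: "l < r" using i by simp
    have "f (\<zeta> ^ s l * u l) = \<zeta> ^ s l * (\<zeta> ^ e l * u l)"
      using l e lr fix_k[OF f subfld_power[OF k \<zeta>(1)]] by (simp add: H_mult[OF f] u\<Phi> \<zeta>\<Phi>)
    also have "\<dots> = \<zeta> ^ shift n i e s l * u l"
      using l by (simp add: shift_def \<zeta>_pow_mod power_add)
    finally show "f ((\<zeta> ^ s l * u l) ^ t l) = (\<zeta> ^ shift n i e s l * u l) ^ t l"
      using l by (simp add: H_power[OF f] subfld_mult[OF subfld_\<Phi>] u\<Phi> \<zeta>\<Phi>)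
  qed
  finally show ?thesis .
qed

lemma cf_N: "i \<le> m \<Longrightarrow> cf i t s \<in> N m"
  unfolding cf_def using \<zeta> k_subset_N[of m] u_N
  by (intro subfld_prod[OF subfld_N] subfld_power[OF subfld_N] subfld_mult[OF subfld_N]) auto

lemma u_algebraic: "l < r \<Longrightarrow> u l \<in> M \<Longrightarrow> stable M \<Longrightarrow> u l \<in> alg_cl (Fix M)"
proof -
  assume l: "l < r" "u l \<in> M" and M: "stable M"
  have F: "subfld (Fix M)" by (rule subfld_Fix) (use M in \<open>auto simp: stable_def\<close>)
  have "u l ^ n \<in> Fix M"
  proof (rule FixI)
    show "u l ^ n \<in> M" using l M by (auto simp: stable_def intro: subfld_power)
    fix f assume f: "f \<in> H"
    then obtain e where "f (u l) = \<zeta> ^ e l * u l" using act l by blast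
    moreover have "(\<zeta> ^ e l) ^ n = 1" by (metis \<zeta>(2) power_mult mult.commute power_one)
    moreover have "u l \<in> \<Phi>" using l M by (auto simp: stable_def)
    ultimately show "f (u l ^ n) = u l ^ n" by (simp add: H_power[OF f] power_mult_distrib)
  qed
  then show ?thesis using root_algebraic[OF F _ n] alg_cl_superset[OF F] by blast
qed

text \<open>Two steps in fact. \<open>H\<close> scales \<open>u m\<close> by roots of unity, which
  gives a purely transcendental step. Then \<open>u m ^ n\<close> is invariant, and the conjugates
  form a generic point of that norm in an algebra split by the earlier \<open>u l\<close>.\<close>

lemma tower_step:
  assumes m: "m < r"
  shows "tstep\<^sup>*\<^sup>* (Fix (L m)) (Fix (L (Suc m)))"
proof -
  have stL: "stable (L m)" using m by (intro stable_L) simp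
  define M where "M = fgen (L m \<union> {u m})"
  have semi: "semi (L m) (u m)" by (rule semi_u[OF m k_subset_L])
  obtain w where w: "w \<notin> alg_cl (L m)" "Fix M = fgen (Fix (L m) \<union> {w})"
    unfolding M_def using Fix_semi_invariant[OF stL semi u_transcendental[OF m]] by blast
  have FL: "subfld (Fix (L m))" by (rule subfld_Fix) (use stL in \<open>auto simp: stable_def\<close>)
  have "w \<notin> alg_cl (Fix (L m))" using w(1) alg_cl_mono[of "Fix (L m)" "L m"] by (auto simp: Fix_def)
  then have step1: "tstep (Fix (L m)) (Fix M)" unfolding w(2) by (rule tstep_transcendental[OF FL])
  have stM: "stable M"
    unfolding M_def
  proof (rule stable_fgen[OF stL])
    show "{u m} \<subseteq> \<Phi>" using semi by (simp add: semi_def)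
    show "f y \<in> fgen (L m \<union> {u m})" if "f \<in> H" "y \<in> {u m}" for f y
      using semi that unfolding semi_def by (auto intro!: subfld_mult[OF subfld_fgen] intro: fgen_inc) (metis fgen_inc insertCI subfld_fgen subfld_mult)
  qed
  note FM = stableD(1)[OF stM]
  have LM: "L m \<subseteq> M" "u m \<in> M" unfolding M_def by (auto intro: fgen_inc)
  have NM: "N m \<subseteq> M" using N_subset_L LM by blast
  have kM: "k \<subseteq> M" using k_subset_L LM by blast
  let ?q = "n ^ m"
  have q: "?q > 0" using n by simp
  have card: "card (box n m - {box0 m}) = ?q - 1"
    using box0_in[OF n, of m] by (simp add: card_box)
  obtain h where h: "bij_betw h {1..?q - 1} (box n m - {box0 m})"
    using ex_bij_betw_nat_finite_1[of "box n m - {box0 m}"] card by auto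
  \<comment> \<open>The dependent conjugate receives number \<open>0\<close>, since
    \<open>norm_torsor\<close> asks for independence of the components \<open>1\<close> to
    \<open>q - 1\<close>.\<close>
  define b where "b = h(0 := box0 m)"
  have set_q: "{..<?q} = insert 0 {1..?q - 1}" using q by auto
  have bij_b1: "bij_betw b {1..?q - 1} (box n m - {box0 m})"
    using h by (rule bij_betw_cong[THEN iffD1, rotated]) (auto simp: b_def)
  have bij_b: "bij_betw b {..<?q} (box n m)"
  proof -
    have "bij_betw b {0} {box0 m}" by (simp add: b_def bij_betw_def)
    from bij_betw_combine[OF this bij_b1] have "bij_betw b ({0} \<union> {1..?q - 1}) ({box0 m} \<union> (box n m - {box0 m}))"
      by auto
    moreover have "{box0 m} \<union> (box n m - {box0 m}) = box n m" using box0_in[OF n, of m] by blast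
    ultimately show ?thesis unfolding set_q by simp
  qed
  have b_in: "b i \<in> box n m" if "i < ?q" for i using bij_b that by (auto simp: bij_betw_def)
  have b_eq: "b i = b j \<longleftrightarrow> i = j" if "i < ?q" "j < ?q" for i j
    using bij_b that by (auto simp: bij_betw_def inj_on_def)
  define C where "C i s = cf m (b i) (b s)" for i s
  define C' where "C' s i = inverse (cf m (b i) (b s)) / of_nat ?q" for s i
  define z where "z s = zf m (b s)" for s
  let ?E = "alg_cl (Fix M)"
  have FF: "subfld (Fix M)" by (rule subfld_Fix) (use stM in \<open>auto simp: stable_def\<close>)
  have FE: "subfld ?E" "Fix M \<subseteq> ?E" using subfld_alg_cl[OF FF] alg_cl_superset[OF FF] by auto
  have kF: "k \<subseteq> Fix M" using kM fix_k by (auto simp: Fix_def)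
  have cf_E: "cf m t s \<in> M \<and> cf m t s \<in> ?E" for t s
  proof
    show "cf m t s \<in> M" using cf_N[of m m] NM by blast
    have "u l \<in> ?E" if "l < m" for l
      by (rule u_algebraic) (use that m stM u_N NM in auto)
    then show "cf m t s \<in> ?E"
      unfolding cf_def using \<zeta> kF FE(2)
      by (intro subfld_prod[OF FE(1)] subfld_power[OF FE(1)] subfld_mult[OF FE(1)]) auto
  qed
  have z_prod: "(\<Prod>s<?q. z s) = u m ^ n"
    unfolding z_def using prod.reindex_bij_betw[OF bij_b, of "zf m"] zf_prod[OF m] by simp
  have perm: "\<exists>\<pi>. bij_betw \<pi> {..<?q} {..<?q} \<and>
      (\<forall>i<?q. \<forall>s<?q. f (C i s) = C i (\<pi> s) \<and> f (C' s i) = C' (\<pi> s) i) \<and> (\<forall>s<?q. f (z s) = z (\<pi> s))"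
    if f: "f \<in> H" for f
  proof -
    obtain e where e: "\<forall>i<r. f (u i) = \<zeta> ^ e i * u i" "\<forall>i<r. \<forall>s\<in>box n i. f (zf i s) = zf i (shift n i e s)"
      using act[OF f] by blast
    let ?\<pi> = "\<lambda>s. the_inv_into {..<?q} b (shift n m e (b s))"
    have inj: "inj_on b {..<?q}" "b ` {..<?q} = box n m" using bij_b by (auto simp: bij_betw_def)
    have b\<pi>: "b (?\<pi> s) = shift n m e (b s)" for s
      by (rule f_the_inv_into_f[OF inj(1)]) (simp add: inj(2) shift_in[OF n])
    have "bij_betw ?\<pi> {..<?q} {..<?q}"
      using bij_betw_trans[OF bij_betw_trans[OF bij_b bij_shift[OF n]] bij_betw_the_inv_into[OF bij_b], of e]
      by (simp add: comp_def)
    moreover have fc: "f (cf m t s) = cf m t (shift n m e s)" for t s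
      using cf_act[OF f e(1)] m by simp
    moreover have "f (inverse (cf m t s) / of_nat ?q) = inverse (cf m t (shift n m e s)) / of_nat ?q" for t s
    proof -
      have c: "cf m t s \<in> \<Phi>" using cf_E stableD(2)[OF stM] by blast
      then have "inverse (cf m t s) \<in> \<Phi>" by (rule subfld_inverse[OF subfld_\<Phi>])
      then have "f (inverse (cf m t s) / of_nat ?q) = f (inverse (cf m t s)) / f (of_nat ?q)"
        by (rule H_divide[OF f _ subfld_of_nat[OF subfld_\<Phi>]])
      then show ?thesis by (simp only: H_of_nat[OF f] H_inverse[OF f c] fc)
    qed
    ultimately show ?thesis
      using e(2) m b_in by (intro exI[of _ ?\<pi>]) (auto simp: C_def C'_def z_def b\<pi>)
  qed
  have "norm_torsor (Fix M) ?q C C' (u m ^ n) z"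
  proof (rule norm_torsor_descent[OF stM q])
    show "C i s \<in> M \<and> C i s \<in> ?E" for i s using cf_E by (simp add: C_def)
    show "C' s i \<in> M \<and> C' s i \<in> ?E" for i s
      using cf_E FM FE(1) by (auto simp: C'_def simp del: of_nat_power intro!: subfld_divide subfld_inverse subfld_of_nat)
    show "(\<Sum>s<?q. C i s * C' s j) = of_bool (i = j)" if "i < ?q" "j < ?q" for i j
    proof -
      have "(\<Sum>s<?q. C i s * C' s j) = (\<Sum>s\<in>box n m. cf m (b i) s * (inverse (cf m (b j) s) / of_nat (n ^ m)))"
        unfolding C_def C'_def by (rule sum.reindex_bij_betw[OF bij_b])
      also have "\<dots> = of_bool (b i = b j)" by (rule cf_orthogonal_s) (use m b_in that in auto)
      finally show ?thesis using b_eq[OF that] by simp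
    qed
    show "(\<Sum>i<?q. C' s i * C i t) = of_bool (s = t)" if "s < ?q" "t < ?q" for s t
    proof -
      have "(\<Sum>i<?q. C' s i * C i t) = (\<Sum>i\<in>box n m. (inverse (cf m i (b s)) / of_nat (n ^ m)) * cf m i (b t))"
        unfolding C_def C'_def by (rule sum.reindex_bij_betw[OF bij_b])
      also have "\<dots> = of_bool (b s = b t)" by (rule cf_orthogonal_t) (use m b_in that in auto)
      finally show ?thesis using b_eq[OF that] by simp
    qed
    show "u m ^ n \<in> Fix M"
    proof (rule FixI)
      show "u m ^ n \<in> M" using LM(2) by (rule subfld_power[OF FM])
      fix f assume f: "f \<in> H"
      then obtain e where "f (u m) = \<zeta> ^ e m * u m" using act m by blast
      moreover have "(\<zeta> ^ e m) ^ n = 1" by (metis \<zeta>(2) power_mult mult.commute power_one)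
      moreover have "u m \<in> \<Phi>" using LM(2) stableD(2)[OF stM] by blast
      ultimately show "f (u m ^ n) = u m ^ n" by (simp add: H_power[OF f] power_mult_distrib)
    qed
    show "u m ^ n \<noteq> 0" using u_nonzero[OF m] by simp
    show "(\<Prod>s<?q. z s) = u m ^ n" by (rule z_prod)
    \<comment> \<open>\<open>Fix M\<close>, and with it its algebraic closure, is algebraic over the
      generators that precede the norms, so the free conjugates stay generic over that
      closure.\<close>
    have MA: "M \<subseteq> acl k (x ` insert (Chr m) (Lin ` {..<d} \<union> cidx n m))" (is "_ \<subseteq> ?A")
    proof -
      have "fgen (k \<union> x ` insert (Chr m) (Lin ` {..<d} \<union> cidx n m)) \<subseteq> ?A" by (rule fgen_acl)
      moreover have "M \<subseteq> fgen (k \<union> x ` insert (Chr m) (Lin ` {..<d} \<union> cidx n m))"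
        unfolding M_def L_def fgen_fgen_Un by (rule fgen_mono) auto
      ultimately show ?thesis by blast
    qed
    have "?E \<subseteq> ?A" by (rule alg_cl_least) (use MA in \<open>auto simp: Fix_def\<close>)
    note g = gen_norms[OF m FE(1) this]
    have q1: "{1..<?q} = {1..?q - 1}" using q by auto
    show "gen ?E {1..<?q} z"
      unfolding z_def q1 by (rule gen_reindex[OF g]) (use bij_b1 in \<open>simp_all add: bij_betw_def\<close>)
    show "\<exists>\<pi>. bij_betw \<pi> {..<?q} {..<?q} \<and>
      (\<forall>i<?q. \<forall>s<?q. f (C i s) = C i (\<pi> s) \<and> f (C' s i) = C' (\<pi> s) i)" if "f \<in> H" for f
      using perm[OF that] by blast
  qed
  note T_tstep = norm_torsor.tstep[OF this] and T_zz_yy = norm_torsor.zz_yy[OF this]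
  \<comment> \<open>The coordinates over \<open>Fix M\<close>. An element of \<open>H\<close>
    permutes \<open>s\<close> in \<open>C i s\<close> and in \<open>z s\<close> simultaneously, so
    these sums are invariant; the inverse matrix shows that they generate the same field over
    \<open>M\<close> as the \<open>z s\<close>.\<close>
  let ?y = "\<lambda>i. \<Sum>s<?q. C i s * z s"
  have z\<Phi>: "z s \<in> \<Phi>" if "s < ?q" for s
    using zf_N[of m r "b s"] N_\<Phi>[of r] b_in[OF that] m by (auto simp: z_def)
  have C\<Phi>: "C i s \<in> \<Phi>" for i s using cf_E stableD(2)[OF stM] by (auto simp: C_def)
  have yF: "?y i \<in> Fix \<Phi>" if i: "i < ?q" for i
  proof (rule FixI)
    show "?y i \<in> \<Phi>" by (intro subfld_sum[OF subfld_\<Phi>] subfld_mult[OF subfld_\<Phi>] C\<Phi> z\<Phi>) simp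
    fix f assume f: "f \<in> H"
    obtain \<pi> where \<pi>: "bij_betw \<pi> {..<?q} {..<?q}" "\<And>s. s < ?q \<Longrightarrow> f (C i s) = C i (\<pi> s)" "\<And>s. s < ?q \<Longrightarrow> f (z s) = z (\<pi> s)"
      using perm[OF f] i by blast
    have "f (?y i) = (\<Sum>s<?q. f (C i s * z s))"
      by (rule H_sum[OF f]) (auto intro!: subfld_mult[OF subfld_\<Phi>] C\<Phi> z\<Phi>)
    also have "\<dots> = (\<Sum>s<?q. C i (\<pi> s) * z (\<pi> s))"
      by (rule sum.cong) (auto simp: H_mult[OF f] C\<Phi> z\<Phi> \<pi>)
    also have "\<dots> = ?y i" by (rule sum.reindex_bij_betw[OF \<pi>(1), where g = "\<lambda>s. C i s * z s"])
    finally show "f (?y i) = ?y i" .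
  qed
  have "fgen (M \<union> ?y ` {..<?q}) = fgen (M \<union> z ` {..<?q})"
  proof (rule fgen_eqI)
    have "?y i \<in> fgen (M \<union> z ` {..<?q})" for i
      using cf_E by (intro subfld_sum[OF subfld_fgen] subfld_mult[OF subfld_fgen]) (auto simp: C_def intro: fgen_inc)
    then show "M \<union> ?y ` {..<?q} \<subseteq> fgen (M \<union> z ` {..<?q})" by (auto intro: fgen_inc)
    have zs: "(\<Sum>i<?q. C' s i * ?y i) \<in> fgen (M \<union> ?y ` {..<?q})" for s
    proof (rule subfld_sum[OF subfld_fgen], rule subfld_mult[OF subfld_fgen])
      fix i assume "i \<in> {..<?q}"
      then show "?y i \<in> fgen (M \<union> ?y ` {..<?q})" by (intro fgen_inc) blast
      have "C' s i \<in> M" unfolding C'_def using cf_E by (intro subfld_divide[OF FM] subfld_inverse[OF FM] subfld_of_nat[OF FM]) auto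
      then show "C' s i \<in> fgen (M \<union> ?y ` {..<?q})" by (intro fgen_inc) blast
    qed
    have "z s \<in> fgen (M \<union> ?y ` {..<?q})" if "s < ?q" for s
      using zs[of s] unfolding T_zz_yy[OF that, of z] .
    then show "M \<union> z ` {..<?q} \<subseteq> fgen (M \<union> ?y ` {..<?q})" by (auto intro: fgen_inc)
  qed
  also have "z ` {..<?q} = zf m ` box n m"
    using bij_b by (auto simp: z_def bij_betw_def image_image[symmetric])
  also have "fgen (M \<union> zf m ` box n m) = L (Suc m)"
  proof -
    have "fgen (M \<union> zf m ` box n m) = fgen (M \<union> x ` Nrm m ` (box n m - {box0 m}))"
    proof (rule fgen_eqI)
      show "M \<union> zf m ` box n m \<subseteq> fgen (M \<union> x ` Nrm m ` (box n m - {box0 m}))"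
        using LM by (auto intro!: zf_in intro: fgen_inc)
      show "M \<union> x ` Nrm m ` (box n m - {box0 m}) \<subseteq> fgen (M \<union> zf m ` box n m)"
        using x_zf_subset[of m] by (auto intro!: fgen_inc)
    qed
    also have "\<dots> = L (Suc m)"
      unfolding M_def L_def fgen_fgen_Un cidx_Suc by (simp add: image_Un Un_ac)
    finally show ?thesis .
  qed
  finally have "fgen (M \<union> ?y ` {..<?q}) = L (Suc m)" .
  then have "Fix (L (Suc m)) = fgen (Fix M \<union> ?y ` {..<?q})"
    using Fix_adjoin_fixed[OF stM, of "{..<?q}" ?y] yF by simp
  then have "tstep (Fix M) (Fix (L (Suc m)))" using T_tstep by simp
  then show ?thesis using step1 by (meson rtranclp.rtrancl_into_rtrancl rtranclp.rtrancl_refl)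
qed

lemma tower: "m \<le> r \<Longrightarrow> tstep\<^sup>*\<^sup>* (Fix (L 0)) (Fix (L m))"
proof (induction m)
  case (Suc m)
  then show ?case using tower_step[of m] by (meson Suc_le_lessD rtranclp_trans Suc_leD)
qed simp

text \<open>Here the norms come before \<open>u m\<close>: the field \<open>A\<close> of
  \<open>N m\<close> and all conjugates is generated over \<open>N m\<close> by independent
  invariant sums \<open>y t\<close>, so its fixed field is purely transcendental over that of
  \<open>N m\<close>. Adjoining the root \<open>u m\<close> afterwards adds no invariants, because
  some element of \<open>H\<close> fixes \<open>A\<close> and moves \<open>u m\<close>.\<close>

lemma rational_N: "m \<le> r \<Longrightarrow> rat k (Fix (N m))"
proof (induction m)
  case 0
  have "N 0 = k" by (simp add: N_def cidx_def fgen_subfld k)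
  moreover have "Fix k = k" using fix_k by (auto simp: Fix_def)
  ultimately show ?case by (simp add: rat_refl k)
next
  case (Suc m)
  then have m: "m < r" and st: "stable (N m)" by (auto intro: stable_N)
  note FN = stableD(1)[OF st]
  define y where "y t = (\<Sum>s\<in>box n m. cf m t s * zf m s)" for t
  define A where "A = fgen (N m \<union> zf m ` box n m)"
  have zf\<Phi>: "zf m s \<in> \<Phi>" if "s \<in> box n m" for s using zf_N[of m r s] N_\<Phi>[of r] that m by auto
  have cfN: "cf m t s \<in> N m" for t s by (rule cf_N) simp
  have cf\<Phi>: "cf m t s \<in> \<Phi>" for t s using cfN stableD(2)[OF st] by blast
  have yF: "y t \<in> Fix \<Phi>" for t
  proof (rule FixI)
    show "y t \<in> \<Phi>" unfolding y_def by (intro subfld_sum[OF subfld_\<Phi>] subfld_mult[OF subfld_\<Phi>] cf\<Phi> zf\<Phi>)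
    fix f assume f: "f \<in> H"
    obtain e where e: "\<forall>i<r. f (u i) = \<zeta> ^ e i * u i" "\<forall>i<r. \<forall>s\<in>box n i. f (zf i s) = zf i (shift n i e s)"
      using act[OF f] by blast
    have "f (y t) = (\<Sum>s\<in>box n m. f (cf m t s * zf m s))"
      unfolding y_def by (rule H_sum[OF f]) (intro subfld_mult[OF subfld_\<Phi>] cf\<Phi> zf\<Phi>)
    also have "\<dots> = (\<Sum>s\<in>box n m. cf m t (shift n m e s) * zf m (shift n m e s))"
      by (rule sum.cong) (use e m cf_act[OF f e(1)] in \<open>auto simp: H_mult[OF f] cf\<Phi> zf\<Phi>\<close>)
    also have "\<dots> = y t"
      unfolding y_def by (rule sum.reindex_bij_betw[OF bij_shift[OF n], where g = "\<lambda>s. cf m t s * zf m s"])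
    finally show "f (y t) = y t" .
  qed
  have zy: "zf m s = (\<Sum>t\<in>box n m. (inverse (cf m t s) / of_nat (n ^ m)) * y t)" if s: "s \<in> box n m" for s
  proof -
    have "(\<Sum>t\<in>box n m. (inverse (cf m t s) / of_nat (n ^ m)) * y t)
      = (\<Sum>t\<in>box n m. \<Sum>s'\<in>box n m. (inverse (cf m t s) / of_nat (n ^ m)) * cf m t s' * zf m s')"
      by (simp add: y_def sum_distrib_left mult.assoc)
    also have "\<dots> = (\<Sum>s'\<in>box n m. (\<Sum>t\<in>box n m. (inverse (cf m t s) / of_nat (n ^ m)) * cf m t s') * zf m s')"
      by (subst sum.swap) (simp add: sum_distrib_right)
    also have "\<dots> = (\<Sum>s'\<in>box n m. of_bool (s = s') * zf m s')"
      by (rule sum.cong) (use cf_orthogonal_t[OF _ s] m in auto)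
    also have "\<dots> = zf m s"
      using s by (simp add: of_bool_def if_distrib[of "\<lambda>c. c * _"] cong: if_cong)
    finally show ?thesis by simp
  qed
  have A_y: "A = fgen (N m \<union> y ` box n m)"
    unfolding A_def
  proof (rule fgen_eqI)
    have "zf m s \<in> fgen (N m \<union> y ` box n m)" if "s \<in> box n m" for s
      unfolding zy[OF that] using cfN
      by (intro subfld_sum[OF subfld_fgen] subfld_mult[OF subfld_fgen] subfld_divide[OF subfld_fgen]
          subfld_inverse[OF subfld_fgen] subfld_of_nat[OF subfld_fgen]) (auto intro: fgen_inc)
    then show "N m \<union> zf m ` box n m \<subseteq> fgen (N m \<union> y ` box n m)" by (auto intro: fgen_inc)
    have "y t \<in> fgen (N m \<union> zf m ` box n m)" for t
      unfolding y_def using cfN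
      by (intro subfld_sum[OF subfld_fgen] subfld_mult[OF subfld_fgen]) (auto intro: fgen_inc)
    then show "N m \<union> y ` box n m \<subseteq> fgen (N m \<union> zf m ` box n m)" by (auto intro: fgen_inc)
  qed
  have FA: "Fix A = fgen (Fix (N m) \<union> y ` box n m)"
    unfolding A_y by (rule Fix_adjoin_fixed[OF st]) (rule yF)
  have gen_y: "gen (N m) (box n m) y"
  proof -
    have "zf m ` box n m \<subseteq> acl (N m) (y ` box n m)"
      using fgen_acl[of "N m" "y ` box n m"] A_y fgen_superset[of "N m \<union> zf m ` box n m"] by (auto simp: A_def)
    then show ?thesis using gen_spanning[OF FN _ gen_N_norms[OF m], of "box n m" y] by simp
  qed
  have "rat k (Fix A)"
    unfolding FA
  proof (rule rat_adjoin_family[OF k])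
    show "subfld (Fix (N m))" by (rule subfld_Fix) (use st in \<open>auto simp: stable_def\<close>)
    show "rat k (Fix (N m))" using Suc by simp
    show "gen (Fix (N m)) (box n m) y" by (rule gen_mono[OF gen_y]) (auto simp: Fix_def)
  qed simp
  moreover have "Fix (fgen (A \<union> {u m})) = Fix A"
  proof -
    have stA: "stable A"
      unfolding A_y
    proof (rule stable_fgen[OF st])
      show "y ` box n m \<subseteq> \<Phi>" using yF by (auto simp: Fix_def)
      show "f w \<in> fgen (N m \<union> y ` box n m)" if "f \<in> H" "w \<in> y ` box n m" for f w
        using that yF by (auto simp: Fix_def intro: fgen_inc)
    qed
    have NA: "N m \<subseteq> A" "zf m ` box n m \<subseteq> A" unfolding A_def by (auto intro: fgen_inc)
    obtain \<tau> where \<tau>: "\<tau> \<in> H" "\<forall>i<r. \<tau> (u i) = (if i = m then \<zeta> * u i else u i)"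
      "\<forall>i<r. \<forall>s\<in>box n i. \<tau> (zf i s) = zf i (shift n i (\<lambda>l. of_bool (l = m)) s)"
      using rot[OF m] by blast
    \<comment> \<open>Indices of level \<open>i\<close> only have components \<open>l < i\<close>,
      so for \<open>i \<le> m\<close> the unit vector at \<open>m\<close> does not move
      them.\<close>
    have sh: "shift n i (\<lambda>l. of_bool (l = m)) s = s" if "i \<le> m" "s \<in> box n i" for i s
      by (rule shift_eqI) (use that box_less[OF that(2)] in auto)
    have "A \<subseteq> {a \<in> \<Phi>. \<tau> a = a}"
      unfolding A_def N_def fgen_fgen_Un
    proof (rule fgen_least)
      show "subfld {a \<in> \<Phi>. \<tau> a = a}"
        by (rule subfldI) (auto simp: H_1 H_diff H_mult H_inverse \<tau>(1) subfld_closed[OF subfld_\<Phi>])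
      have "\<tau> (x j) = x j" if j: "j \<in> cidx n m" for j
      proof -
        from j consider i where "i < m" "j = Chr i" | i s where "i < m" "s \<in> box n i" "s \<noteq> box0 i" "j = Nrm i s"
          by (auto simp: cidx_def)
        then show ?thesis
        proof cases
          case 1
          then show ?thesis using \<tau>(2) m by auto
        next
          case 2
          then have "x j = zf i s" by (simp add: zf_def)
          then show ?thesis using \<tau>(3) m 2 sh[of i s] by simp
        qed
      qed
      moreover have "x ` cidx n m \<subseteq> \<Phi>" using N_\<Phi>[of m] m fgen_superset[of "k \<union> x ` cidx n m"] by (auto simp: N_def)
      moreover have "k \<subseteq> \<Phi>" using k_Fix by (auto simp: Fix_def)
      moreover have "\<tau> (zf m s) = zf m s" if "s \<in> box n m" for s using \<tau>(3) m sh[of m s] that by simp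
      ultimately show "k \<union> x ` cidx n m \<union> zf m ` box n m \<subseteq> {a \<in> \<Phi>. \<tau> a = a}"
        using fix_k[OF \<tau>(1)] zf\<Phi> by auto
    qed
    then have \<tau>A: "\<tau> a = a" if "a \<in> A" for a using that by blast
    have kA: "k \<subseteq> A" using k_subset_N NA by blast
    show ?thesis
    proof (rule Fix_kummer[OF stA semi_u[OF m kA] n _ \<tau>(1) \<tau>A])
      show "u m ^ n \<in> A" unfolding zf_prod[OF m, symmetric]
        using NA(2) by (intro subfld_prod) (auto simp: A_def)
      show "\<tau> (u m) = \<zeta> * u m" using \<tau>(2) m by simp
      show "\<zeta> \<in> A" using \<zeta> kA by blast
    qed (use \<zeta> prim in auto)
  qed
  moreover have "fgen (A \<union> {u m}) = N (Suc m)"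
  proof -
    have "fgen (A \<union> {u m}) = fgen (N m \<union> (zf m ` box n m \<union> {u m}))"
      unfolding A_def fgen_fgen_Un by (simp add: Un_assoc)
    also have "\<dots> = fgen (N m \<union> (x ` Nrm m ` (box n m - {box0 m}) \<union> {u m}))"
      by (rule fgen_eqI) (use x_zf_subset[of m] in \<open>auto intro!: zf_in intro: fgen_inc\<close>)
    also have "\<dots> = N (Suc m)"
      unfolding N_def fgen_fgen_Un cidx_Suc by (simp add: image_Un Un_ac)
    finally show ?thesis .
  qed
  ultimately show ?case by simp
qed

end

section \<open>Simultaneous diagonalisation\<close>

lemma funpow_closed: "(\<And>y. y \<in> Q \<Longrightarrow> f y \<in> Q) \<Longrightarrow> y \<in> Q \<Longrightarrow> (f ^^ t) y \<in> Q"
  by (induction t) auto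

context norm_family
begin

lemma root_of_unity:
  assumes "c ^ n = 1"
  obtains a where "a < n" "c = \<zeta> ^ a"
proof -
  let ?R = "{c :: 'w. c ^ n = 1}"
  let ?p = "Polynomial.monom 1 n - 1 :: 'w poly"
  have "Polynomial.coeff ?p n = 1" using n by simp
  then have p: "?p \<noteq> 0" by (metis coeff_0 zero_neq_one)
  have R: "?R = {c. poly ?p c = 0}" by (auto simp: poly_monom)
  have "degree ?p \<le> n"
    by (rule degree_diff_le) (simp_all add: degree_monom_le)
  then have "card ?R \<le> n" "finite ?R"
    using card_poly_roots_bound[OF p] poly_roots_finite[OF p] unfolding R by auto
  moreover have "(\<lambda>a. \<zeta> ^ a) ` {..<n} \<subseteq> ?R"
    using \<zeta>(2) by (auto simp flip: power_mult) (metis mult.commute power_mult power_one)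
  moreover have "card ((\<lambda>a. \<zeta> ^ a) ` {..<n}) = n"
    by (subst card_image) (auto intro!: inj_onI \<zeta>_pow_eq)
  ultimately have "(\<lambda>a. \<zeta> ^ a) ` {..<n} = ?R" by (intro card_seteq) auto
  then show ?thesis using assms that by blast
qed

lemma \<zeta>_sum: "t < n \<Longrightarrow> (\<Sum>m<n. inverse (\<zeta> ^ (m * t))) = (if t = 0 then of_nat n else 0)"
proof -
  assume t: "t < n"
  have "(\<Sum>m<n. inverse (\<zeta> ^ (m * t))) = (\<Sum>m<n. (inverse (\<zeta> ^ t)) ^ m)"
    by (intro sum.cong) (simp_all add: power_inverse flip: power_mult, simp add: mult.commute)
  also have "\<dots> = (if inverse (\<zeta> ^ t) = 1 then of_nat n else 0)"
  proof (rule geometric)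
    have "(\<zeta> ^ t) ^ n = 1" by (metis \<zeta>(2) power_mult mult.commute power_one)
    then show "inverse (\<zeta> ^ t) ^ n = 1" by (simp add: power_inverse)
  qed
  also have "inverse (\<zeta> ^ t) = 1 \<longleftrightarrow> t = 0"
    using prim[of t] t by auto
  finally show ?thesis .
qed

text \<open>\<open>Q\<close> is only a space over \<open>k\<close> and may have infinite dimension,
  so a single vector is decomposed. An operator whose \<open>n\<close>-th power is the identity
  splits it into spectral projections, and projecting a common eigenvector of commuting operators
  keeps it one.\<close>

lemma simultaneous_eigenvectors:
  assumes J: "finite J"
    and Q: "\<And>y z. y \<in> Q \<Longrightarrow> z \<in> Q \<Longrightarrow> y + z \<in> Q" "\<And>c y. c \<in> k \<Longrightarrow> y \<in> Q \<Longrightarrow> c * y \<in> Q" "0 \<in> Q"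
    and T: "\<And>j y. j \<in> J \<Longrightarrow> y \<in> Q \<Longrightarrow> T j y \<in> Q"
    and add: "\<And>j y z. j \<in> J \<Longrightarrow> y \<in> Q \<Longrightarrow> z \<in> Q \<Longrightarrow> T j (y + z) = T j y + T j z"
    and scale: "\<And>j c y. j \<in> J \<Longrightarrow> c \<in> k \<Longrightarrow> y \<in> Q \<Longrightarrow> T j (c * y) = c * T j y"
    and pow: "\<And>j y. j \<in> J \<Longrightarrow> y \<in> Q \<Longrightarrow> (T j ^^ n) y = y"
    and comm: "\<And>i j y. i \<in> J \<Longrightarrow> j \<in> J \<Longrightarrow> y \<in> Q \<Longrightarrow> T i (T j y) = T j (T i y)"
    and y: "y \<in> Q"
  shows "\<exists>Y. finite Y \<and> Y \<subseteq> Q \<and> y \<in> fspan k Y \<and> (\<forall>z\<in>Y. \<forall>j\<in>J. \<exists>c\<in>k. T j z = c * z)"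
proof -
  have "finite J' \<Longrightarrow> J' \<subseteq> J \<Longrightarrow> \<exists>Y. finite Y \<and> Y \<subseteq> Q \<and> y \<in> fspan k Y \<and>
      (\<forall>z\<in>Y. \<forall>j\<in>J'. \<exists>c\<in>k. T j z = c * z)" for J'
  proof (induction J' rule: finite_induct)
    case empty
    then show ?case using y fspan_inc[OF k, of y "{y}"] by (intro exI[of _ "{y}"]) auto
  next
    case (insert j J')
    then have j: "j \<in> J" and J': "J' \<subseteq> J" by auto
    obtain Y where Y: "finite Y" "Y \<subseteq> Q" "y \<in> fspan k Y" "\<forall>z\<in>Y. \<forall>i\<in>J'. \<exists>c\<in>k. T i z = c * z"
      using insert by auto
    have powQ: "(T j ^^ t) z \<in> Q" if "z \<in> Q" for t z by (rule funpow_closed) (use T[OF j] that in auto)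
    have sumQ: "(\<Sum>t\<in>I. g t) \<in> Q" if "\<And>t. t \<in> I \<Longrightarrow> g t \<in> Q" for I g
      using that by (induction I rule: infinite_finite_induct) (auto intro: Q)
    have T0: "T i 0 = 0" if "i \<in> J" for i using scale[OF that subfld_0[OF k] Q(3)] by simp
    have Tsum: "T i (\<Sum>t\<in>I. g t) = (\<Sum>t\<in>I. T i (g t))" if "i \<in> J" "\<And>t. t \<in> I \<Longrightarrow> g t \<in> Q" for I g i
      using that(2) by (induction I rule: infinite_finite_induct) (auto simp: add[OF that(1)] sumQ T0[OF that(1)])
    have ik: "inverse (\<zeta> ^ a) \<in> k" for a using \<zeta>(1) by (intro subfld_inverse[OF k] subfld_power[OF k])
    \<comment> \<open>Up to the factor \<open>n\<close>, the projection to the eigenvalue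
      \<open>\<zeta> ^ m\<close> of \<open>T j\<close>.\<close>
    define P where "P m z = (\<Sum>t<n. inverse (\<zeta> ^ (m * t)) * (T j ^^ t) z)" for m z
    have PQ: "P m z \<in> Q" if "z \<in> Q" for m z
      unfolding P_def by (intro sumQ Q(2) ik powQ that)
    have TP: "T i (P m z) = (\<Sum>t<n. inverse (\<zeta> ^ (m * t)) * T i ((T j ^^ t) z))" if "i \<in> J" "z \<in> Q" for i m z
    proof -
      have "T i (P m z) = (\<Sum>t<n. T i (inverse (\<zeta> ^ (m * t)) * (T j ^^ t) z))"
        unfolding P_def by (rule Tsum[OF that(1)]) (intro Q(2) ik powQ that)
      also have "\<dots> = (\<Sum>t<n. inverse (\<zeta> ^ (m * t)) * T i ((T j ^^ t) z))"
        by (rule sum.cong[OF refl], rule scale[OF that(1) ik powQ[OF that(2)]])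
      finally show ?thesis .
    qed
    have eig_j: "T j (P m z) = \<zeta> ^ m * P m z" if z: "z \<in> Q" for m z
    proof -
      let ?g = "\<lambda>t. inverse (\<zeta> ^ (m * t)) * (T j ^^ t) z"
      have "T j (P m z) = (\<Sum>t<n. \<zeta> ^ m * ?g (Suc t))"
        unfolding TP[OF j z] using \<zeta>_nonzero
        by (intro sum.cong) (simp_all add: power_add)
      also have "\<dots> = \<zeta> ^ m * (\<Sum>t<n. ?g (Suc t))" by (simp add: sum_distrib_left)
      also have "(\<Sum>t<n. ?g (Suc t)) = (\<Sum>t<n. ?g t)"
      proof -
        have "?g n = z" using pow[OF j z] \<zeta>(2) by (simp add: power_mult mult.commute[of m n])
        moreover have "(\<Sum>t<Suc n. ?g t) = ?g 0 + (\<Sum>t<n. ?g (Suc t))" by (rule sum.lessThan_Suc_shift)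
        ultimately show ?thesis by simp
      qed
      finally show ?thesis by (simp add: P_def)
    qed
    have eig_i: "T i (P m z) = c * P m z" if i: "i \<in> J'" and z: "z \<in> Q" "c \<in> k" "T i z = c * z" for i c m z
    proof -
      have iJ: "i \<in> J" using i J' by auto
      have "T i ((T j ^^ t) z) = c * (T j ^^ t) z" for t
      proof (induction t)
        case (Suc t)
        have "T i (T j ((T j ^^ t) z)) = T j (c * (T j ^^ t) z)"
          using comm[OF iJ j powQ[OF z(1)]] Suc by simp
        then show ?case using scale[OF j z(2) powQ[OF z(1)]] by simp
      qed (use z in simp)
      then show ?thesis
        unfolding TP[OF iJ z(1)] by (simp add: P_def sum_distrib_left mult_ac)
    qed
    have recover: "z = (\<Sum>m<n. inverse (of_nat n) * P m z)" if z: "z \<in> Q" for z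
    proof -
      have "(\<Sum>m<n. P m z) = (\<Sum>t<n. (\<Sum>m<n. inverse (\<zeta> ^ (m * t))) * (T j ^^ t) z)"
        unfolding P_def by (subst sum.swap) (simp add: sum_distrib_right)
      also have "\<dots> = (\<Sum>t<n. if t = 0 then of_nat n * z else 0)"
        by (intro sum.cong) (auto simp: \<zeta>_sum)
      also have "\<dots> = of_nat n * z" using n by simp
      finally have "inverse (of_nat n) * (\<Sum>m<n. P m z) = z" using n by simp
      then show ?thesis by (simp add: sum_distrib_left)
    qed
    let ?Y = "(\<lambda>(m, z). P m z) ` ({..<n} \<times> Y)"
    have "Y \<subseteq> fspan k ?Y"
    proof
      fix z assume z: "z \<in> Y"
      have "(\<Sum>m<n. inverse (of_nat n) * P m z) \<in> fspan k ?Y"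
        using z by (intro fspan_sum[OF k] fspan_scale[OF k] fspan_inc[OF k] subfld_inverse[OF k] subfld_of_nat[OF k])
          (auto intro!: image_eqI[where x = "(m, z)" for m])
      then show "z \<in> fspan k ?Y" using recover[of z] z Y(2) by auto
    qed
    then have "y \<in> fspan k ?Y" using Y(3) fspan_least[OF k] by blast
    moreover have "\<exists>c\<in>k. T i z = c * z" if z: "z \<in> ?Y" and i: "i \<in> insert j J'" for z i
    proof -
      obtain m z' where z': "z = P m z'" "z' \<in> Y" using z by auto
      then have Q': "z' \<in> Q" using Y(2) by blast
      show ?thesis
      proof (cases "i = j")
        case True
        then show ?thesis using eig_j[OF Q'] z' subfld_power[OF k \<zeta>(1)] by blast
      next
        case False
        then have "i \<in> J'" using i by simp
        moreover from this obtain c where "c \<in> k" "T i z' = c * z'" using Y(4) z' by blast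
        ultimately show ?thesis using eig_i[OF _ Q'] z' by blast
      qed
    qed
    moreover have "finite ?Y" "?Y \<subseteq> Q" using Y PQ by auto
    ultimately show ?case by (intro exI[of _ ?Y]) blast
  qed
  then show ?thesis using J by blast
qed

end

section \<open>Groups of class two\<close>

text \<open>The automorphisms in \<open>T\<close> come from the central subgroup; \<open>\<sigma> j\<close> generate the group modulo \<open>T\<close>.\<close>

locale class2_tower = norm_tower +
  fixes \<sigma> :: "nat \<Rightarrow> 'a \<Rightarrow> 'a" and T :: "('a \<Rightarrow> 'a) set"
  assumes \<sigma>_H: "j < r \<Longrightarrow> \<sigma> j \<in> H"
    and \<sigma>_u: "i < r \<Longrightarrow> j < r \<Longrightarrow> \<sigma> j (u i) = (if i = j then \<zeta> * u i else u i)"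
    and \<sigma>_zf: "i < r \<Longrightarrow> j < r \<Longrightarrow> s \<in> box n i \<Longrightarrow> \<sigma> j (zf i s) = zf i (shift n i (\<lambda>l. of_bool (l = j)) s)"
    and \<sigma>_pow: "j < r \<Longrightarrow> \<sigma> j ^^ n = id"
    and T_H: "T \<subseteq> H" and T_N: "\<tau> \<in> T \<Longrightarrow> y \<in> N r \<Longrightarrow> \<tau> y = y"
    and T_pow: "\<tau> \<in> T \<Longrightarrow> \<tau> ^^ n = id"
    and T_comm: "\<tau> \<in> T \<Longrightarrow> f \<in> H \<Longrightarrow> \<tau> \<circ> f = f \<circ> \<tau>"
    and commutator: "i < r \<Longrightarrow> j < r \<Longrightarrow> \<exists>\<tau>\<in>T. \<sigma> i \<circ> \<sigma> j = \<tau> \<circ> (\<sigma> j \<circ> \<sigma> i)"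
    and H_generated: "(\<And>\<tau>. \<tau> \<in> T \<Longrightarrow> P \<tau>) \<Longrightarrow> (\<And>j. j < r \<Longrightarrow> P (\<sigma> j)) \<Longrightarrow>
      (\<And>f g. f \<in> H \<Longrightarrow> g \<in> H \<Longrightarrow> P f \<Longrightarrow> P g \<Longrightarrow> P (f \<circ> g)) \<Longrightarrow> h \<in> H \<Longrightarrow> P h"
begin

abbreviation "V \<equiv> x ` Lin ` {..<d}"

lemma V_\<Phi>: "V \<subseteq> \<Phi>"
  unfolding \<Phi>_eq L_def by (auto intro: fgen_inc)

lemma N\<Phi>: "N r \<subseteq> \<Phi>"
  by (rule N_\<Phi>) simp

lemma kN: "k \<subseteq> N r"
  by (rule k_subset_N)

lemma span_\<Phi>: "F \<subseteq> \<Phi> \<Longrightarrow> subfld F \<Longrightarrow> B \<subseteq> \<Phi> \<Longrightarrow> w \<in> fspan F B \<Longrightarrow> w \<in> \<Phi>"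
proof -
  assume F: "F \<subseteq> \<Phi>" "subfld F" "B \<subseteq> \<Phi>" and w: "w \<in> fspan F B"
  from w show ?thesis
    by induction (use F in \<open>auto intro!: subfld_add[OF subfld_\<Phi>] subfld_mult[OF subfld_\<Phi>] simp: subfld_0[OF subfld_\<Phi>]\<close>)
qed

lemma span_act:
  assumes F: "stable F" "k \<subseteq> F" and f: "f \<in> H" and w: "w \<in> fspan F V"
  shows "f w \<in> fspan F V"
proof -
  note sF = stableD(1)[OF F(1)]
  have F\<Phi>: "F \<subseteq> \<Phi>" using F by (simp add: stable_def)
  have kF: "fspan k V \<subseteq> fspan F V"
  proof
    fix z assume "z \<in> fspan k V"
    then show "z \<in> fspan F V" by induction (use F(2) in \<open>auto intro: fspan.intros\<close>)
  qed
  from w show ?thesis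
  proof induction
    case zero
    then show ?case by (simp add: H_0[OF f] fspan.zero)
  next
    case (step w c v)
    have "v \<in> \<Phi>" "c \<in> \<Phi>" "w \<in> \<Phi>" using step V_\<Phi> F\<Phi> span_\<Phi>[OF F\<Phi> sF V_\<Phi>] by auto
    then have "f (c * v + w) = f c * f v + f w"
      by (simp add: H_add[OF f] H_mult[OF f] subfld_mult[OF subfld_\<Phi>])
    moreover have "f v \<in> fspan F V" using lin[OF f] step kF by auto
    ultimately show ?case
      using step stableD(3)[OF F(1) f] by (auto intro!: fspan_add[OF sF] fspan_scale[OF sF])
  qed
qed

text \<open>An element of \<open>N r\<close> that \<open>\<sigma> i\<close> multiplies by the inverse of \<open>\<zeta>\<close> and whose norm under \<open>\<sigma> j\<close> is \<open>1\<close>: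
  it trivialises the symbol of the \<open>i\<close>-th and the \<open>j\<close>-th Kummer generator.\<close>

definition \<theta> :: "nat \<Rightarrow> nat \<Rightarrow> 'a" where
  "\<theta> i j = (\<Prod>s\<in>{s \<in> box n i. s j = 0}. zf i s) / u i"

lemma \<theta>_N: "i < r \<Longrightarrow> \<theta> i j \<in> N r"
  unfolding \<theta>_def by (intro subfld_divide[OF subfld_N] subfld_prod[OF subfld_N] zf_N u_N) auto

lemma \<theta>_nonzero: "i < r \<Longrightarrow> \<theta> i j \<noteq> 0"
  using zf_nonzero[of i] u_nonzero[of i] by (simp add: \<theta>_def)

text \<open>The slice \<open>s j = 0\<close> is stable under translation in a direction
  \<open>l \<noteq> j\<close>, so the numerator is fixed; the denominator \<open>u i\<close>
  contributes a factor only for \<open>l = i\<close>.\<close>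

lemma \<sigma>_\<theta>:
  assumes "i < r" "l < r" "l \<noteq> j" "j < i"
  shows "\<sigma> l (\<theta> i j) = (if l = i then inverse \<zeta> * \<theta> i j else \<theta> i j)"
proof -
  let ?B = "{s \<in> box n i. s j = 0}" and ?h = "shift n i (\<lambda>a. of_bool (a = l))"
  note f = \<sigma>_H[OF assms(2)]
  have zf\<Phi>: "zf i s \<in> \<Phi>" if "s \<in> box n i" for s using zf_N[OF assms(1) that] N\<Phi> by blast
  have u\<Phi>: "u i \<in> \<Phi>" using u_N[OF assms(1)] N\<Phi> by blast
  have "?h ` ?B \<subseteq> ?B" using shift_in[OF n] assms by (auto simp: shift_def)
  moreover have inj: "inj_on ?h ?B" by (rule inj_on_subset[of _ "box n i"]) (use bij_shift[OF n] in \<open>auto simp: bij_betw_def\<close>)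
  ultimately have bij: "bij_betw ?h ?B ?B" unfolding bij_betw_def by (simp add: endo_inj_surj)
  have "\<sigma> l (\<Prod>s\<in>?B. zf i s) = (\<Prod>s\<in>?B. \<sigma> l (zf i s))"
    by (rule H_prod[OF f]) (use zf\<Phi> in auto)
  also have "\<dots> = (\<Prod>s\<in>?B. zf i (?h s))"
    by (rule prod.cong) (use \<sigma>_zf[OF assms(1,2)] in auto)
  also have "\<dots> = (\<Prod>s\<in>?B. zf i s)" by (rule prod.reindex_bij_betw[OF bij])
  finally have *: "\<sigma> l (\<Prod>s\<in>?B. zf i s) = (\<Prod>s\<in>?B. zf i s)" .
  have "(\<Prod>s\<in>?B. zf i s) \<in> \<Phi>" by (rule subfld_prod[OF subfld_\<Phi>]) (use zf\<Phi> in auto)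
  then have "\<sigma> l (\<theta> i j) = (\<Prod>s\<in>?B. zf i s) / \<sigma> l (u i)"
    unfolding \<theta>_def using H_divide[OF f _ u\<Phi>] * by simp
  then show ?thesis
    using \<sigma>_u[OF assms(1,2)] \<zeta>_nonzero by (auto simp: \<theta>_def field_simps)
qed

lemma \<sigma>_pow_zf:
  assumes "i < r" "j < i" "s \<in> box n i"
  shows "(\<sigma> j ^^ t) (zf i s) = zf i (shift n i (\<lambda>l. of_bool (l = j) * t) s)"
proof (induction t)
  case 0
  show ?case using shift_zero[OF assms(3)] by simp
next
  case (Suc t)
  then show ?case
    using \<sigma>_zf[of i j] assms shift_in[OF n] by (simp add: shift_shift algebra_simps)
qed

text \<open>\<open>\<sigma> j\<close> carries the slice \<open>s j = 0\<close> through all the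
  slices \<open>s j = t\<close>, so the conjugates of the numerator multiply to the full norm
  \<open>u i ^ n\<close>, while the denominator \<open>u i\<close> is fixed by
  \<open>\<sigma> j\<close>.\<close>

lemma norm_\<theta>:
  assumes "i < r" "j < i"
  shows "(\<Prod>t<n. (\<sigma> j ^^ t) (\<theta> i j)) = 1"
proof -
  let ?B = "{s \<in> box n i. s j = 0}" and ?sh = "\<lambda>t. shift n i (\<lambda>l. of_bool (l = j) * t)"
  have jr: "j < r" using assms by simp
  have f: "\<sigma> j ^^ t \<in> H" for t by (rule funpow_H[OF \<sigma>_H[OF jr]])
  have zf\<Phi>: "zf i s \<in> \<Phi>" if "s \<in> box n i" for s using zf_N[OF assms(1) that] N\<Phi> by blast
  have u\<Phi>: "u i \<in> \<Phi>" using u_N[OF assms(1)] N\<Phi> by blast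
  have P\<Phi>: "(\<Prod>s\<in>?B. zf i s) \<in> \<Phi>" by (rule subfld_prod[OF subfld_\<Phi>]) (use zf\<Phi> in auto)
  have u: "(\<sigma> j ^^ t) (u i) = u i" for t
    by (induction t) (use \<sigma>_u[OF assms(1) jr] assms in auto)
  have "(\<sigma> j ^^ t) (\<theta> i j) = (\<Prod>s\<in>?B. zf i (?sh t s)) / u i" for t
  proof -
    have "(\<sigma> j ^^ t) (\<Prod>s\<in>?B. zf i s) = (\<Prod>s\<in>?B. (\<sigma> j ^^ t) (zf i s))"
      by (rule H_prod[OF f]) (use zf\<Phi> in auto)
    also have "\<dots> = (\<Prod>s\<in>?B. zf i (?sh t s))"
      by (rule prod.cong) (use \<sigma>_pow_zf[OF assms] in auto)
    finally show ?thesis unfolding \<theta>_def using H_divide[OF f P\<Phi> u\<Phi>] u by simp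
  qed
  then have "(\<Prod>t<n. (\<sigma> j ^^ t) (\<theta> i j)) = (\<Prod>t<n. \<Prod>s\<in>?B. zf i (?sh t s)) / u i ^ n"
    by (simp add: prod_dividef)
  also have "(\<Prod>t<n. \<Prod>s\<in>?B. zf i (?sh t s)) = (\<Prod>(t, s)\<in>{..<n} \<times> ?B. zf i (?sh t s))"
    by (simp add: prod.cartesian_product)
  also have "\<dots> = (\<Prod>s\<in>box n i. zf i s)"
  proof (rule prod.reindex_bij_witness[where i = "\<lambda>s. (s j, s(j := 0))" and j = "\<lambda>(t, s). ?sh t s"])
    fix ts assume ts: "ts \<in> {..<n} \<times> ?B"
    obtain t s where [simp]: "ts = (t, s)" by force
    have t: "t < n" and s: "s \<in> box n i" "s j = 0" using ts by auto
    have "s(j := t) \<in> box n i" using s t assms(2) by (auto simp: box_def PiE_iff extensional_def)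
    then have sh: "?sh t s = s(j := t)" by (rule shift_eqI) (use s t box_less[OF s(1)] in auto)
    show "(\<lambda>s. (s j, s(j := 0))) (case ts of (t, s) \<Rightarrow> ?sh t s) = ts" using sh s by (auto simp: fun_eq_iff)
    show "(case ts of (t, s) \<Rightarrow> ?sh t s) \<in> box n i" using shift_in[OF n] by simp
    show "zf i (case ts of (t, s) \<Rightarrow> ?sh t s) = (case ts of (t, s) \<Rightarrow> zf i (?sh t s))" by simp
  next
    fix s assume s: "s \<in> box n i"
    have sj: "s j < n" by (rule box_less[OF s assms(2)])
    show "(s j, s(j := 0)) \<in> {..<n} \<times> ?B"
      using s sj n assms(2) by (auto simp: box_def PiE_iff extensional_def)
    show "(case (s j, s(j := 0)) of (t, s) \<Rightarrow> ?sh t s) = s"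
      unfolding prod.case by (rule shift_eqI) (use s box_less[OF s] in auto)
  qed
  also have "\<dots> = u i ^ n" by (rule zf_prod[OF assms(1)])
  finally show ?thesis using u_nonzero[OF assms(1)] by simp
qed

text \<open>On vectors with central character \<open>\<chi>\<close> the commutator of
  \<open>\<sigma> i\<close> and \<open>\<sigma> j\<close> is the scalar
  \<open>\<zeta> ^ a i j\<close>. For \<open>j < i\<close> the map \<open>\<sigma> i\<close> scales
  the multiplier \<open>\<gamma> j\<close> by the inverse scalar, and norm one keeps the
  \<open>n\<close>-th power of the twisted operator trivial. Eigenvectors of the twists are
  semi-invariant since \<open>\<sigma> j\<close> differs from its twist by a factor in
  \<open>N r\<close>.\<close>

lemma eigenform_decomposition:
  assumes y: "y \<in> fspan k V" "y \<noteq> 0" and eig: "\<And>\<tau>. \<tau> \<in> T \<Longrightarrow> \<tau> y = \<chi> \<tau> * y \<and> \<chi> \<tau> \<in> k"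
  shows "\<exists>Y. finite Y \<and> Y \<subseteq> fspan (N r) V \<and> y \<in> fspan k Y \<and> (\<forall>z\<in>Y. semi (N r) z)"
proof -
  have stN: "stable (N r)" by (rule stable_N) simp
  have span\<Phi>: "w \<in> \<Phi>" if "w \<in> fspan (N r) V" for w by (rule span_\<Phi>[OF N\<Phi> subfld_N V_\<Phi> that])
  have \<tau>H: "\<tau> \<in> H" if "\<tau> \<in> T" for \<tau> using that T_H by blast
  have yN: "y \<in> fspan (N r) V"
    using y(1) by induction (use kN in \<open>auto intro: fspan.intros\<close>)
  have \<chi>_pow: "\<chi> \<tau> ^ n = 1" if \<tau>: "\<tau> \<in> T" for \<tau>
  proof -
    have "(\<tau> ^^ t) y = \<chi> \<tau> ^ t * y" for t
    proof (induction t)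
      case (Suc t)
      have "\<chi> \<tau> ^ t \<in> k" using eig[OF \<tau>] by (intro subfld_power[OF k]) simp
      then have "\<chi> \<tau> ^ t \<in> \<Phi>" "\<tau> (\<chi> \<tau> ^ t) = \<chi> \<tau> ^ t" using k_\<Phi> fix_k[OF \<tau>H[OF \<tau>]] by auto
      then show ?case using Suc eig[OF \<tau>] span\<Phi>[OF yN] by (simp add: H_mult[OF \<tau>H[OF \<tau>]])
    qed simp
    from this[of n] T_pow[OF \<tau>] y(2) show ?thesis by simp
  qed
  obtain \<kappa> where \<kappa>: "\<And>i j. i < r \<Longrightarrow> j < r \<Longrightarrow> \<kappa> i j \<in> T"
    "\<And>i j. i < r \<Longrightarrow> j < r \<Longrightarrow> \<sigma> i \<circ> \<sigma> j = \<kappa> i j \<circ> (\<sigma> j \<circ> \<sigma> i)"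
    using commutator by metis
  have "\<exists>a. i < r \<longrightarrow> j < r \<longrightarrow> \<chi> (\<kappa> i j) = \<zeta> ^ a" for i j
    using root_of_unity[OF \<chi>_pow[OF \<kappa>(1)]] by metis
  then obtain a where a: "\<And>i j. i < r \<Longrightarrow> j < r \<Longrightarrow> \<chi> (\<kappa> i j) = \<zeta> ^ a i j" by metis
  \<comment> \<open>Only \<open>i > j\<close> enters: each pair of indices is corrected once, in the
    operator with the smaller index.\<close>
  define \<gamma> where "\<gamma> j = (\<Prod>i\<in>{j<..<r}. \<theta> i j ^ a i j)" for j
  have \<gamma>N: "\<gamma> j \<in> N r" for j
    unfolding \<gamma>_def by (intro subfld_prod[OF subfld_N] subfld_power[OF subfld_N] \<theta>_N) auto
  have \<gamma>0: "\<gamma> j \<noteq> 0" for j using \<theta>_nonzero by (auto simp: \<gamma>_def)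
  have \<theta>\<Phi>: "\<theta> i j ^ b \<in> \<Phi>" if "i < r" for i j b
    using \<theta>_N[OF that] N\<Phi> by (intro subfld_power[OF subfld_\<Phi>]) blast
  have \<sigma>\<gamma>: "\<sigma> l (\<gamma> j) = (if j < l then inverse (\<zeta> ^ a l j) * \<gamma> j else \<gamma> j)" if l: "l < r" "l \<noteq> j" for l j
  proof -
    note f = \<sigma>_H[OF l(1)]
    have "\<sigma> l (\<gamma> j) = (\<Prod>i\<in>{j<..<r}. \<sigma> l (\<theta> i j ^ a i j))"
      unfolding \<gamma>_def by (rule H_prod[OF f]) (use \<theta>\<Phi> in auto)
    also have "\<dots> = (\<Prod>i\<in>{j<..<r}. (if i = l then inverse (\<zeta> ^ a i j) else 1) * \<theta> i j ^ a i j)"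
    proof (rule prod.cong[OF refl])
      fix i assume i: "i \<in> {j<..<r}"
      then have "\<sigma> l (\<theta> i j ^ a i j) = \<sigma> l (\<theta> i j) ^ a i j" using \<theta>_N N\<Phi> by (intro H_power[OF f]) auto
      then show "\<sigma> l (\<theta> i j ^ a i j) = (if i = l then inverse (\<zeta> ^ a i j) else 1) * \<theta> i j ^ a i j"
        using \<sigma>_\<theta>[of i l j] i l by (auto simp: power_mult_distrib power_inverse)
    qed
    also have "\<dots> = (\<Prod>i\<in>{j<..<r}. if i = l then inverse (\<zeta> ^ a i j) else 1) * \<gamma> j"
      by (simp add: prod.distrib \<gamma>_def)
    also have "(\<Prod>i\<in>{j<..<r}. if i = l then inverse (\<zeta> ^ a i j) else 1) = (if j < l then inverse (\<zeta> ^ a l j) else 1)"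
      using l by (simp add: prod.delta)
    finally show ?thesis by simp
  qed
  have norm_\<gamma>: "(\<Prod>t<n. (\<sigma> j ^^ t) (\<gamma> j)) = 1" if j: "j < r" for j
  proof -
    have f: "\<sigma> j ^^ t \<in> H" for t by (rule funpow_H[OF \<sigma>_H[OF j]])
    have "(\<sigma> j ^^ t) (\<gamma> j) = (\<Prod>i\<in>{j<..<r}. (\<sigma> j ^^ t) (\<theta> i j) ^ a i j)" for t
    proof -
      have "(\<sigma> j ^^ t) (\<gamma> j) = (\<Prod>i\<in>{j<..<r}. (\<sigma> j ^^ t) (\<theta> i j ^ a i j))"
        unfolding \<gamma>_def by (rule H_prod[OF f]) (use \<theta>\<Phi> in auto)
      also have "\<dots> = (\<Prod>i\<in>{j<..<r}. (\<sigma> j ^^ t) (\<theta> i j) ^ a i j)"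
        by (rule prod.cong[OF refl], rule H_power[OF f]) (use \<theta>_N N\<Phi> in auto)
      finally show ?thesis .
    qed
    then have "(\<Prod>t<n. (\<sigma> j ^^ t) (\<gamma> j)) = (\<Prod>i\<in>{j<..<r}. (\<Prod>t<n. (\<sigma> j ^^ t) (\<theta> i j)) ^ a i j)"
      by (simp add: prod.swap[of _ _ "{..<n}"] prod_power_distrib)
    also have "\<dots> = 1" by (rule prod.neutral) (simp add: norm_\<theta>)
    finally show ?thesis .
  qed
  \<comment> \<open>The \<open>\<chi>\<close>-part of the span over \<open>N r\<close> rather than
    over \<open>k\<close>, because multiplication by \<open>\<gamma> j\<close> may leave the latter.
    The twisted operators are linear over \<open>k\<close> only.\<close>
  define Q where "Q = {w \<in> fspan (N r) V. \<forall>\<tau>\<in>T. \<tau> w = \<chi> \<tau> * w}"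
  define D where "D j w = \<gamma> j * \<sigma> j w" for j w
  have Q\<Phi>: "w \<in> \<Phi>" if "w \<in> Q" for w using that span\<Phi> by (simp add: Q_def)
  have \<chi>\<Phi>: "\<chi> \<tau> \<in> \<Phi>" "\<chi> \<tau> \<in> k" if "\<tau> \<in> T" for \<tau> using eig[OF that] k_\<Phi> by auto
  have \<gamma>\<Phi>: "\<gamma> j \<in> \<Phi>" for j using \<gamma>N N\<Phi> by blast
  have N_mult: "c * w \<in> Q" if "c \<in> N r" "w \<in> Q" for c w
  proof -
    have "\<tau> (c * w) = \<chi> \<tau> * (c * w)" if \<tau>: "\<tau> \<in> T" for \<tau>
      using T_N[OF \<tau> \<open>c \<in> N r\<close>] \<open>w \<in> Q\<close> \<tau> \<open>c \<in> N r\<close> N\<Phi> Q\<Phi>[OF \<open>w \<in> Q\<close>]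
      by (subst H_mult[OF \<tau>H[OF \<tau>]]) (auto simp: Q_def mult_ac)
    then show ?thesis using that by (auto simp: Q_def intro!: fspan_scale[OF subfld_N])
  qed
  have \<sigma>Q: "\<sigma> j w \<in> Q" if j: "j < r" and w: "w \<in> Q" for j w
  proof -
    have "\<tau> (\<sigma> j w) = \<chi> \<tau> * \<sigma> j w" if \<tau>: "\<tau> \<in> T" for \<tau>
    proof -
      have "\<tau> (\<sigma> j w) = \<sigma> j (\<tau> w)" using fun_cong[OF T_comm[OF \<tau> \<sigma>_H[OF j]], of w] by simp
      also have "\<dots> = \<sigma> j (\<chi> \<tau> * w)" using w \<tau> by (simp add: Q_def)
      also have "\<dots> = \<chi> \<tau> * \<sigma> j w"
        using H_mult[OF \<sigma>_H[OF j] \<chi>\<Phi>(1)[OF \<tau>] Q\<Phi>[OF w]] fix_k[OF \<sigma>_H[OF j] \<chi>\<Phi>(2)[OF \<tau>]] by simp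
      finally show ?thesis .
    qed
    then show ?thesis using w span_act[OF stN kN \<sigma>_H[OF j]] by (simp add: Q_def)
  qed
  have DQ: "D j w \<in> Q" if "j < r" "w \<in> Q" for j w
    unfolding D_def by (intro N_mult \<gamma>N \<sigma>Q that)
  have D_D: "D i (D j w) = \<gamma> i * \<sigma> i (\<gamma> j) * \<sigma> i (\<sigma> j w)" if "i < r" "j < r" "w \<in> Q" for i j w
    unfolding D_def using H_mult[OF \<sigma>_H[OF that(1)] \<gamma>\<Phi> Q\<Phi>[OF \<sigma>Q[OF that(2,3)]]] by (simp add: mult.assoc)
  \<comment> \<open>The factor \<open>\<zeta> ^ a i j\<close> of the commutator meets its inverse
    from \<open>\<sigma> i (\<gamma> j)\<close>, whereas \<open>\<sigma> j\<close> fixes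
    \<open>\<gamma> i\<close>.\<close>
  have comm_lt: "D i (D j w) = D j (D i w)" if i: "i < r" and j: "j < i" and w: "w \<in> Q" for i j w
  proof -
    have jr: "j < r" using i j by simp
    have "\<sigma> i (\<sigma> j w) = \<kappa> i j (\<sigma> j (\<sigma> i w))" using fun_cong[OF \<kappa>(2)[OF i jr], of w] by simp
    also have "\<dots> = \<chi> (\<kappa> i j) * \<sigma> j (\<sigma> i w)"
      using \<sigma>Q[OF jr \<sigma>Q[OF i w]] \<kappa>(1)[OF i jr] unfolding Q_def by blast
    also have "\<dots> = \<zeta> ^ a i j * \<sigma> j (\<sigma> i w)" by (simp only: a[OF i jr])
    finally show ?thesis
      unfolding D_D[OF i jr w] D_D[OF jr i w] using \<sigma>\<gamma>[OF i, of j] \<sigma>\<gamma>[OF jr, of i] j \<zeta>_nonzero by simp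
  qed
  have comm: "D i (D j w) = D j (D i w)" if "i < r" "j < r" "w \<in> Q" for i j w
    using comm_lt[of i j w] comm_lt[of j i w] that by (cases i j rule: linorder_cases) auto
  have D_pow: "(D j ^^ n) w = w" if j: "j < r" and w: "w \<in> Q" for j w
  proof -
    have f: "\<sigma> j ^^ t \<in> H" for t by (rule funpow_H[OF \<sigma>_H[OF j]])
    \<comment> \<open>Moving all multipliers to the left leaves a partial norm of
      \<open>\<gamma> j\<close>, which becomes the full norm at \<open>t = n\<close>.\<close>
    have "(D j ^^ t) w = (\<Prod>t'<t. (\<sigma> j ^^ t') (\<gamma> j)) * (\<sigma> j ^^ t) w" for t
    proof (induction t)
      case (Suc t)
      have p\<Phi>: "(\<sigma> j ^^ t') (\<gamma> j) \<in> \<Phi>" for t' using H_closed[OF f \<gamma>\<Phi>] .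
      have "\<sigma> j (\<Prod>t'<t. (\<sigma> j ^^ t') (\<gamma> j)) = (\<Prod>t'<t. (\<sigma> j ^^ Suc t') (\<gamma> j))"
        using H_prod[OF \<sigma>_H[OF j], of "{..<t}" "\<lambda>t'. (\<sigma> j ^^ t') (\<gamma> j)"] p\<Phi> by simp
      moreover have "(\<Prod>t'<t. (\<sigma> j ^^ t') (\<gamma> j)) \<in> \<Phi>" by (intro subfld_prod[OF subfld_\<Phi>] p\<Phi>)
      moreover have "(\<Prod>t'<Suc t. (\<sigma> j ^^ t') (\<gamma> j)) = \<gamma> j * (\<Prod>t'<t. (\<sigma> j ^^ Suc t') (\<gamma> j))"
        using prod.lessThan_Suc_shift[of "\<lambda>t'. (\<sigma> j ^^ t') (\<gamma> j)" t] by simp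
      ultimately show ?case
        using Suc H_mult[OF \<sigma>_H[OF j] _ H_closed[OF f Q\<Phi>[OF w]]] by (simp add: D_def mult.assoc)
    qed simp
    from this[of n] norm_\<gamma>[OF j] \<sigma>_pow[OF j] show ?thesis by simp
  qed
  have "\<exists>Y. finite Y \<and> Y \<subseteq> Q \<and> y \<in> fspan k Y \<and> (\<forall>z\<in>Y. \<forall>j\<in>{..<r}. \<exists>c\<in>k. D j z = c * z)"
  proof (rule simultaneous_eigenvectors)
    show "w + w' \<in> Q" if "w \<in> Q" "w' \<in> Q" for w w'
    proof -
      have "\<tau> (w + w') = \<chi> \<tau> * (w + w')" if \<tau>: "\<tau> \<in> T" for \<tau>
        using H_add[OF \<tau>H[OF \<tau>] Q\<Phi>[OF \<open>w \<in> Q\<close>] Q\<Phi>[OF \<open>w' \<in> Q\<close>]] \<open>w \<in> Q\<close> \<open>w' \<in> Q\<close> \<tau>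
        by (simp add: Q_def distrib_left)
      then show ?thesis using that by (auto simp: Q_def intro: fspan_add[OF subfld_N])
    qed
    show "c * w \<in> Q" if "c \<in> k" "w \<in> Q" for c w using N_mult that kN by blast
    show "0 \<in> Q" using H_0[OF \<tau>H] by (simp add: Q_def fspan.zero)
    show "y \<in> Q" using yN eig by (simp add: Q_def)
    show "D j w \<in> Q" if "j \<in> {..<r}" "w \<in> Q" for j w using DQ that by simp
    show "D j (w + w') = D j w + D j w'" if "j \<in> {..<r}" "w \<in> Q" "w' \<in> Q" for j w w'
      using H_add[OF \<sigma>_H Q\<Phi>[OF that(2)] Q\<Phi>[OF that(3)], of j] that by (simp add: D_def distrib_left)
    show "D j (c * w) = c * D j w" if "j \<in> {..<r}" "c \<in> k" "w \<in> Q" for j c w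
      using H_mult[OF \<sigma>_H _ Q\<Phi>[OF that(3)], of j c] fix_k[OF \<sigma>_H that(2), of j] that k_\<Phi> by (auto simp: D_def mult_ac)
    show "(D j ^^ n) w = w" if "j \<in> {..<r}" "w \<in> Q" for j w using D_pow that by simp
    show "D i (D j w) = D j (D i w)" if "i \<in> {..<r}" "j \<in> {..<r}" "w \<in> Q" for i j w using comm that by simp
  qed simp
  then obtain Y where Y: "finite Y" "Y \<subseteq> Q" "y \<in> fspan k Y" "\<forall>z\<in>Y. \<forall>j\<in>{..<r}. \<exists>c\<in>k. D j z = c * z" by blast
  have "semi (N r) z" if z: "z \<in> Y" for z
    unfolding semi_def
  proof (intro conjI ballI)
    have zQ: "z \<in> Q" using z Y(2) by blast
    then show z\<Phi>: "z \<in> \<Phi>" by (rule Q\<Phi>)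
    fix h assume "h \<in> H"
    then show "\<exists>c\<in>N r. h z = c * z"
    proof (rule H_generated[where P = "\<lambda>h. \<exists>c\<in>N r. h z = c * z", rotated -1])
      show "\<exists>c\<in>N r. \<tau> z = c * z" if "\<tau> \<in> T" for \<tau>
        using zQ that \<chi>\<Phi>(2)[OF that] kN by (auto simp: Q_def)
      show "\<exists>c\<in>N r. \<sigma> j z = c * z" if j: "j < r" for j
      proof -
        obtain c where c: "c \<in> k" "\<gamma> j * \<sigma> j z = c * z" using Y(4) z j by (auto simp: D_def)
        then have "\<sigma> j z = c / \<gamma> j * z" using \<gamma>0[of j] by (simp add: field_simps)
        moreover have "c / \<gamma> j \<in> N r" using c kN \<gamma>N by (intro subfld_divide[OF subfld_N]) auto
        ultimately show ?thesis by blast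
      qed
      show "\<exists>c\<in>N r. (f \<circ> g) z = c * z" if fg: "f \<in> H" "g \<in> H" "\<exists>c\<in>N r. f z = c * z" "\<exists>c\<in>N r. g z = c * z" for f g
      proof -
        obtain c c' where c: "c \<in> N r" "f z = c * z" "c' \<in> N r" "g z = c' * z" using fg by blast
        have "(f \<circ> g) z = f c' * c * z" using c H_mult[OF fg(1) _ z\<Phi>, of c'] N\<Phi> by auto
        moreover have "f c' * c \<in> N r" using c stableD(3)[OF stN fg(1)] by (intro subfld_mult[OF subfld_N])
        ultimately show ?thesis by blast
      qed
    qed
  qed
  then show ?thesis using Y by (intro exI[of _ Y]) (auto simp: Q_def)
qed

text \<open>\<open>T\<close> acts on the span of \<open>V\<close> over \<open>k\<close> by commuting
  operators of finite order; diagonalising it supplies the characters \<open>\<chi>\<close> that the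
  twisting requires.\<close>

lemma semi_invariant_span:
  assumes "v \<in> V"
  shows "\<exists>Y. finite Y \<and> Y \<subseteq> fspan (N r) V \<and> v \<in> fspan k Y \<and> (\<forall>z\<in>Y. semi (N r) z)"
proof -
  have finT: "finite T" using T_H finite_H finite_subset by blast
  have \<tau>H: "\<tau> \<in> H" if "\<tau> \<in> T" for \<tau> using that T_H by blast
  have span\<Phi>: "w \<in> \<Phi>" if "w \<in> fspan k V" for w by (rule span_\<Phi>[OF k_\<Phi> k V_\<Phi> that])
  have "\<exists>Y. finite Y \<and> Y \<subseteq> fspan k V \<and> v \<in> fspan k Y \<and> (\<forall>z\<in>Y. \<forall>\<tau>\<in>T. \<exists>c\<in>k. \<tau> z = c * z)"
  proof (rule simultaneous_eigenvectors[OF finT, where T = "\<lambda>\<tau>. \<tau>"])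
    show "\<tau> w \<in> fspan k V" if "\<tau> \<in> T" "w \<in> fspan k V" for \<tau> w
      by (rule span_act[OF stable_k order_refl \<tau>H[OF that(1)] that(2)])
    show "\<tau> (w + w') = \<tau> w + \<tau> w'" if "\<tau> \<in> T" "w \<in> fspan k V" "w' \<in> fspan k V" for \<tau> w w'
      using H_add[OF \<tau>H span\<Phi> span\<Phi>] that by blast
    show "\<tau> (c * w) = c * \<tau> w" if "\<tau> \<in> T" "c \<in> k" "w \<in> fspan k V" for \<tau> c w
      using H_mult[OF \<tau>H _ span\<Phi>, of \<tau> c w] fix_k[OF \<tau>H, of \<tau> c] that k_\<Phi> by auto
    show "(\<tau> ^^ n) w = w" if "\<tau> \<in> T" for \<tau> w using T_pow[OF that] by simp
    show "\<tau> (\<tau>' w) = \<tau>' (\<tau> w)" if "\<tau> \<in> T" "\<tau>' \<in> T" for \<tau> \<tau>' w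
      using fun_cong[OF T_comm[OF that(1) \<tau>H[OF that(2)]], of w] by simp
  qed (use assms in \<open>auto intro: fspan_add[OF k] fspan_scale[OF k] fspan.zero fspan_inc[OF k]\<close>)
  then obtain Y where Y: "finite Y" "Y \<subseteq> fspan k V" "v \<in> fspan k Y" "\<forall>z\<in>Y. \<forall>\<tau>\<in>T. \<exists>c\<in>k. \<tau> z = c * z" by blast
  have "\<exists>Y'. finite Y' \<and> Y' \<subseteq> fspan (N r) V \<and> y \<in> fspan k Y' \<and> (\<forall>z\<in>Y'. semi (N r) z)" if y: "y \<in> Y" for y
  proof (cases "y = 0")
    case True
    then show ?thesis by (intro exI[of _ "{}"]) (auto intro: fspan.zero)
  next
    case False
    have "\<forall>\<tau>\<in>T. \<exists>c\<in>k. \<tau> y = c * y" using Y(4) y by blast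
    then obtain \<chi> where "\<And>\<tau>. \<tau> \<in> T \<Longrightarrow> \<tau> y = \<chi> \<tau> * y \<and> \<chi> \<tau> \<in> k" by metis
    then show ?thesis using eigenform_decomposition[of y \<chi>] False y Y(2) by blast
  qed
  then obtain W where W: "\<And>y. y \<in> Y \<Longrightarrow> finite (W y) \<and> W y \<subseteq> fspan (N r) V \<and> y \<in> fspan k (W y) \<and> (\<forall>z\<in>W y. semi (N r) z)"
    by metis
  have "Y \<subseteq> fspan k (\<Union>y\<in>Y. W y)"
  proof
    fix y assume y: "y \<in> Y"
    then have "fspan k (W y) \<subseteq> fspan k (\<Union>y\<in>Y. W y)" by (intro fspan_mono) blast
    then show "y \<in> fspan k (\<Union>y\<in>Y. W y)" using W[OF y] by blast
  qed
  then have "v \<in> fspan k (\<Union>y\<in>Y. W y)" using Y(3) fspan_least[OF k] by blast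
  then show ?thesis using W Y(1) by (intro exI[of _ "\<Union>y\<in>Y. W y"]) blast
qed

text \<open>The semi-invariants span the coordinates over \<open>N r\<close>. A basis
  \<open>B\<close> chosen among them has at most \<open>d\<close> elements, hence is algebraically
  independent over \<open>N r\<close>, and adjoining its elements one by one adds one independent
  generator to the fixed field each time.\<close>

theorem rational_top: "rat k (Fix \<Phi>)"
proof -
  have stN: "stable (N r)" by (rule stable_N) simp
  obtain W where W: "\<And>v. v \<in> V \<Longrightarrow> finite (W v) \<and> W v \<subseteq> fspan (N r) V \<and> v \<in> fspan k (W v) \<and> (\<forall>z\<in>W v. semi (N r) z)"
    using semi_invariant_span by metis
  let ?B = "\<Union>v\<in>V. W v"
  interpret lin: pregeometry "fspan (N r)" by (rule pregeometry_fspan[OF subfld_N])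
  have finB: "finite ?B" using W by blast
  obtain B where B: "B \<subseteq> ?B" "lin.indep B" "?B \<subseteq> fspan (N r) B" using lin.ex_basis[OF finB] by blast
  have Bfin: "finite B" using finB B(1) finite_subset by blast
  have V_B: "V \<subseteq> fspan (N r) B"
  proof
    fix v assume v: "v \<in> V"
    have "fspan k (W v) \<subseteq> fspan (N r) (W v)"
    proof
      fix z assume "z \<in> fspan k (W v)"
      then show "z \<in> fspan (N r) (W v)" by induction (use kN in \<open>auto intro: fspan.intros\<close>)
    qed
    moreover have "fspan (N r) (W v) \<subseteq> fspan (N r) B"
      by (rule fspan_least[OF subfld_N]) (use B(3) v in blast)
    ultimately show "v \<in> fspan (N r) B" using W[OF v] by blast
  qed
  have semiB: "semi (N r) y" if "y \<in> B" for y using B(1) W that by blast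
  have B_V: "B \<subseteq> fspan (N r) V" using B(1) W by blast
  have "card B \<le> card V" using lin.card_le[OF _ B(2) B_V] by simp
  also have "card V \<le> card (Lin ` {..<d})" by (rule card_image_le) simp
  finally have card: "card B \<le> card (Lin ` {..<d})" .
  have span_fgen: "fspan (N r) S \<subseteq> fgen (N r \<union> S)" for S
  proof
    fix z assume "z \<in> fspan (N r) S"
    then show "z \<in> fgen (N r \<union> S)"
      by induction (auto intro!: subfld_add[OF subfld_fgen] subfld_mult[OF subfld_fgen] intro: fgen_inc simp: subfld_0[OF subfld_fgen])
  qed
  have gen_V: "gen (N r) (Lin ` {..<d}) x"
  proof (rule gen_base_change[OF k subfld_N])
    show "N r \<subseteq> acl k (x ` cidx n r)" unfolding N_def by (rule fgen_acl)
    show "gen k (cidx n r \<union> Lin ` {..<d}) x" using gen_x by (simp add: Un_commute)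
  qed (auto simp: cidx_def)
  have "V \<subseteq> acl (N r) B" using V_B span_fgen[of B] fgen_acl[of "N r" B] by blast
  then have gen_B: "gen (N r) B (\<lambda>y. y)"
    using gen_spanning[OF subfld_N _ gen_V Bfin card, of "\<lambda>y. y"] by simp
  have "finite B' \<Longrightarrow> B' \<subseteq> B \<Longrightarrow> rat k (Fix (fgen (N r \<union> B'))) \<and> stable (fgen (N r \<union> B'))" for B'
  proof (induction B' rule: finite_induct)
    case empty
    then show ?case using rational_N[of r] stN by (simp add: fgen_subfld)
  next
    case (insert y B')
    let ?M = "fgen (N r \<union> B')"
    have M: "rat k (Fix ?M)" "stable ?M" using insert by auto
    have NM: "N r \<subseteq> ?M" by (auto intro: fgen_inc)
    have semi: "semi ?M y" using semiB[of y] insert.prems NM unfolding semi_def by blast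
    have "y \<notin> alg_cl (fgen (N r \<union> (\<lambda>y. y) ` B'))"
      by (rule gen_transcendental[OF subfld_N gen_mono[OF gen_B]]) (use insert in auto)
    then have tr: "y \<notin> alg_cl ?M" by simp
    obtain w where w: "w \<notin> alg_cl ?M" "Fix (fgen (?M \<union> {y})) = fgen (Fix ?M \<union> {w})"
      using Fix_semi_invariant[OF M(2) semi tr] by blast
    have "w \<notin> alg_cl (Fix ?M)" using w(1) alg_cl_mono[of "Fix ?M" ?M] by (auto simp: Fix_def)
    then have "rat k (Fix (fgen (?M \<union> {y})))" unfolding w(2) by (rule rat_adjoin[OF k M(1)])
    moreover have "stable (fgen (?M \<union> {y}))"
    proof (rule stable_fgen[OF M(2)])
      show "{y} \<subseteq> \<Phi>" using semi by (simp add: semi_def)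
      show "f z \<in> fgen (?M \<union> {y})" if fz: "f \<in> H" "z \<in> {y}" for f z
      proof -
        obtain c where c: "c \<in> ?M" "f z = c * y" using semi fz by (auto simp: semi_def)
        show ?thesis unfolding c(2) by (rule subfld_mult[OF subfld_fgen]) (use c(1) in \<open>auto intro: fgen_inc\<close>)
      qed
    qed
    moreover have "fgen (?M \<union> {y}) = fgen (N r \<union> insert y B')" unfolding fgen_fgen_Un by simp
    ultimately show ?case by simp
  qed
  then have "rat k (Fix (fgen (N r \<union> B)))" using Bfin by blast
  moreover have "fgen (N r \<union> B) = \<Phi>"
  proof
    have "B \<subseteq> \<Phi>" using semiB by (auto simp: semi_def)
    then show "fgen (N r \<union> B) \<subseteq> \<Phi>" by (intro fgen_least[OF subfld_\<Phi>]) (use N\<Phi> in blast)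
    have "V \<subseteq> fgen (N r \<union> B)" using V_B span_fgen[of B] by blast
    moreover have "N r \<subseteq> fgen (N r \<union> B)" by (auto intro: fgen_inc)
    moreover have "k \<union> x ` cidx n r \<subseteq> N r" unfolding N_def by (rule fgen_superset)
    ultimately show "\<Phi> \<subseteq> fgen (N r \<union> B)"
      unfolding \<Phi>_eq L_def by (intro fgen_least) (auto simp: image_Un)
  qed
  ultimately show ?thesis by simp
qed

end

section \<open>The coordinate ring of a representation\<close>

text \<open>A root \<omega> of \<open>1 + X + \<dots> + X ^ (l - 1)\<close> has order
  \<open>l\<close>, and an \<open>l ^ (m - 1)\<close>-th root of it has order \<open>l ^ m\<close>:
  a smaller exponent killing that root could be replaced by its gcd with \<open>l ^ m\<close>, a
  proper power of \<open>l\<close>, which would make \<omega> trivial.\<close>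

lemma ex_primitive_root_of_unity:
  fixes l :: nat
  assumes l: "Factorial_Ring.prime l"
  shows "\<exists>\<zeta> :: 'k::{alg_closed_field, field_char_0}. \<zeta> ^ (l ^ m) = 1 \<and> (\<forall>i. 0 < i \<longrightarrow> i < l ^ m \<longrightarrow> \<zeta> ^ i \<noteq> 1)"
proof (cases m)
  case 0
  then show ?thesis by (intro exI[of _ 1]) auto
next
  case (Suc m')
  have l1: "l > 1" using l by (rule prime_gt_1_nat)
  have "\<exists>\<omega> :: 'k. (\<Sum>j\<le>l - 1. 1 * \<omega> ^ j) = 0" by (rule alg_closed) (use l1 in auto)
  then obtain \<omega> :: 'k where "(\<Sum>j\<le>l - 1. \<omega> ^ j) = 0" by auto
  then have \<omega>: "(\<Sum>j<l. \<omega> ^ j) = 0" using l1 lessThan_Suc_atMost[of "l - 1"] by simp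
  have "\<omega> \<noteq> 1" using \<omega> l1 by auto
  then have \<omega>l: "\<omega> ^ l = 1" using \<omega> geometric_sum[of \<omega> l] by simp
  obtain \<zeta> where \<zeta>: "\<zeta> ^ (l ^ m') = \<omega>" using nth_root_exists[of "l ^ m'" \<omega>] l1 by auto
  have "\<zeta> ^ (l ^ m) = (\<zeta> ^ (l ^ m')) ^ l" unfolding Suc by (simp only: power_Suc2 power_mult)
  then have one: "\<zeta> ^ (l ^ m) = 1" by (simp only: \<zeta> \<omega>l)
  have "\<zeta> ^ i \<noteq> 1" if i: "0 < i" "i < l ^ m" for i
  proof
    assume "\<zeta> ^ i = 1"
    let ?g = "gcd i (l ^ m)"
    obtain a c where "i * a = l ^ m * c + ?g" using bezout_nat[of i "l ^ m"] i by auto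
    then have "(\<zeta> ^ i) ^ a = (\<zeta> ^ (l ^ m)) ^ c * \<zeta> ^ ?g" by (simp flip: power_mult power_add)
    then have g: "\<zeta> ^ ?g = 1" using one \<open>\<zeta> ^ i = 1\<close> by simp
    obtain j where j: "j \<le> m" "?g = l ^ j" using divides_primepow_nat[OF l, of ?g m] by auto
    have "?g \<le> i" using i by (simp add: dvd_imp_le)
    then have "j \<noteq> m" using j(2) i by auto
    then have "l ^ j dvd l ^ m'" using j(1) Suc by (intro le_imp_power_dvd) auto
    then obtain c where "l ^ m' = l ^ j * c" by blast
    then have "\<omega> = 1" using \<zeta> g j(2) by (simp add: power_mult)
    then show False using \<open>\<omega> \<noteq> 1\<close> by blast
  qed
  then show ?thesis using one by blast
qed

locale coordinate_ring = finite_dimensional_vector_space scale Basis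
  for scale :: "'k::field_char_0 \<Rightarrow> 'v::ab_group_add \<Rightarrow> 'v" and Basis +
  fixes \<phi> :: "('v \<Rightarrow> 'k) \<Rightarrow> 'k universal" and b :: "nat \<Rightarrow> 'v" and d :: nat
  assumes \<phi>: "function_field_embedding scale \<phi>" and b: "bij_betw b {..<d} Basis"
begin

abbreviation "k0 \<equiv> range (ground :: 'k \<Rightarrow> 'k universal)"

abbreviation "PV \<equiv> polynomial_functions scale"

definition co :: "nat \<Rightarrow> 'v \<Rightarrow> 'k" where
  "co j v = representation Basis v (b j)"

lemma k0: "subfld k0"
  by (rule subfld_ground)

lemma \<phi>_const: "\<phi> (\<lambda>_. c) = ground c"
  using \<phi> unfolding function_field_embedding_def by blast

lemma \<phi>_add: "p \<in> PV \<Longrightarrow> q \<in> PV \<Longrightarrow> \<phi> (\<lambda>v. p v + q v) = \<phi> p + \<phi> q"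
  using \<phi> unfolding function_field_embedding_def by blast

lemma \<phi>_mult: "p \<in> PV \<Longrightarrow> q \<in> PV \<Longrightarrow> \<phi> (\<lambda>v. p v * q v) = \<phi> p * \<phi> q"
  using \<phi> unfolding function_field_embedding_def by blast

lemma \<phi>_inj: "p \<in> PV \<Longrightarrow> q \<in> PV \<Longrightarrow> \<phi> p = \<phi> q \<longleftrightarrow> p = q"
  using \<phi> unfolding function_field_embedding_def by (meson inj_on_eq_iff)

lemma \<phi>_eq_0: "p \<in> PV \<Longrightarrow> \<phi> p = 0 \<longleftrightarrow> p = (\<lambda>_. 0)"
  using \<phi>_inj[OF _ polynomial_functions.const, of p 0] \<phi>_const[of 0] by (simp add: ground_hom)

lemma \<phi>_combination:
  assumes "finite J" "\<And>j. j \<in> J \<Longrightarrow> m j \<in> PV"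
  shows "(\<lambda>v. \<Sum>j\<in>J. c j * m j v) \<in> PV \<and> \<phi> (\<lambda>v. \<Sum>j\<in>J. c j * m j v) = (\<Sum>j\<in>J. ground (c j) * \<phi> (m j))"
  using assms
proof (induction J rule: finite_induct)
  case empty
  then show ?case using \<phi>_const[of 0] polynomial_functions.const[of 0] by (simp add: ground_hom)
next
  case (insert j J)
  have 1: "(\<lambda>v. c j * m j v) \<in> PV" using insert.prems by (intro polynomial_functions.mult polynomial_functions.const) auto
  have 2: "\<phi> (\<lambda>v. c j * m j v) = ground (c j) * \<phi> (m j)"
    using \<phi>_mult[OF polynomial_functions.const, of "m j" "c j"] insert.prems by (simp add: \<phi>_const)
  show ?case
    using insert polynomial_functions.add[OF 1, of "\<lambda>v. \<Sum>j\<in>J. c j * m j v"] \<phi>_add[OF 1, of "\<lambda>v. \<Sum>j\<in>J. c j * m j v"] 2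
    by simp
qed

lemma b_Basis: "j < d \<Longrightarrow> b j \<in> Basis"
  using b by (auto simp: bij_betw_def)

lemma b_eq: "i < d \<Longrightarrow> j < d \<Longrightarrow> b i = b j \<longleftrightarrow> i = j"
  using b by (auto simp: bij_betw_def inj_on_def)

lemma linear_co: "Vector_Spaces.linear scale (*) (co j)"
proof -
  have "vector_space ((*) :: 'k \<Rightarrow> 'k \<Rightarrow> 'k)" by unfold_locales (auto simp: algebra_simps)
  then show ?thesis
    unfolding Vector_Spaces.linear_iff co_def using vector_space_axioms
    by (auto simp: representation_add[OF independent_Basis] representation_scale[OF independent_Basis] span_Basis)
qed

lemma co_PV: "co j \<in> PV"
  by (rule polynomial_functions.linear[OF linear_co])

lemma co_sum: "j < d \<Longrightarrow> co j (\<Sum>i<d. scale (e i) (b i)) = e j"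
proof -
  assume j: "j < d"
  interpret c: Vector_Spaces.linear scale "(*)" "co j" by (rule linear_co)
  have "co j (\<Sum>i<d. scale (e i) (b i)) = (\<Sum>i<d. e i * co j (b i))"
    by (simp add: c.sum c.scale)
  also have "\<dots> = (\<Sum>i<d. if i = j then e i else 0)"
    by (intro sum.cong) (use j b_Basis b_eq in \<open>auto simp: co_def representation_basis[OF independent_Basis]\<close>)
  also have "\<dots> = e j" using j by simp
  finally show ?thesis .
qed

lemma linear_expansion:
  assumes "Vector_Spaces.linear scale (*) m"
  shows "m = (\<lambda>v. \<Sum>j<d. m (b j) * co j v)"
proof
  fix v
  interpret m: Vector_Spaces.linear scale "(*)" m by fact
  have "v = (\<Sum>c\<in>Basis. scale (representation Basis v c) c)"
    by (rule sum_representation_eq[OF independent_Basis _ finite_Basis, symmetric]) (simp_all add: span_Basis)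
  then have "m v = m (\<Sum>c\<in>Basis. scale (representation Basis v c) c)" by (rule arg_cong)
  also have "\<dots> = (\<Sum>c\<in>Basis. representation Basis v c * m c)" unfolding m.sum m.scale ..
  also have "\<dots> = (\<Sum>j<d. representation Basis v (b j) * m (b j))"
    by (rule sum.reindex_bij_betw[OF b, symmetric])
  finally show "m v = (\<Sum>j<d. m (b j) * co j v)" by (simp add: co_def mult.commute)
qed

lemma \<phi>_linear: "Vector_Spaces.linear scale (*) m \<Longrightarrow> \<phi> m = (\<Sum>j<d. ground (m (b j)) * \<phi> (co j))"
  using \<phi>_combination[of "{..<d}" co "\<lambda>j. m (b j)"] linear_expansion[of m] co_PV by simp

text \<open>One function \<open>P\<close> is tracked through its image under \<open>\<phi>\<close>
  and through its values at ground points; in \<open>gen_co\<close> injectivity of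
  \<open>\<phi>\<close> gives \<open>P = 0\<close>, and the values then show that \<open>p\<close>
  vanishes.\<close>

lemma pf_\<phi>:
  assumes "p \<in> pf k0 {..<d}"
  shows "\<exists>P\<in>PV. p (\<lambda>j. \<phi> (co j)) = \<phi> P \<and>
    (\<forall>e. p (\<lambda>j. ground (e j)) = ground (P (\<Sum>i<d. scale (e i) (b i))))"
  using assms
proof induction
  case (const c)
  then obtain a where "c = ground a" by blast
  then show ?case by (intro bexI[of _ "\<lambda>_. a"]) (auto simp: \<phi>_const intro: polynomial_functions.const)
next
  case (proj j)
  then show ?case by (intro bexI[of _ "co j"]) (auto simp: co_sum co_PV)
next
  case (add p q)
  then obtain P Q where PQ: "P \<in> PV" "p (\<lambda>j. \<phi> (co j)) = \<phi> P" "\<forall>e. p (\<lambda>j. ground (e j)) = ground (P (\<Sum>i<d. scale (e i) (b i)))"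
    "Q \<in> PV" "q (\<lambda>j. \<phi> (co j)) = \<phi> Q" "\<forall>e. q (\<lambda>j. ground (e j)) = ground (Q (\<Sum>i<d. scale (e i) (b i)))" by blast
  then show ?case
    by (intro bexI[of _ "\<lambda>v. P v + Q v"]) (auto simp: \<phi>_add ground_hom intro: polynomial_functions.add)
next
  case (mult p q)
  then obtain P Q where PQ: "P \<in> PV" "p (\<lambda>j. \<phi> (co j)) = \<phi> P" "\<forall>e. p (\<lambda>j. ground (e j)) = ground (P (\<Sum>i<d. scale (e i) (b i)))"
    "Q \<in> PV" "q (\<lambda>j. \<phi> (co j)) = \<phi> Q" "\<forall>e. q (\<lambda>j. ground (e j)) = ground (Q (\<Sum>i<d. scale (e i) (b i)))" by blast
  then show ?case
    by (intro bexI[of _ "\<lambda>v. P v * Q v"]) (auto simp: \<phi>_mult ground_hom intro: polynomial_functions.mult)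
qed

lemma \<phi>_pf:
  assumes "P \<in> PV"
  shows "\<exists>p\<in>pf k0 {..<d}. \<phi> P = p (\<lambda>j. \<phi> (co j))"
  using assms
proof induction
  case (const c)
  then show ?case by (intro bexI[of _ "\<lambda>_. ground c"]) (auto simp: \<phi>_const intro: pf.const)
next
  case (linear m)
  then show ?case
    by (intro bexI[of _ "\<lambda>e. \<Sum>j<d. ground (m (b j)) * e j"])
      (auto simp: \<phi>_linear intro!: pf_sum[OF k0] pf.intros)
next
  case (add P Q)
  then obtain p q where "p \<in> pf k0 {..<d}" "\<phi> P = p (\<lambda>j. \<phi> (co j))" "q \<in> pf k0 {..<d}" "\<phi> Q = q (\<lambda>j. \<phi> (co j))" by blast
  then show ?case using add.hyps
    by (intro bexI[of _ "\<lambda>e. p e + q e"]) (auto simp: \<phi>_add intro: pf.add)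
next
  case (mult P Q)
  then obtain p q where "p \<in> pf k0 {..<d}" "\<phi> P = p (\<lambda>j. \<phi> (co j))" "q \<in> pf k0 {..<d}" "\<phi> Q = q (\<lambda>j. \<phi> (co j))" by blast
  then show ?case using mult.hyps
    by (intro bexI[of _ "\<lambda>e. p e * q e"]) (auto simp: \<phi>_mult intro: pf.mult)
qed

lemma gen_co: "gen k0 {..<d} (\<lambda>j. \<phi> (co j))"
  unfolding gen_def
proof (intro ballI impI allI)
  fix p e assume p: "p \<in> pf k0 {..<d}" "p (\<lambda>j. \<phi> (co j)) = 0"
  obtain P where P: "P \<in> PV" "p (\<lambda>j. \<phi> (co j)) = \<phi> P"
    "\<forall>e. p (\<lambda>j. ground (e j)) = ground (P (\<Sum>i<d. scale (e i) (b i)))" using pf_\<phi>[OF p(1)] by blast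
  then have P0: "P = (\<lambda>_. 0)" using p(2) \<phi>_eq_0 by simp
  show "p e = 0"
  proof (rule pf_zero[OF _ p(1) infinite_subfld[OF k0]])
    fix e :: "nat \<Rightarrow> 'k universal" assume "\<And>i. i \<in> {..<d} \<Longrightarrow> e i \<in> k0"
    then have "\<forall>i\<in>{..<d}. \<exists>a. e i = ground a" by blast
    then obtain a where "\<And>i. i \<in> {..<d} \<Longrightarrow> e i = ground (a i)" by metis
    then have "p e = p (\<lambda>i. ground (a i))" by (intro pf_cong[OF p(1)])
    then show "p e = 0" using P(3) P0 by (simp add: ground_hom)
  qed simp
qed

lemma linear_comp:
  "Vector_Spaces.linear scale (*) m \<Longrightarrow> Vector_Spaces.linear scale scale h \<Longrightarrow>
    Vector_Spaces.linear scale (*) (m \<circ> h)"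
  by (rule Vector_Spaces.linear_compose)

lemma PV_comp:
  assumes h: "Vector_Spaces.linear scale scale h" and p: "p \<in> PV"
  shows "p \<circ> h \<in> PV"
  using p
proof induction
  case (const c)
  then show ?case using polynomial_functions.const[of c] by (simp add: comp_def)
next
  case (linear m)
  then show ?case by (intro polynomial_functions.linear linear_comp h)
next
  case (add p q)
  then show ?case using polynomial_functions.add[of "p \<circ> h" scale "q \<circ> h"] by (simp add: comp_def)
next
  case (mult p q)
  then show ?case using polynomial_functions.mult[of "p \<circ> h" scale "q \<circ> h"] by (simp add: comp_def)
qed

end

section \<open>The action on the tower\<close>

locale rep_tower = coordinate_ring scale Basis \<phi> b d +
  norm_family "range (ground :: 'k \<Rightarrow> 'k universal)" n r d \<zeta> x + G: group G + A: comm_group A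
  for scale :: "'k::field_char_0 \<Rightarrow> 'v::ab_group_add \<Rightarrow> 'v" and Basis \<phi> b d n r \<zeta> x
    and G :: "('g, 'g1) monoid_scheme" and A :: "('a, 'a1) monoid_scheme" +
  fixes \<pi> :: "'g \<Rightarrow> 'a" and \<rho> :: "'g \<Rightarrow> 'v \<Rightarrow> 'v" and gs :: "nat \<Rightarrow> 'g"
  assumes x_Lin: "j < d \<Longrightarrow> x (Lin j) = \<phi> (co j)"
    and gs: "bij_betw gs {..<r} (carrier G)" and n_order: "n = Coset.order G"
    and \<pi>: "\<pi> \<in> hom G A"
    and central: "\<And>g h. g \<in> carrier G \<Longrightarrow> h \<in> carrier G \<Longrightarrow> \<pi> g = \<one>\<^bsub>A\<^esub> \<Longrightarrow> g \<otimes>\<^bsub>G\<^esub> h = h \<otimes>\<^bsub>G\<^esub> g"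
    and \<rho>: "representation_on scale G \<rho>"
begin

abbreviation "\<Phi> \<equiv> L r"

abbreviation act_inv :: "'g \<Rightarrow> 'v \<Rightarrow> 'v" where
  "act_inv g \<equiv> \<rho> (inv\<^bsub>G\<^esub> g)"

lemma finite_G: "finite (carrier G)"
  using gs bij_betw_finite by blast

lemma linear_\<rho>: "g \<in> carrier G \<Longrightarrow> Vector_Spaces.linear scale scale (\<rho> g)"
  using \<rho> by (simp add: representation_on_def)

lemma \<rho>_mult: "g \<in> carrier G \<Longrightarrow> h \<in> carrier G \<Longrightarrow> \<rho> (g \<otimes>\<^bsub>G\<^esub> h) = \<rho> g \<circ> \<rho> h"
  using \<rho> by (simp add: representation_on_def)

lemma \<rho>_one: "\<rho> \<one>\<^bsub>G\<^esub> = id"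
  using \<rho> by (simp add: representation_on_def)

lemma act_inv_mult: "g \<in> carrier G \<Longrightarrow> h \<in> carrier G \<Longrightarrow> act_inv (g \<otimes>\<^bsub>G\<^esub> h) = act_inv h \<circ> act_inv g"
  by (simp add: G.inv_mult_group \<rho>_mult)

lemma PV_act: "g \<in> carrier G \<Longrightarrow> p \<in> PV \<Longrightarrow> p \<circ> act_inv g \<in> PV"
  by (rule PV_comp) (simp_all add: linear_\<rho>)

lemma \<phi>_\<Phi>: "p \<in> PV \<Longrightarrow> \<phi> p \<in> \<Phi>" and \<phi>_L0: "p \<in> PV \<Longrightarrow> \<phi> p \<in> L 0"
proof -
  assume "p \<in> PV"
  then obtain q where q: "q \<in> pf k0 {..<d}" "\<phi> p = q (\<lambda>j. \<phi> (co j))" using \<phi>_pf by blast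
  have "\<phi> (co j) \<in> L 0" if "j < d" for j
    using x_Lin[OF that] that unfolding L_def by (metis UnCI fgen_inc imageI lessThan_iff)
  then show L0: "\<phi> p \<in> L 0" unfolding q(2) by (intro pf_value[OF q(1)] subfld_L k_subset_L) simp
  then show "\<phi> p \<in> \<Phi>" using L_mono[of 0 r] by blast
qed

text \<open>The automorphism \<open>f\<close> acts on \<open>V\<close> through \<open>g\<close> and on the Kummer generators through \<open>e \<in> (\<int>/n)\<^sup>r\<close>.\<close>

definition tag :: "('k universal \<Rightarrow> 'k universal) \<Rightarrow> 'g \<Rightarrow> (nat \<Rightarrow> nat) \<Rightarrow> bool" where
  "tag f g e \<longleftrightarrow> f \<in> auts k0 \<Phi> \<and> (\<forall>p\<in>PV. f (\<phi> p) = \<phi> (p \<circ> act_inv g)) \<and>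
     (\<forall>i<r. f (u i) = \<zeta> ^ e i * u i \<and> (\<forall>s\<in>box n i. f (zf i s) = zf i (shift n i e s)))"

lemma tag_auts: "tag f g e \<Longrightarrow> f \<in> auts k0 \<Phi>"
  by (simp add: tag_def)

lemma auts_\<Phi>:
  assumes "f \<in> auts k0 \<Phi>"
  shows "c \<in> k0 \<Longrightarrow> f c = c" "y \<in> \<Phi> \<Longrightarrow> z \<in> \<Phi> \<Longrightarrow> f (y * z) = f y * f z"
    "y \<in> \<Phi> \<Longrightarrow> z \<in> \<Phi> \<Longrightarrow> f (y + z) = f y + f z" "y \<in> \<Phi> \<Longrightarrow> f y \<in> \<Phi>"
  using assms by (auto simp: auts_def)

lemma x_\<Phi>: "i \<in> Lin ` {..<d} \<union> cidx n r \<Longrightarrow> x i \<in> \<Phi>"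
  unfolding L_def by (auto intro: fgen_inc)

lemma k0_\<Phi>: "k0 \<subseteq> \<Phi>"
  by (rule k_subset_L)

lemma u_\<Phi>: "i < r \<Longrightarrow> u i \<in> \<Phi>" and zf_\<Phi>: "i < r \<Longrightarrow> s \<in> box n i \<Longrightarrow> zf i s \<in> \<Phi>"
  using u_N[of i r] zf_N[of i r s] N_subset_L by blast+

lemma tag_id: "tag id \<one>\<^bsub>G\<^esub> (\<lambda>_. 0)"
  by (simp add: tag_def auts_id \<rho>_one shift_zero)

lemma tag_comp:
  assumes f: "tag f g e" and f': "tag f' g' e'" and g: "g \<in> carrier G" "g' \<in> carrier G"
  shows "tag (f \<circ> f') (g \<otimes>\<^bsub>G\<^esub> g') (\<lambda>i. e i + e' i)"
  unfolding tag_def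
proof (intro conjI ballI allI impI)
  note a = tag_auts[OF f] tag_auts[OF f']
  show "f \<circ> f' \<in> auts k0 \<Phi>" by (rule auts_comp[OF a])
  fix p assume p: "p \<in> PV"
  then have "(f \<circ> f') (\<phi> p) = \<phi> (p \<circ> act_inv g' \<circ> act_inv g)"
    using f f' PV_act[OF g(2) p] by (simp add: tag_def)
  then show "(f \<circ> f') (\<phi> p) = \<phi> (p \<circ> act_inv (g \<otimes>\<^bsub>G\<^esub> g'))" using act_inv_mult[OF g] by (simp add: comp_assoc)
next
  note a = tag_auts[OF f] tag_auts[OF f']
  fix i assume i: "i < r"
  have \<zeta>k: "\<zeta> ^ m \<in> k0" for m by (rule subfld_power[OF k0 \<zeta>(1)])
  have "(f \<circ> f') (u i) = f (\<zeta> ^ e' i * u i)" using f' i by (simp add: tag_def)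
  also have "\<dots> = \<zeta> ^ e' i * f (u i)"
    using auts_\<Phi>(2)[OF a(1), of "\<zeta> ^ e' i" "u i"] auts_\<Phi>(1)[OF a(1) \<zeta>k] \<zeta>k k0_\<Phi> u_\<Phi>[OF i] by auto
  also have "\<dots> = \<zeta> ^ (e i + e' i) * u i" using f i by (simp add: tag_def power_add)
  finally show "(f \<circ> f') (u i) = \<zeta> ^ (e i + e' i) * u i" .
  fix s assume s: "s \<in> box n i"
  show "(f \<circ> f') (zf i s) = zf i (shift n i (\<lambda>i. e i + e' i) s)"
    using f f' i s shift_in[OF n] by (simp add: tag_def shift_shift)
qed

lemma tag_funpow: "tag f g e \<Longrightarrow> g \<in> carrier G \<Longrightarrow> tag (f ^^ m) (g [^]\<^bsub>G\<^esub> m) (\<lambda>i. m * e i)"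
proof (induction m)
  case 0
  then show ?case using tag_id by (simp add: id_def)
next
  case (Suc m)
  have "tag (f ^^ m \<circ> f) (g [^]\<^bsub>G\<^esub> m \<otimes>\<^bsub>G\<^esub> g) (\<lambda>i. m * e i + e i)"
    using Suc by (intro tag_comp) auto
  moreover have "f ^^ m \<circ> f = f ^^ Suc m" by (rule funpow_Suc_right[symmetric])
  ultimately show ?case by (simp add: add.commute del: funpow.simps)
qed

text \<open>An automorphism is determined by its values on the generators, and these depend on
  \<open>e\<close> only modulo \<open>n\<close>. Identities in \<open>H\<close> can thus be computed
  in \<open>G\<close> and \<open>(\<int>/n)\<^sup>r\<close>.\<close>

lemma tag_unique:
  assumes f: "tag f g e" and f': "tag f' g e'" and e: "\<And>i. i < r \<Longrightarrow> e i mod n = e' i mod n"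
  shows "f = f'"
proof (rule auts_eqI[OF k0, of _ x "Lin ` {..<d} \<union> cidx n r"])
  show "f \<in> auts k0 (fgen (k0 \<union> x ` (Lin ` {..<d} \<union> cidx n r)))"
    "f' \<in> auts k0 (fgen (k0 \<union> x ` (Lin ` {..<d} \<union> cidx n r)))"
    using tag_auts[OF f] tag_auts[OF f'] by (simp_all add: L_def)
  fix i assume "i \<in> Lin ` {..<d} \<union> cidx n r"
  then consider j where "j < d" "i = Lin j" | j where "j < r" "i = Chr j"
    | j s where "j < r" "s \<in> box n j" "s \<noteq> box0 j" "i = Nrm j s" by (auto simp: cidx_def)
  then show "f (x i) = f' (x i)"
  proof cases
    case 1
    then show ?thesis using f f' co_PV by (simp add: tag_def x_Lin)
  next
    case 2
    have "\<zeta> ^ e j = \<zeta> ^ e' j" using e[OF 2(1)] \<zeta>_pow_mod by metis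
    then show ?thesis using f f' 2 by (simp add: tag_def)
  next
    case 3
    then have "x i = zf j s" by (simp add: zf_def)
    moreover have "shift n j e s = shift n j e' s"
    proof
      fix l
      have "(s l + e l) mod n = (s l + e' l) mod n" if "l < j"
        using e[of l] that 3(1) by (metis less_trans mod_add_right_eq)
      then show "shift n j e s l = shift n j e' s l" by (simp add: shift_def)
    qed
    ultimately show ?thesis using f f' 3 by (simp add: tag_def)
  qed
qed

lemma \<phi>_act_span: "g \<in> carrier G \<Longrightarrow> \<phi> (co j \<circ> act_inv g) = (\<Sum>i<d. ground (co j (act_inv g (b i))) * \<phi> (co i))"
  using \<phi>_linear[OF linear_comp[OF linear_co linear_\<rho>], of "inv\<^bsub>G\<^esub> g" j] by simp

text \<open>The matrix of \<open>\<rho> g\<close> undoes that of its inverse, so the transformed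
  coordinates generate the original ones.\<close>

lemma \<phi>_act_span': "g \<in> carrier G \<Longrightarrow> \<phi> (co j) = (\<Sum>i<d. ground (co j (\<rho> g (b i))) * \<phi> (co i \<circ> act_inv g))"
proof -
  assume g: "g \<in> carrier G"
  have "co j (\<rho> g w) = (\<Sum>i<d. co j (\<rho> g (b i)) * co i w)" for w
    using fun_cong[OF linear_expansion[OF linear_comp[OF linear_co linear_\<rho>[OF g]]], of j w] unfolding comp_def .
  then have "co j \<circ> \<rho> g \<circ> act_inv g = (\<lambda>v. \<Sum>i<d. co j (\<rho> g (b i)) * (co i \<circ> act_inv g) v)"
    unfolding comp_def by (intro ext)
  moreover have "co j \<circ> \<rho> g \<circ> act_inv g = co j"
    using \<rho>_mult[of g "inv\<^bsub>G\<^esub> g"] g \<rho>_one by (simp add: comp_assoc)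
  ultimately have "\<phi> (co j) = \<phi> (\<lambda>v. \<Sum>i<d. co j (\<rho> g (b i)) * (co i \<circ> act_inv g) v)" by simp
  also have "\<dots> = (\<Sum>i<d. ground (co j (\<rho> g (b i))) * \<phi> (co i \<circ> act_inv g))"
    by (rule conjunct2[OF \<phi>_combination]) (use PV_act[OF g co_PV] in \<open>simp_all only: finite_lessThan\<close>)
  finally show ?thesis .
qed

text \<open>The images \<open>x'\<close> of the free variables are prescribed. They generate the old
  variables, so by counting they form a generic family and the substitution is an automorphism. Here
  \<open>g\<close> and \<open>e\<close> are unrelated; their compatibility over \<open>A\<close> is
  imposed in the definition of \<open>H\<close>.\<close>

lemma ex_tag:
  assumes g: "g \<in> carrier G"
  shows "\<exists>f. tag f g e"
proof -
  let ?I = "Lin ` {..<d} \<union> cidx n r"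
  define x' where "x' i = (case i of Lin j \<Rightarrow> \<phi> (co j \<circ> act_inv g) | Chr i \<Rightarrow> \<zeta> ^ e i * u i | Nrm i s \<Rightarrow> zf i (shift n i e s))" for i
  let ?F = "fgen (k0 \<union> x' ` ?I)"
  have \<zeta>k: "\<zeta> ^ m \<in> k0" for m by (rule subfld_power[OF k0 \<zeta>(1)])
  have kF: "k0 \<subseteq> ?F" by (auto intro: fgen_inc)
  have xF: "x' i \<in> ?F" if "i \<in> ?I" for i using that by (intro fgen_inc) blast
  have uF: "u i \<in> ?F" if i: "i < r" for i
  proof -
    have "x' (Chr i) \<in> ?F" by (rule xF) (use i in \<open>auto simp: cidx_def\<close>)
    then have "x' (Chr i) / \<zeta> ^ e i \<in> ?F" using \<zeta>k kF by (intro subfld_divide[OF subfld_fgen]) auto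
    then show ?thesis using \<zeta>_nonzero by (simp add: x'_def)
  qed
  have zF: "zf i t \<in> ?F" if i: "i < r" and t: "t \<in> box n i" for i t
  proof -
    have *: "zf i (shift n i e s) \<in> ?F" if "s \<in> box n i - {box0 i}" for s
    proof -
      have "x' (Nrm i s) \<in> ?F" by (rule xF) (use i that in \<open>auto simp: cidx_def\<close>)
      then show ?thesis by (simp add: x'_def)
    qed
    have bij: "bij_betw (shift n i e) (box n i) (box n i)" by (rule bij_shift[OF n])
    have img: "shift n i e ` box n i = box n i" using bij by (simp add: bij_betw_def)
    have other: "zf i t \<in> ?F" if t': "t \<in> box n i - {shift n i e (box0 i)}" for t
    proof -
      have "t \<in> shift n i e ` box n i" using t' img by simp
      then obtain s where s: "s \<in> box n i" "t = shift n i e s" by blast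
      then have "s \<noteq> box0 i" using t' by blast
      then show ?thesis using *[of s] s by simp
    qed
    \<comment> \<open>The conjugate with this index is the image of the dependent one and not itself
      a prescribed value; the norm equation recovers it from the others.\<close>
    let ?t0 = "shift n i e (box0 i)"
    have t0: "?t0 \<in> box n i" by (rule shift_in[OF n])
    have "zf i ?t0 * (\<Prod>t\<in>box n i - {?t0}. zf i t) = u i ^ n"
      using prod.remove[OF finite_box t0, of "zf i"] zf_prod[OF i] by simp
    moreover have nz: "(\<Prod>t\<in>box n i - {?t0}. zf i t) \<noteq> 0" using zf_nonzero[OF i] by simp
    ultimately have "zf i ?t0 = u i ^ n / (\<Prod>t\<in>box n i - {?t0}. zf i t)" by (simp add: eq_divide_eq)
    also have "\<dots> \<in> ?F"
      using uF[OF i] other by (intro subfld_divide[OF subfld_fgen] subfld_power[OF subfld_fgen] subfld_prod[OF subfld_fgen]) auto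
    finally show ?thesis using other[of t] t by (cases "t = ?t0") auto
  qed
  have "x ` ?I \<subseteq> ?F"
  proof
    fix y assume "y \<in> x ` ?I"
    then consider j where "j < d" "y = x (Lin j)" | j where "j < r" "y = u j"
      | j s where "j < r" "s \<in> box n j" "s \<noteq> box0 j" "y = x (Nrm j s)" by (auto simp: cidx_def)
    then show "y \<in> ?F"
    proof cases
      case 1
      have "\<phi> (co i \<circ> act_inv g) \<in> ?F" if "i < d" for i
        using xF[of "Lin i"] that by (simp add: x'_def)
      then have "\<phi> (co j) \<in> ?F"
        unfolding \<phi>_act_span'[OF g, of j] using kF by (intro subfld_sum[OF subfld_fgen] subfld_mult[OF subfld_fgen]) auto
      then show ?thesis using 1 by (simp add: x_Lin)
    next
      case 2
      then show ?thesis using uF by simp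
    next
      case 3
      then have "y = zf j s" by (simp add: zf_def)
      then show ?thesis using zF 3 by simp
    qed
  qed
  then have "x ` ?I \<subseteq> acl k0 (x' ` ?I)" using fgen_acl[of k0 "x' ` ?I"] by blast
  then have gen': "gen k0 ?I x'" using gen_spanning[OF k0 _ gen_x, of ?I x'] by simp
  have x'\<Phi>: "x' i \<in> \<Phi>" if "i \<in> ?I" for i
  proof -
    from that consider j where "j < d" "i = Lin j" | j where "j < r" "i = Chr j"
      | j s where "j < r" "s \<in> box n j" "i = Nrm j s" by (auto simp: cidx_def)
    then show ?thesis
    proof cases
      case 1
      then show ?thesis using \<phi>_\<Phi>[OF PV_act[OF g co_PV]] by (simp add: x'_def)
    next
      case 2
      then show ?thesis using u_\<Phi> \<zeta>k k0_\<Phi> by (auto simp: x'_def intro!: subfld_mult[OF subfld_L])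
    next
      case 3
      then show ?thesis using zf_\<Phi> shift_in[OF n] by (simp add: x'_def)
    qed
  qed
  obtain f where f: "f \<in> auts k0 \<Phi>" "\<And>i. i \<in> ?I \<Longrightarrow> f (x i) = x' i"
    using ex_aut[OF k0 gen_x gen'] x'\<Phi> unfolding L_def by blast
  have f_u: "f (u i) = \<zeta> ^ e i * u i" if "i < r" for i
    using f(2)[of "Chr i"] that by (simp add: x'_def cidx_def)
  have f_Nrm: "f (x (Nrm i s)) = zf i (shift n i e s)" if "i < r" "s \<in> box n i - {box0 i}" for i s
    using f(2)[of "Nrm i s"] that by (auto simp: x'_def cidx_def)
  have f_pf: "f (p x) = p (\<lambda>i. f (x i))" if "p \<in> pf k0 ?I" for p
    by (rule auts_pf[OF f(1) subfld_L k0_\<Phi> x_\<Phi> that])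
  have "f (zf i s) = zf i (shift n i e s)" if i: "i < r" and s: "s \<in> box n i" for i s
  proof (cases "s = box0 i")
    case False
    then show ?thesis using f_Nrm[OF i, of s] s by (simp add: zf_def)
  next
    case True
    \<comment> \<open>The dependent conjugate is no free variable, so its image is computed from the
      norm equation: \<open>f\<close> fixes \<open>u i ^ n\<close> and sends every other factor to
      its shift.\<close>
    let ?P = "\<Prod>t\<in>box n i - {box0 i}. x (Nrm i t)"
    have Nrm_I: "Nrm i t \<in> ?I" if "t \<in> box n i - {box0 i}" for t using that i by (auto simp: cidx_def)
    have P0: "?P \<noteq> 0" using x_nonzero Nrm_I by simp
    have P\<Phi>: "?P \<in> \<Phi>" by (intro subfld_prod[OF subfld_L] x_\<Phi> Nrm_I)
    have "f ?P = (\<Prod>t\<in>box n i - {box0 i}. f (x (Nrm i t)))"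
      by (rule f_pf[of "\<lambda>e. \<Prod>t\<in>box n i - {box0 i}. e (Nrm i t)"]) (intro pf_prod[OF k0] pf.proj Nrm_I)
    also have "\<dots> = (\<Prod>t\<in>box n i - {box0 i}. zf i (shift n i e t))"
      by (rule prod.cong) (use f_Nrm[OF i] in auto)
    finally have fP: "f ?P = (\<Prod>t\<in>box n i - {box0 i}. zf i (shift n i e t))" .
    have "f (u i ^ n) = f (u i) ^ n"
      by (rule f_pf[of "\<lambda>e. e (Chr i) ^ n"]) (intro pf_power[OF k0] pf.proj, use i in \<open>auto simp: cidx_def\<close>)
    also have "\<dots> = u i ^ n" using f_u[OF i] \<zeta>(2) by (simp add: power_mult_distrib mult.commute flip: power_mult) (simp add: power_mult)
    also have "\<dots> = (\<Prod>t\<in>box n i. zf i (shift n i e t))"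
      using prod.reindex_bij_betw[OF bij_shift[OF n], of "zf i" i e] zf_prod[OF i] by simp
    also have "\<dots> = zf i (shift n i e (box0 i)) * f ?P"
      unfolding fP by (rule prod.remove) (simp_all add: box0_in n)
    finally have 1: "f (u i ^ n) = zf i (shift n i e (box0 i)) * f ?P" .
    have "zf i (box0 i) * ?P = u i ^ n" using P0 by (simp add: zf_def)
    then have "f (zf i (box0 i)) * f ?P = f (u i ^ n)"
      using auts_\<Phi>(2)[OF f(1) zf_\<Phi>[OF i box0_in[OF n]] P\<Phi>] by simp
    moreover have "f ?P \<noteq> 0"
      unfolding fP using zf_nonzero[OF i shift_in[OF n]] by simp
    ultimately show ?thesis using 1 True by simp
  qed
  moreover have "f (\<phi> p) = \<phi> (p \<circ> act_inv g)" if "p \<in> PV" for p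
    using that
  proof induction
    case (const c)
    then show ?case using auts_\<Phi>(1)[OF f(1)] by (simp add: \<phi>_const comp_def)
  next
    case (linear m)
    have m: "m \<circ> act_inv g = (\<lambda>v. \<Sum>j<d. m (b j) * (co j \<circ> act_inv g) v)"
    proof
      fix v show "(m \<circ> act_inv g) v = (\<Sum>j<d. m (b j) * (co j \<circ> act_inv g) v)"
        using fun_cong[OF linear_expansion[OF linear], of "act_inv g v"] unfolding comp_def .
    qed
    have "f (\<phi> m) = f (\<Sum>j<d. ground (m (b j)) * x (Lin j))"
      using \<phi>_linear[OF linear] by (simp add: x_Lin)
    also have "\<dots> = (\<Sum>j<d. ground (m (b j)) * f (x (Lin j)))"
      by (rule f_pf[of "\<lambda>e. \<Sum>j<d. ground (m (b j)) * e (Lin j)"])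
        (intro pf_sum[OF k0] pf.mult pf.const pf.proj, auto)
    also have "\<dots> = (\<Sum>j<d. ground (m (b j)) * \<phi> (co j \<circ> act_inv g))"
      by (rule sum.cong) (use f(2) in \<open>auto simp: x'_def\<close>)
    also have "\<dots> = \<phi> (m \<circ> act_inv g)"
      unfolding m by (rule conjunct2[OF \<phi>_combination, symmetric])
        (use PV_act[OF g co_PV] in \<open>simp_all only: finite_lessThan\<close>)
    finally show ?case .
  next
    case (add p q)
    then show ?case
      using \<phi>_add[OF PV_act[OF g] PV_act[OF g], of p q] auts_\<Phi>(3)[OF f(1) \<phi>_\<Phi> \<phi>_\<Phi>, of p q]
      by (simp add: \<phi>_add comp_def)
  next
    case (mult p q)
    then show ?case
      using \<phi>_mult[OF PV_act[OF g] PV_act[OF g], of p q] auts_\<Phi>(2)[OF f(1) \<phi>_\<Phi> \<phi>_\<Phi>, of p q]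
      by (simp add: \<phi>_mult comp_def)
  qed
  ultimately show ?thesis using f(1) f_u by (auto simp: tag_def)
qed

text \<open>The group acting on the tower is the fibre product of \<open>G\<close> and \<open>(\<int>/n)\<^sup>r\<close> over \<open>A\<close>, where \<open>e\<close> is
  mapped to the product of the \<open>\<pi> (gs i) ^ e i\<close>.\<close>

definition cond :: "'g \<Rightarrow> (nat \<Rightarrow> nat) \<Rightarrow> bool" where
  "cond g e \<longleftrightarrow> \<pi> g = finprod A (\<lambda>i. \<pi> (gs i) [^]\<^bsub>A\<^esub> e i) {..<r}"

definition H :: "('k universal \<Rightarrow> 'k universal) set" where
  "H = {f. \<exists>g\<in>carrier G. \<exists>e. cond g e \<and> tag f g e}"

text \<open>The copy in \<open>H\<close> of the kernel of \<open>\<pi>\<close>; with zero exponents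
  it acts on the coordinates of the representation only.\<close>

definition T :: "('k universal \<Rightarrow> 'k universal) set" where
  "T = {f. \<exists>g\<in>carrier G. \<pi> g = \<one>\<^bsub>A\<^esub> \<and> tag f g (\<lambda>_. 0)}"

definition \<sigma> :: "nat \<Rightarrow> 'k universal \<Rightarrow> 'k universal" where
  "\<sigma> j = (SOME f. tag f (gs j) (\<lambda>i. of_bool (i = j)))"

lemma gs_G: "j < r \<Longrightarrow> gs j \<in> carrier G"
  using gs by (auto simp: bij_betw_def)

lemma \<pi>_A: "g \<in> carrier G \<Longrightarrow> \<pi> g \<in> carrier A"
  using \<pi> by (auto simp: hom_def)

lemma \<pi>_mult: "g \<in> carrier G \<Longrightarrow> h \<in> carrier G \<Longrightarrow> \<pi> (g \<otimes>\<^bsub>G\<^esub> h) = \<pi> g \<otimes>\<^bsub>A\<^esub> \<pi> h"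
  using \<pi> by (auto simp: hom_def)

lemma \<pi>_one: "\<pi> \<one>\<^bsub>G\<^esub> = \<one>\<^bsub>A\<^esub>"
  using group_hom.hom_one[of G A \<pi>] \<pi> by (simp add: group_hom_def group_hom_axioms_def G.group_axioms A.group_axioms)

lemma \<pi>_inv: "g \<in> carrier G \<Longrightarrow> \<pi> (inv\<^bsub>G\<^esub> g) = inv\<^bsub>A\<^esub> \<pi> g"
  using group_hom.hom_inv[of G A \<pi>] \<pi> by (simp add: group_hom_def group_hom_axioms_def G.group_axioms A.group_axioms)

lemma pow_A: "(\<lambda>i. \<pi> (gs i) [^]\<^bsub>A\<^esub> (e i :: nat)) \<in> {..<r} \<rightarrow> carrier A"
  using \<pi>_A[OF gs_G] by auto

lemma cond_comp:
  assumes "cond g e" "cond g' e'" "g \<in> carrier G" "g' \<in> carrier G"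
  shows "cond (g \<otimes>\<^bsub>G\<^esub> g') (\<lambda>i. e i + e' i)"
proof -
  have "finprod A (\<lambda>i. \<pi> (gs i) [^]\<^bsub>A\<^esub> (e i + e' i)) {..<r}
    = finprod A (\<lambda>i. \<pi> (gs i) [^]\<^bsub>A\<^esub> e i \<otimes>\<^bsub>A\<^esub> \<pi> (gs i) [^]\<^bsub>A\<^esub> e' i) {..<r}"
    by (rule A.finprod_cong') (use \<pi>_A[OF gs_G] in \<open>auto simp: A.nat_pow_mult\<close>)
  also have "\<dots> = finprod A (\<lambda>i. \<pi> (gs i) [^]\<^bsub>A\<^esub> e i) {..<r} \<otimes>\<^bsub>A\<^esub> finprod A (\<lambda>i. \<pi> (gs i) [^]\<^bsub>A\<^esub> e' i) {..<r}"
    by (rule A.finprod_multf[OF pow_A pow_A])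
  finally show ?thesis using assms by (simp add: cond_def \<pi>_mult)
qed

lemma cond_zero: "cond g (\<lambda>_. 0) \<longleftrightarrow> \<pi> g = \<one>\<^bsub>A\<^esub>"
  by (simp add: cond_def)

lemma cond_gs: "j < r \<Longrightarrow> cond (gs j) (\<lambda>i. of_bool (i = j))"
proof -
  assume j: "j < r"
  have "finprod A (\<lambda>i. \<pi> (gs i) [^]\<^bsub>A\<^esub> (of_bool (i = j) :: nat)) {..<r}
    = finprod A (\<lambda>i. if j = i then \<pi> (gs i) else \<one>\<^bsub>A\<^esub>) {..<r}"
    by (rule A.finprod_cong') (use \<pi>_A[OF gs_G] in auto)
  also have "\<dots> = \<pi> (gs j)"
    by (rule A.finprod_singleton) (use j \<pi>_A[OF gs_G] in auto)
  finally show ?thesis by (simp add: cond_def)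
qed

lemma tag_\<sigma>: "j < r \<Longrightarrow> tag (\<sigma> j) (gs j) (\<lambda>i. of_bool (i = j))"
  unfolding \<sigma>_def by (rule someI_ex[OF ex_tag[OF gs_G]])

lemma H_comp: "f \<in> H \<Longrightarrow> f' \<in> H \<Longrightarrow> f \<circ> f' \<in> H"
  unfolding H_def using tag_comp cond_comp by (blast intro: G.m_closed)

lemma id_H: "id \<in> H"
  unfolding H_def using tag_id cond_zero \<pi>_one by (blast intro: G.one_closed)

lemma T_H: "T \<subseteq> H"
  unfolding T_def H_def using cond_zero by blast

lemma \<sigma>_H: "j < r \<Longrightarrow> \<sigma> j \<in> H"
  unfolding H_def using tag_\<sigma> cond_gs gs_G by blast

lemma H_auts: "H \<subseteq> auts k0 \<Phi>"
  unfolding H_def using tag_auts by blast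

text \<open>An element of \<open>H\<close> is determined by its values on finitely many generators,
  and each value is confined to a finite set: transforms of coordinates by \<open>G\<close>,
  multiples by powers of \<open>\<zeta>\<close>, or conjugates.\<close>

lemma finite_H: "finite H"
proof -
  let ?I = "Lin ` {..<d} \<union> cidx n r"
  let ?V = "(\<lambda>(j, g). \<phi> (co j \<circ> act_inv g)) ` ({..<d} \<times> carrier G) \<union>
    (\<lambda>(i, m). \<zeta> ^ m * u i) ` ({..<r} \<times> {..<n}) \<union> (\<Union>i<r. zf i ` box n i)"
  have "inj_on (\<lambda>f. \<lambda>i\<in>?I. f (x i)) H"
  proof (rule inj_onI)
    fix f f' assume ff': "f \<in> H" "f' \<in> H" "(\<lambda>i\<in>?I. f (x i)) = (\<lambda>i\<in>?I. f' (x i))"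
    have "f (x i) = f' (x i)" if "i \<in> ?I" for i using fun_cong[OF ff'(3), of i] that by simp
    then show "f = f'"
      using auts_eqI[OF k0, of f x ?I f'] ff' H_auts unfolding L_def by blast
  qed
  moreover have "(\<lambda>f. \<lambda>i\<in>?I. f (x i)) ` H \<subseteq> ?I \<rightarrow>\<^sub>E ?V"
  proof (intro image_subsetI PiE_I)
    fix f i assume f: "f \<in> H" and i: "i \<in> ?I"
    obtain g e where ge: "g \<in> carrier G" "tag f g e" using f unfolding H_def by blast
    from i consider j where "j < d" "i = Lin j" | j where "j < r" "i = Chr j"
      | j s where "j < r" "s \<in> box n j" "s \<noteq> box0 j" "i = Nrm j s" by (auto simp: cidx_def)
    then have "f (x i) \<in> ?V"
    proof cases
      case 1
      then have "f (x i) = \<phi> (co j \<circ> act_inv g)" using ge co_PV by (simp add: x_Lin tag_def)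
      moreover have "\<dots> \<in> (\<lambda>(j, g). \<phi> (co j \<circ> act_inv g)) ` ({..<d} \<times> carrier G)"
        by (rule image_eqI[of _ _ "(j, g)"]) (use 1 ge in simp_all)
      ultimately show ?thesis by simp
    next
      case 2
      then have "f (x i) = \<zeta> ^ (e j mod n) * u j" using ge by (simp add: tag_def \<zeta>_pow_mod)
      moreover have "\<dots> \<in> (\<lambda>(i, m). \<zeta> ^ m * u i) ` ({..<r} \<times> {..<n})"
        by (rule image_eqI[of _ _ "(j, e j mod n)"]) (use 2 n in simp_all)
      ultimately show ?thesis by simp
    next
      case 3
      then have "x i = zf j s" by (simp add: zf_def)
      then have "f (x i) = zf j (shift n j e s)" using ge 3 by (simp add: tag_def)
      moreover have "\<dots> \<in> (\<Union>i<r. zf i ` box n i)"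
        using 3 shift_in[OF n, of j e s] by (intro UN_I[of j] imageI) simp_all
      ultimately show ?thesis by simp
    qed
    then show "(\<lambda>i\<in>?I. f (x i)) i \<in> ?V" using i by simp
  qed auto
  moreover have "finite (?I \<rightarrow>\<^sub>E ?V)"
    by (intro finite_PiE) (use finite_G in auto)
  ultimately show ?thesis using inj_on_finite by blast
qed

lemma T_central: "\<tau> \<in> T \<Longrightarrow> f \<in> H \<Longrightarrow> \<tau> \<circ> f = f \<circ> \<tau>"
proof -
  assume "\<tau> \<in> T" "f \<in> H"
  then obtain c g e where c: "c \<in> carrier G" "\<pi> c = \<one>\<^bsub>A\<^esub>" "tag \<tau> c (\<lambda>_. 0)"
    and g: "g \<in> carrier G" "tag f g e" unfolding T_def H_def by blast
  have "tag (\<tau> \<circ> f) (c \<otimes>\<^bsub>G\<^esub> g) (\<lambda>i. 0 + e i)" by (rule tag_comp[OF c(3) g(2) c(1) g(1)])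
  moreover have "tag (f \<circ> \<tau>) (c \<otimes>\<^bsub>G\<^esub> g) (\<lambda>i. e i + 0)"
    using tag_comp[OF g(2) c(3) g(1) c(1)] central[OF c(1) g(1) c(2)] by simp
  ultimately show ?thesis by (rule tag_unique) simp
qed

lemma ex_T: "c \<in> carrier G \<Longrightarrow> \<pi> c = \<one>\<^bsub>A\<^esub> \<Longrightarrow> \<exists>\<tau>\<in>T. tag \<tau> c (\<lambda>_. 0)"
  unfolding T_def using ex_tag by blast

text \<open>The commutator of \<open>gs i\<close> and \<open>gs j\<close> lies in the kernel of
  \<open>\<pi>\<close> because \<open>A\<close> is commutative, and the exponent parts commute;
  \<open>tag_unique\<close> turns this into an equation of automorphisms.\<close>

lemma commutator:
  assumes i: "i < r" and j: "j < r"
  shows "\<exists>\<tau>\<in>T. \<sigma> i \<circ> \<sigma> j = \<tau> \<circ> (\<sigma> j \<circ> \<sigma> i)"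
proof -
  note g = gs_G[OF i] gs_G[OF j]
  let ?p = "gs i \<otimes>\<^bsub>G\<^esub> gs j" and ?q = "gs j \<otimes>\<^bsub>G\<^esub> gs i"
  have pq: "?p \<in> carrier G" "?q \<in> carrier G" using g by auto
  let ?c = "?p \<otimes>\<^bsub>G\<^esub> inv\<^bsub>G\<^esub> ?q"
  have cG: "?c \<in> carrier G" using pq by simp
  have "\<pi> ?p = \<pi> ?q" using g by (simp add: \<pi>_mult A.m_comm \<pi>_A)
  then have "\<pi> ?c = \<one>\<^bsub>A\<^esub>" using pq \<pi>_A[OF pq(2)] by (simp add: \<pi>_mult[of ?p "inv\<^bsub>G\<^esub> ?q"] \<pi>_inv)
  then obtain \<tau> where \<tau>: "\<tau> \<in> T" "tag \<tau> ?c (\<lambda>_. 0)" using ex_T[OF cG] by blast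
  have "tag (\<tau> \<circ> (\<sigma> j \<circ> \<sigma> i)) (?c \<otimes>\<^bsub>G\<^esub> ?q) (\<lambda>l. 0 + (of_bool (l = j) + of_bool (l = i)))"
    by (intro tag_comp \<tau>(2) tag_\<sigma> i j g cG pq)
  moreover have "?c \<otimes>\<^bsub>G\<^esub> ?q = ?p" using pq by (simp add: G.m_assoc)
  ultimately have "tag (\<tau> \<circ> (\<sigma> j \<circ> \<sigma> i)) ?p (\<lambda>l. 0 + (of_bool (l = j) + of_bool (l = i)))" by simp
  moreover have "tag (\<sigma> i \<circ> \<sigma> j) ?p (\<lambda>l. of_bool (l = i) + of_bool (l = j))"
    by (intro tag_comp tag_\<sigma> i j g)
  ultimately have "\<sigma> i \<circ> \<sigma> j = \<tau> \<circ> (\<sigma> j \<circ> \<sigma> i)"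
    by (intro tag_unique[of "\<sigma> i \<circ> \<sigma> j" ?p]) (auto simp: add.commute)
  then show ?thesis using \<tau>(1) by blast
qed

text \<open>The product of the powers \<open>\<sigma> m ^^ e m\<close> has the same exponents as
  \<open>h\<close> below \<open>r\<close>. By the fibre product condition the two elements of
  \<open>G\<close> have the same image in \<open>A\<close>, so the remaining factor lies in
  \<open>T\<close>.\<close>

lemma H_generated:
  assumes PT: "\<And>\<tau>. \<tau> \<in> T \<Longrightarrow> P \<tau>" and P\<sigma>: "\<And>j. j < r \<Longrightarrow> P (\<sigma> j)"
    and Pcomp: "\<And>f g. f \<in> H \<Longrightarrow> g \<in> H \<Longrightarrow> P f \<Longrightarrow> P g \<Longrightarrow> P (f \<circ> g)" and h: "h \<in> H"
  shows "P h"
proof -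
  obtain g e where g: "g \<in> carrier G" "cond g e" "tag h g e" using h unfolding H_def by blast
  have idT: "id \<in> T" unfolding T_def using tag_id \<pi>_one by blast
  have Hpow: "\<sigma> j ^^ t \<in> H \<and> P (\<sigma> j ^^ t) \<and> cond (gs j [^]\<^bsub>G\<^esub> t) (\<lambda>i. t * of_bool (i = j))" if j: "j < r" for j t
  proof (induction t)
    case 0
    then show ?case using id_H PT[OF idT] cond_zero \<pi>_one by (simp add: id_def)
  next
    case (Suc t)
    have eq: "\<sigma> j ^^ Suc t = \<sigma> j ^^ t \<circ> \<sigma> j" by (rule funpow_Suc_right)
    have "cond (gs j [^]\<^bsub>G\<^esub> t \<otimes>\<^bsub>G\<^esub> gs j) (\<lambda>i. t * of_bool (i = j) + of_bool (i = j))"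
      using Suc j gs_G by (intro cond_comp cond_gs) auto
    then have "cond (gs j [^]\<^bsub>G\<^esub> Suc t) (\<lambda>i. Suc t * of_bool (i = j))" by (simp add: add.commute)
    then show ?case
      unfolding eq using Suc H_comp[of "\<sigma> j ^^ t" "\<sigma> j"] Pcomp[of "\<sigma> j ^^ t" "\<sigma> j"] \<sigma>_H[OF j] P\<sigma>[OF j]
      by blast
  qed
  have "m \<le> r \<Longrightarrow> \<exists>f g'. f \<in> H \<and> P f \<and> g' \<in> carrier G \<and> cond g' (\<lambda>l. if l < m then e l else 0) \<and>
    tag f g' (\<lambda>l. if l < m then e l else 0)" for m
  proof (induction m)
    case 0
    show ?case using id_H PT[OF idT] tag_id cond_zero \<pi>_one
      by (intro exI[of _ id] exI[of _ "\<one>\<^bsub>G\<^esub>"] conjI) (simp_all only: not_less_zero if_False G.one_closed)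
  next
    case (Suc m)
    then obtain f g' where f: "f \<in> H" "P f" "g' \<in> carrier G" "cond g' (\<lambda>l. if l < m then e l else 0)"
      "tag f g' (\<lambda>l. if l < m then e l else 0)" by auto
    have m: "m < r" using Suc by simp
    have eq: "(\<lambda>l. (if l < m then e l else 0) + e m * of_bool (l = m)) = (\<lambda>l. if l < Suc m then e l else 0)"
      by (auto simp: fun_eq_iff less_Suc_eq)
    let ?s = "\<sigma> m ^^ e m" and ?g = "gs m [^]\<^bsub>G\<^esub> e m"
    have "tag (f \<circ> ?s) (g' \<otimes>\<^bsub>G\<^esub> ?g) (\<lambda>l. (if l < m then e l else 0) + e m * of_bool (l = m))"
      using f m gs_G by (intro tag_comp tag_funpow tag_\<sigma>) auto
    moreover have "cond (g' \<otimes>\<^bsub>G\<^esub> ?g) (\<lambda>l. (if l < m then e l else 0) + e m * of_bool (l = m))"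
      using f m gs_G Hpow[OF m] by (intro cond_comp) auto
    moreover have "f \<circ> ?s \<in> H" "P (f \<circ> ?s)"
      using f Hpow[OF m, of "e m"] by (blast intro: H_comp Pcomp)+
    moreover have "g' \<otimes>\<^bsub>G\<^esub> ?g \<in> carrier G" using f m gs_G by simp
    ultimately show ?case unfolding eq by blast
  qed
  then obtain f g' where f: "f \<in> H" "P f" "g' \<in> carrier G" "cond g' (\<lambda>l. if l < r then e l else 0)"
    "tag f g' (\<lambda>l. if l < r then e l else 0)" by blast
  have "\<pi> g' = \<pi> g"
    using f(4) g(2) A.finprod_cong'[of "{..<r}" "{..<r}" "\<lambda>i. \<pi> (gs i) [^]\<^bsub>A\<^esub> e i" "\<lambda>i. \<pi> (gs i) [^]\<^bsub>A\<^esub> (if i < r then e i else 0)"] pow_A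
    by (simp add: cond_def)
  let ?c = "inv\<^bsub>G\<^esub> g' \<otimes>\<^bsub>G\<^esub> g"
  have c: "?c \<in> carrier G" using f g by simp
  have "\<pi> ?c = \<one>\<^bsub>A\<^esub>" using f g \<open>\<pi> g' = \<pi> g\<close> \<pi>_A[OF g(1)] by (simp add: \<pi>_mult \<pi>_inv)
  then obtain \<tau> where \<tau>: "\<tau> \<in> T" "tag \<tau> ?c (\<lambda>_. 0)" using ex_T[OF c] by blast
  have "tag (f \<circ> \<tau>) (g' \<otimes>\<^bsub>G\<^esub> ?c) (\<lambda>l. (if l < r then e l else 0) + 0)"
    by (rule tag_comp[OF f(5) \<tau>(2) f(3) c])
  moreover have "g' \<otimes>\<^bsub>G\<^esub> ?c = g" using f g by (simp add: G.m_assoc[symmetric])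
  ultimately have "tag (f \<circ> \<tau>) g (\<lambda>l. (if l < r then e l else 0) + 0)" by simp
  then have "h = f \<circ> \<tau>" by (rule tag_unique[OF g(3)]) simp
  then show ?thesis using Pcomp[OF f(1) _ f(2) PT[OF \<tau>(1)]] \<tau>(1) T_H by blast
qed

lemma class2: "class2_tower (range ground) n r d \<zeta> x \<Phi> H \<sigma> T"
proof -
  have fin: "fin_act \<Phi> H"
    by (rule auts_fin_act[OF subfld_L finite_H id_H H_comp H_auts])
  have fix_k: "f c = c" if "f \<in> H" "c \<in> k0" for f c using that H_auts auts_\<Phi>(1) by blast
  have \<sigma>_u: "\<sigma> j (u i) = (if i = j then \<zeta> * u i else u i)"
    and \<sigma>_zf: "s \<in> box n i \<Longrightarrow> \<sigma> j (zf i s) = zf i (shift n i (\<lambda>l. of_bool (l = j)) s)" if "i < r" "j < r" for i j s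
    using tag_\<sigma>[OF that(2)] that by (auto simp: tag_def)
  have tower: "norm_tower (range ground) n r d \<zeta> x \<Phi> H"
  proof (intro norm_tower.intro norm_tower_axioms.intro)
    show "norm_family (range ground) n r d \<zeta> x" by (rule norm_family_axioms)
    show "fin_act \<Phi> H" by (rule fin)
    show "f c = c" if "f \<in> H" "c \<in> k0" for f c using fix_k that .
    show "\<exists>e. \<forall>i<r. f (u i) = \<zeta> ^ e i * u i \<and> (\<forall>s\<in>box n i. f (zf i s) = zf i (shift n i e s))" if "f \<in> H" for f
      using that unfolding H_def tag_def by blast
    show "f (x (Lin j)) \<in> fspan k0 (x ` Lin ` {..<d})" if "f \<in> H" "j < d" for f j
    proof -
      obtain g e where g: "g \<in> carrier G" "tag f g e" using \<open>f \<in> H\<close> unfolding H_def by blast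
      have "f (x (Lin j)) = (\<Sum>i<d. ground (co j (act_inv g (b i))) * x (Lin i))"
        using g co_PV \<phi>_act_span[OF g(1)] that by (simp add: tag_def x_Lin)
      then show ?thesis
        by (simp only:) (intro fspan_sum[OF k0] fspan_scale[OF k0] fspan_inc[OF k0], auto)
    qed
    show "\<exists>f\<in>H. \<forall>i<r. f (u i) = (if i = j then \<zeta> * u i else u i) \<and>
      (\<forall>s\<in>box n i. f (zf i s) = zf i (shift n i (\<lambda>l. of_bool (l = j)) s))" if "j < r" for j
      using \<sigma>_u \<sigma>_zf \<sigma>_H that by (intro bexI[of _ "\<sigma> j"]) auto
  qed simp
  \<comment> \<open>The \<open>n\<close>-th power acts through a power of \<open>gs j\<close> with
    exponent the order of \<open>G\<close> and through multiples of \<open>n\<close>; hence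
    \<open>n\<close> is at once the order of \<open>\<zeta>\<close> and of \<open>G\<close>.\<close>
  have \<sigma>_pow: "\<sigma> j ^^ n = id" if j: "j < r" for j
  proof (rule tag_unique)
    show "tag (\<sigma> j ^^ n) \<one>\<^bsub>G\<^esub> (\<lambda>i. n * of_bool (i = j))"
      using tag_funpow[OF tag_\<sigma>[OF j] gs_G[OF j], of n] G.pow_order_eq_1[OF gs_G[OF j]] n_order by simp
    show "tag id \<one>\<^bsub>G\<^esub> (\<lambda>_. 0)" by (rule tag_id)
  qed simp
  have T_pow: "\<tau> ^^ n = id" if \<tau>: "\<tau> \<in> T" for \<tau>
  proof -
    obtain c where c: "c \<in> carrier G" "tag \<tau> c (\<lambda>_. 0)" using \<tau> unfolding T_def by blast
    show ?thesis
    proof (rule tag_unique)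
      show "tag (\<tau> ^^ n) \<one>\<^bsub>G\<^esub> (\<lambda>i. n * 0)"
        using tag_funpow[OF c(2,1), of n] G.pow_order_eq_1[OF c(1)] n_order by simp
      show "tag id \<one>\<^bsub>G\<^esub> (\<lambda>_. 0)" by (rule tag_id)
    qed simp
  qed
  have T_N: "\<tau> y = y" if \<tau>: "\<tau> \<in> T" and y: "y \<in> N r" for \<tau> y
  proof -
    interpret F: fin_act \<Phi> H by (rule fin)
    have \<tau>H: "\<tau> \<in> H" using \<tau> T_H by blast
    obtain c where c: "c \<in> carrier G" "tag \<tau> c (\<lambda>_. 0)" using \<tau> unfolding T_def by blast
    have "N r \<subseteq> {a \<in> \<Phi>. \<tau> a = a}"
      unfolding N_def
    proof (rule fgen_least)
      show "subfld {a \<in> \<Phi>. \<tau> a = a}"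
        by (rule subfldI) (auto simp: F.H_1 F.H_diff F.H_mult F.H_inverse \<tau>H subfld_closed[OF subfld_L])
      have "\<tau> (x i) = x i" if i: "i \<in> cidx n r" for i
      proof -
        from i consider j where "j < r" "i = Chr j"
          | j s where "j < r" "s \<in> box n j" "s \<noteq> box0 j" "i = Nrm j s" by (auto simp: cidx_def)
        then show ?thesis
        proof cases
          case 1
          then show ?thesis using c by (simp add: tag_def)
        next
          case 2
          then have "x i = zf j s" by (simp add: zf_def)
          then show ?thesis using c 2 by (simp add: tag_def shift_zero)
        qed
      qed
      then show "range ground \<union> x ` cidx n r \<subseteq> {a \<in> \<Phi>. \<tau> a = a}"
        using fix_k[OF \<tau>H] k0_\<Phi> x_\<Phi> by auto
    qed
    then show ?thesis using y by blast
  qed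
  show ?thesis
    by (intro class2_tower.intro class2_tower_axioms.intro tower)
      (fact \<sigma>_H \<sigma>_u \<sigma>_zf \<sigma>_pow T_H T_N T_pow T_central commutator H_generated)+
qed

text \<open>Every element of \<open>G\<close> is some \<open>gs j\<close> and is lifted by
  \<open>\<sigma> j\<close>, so \<open>H\<close> maps onto \<open>G\<close>; on \<open>k(V)\<close>
  an element of \<open>H\<close> acts through its image. Hence the fixed field at level
  \<open>0\<close> is the field of invariants, where the tower starts.\<close>

theorem toric_rational_tower: "admits_toric_rational_tower k0 (field_of_invariants scale G \<rho> \<phi>)"
proof -
  interpret C: class2_tower "range ground" n r d \<zeta> x \<Phi> H \<sigma> T by (rule class2)
  let ?v = "\<lambda>j. \<phi> (co j)"
  have L0: "L 0 = fgen (k0 \<union> ?v ` {..<d})"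
    using image_cong[OF refl, of "{..<d}" "\<lambda>j. x (Lin j)" ?v] x_Lin by (simp add: L_def cidx_def image_image)
  have fixed: "(\<forall>f\<in>H. f (\<phi> p / \<phi> q) = \<phi> p / \<phi> q) \<longleftrightarrow>
    (\<forall>g\<in>carrier G. \<phi> (p \<circ> act_inv g) / \<phi> (q \<circ> act_inv g) = \<phi> p / \<phi> q)" if pq: "p \<in> PV" "q \<in> PV" for p q
  proof -
    have *: "f (\<phi> p / \<phi> q) = \<phi> (p \<circ> act_inv g) / \<phi> (q \<circ> act_inv g)" if "f \<in> H" "tag f g e" for f g e
      using C.H_divide[OF that(1) \<phi>_\<Phi>[OF pq(1)] \<phi>_\<Phi>[OF pq(2)]] that(2) pq by (simp add: tag_def)
    have "\<exists>f\<in>H. \<exists>e. tag f g e" if "g \<in> carrier G" for g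
    proof -
      have "g \<in> gs ` {..<r}" using gs that by (simp add: bij_betw_def)
      then obtain j where "j < r" "g = gs j" by blast
      then show ?thesis using tag_\<sigma> \<sigma>_H by blast
    qed
    moreover have "\<exists>g\<in>carrier G. \<exists>e. tag f g e" if "f \<in> H" for f using that unfolding H_def by blast
    ultimately show ?thesis using * by metis
  qed
  have inv: "field_of_invariants scale G \<rho> \<phi> = C.Fix (L 0)"
  proof (intro equalityI subsetI)
    fix y assume "y \<in> field_of_invariants scale G \<rho> \<phi>"
    then obtain p q where pq: "p \<in> PV" "q \<in> PV" "y = \<phi> p / \<phi> q"
      "\<forall>g\<in>carrier G. \<phi> (p \<circ> act_inv g) / \<phi> (q \<circ> act_inv g) = \<phi> p / \<phi> q"
      unfolding field_of_invariants_def by blast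
    have "y \<in> L 0" unfolding pq(3) by (intro subfld_divide[OF subfld_L] \<phi>_L0 pq)
    then show "y \<in> C.Fix (L 0)" using fixed[OF pq(1,2)] pq(3,4) by (auto intro: C.FixI)
  next
    fix y assume y: "y \<in> C.Fix (L 0)"
    then have "y \<in> fgen (k0 \<union> ?v ` {..<d})" using C.FixD(1) L0 by blast
    then obtain p q where pq: "p \<in> pf k0 {..<d}" "q \<in> pf k0 {..<d}" "q ?v \<noteq> 0" "y = p ?v / q ?v"
      by (rule fgenE[OF k0])
    obtain P Q where PQ: "P \<in> PV" "p ?v = \<phi> P" "Q \<in> PV" "q ?v = \<phi> Q" using pf_\<phi>[OF pq(1)] pf_\<phi>[OF pq(2)] by blast
    have "Q \<noteq> (\<lambda>_. 0)" using pq(3) PQ \<phi>_eq_0 by simp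
    moreover have "\<forall>f\<in>H. f (\<phi> P / \<phi> Q) = \<phi> P / \<phi> Q" using C.FixD(2)[OF y] pq(4) PQ by simp
    ultimately show "y \<in> field_of_invariants scale G \<rho> \<phi>"
      using fixed[OF PQ(1,3)] PQ pq(4) unfolding field_of_invariants_def by auto
  qed
  have "\<exists>xs. C.Fix (L 0) = fgen (k0 \<union> set xs)"
    unfolding L0
  proof (rule C.Fix_finitely_generated[OF k0])
    show "k0 \<subseteq> C.Fix \<Phi>" by (rule C.k_Fix)
    show "?v i \<in> \<Phi>" for i by (rule \<phi>_\<Phi>[OF co_PV])
    show "\<exists>p\<in>pf k0 {..<d}. f (?v i) = p ?v" if f: "f \<in> H" and i: "i \<in> {..<d}" for f i
    proof -
      obtain g e where g: "g \<in> carrier G" "tag f g e" using f unfolding H_def by blast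
      then have "f (?v i) = \<phi> (co i \<circ> act_inv g)" using co_PV by (simp add: tag_def)
      then show ?thesis using \<phi>_pf[OF PV_act[OF g(1) co_PV]] by simp
    qed
  qed simp
  then obtain xs where xs: "C.Fix (L 0) = adjoin k0 xs" unfolding adjoin_eq_fgen by blast
  have "tstep\<^sup>*\<^sup>* (C.Fix (L 0)) (C.Fix \<Phi>)" using C.tower[of r] by simp
  moreover have "rational_over k0 (C.Fix \<Phi>)" by (rule rat_imp_rational_over[OF k0 C.rational_top])
  ultimately show ?thesis unfolding inv using tower_from_steps[OF _ xs] by blast
qed

end

section \<open>Choice of the root of unity, the coordinates and the auxiliary variables\<close>

theorem corollary22:
  fixes l :: nat
    and Z :: "('z, 'z1) monoid_scheme"
    and G :: "('g, 'g1) monoid_scheme"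
    and A :: "('a, 'a1) monoid_scheme"
    and \<iota> :: "'z \<Rightarrow> 'g"
    and \<pi> :: "'g \<Rightarrow> 'a"
    and scale :: "'k::{alg_closed_field, field_char_0} \<Rightarrow> 'v::ab_group_add \<Rightarrow> 'v"
    and Basis :: "'v set"
    and \<rho> :: "'g \<Rightarrow> 'v \<Rightarrow> 'v"
    and \<phi> :: "('v \<Rightarrow> 'k) \<Rightarrow> 'k universal"
  assumes "Factorial_Ring.prime l"
    and "group G" and "\<exists>n. Coset.order G = l ^ n"
    and "comm_group A" and "\<exists>n. Coset.order A = l ^ n"
    and "group Z"
    and "\<iota> \<in> mon Z G" and "\<pi> \<in> epi G A" and "kernel G A \<pi> = \<iota> ` carrier Z"
    and "\<forall>z\<in>carrier Z. \<forall>g\<in>carrier G. \<iota> z \<otimes>\<^bsub>G\<^esub> g = g \<otimes>\<^bsub>G\<^esub> \<iota> z"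
    and "finite_dimensional_vector_space scale Basis"
    and "representation_on scale G \<rho>" and "inj_on \<rho> (carrier G)"
    and "function_field_embedding scale \<phi>"
  shows "admits_toric_rational_tower (range (ground :: 'k \<Rightarrow> 'k universal))
           (field_of_invariants scale G \<rho> \<phi>)"
proof -
  interpret G: group G by fact
  interpret V: finite_dimensional_vector_space scale Basis by fact
  define n where "n = Coset.order G"
  obtain m where m: "n = l ^ m" using assms(3) n_def by blast
  have n0: "n > 0" using m prime_gt_0_nat[OF assms(1)] by simp
  obtain \<zeta> :: 'k where \<zeta>: "\<zeta> ^ n = 1" "\<And>i. 0 < i \<Longrightarrow> i < n \<Longrightarrow> \<zeta> ^ i \<noteq> 1"
    using ex_primitive_root_of_unity[OF assms(1), of m] m by blast
  define d where "d = card Basis"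
  obtain b where b: "bij_betw b {..<d} Basis"
    using ex_bij_betw_nat_finite[OF V.finite_Basis] by (auto simp: d_def atLeast0LessThan)
  have "card (carrier G) = n" by (simp add: n_def Coset.order_def)
  moreover from this n0 have "finite (carrier G)" using card.infinite by fastforce
  ultimately obtain gs where gs: "bij_betw gs {..<n} (carrier G)"
    using ex_bij_betw_nat_finite[of "carrier G"] by (auto simp: atLeast0LessThan)
  interpret coordinate_ring scale Basis \<phi> b d
    by (intro coordinate_ring.intro coordinate_ring_axioms.intro assms b)
  \<comment> \<open>Only the \<open>Lin\<close> variables carry prescribed values; \<open>0\<close>
    is a placeholder for the other constructors.\<close>
  let ?lin = "\<lambda>i. case i of Lin j \<Rightarrow> j | _ \<Rightarrow> 0"
  have "gen k0 (Lin ` {..<d}) (\<lambda>i. \<phi> (co (?lin i)))"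
    by (rule gen_reindex[OF gen_co]) (auto simp: inj_on_def)
  moreover have "Lin ` {..<d} \<inter> cidx n n = {}" by (auto simp: cidx_def)
  ultimately obtain x where x: "\<forall>i\<in>Lin ` {..<d}. x i = \<phi> (co (?lin i))" "gen k0 (Lin ` {..<d} \<union> cidx n n) x"
    using gen_extend[OF k0 gen_universal, of "Lin ` {..<d}" "\<lambda>i. \<phi> (co (?lin i))" "cidx n n"] by auto
  have pow: "ground (\<zeta> ^ i) = ground \<zeta> ^ i" for i
    by (induction i) (simp_all add: ground_hom)
  have pow1: "ground \<zeta> ^ i = 1 \<longleftrightarrow> \<zeta> ^ i = 1" for i
    unfolding pow[symmetric] using injD[OF ground_hom(7), of "\<zeta> ^ i" 1] by (auto simp: ground_hom)
  \<comment> \<open>The number of Kummer generators is again \<open>n\<close>, one for each element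
    of \<open>G\<close>.\<close>
  have "rep_tower scale Basis \<phi> b d n n (ground \<zeta>) x G A \<pi> \<rho> gs"
  proof (intro rep_tower.intro rep_tower_axioms.intro norm_family.intro)
    show "coordinate_ring scale Basis \<phi> b d" by (rule coordinate_ring_axioms)
    show "subfld k0" by (rule k0)
    show "ground \<zeta> ^ i \<noteq> 1" if "0 < i" "i < n" for i using \<zeta>(2)[OF that] pow1 by simp
    show "\<pi> \<in> hom G A" using assms(8) by (simp add: epi_def)
    show "g \<otimes>\<^bsub>G\<^esub> h = h \<otimes>\<^bsub>G\<^esub> g" if "g \<in> carrier G" "h \<in> carrier G" "\<pi> g = \<one>\<^bsub>A\<^esub>" for g h
    proof -
      have "g \<in> \<iota> ` carrier Z" using that assms(9) by (auto simp: kernel_def)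
      then show ?thesis using assms(10) that(2) by blast
    qed
  qed (use assms x gs n0 \<zeta>(1) pow1 n_def in auto)
  then show ?thesis by (rule rep_tower.toric_rational_tower)
qed

end
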